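(* Let $0<\beta<1/2$, $0\le\theta\le1$, and let $K\in L^\infty(0,1)$ with $0<K_m\le K\le K_M<\infty$. Assume that $$1+\theta\big({}_0^{l}I_1^\beta u_l\big)-(1-\theta)\big({}_0^{r}I_1^\beta u_l\big)\neq0 .$$ Then the bilinear form $A(w,v):=(K\,DI^\beta_\theta w,Dv)_{L^2(0,1)}$ is bounded and weakly coercive on $H^{1-\beta}_0(0,1)\times H^1_0(0,1)$; that is, there is a constant $\kappa>0$ such that $$\inf_{w\in H^{1-\beta}_0(0,1)\setminus\{0\}}\ \sup_{v\in H^1_0(0,1)\setminus\{0\}}\frac{A(w,v)}{\|w\|_{H^{1-\beta}(0,1)}\|v\|_{H^1(0,1)}}\ge\kappa,$$ $$\sup_{w\in H^{1-\beta}_0(0,1)}A(w,v)>0\qquad\forall v\in H^1_0(0,1)\setminus\{0\}.$$ Consequently, for any $f\in H^{-1}(0,1)$ the Petrov-Galerkin formulation: find $u\in H^{1-\beta}_0(0,1)$ with $A(u,v)=\langle f,v\rangle$ for all $v\in H^1_0(0,1)$, has a unique solution $u$, and $$\|u\|_{H^{1-\beta}(0,1)}\le\frac1\kappa\|f\|_{H^{-1}(0,1)}.$$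
   Context: $D$ is the first-order derivative in $x$. For $\phi$ on $(0,1)$: ${}_0^{l}I_x^{\beta}\phi(x)=\frac1{\Gamma(\beta)}\int_0^x\frac{\phi(s)}{(x-s)^{1-\beta}}ds$, ${}_x^{r}I_1^{\beta}\phi(x)=\frac1{\Gamma(\beta)}\int_x^1\frac{\phi(s)}{(s-x)^{1-\beta}}ds$, and $I^\beta_\theta\phi=\theta\,{}_0^{l}I_x^\beta\phi+(1-\theta)\,{}_x^{r}I_1^\beta\phi$. The numbers ${}_0^{l}I_1^\beta\phi=\frac1{\Gamma(\beta)}\int_0^1(1-s)^{\beta-1}\phi(s)ds$ and ${}_0^{r}I_1^\beta\phi=\frac1{\Gamma(\beta)}\int_0^1 s^{\beta-1}\phi(s)ds$ are the values of the left integral at $x=1$ and of the right integral at $x=0$. For $\mu>0$, $H^\mu_0(0,1)$ is the completion of $C_0^\infty(0,1)$ (functions extended by zero) in the norm $\|w\|_{H^\mu(\mathbb{R})}=\big(\|w\|_{L^2(\mathbb{R})}^2+\||\omega|^\mu\mathcal{F}(w)\|_{L^2(\mathbb{R})}^2\big)^{1/2}$; $\|\cdot\|_{H^\mu(0,1)}$ denotes the (equivalent) fractional Sobolev norm on it. $H^{-1}(0,1)$ is the dual of $H^1_0(0,1)$. Let $w_l^c(x)=1-x$, $w_r^c(x)=x$ and $w_l(x)=\big(\int_0^1\frac{ds}{K(s)}\big)^{-1}\int_x^1\frac{ds}{K(s)}$. The function $u_l$ is the unique element of $H^{1-\beta}_0(0,1)$ satisfying $I^\beta_\theta u_l-(1-\theta)({}_0^{r}I_1^\beta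 u_l)w_l^c-\theta({}_0^{l}I_1^\beta u_l)w_r^c=w_l-w_l^c$. *)

theory Defs
  imports "HOL-Analysis.Analysis"
begin

section \<open>Fractional integrals on the unit interval\<close>

definition left_frac_int :: "real \<Rightarrow> (real \<Rightarrow> real) \<Rightarrow> real \<Rightarrow> real" where
  "left_frac_int \<beta> \<phi> x =
     1 / Gamma \<beta> * (LINT s:{0<..<x}|lborel. \<phi> s / (x - s) powr (1 - \<beta>))"

definition right_frac_int :: "real \<Rightarrow> (real \<Rightarrow> real) \<Rightarrow> real \<Rightarrow> real" where
  "right_frac_int \<beta> \<phi> x =
     1 / Gamma \<beta> * (LINT s:{x<..<1}|lborel. \<phi> s / (s - x) powr (1 - \<beta>))"

definition frac_int :: "real \<Rightarrow> real \<Rightarrow> (real \<Rightarrow> real) \<Rightarrow> real \<Rightarrow> real" where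
  "frac_int \<beta> \<theta> \<phi> x = \<theta> * left_frac_int \<beta> \<phi> x + (1 - \<theta>) * right_frac_int \<beta> \<phi> x"


section \<open>The spaces \<open>H\<^sup>\<mu>\<^sub>0(0,1)\<close>\<close>

definition test_function :: "(real \<Rightarrow> real) \<Rightarrow> bool" where
  "test_function \<phi> \<longleftrightarrow>
     (\<forall>n x. (deriv ^^ n) \<phi> field_differentiable at x) \<and>
     closure {x. \<phi> x \<noteq> 0} \<subseteq> {0<..<1}"

text \<open>
  The integral below converges absolutely for square integrable functions that vanish outside
  the unit interval; the transform is only applied to such functions. The normalisation is the
  unitary one, so that for \<open>\<mu> = 1\<close> the norm is that of \<open>w\<close> and its derivative.
\<close>

definition fourier :: "(real \<Rightarrow> real) \<Rightarrow> real \<Rightarrow> complex" where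
  "fourier w \<omega> =
     complex_of_real (1 / sqrt (2 * pi)) *
       (LINT x|lborel. exp (- (\<i> * complex_of_real (\<omega> * x))) * complex_of_real (w x))"

text \<open>
  The square of the norm of \<open>H\<^sup>\<mu>(\<real>)\<close>, with value \<open>\<infinity>\<close> for functions outside of that space.
\<close>

definition Hnorm_sq :: "real \<Rightarrow> (real \<Rightarrow> real) \<Rightarrow> ennreal" where
  "Hnorm_sq \<mu> w =
     (\<integral>\<^sup>+ x. ennreal ((w x)\<^sup>2) \<partial>lborel) +
     (\<integral>\<^sup>+ \<omega>. ennreal ((\<bar>\<omega>\<bar> powr \<mu> * cmod (fourier w \<omega>))\<^sup>2) \<partial>lborel)"

definition Hnorm :: "real \<Rightarrow> (real \<Rightarrow> real) \<Rightarrow> real" where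
  "Hnorm \<mu> w = sqrt (enn2real (Hnorm_sq \<mu> w))"

text \<open>
  As \<open>H\<^sup>\<mu>(\<real>)\<close> is complete, the completion of the test functions is their closure in it. Its
  elements are represented by Borel functions extended by zero; two functions represent the same
  element if they agree almost everywhere.
\<close>

definition H0 :: "real \<Rightarrow> (real \<Rightarrow> real) set" where
  "H0 \<mu> = {w. w \<in> borel_measurable lborel \<and> (\<forall>x. x \<notin> {0<..<1} \<longrightarrow> w x = 0) \<and>
     (\<exists>\<phi>. (\<forall>n. test_function (\<phi> n)) \<and>
        (\<lambda>n::nat. Hnorm_sq \<mu> (\<lambda>x. w x - \<phi> n x)) \<longlonglongrightarrow> 0)}"

definition H0_nonzero :: "real \<Rightarrow> (real \<Rightarrow> real) set" where
  "H0_nonzero \<mu> = {w \<in> H0 \<mu>. \<not> (AE x in lborel. w x = 0)}"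

text \<open>
  There are several customary norms \<open>\<parallel>\<cdot>\<parallel>\<close> of \<open>H\<^sup>\<mu>(0,1)\<close> (Sobolev--Slobodeckij, restriction or
  interpolation norms, ...), all of them equivalent on \<open>H\<^sup>\<mu>\<^sub>0(0,1)\<close> to the norm defining that
  space. None of them is singled out: the following characterises the admissible ones, which
  include \<^term>\<open>Hnorm \<mu>\<close> itself.
\<close>

definition equivalent_norm_on_H0 :: "real \<Rightarrow> ((real \<Rightarrow> real) \<Rightarrow> real) \<Rightarrow> bool" where
  "equivalent_norm_on_H0 \<mu> N \<longleftrightarrow>
     (\<forall>w\<in>H0 \<mu>. \<forall>z\<in>H0 \<mu>. N (\<lambda>x. w x + z x) \<le> N w + N z) \<and>
     (\<forall>c. \<forall>w\<in>H0 \<mu>. N (\<lambda>x. c * w x) = \<bar>c\<bar> * N w) \<and>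
     (\<exists>c>0. \<exists>C>0. \<forall>w\<in>H0 \<mu>. c * Hnorm \<mu> w \<le> N w \<and> N w \<le> C * Hnorm \<mu> w)"

text \<open>
  The dual of \<open>H\<^sup>\<mu>\<^sub>0(0,1)\<close> and the dual norm, with respect to a norm \<open>N\<close> of \<open>H\<^sup>\<mu>\<^sub>0(0,1)\<close>.
  Boundedness forces a functional to take equal values on functions that agree almost everywhere.
\<close>

definition H0_dual :: "real \<Rightarrow> ((real \<Rightarrow> real) \<Rightarrow> real) \<Rightarrow> ((real \<Rightarrow> real) \<Rightarrow> real) set" where
  "H0_dual \<mu> N = {f.
     (\<forall>v\<in>H0 \<mu>. \<forall>z\<in>H0 \<mu>. f (\<lambda>x. v x + z x) = f v + f z) \<and>
     (\<forall>c. \<forall>v\<in>H0 \<mu>. f (\<lambda>x. c * v x) = c * f v) \<and>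
     (\<exists>C. \<forall>v\<in>H0 \<mu>. \<bar>f v\<bar> \<le> C * N v)}"

definition dual_norm :: "real \<Rightarrow> ((real \<Rightarrow> real) \<Rightarrow> real) \<Rightarrow> ((real \<Rightarrow> real) \<Rightarrow> real) \<Rightarrow> real" where
  "dual_norm \<mu> N f = (SUP v\<in>H0_nonzero \<mu>. \<bar>f v\<bar> / N v)"


section \<open>The derivative and the bilinear form\<close>

text \<open>\<open>g\<close> is a weak derivative of \<open>u\<close> on the open unit interval.\<close>

definition has_weak_deriv :: "(real \<Rightarrow> real) \<Rightarrow> (real \<Rightarrow> real) \<Rightarrow> bool" where
  "has_weak_deriv u g \<longleftrightarrow>
     (\<forall>a b. 0 < a \<and> b < 1 \<longrightarrow>
        set_integrable lborel {a..b} u \<and> set_integrable lborel {a..b} g) \<and>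
     (\<forall>\<phi>. test_function \<phi> \<longrightarrow>
        (LINT x:{0<..<1}|lborel. u x * deriv \<phi> x) = - (LINT x:{0<..<1}|lborel. g x * \<phi> x))"

definition weak_deriv :: "(real \<Rightarrow> real) \<Rightarrow> real \<Rightarrow> real" where
  "weak_deriv u = (SOME g. has_weak_deriv u g)"

definition has_L2_weak_deriv :: "(real \<Rightarrow> real) \<Rightarrow> bool" where
  "has_L2_weak_deriv u \<longleftrightarrow>
     (\<exists>g. has_weak_deriv u g \<and> set_integrable lborel {0<..<1} (\<lambda>x. (g x)\<^sup>2))"

definition form_A ::
    "(real \<Rightarrow> real) \<Rightarrow> real \<Rightarrow> real \<Rightarrow> (real \<Rightarrow> real) \<Rightarrow> (real \<Rightarrow> real) \<Rightarrow> real" where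
  "form_A K \<beta> \<theta> w v =
     (LINT x:{0<..<1}|lborel. K x * weak_deriv (frac_int \<beta> \<theta> w) x * weak_deriv v x)"

definition bounded_bilinear_form ::
    "(real \<Rightarrow> real) set \<Rightarrow> ((real \<Rightarrow> real) \<Rightarrow> real) \<Rightarrow>
     (real \<Rightarrow> real) set \<Rightarrow> ((real \<Rightarrow> real) \<Rightarrow> real) \<Rightarrow>
     ((real \<Rightarrow> real) \<Rightarrow> (real \<Rightarrow> real) \<Rightarrow> real) \<Rightarrow> bool" where
  "bounded_bilinear_form W NW V NV a \<longleftrightarrow>
     (\<forall>w\<in>W. \<forall>z\<in>W. \<forall>v\<in>V. a (\<lambda>x. w x + z x) v = a w v + a z v) \<and>
     (\<forall>c. \<forall>w\<in>W. \<forall>v\<in>V. a (\<lambda>x. c * w x) v = c * a w v) \<and>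
     (\<forall>w\<in>W. \<forall>v\<in>V. \<forall>z\<in>V. a w (\<lambda>x. v x + z x) = a w v + a w z) \<and>
     (\<forall>c. \<forall>w\<in>W. \<forall>v\<in>V. a w (\<lambda>x. c * v x) = c * a w v) \<and>
     (\<exists>C. \<forall>w\<in>W. \<forall>v\<in>V. \<bar>a w v\<bar> \<le> C * NW w * NV v)"


section \<open>The function \<open>u\<^sub>l\<close>\<close>

definition w_l :: "(real \<Rightarrow> real) \<Rightarrow> real \<Rightarrow> real" where
  "w_l K x =
     inverse (LINT s:{0<..<1}|lborel. 1 / K s) * (LINT s:{x<..<1}|lborel. 1 / K s)"

definition w_l_const :: "real \<Rightarrow> real" where
  "w_l_const x = 1 - x"

definition w_r_const :: "real \<Rightarrow> real" where
  "w_r_const x = x"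

definition is_u_l :: "(real \<Rightarrow> real) \<Rightarrow> real \<Rightarrow> real \<Rightarrow> (real \<Rightarrow> real) \<Rightarrow> bool" where
  "is_u_l K \<beta> \<theta> u \<longleftrightarrow> u \<in> H0 (1 - \<beta>) \<and>
     (AE x in lborel. x \<in> {0<..<1} \<longrightarrow>
        frac_int \<beta> \<theta> u x
          - (1 - \<theta>) * right_frac_int \<beta> u 0 * w_l_const x
          - \<theta> * left_frac_int \<beta> u 1 * w_r_const x
        = w_l K x - w_l_const x)"

end

theory Submission
  imports Defs "HOL-Probability.Probability"
begin

text \<open>
  Write \<open>T\<^sub>\<theta> w\<close> for the weak derivative of \<open>frac_int \<beta> \<theta> w\<close> and \<open>D v\<close> for that of \<open>v\<close>, and let all
  norms and inner products be those of \<open>L\<^sup>2(0,1)\<close>. The form is \<open>A(w,v) = (K T\<^sub>\<theta> w, D v)\<close>. As the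
  functions \<open>D v\<close> are exactly those of mean zero (\<open>weak_range_deriv_if_mean_zero\<close>), solving
  \<open>A(w,v) = (g, D v)\<close> for all \<open>v\<close> means solving \<open>T\<^sub>\<theta> w = g / K - a / K\<close> with some constant \<open>a\<close>. So the
  theorem says that \<open>T\<^sub>\<theta>\<close> is an isomorphism of \<open>H\<^sub>0\<close> with exponent \<open>1 - \<beta>\<close> onto a closed subspace of
  \<open>L\<^sup>2\<close>, and that \<open>1 / K\<close> spans a complement of this subspace.

  \<^bold>\<open>Coercivity.\<close> For a test function \<open>\<phi>\<close>, \<open>T\<^sub>\<theta> \<phi>\<close> is the fractional integral of the derivative of
  \<open>\<phi>\<close>, a combination of a left and a right convolution. The left one vanishes to the left of the
  interval and the right one to the right of it. Therefore their product can be integrated over the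
  whole line, where it is a positive multiple of the Riesz energy of order \<open>2 * \<beta>\<close> of the derivative
  (\<open>left_conv_times_right_conv\<close>). A Riesz kernel is a superposition of Gaussians, so the energy is a
  weighted integral of the squared Fourier transform (\<open>Gaussian_energy\<close>, \<open>riesz_energy_Fourier\<close>), here
  the square of the seminorm with exponent \<open>1 - \<beta>\<close>. As \<open>2 * \<beta> < 1\<close>, the squares of the convolutions
  are multiples of the same energy. Hence \<open>T\<^sub>\<theta>\<close> is bounded above and below, and the square of the
  norm of \<open>T\<^sub>\<theta> w\<close> is bounded by a multiple of \<open>(T\<^sub>\<theta> w, T\<^sub>1\<^sub>/\<^sub>2 w)\<close> (\<open>frac_coercive\<close>). All this extends
  from test functions to the whole space by continuity (\<open>extension\<close>), and the range of \<open>T\<^sub>\<theta>\<close> is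
  closed.

  \<^bold>\<open>The range has codimension one.\<close> By the coercivity, \<open>T\<^sub>\<theta>\<close> is onto for one \<open>\<theta>\<close> only if it is for
  all, and it is not for \<open>\<theta> = 1\<close>, because the range of \<open>T\<^sub>1\<close> is orthogonal to the power
  \<open>(1 - x) powr (- \<beta>)\<close> (\<open>left_range_annihilator\<close>, \<open>weak_range_frac_proper\<close>). On the other hand
  \<open>(T\<^sub>\<theta> v, D v)\<close> is a multiple of the Riesz energy of order \<open>\<beta>\<close> of \<open>D v\<close> and therefore positive unless
  \<open>v = 0\<close>; so an annihilator of the range that has mean zero vanishes (\<open>annihilator_mean_zero\<close>). It
  follows that the constants span a complement of the range.

  \<^bold>\<open>The function \<open>u\<^sub>l\<close>.\<close> Differentiating its equation gives \<open>T\<^sub>\<theta> u\<^sub>l = q - \<kappa> / K\<close>, where \<open>q\<close> is the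
  number that is assumed not to vanish (\<open>u_l_weak_deriv\<close>). So \<open>1 / K\<close> takes the place of the constants
  and spans a complement as well (\<open>weak_range_frac_complement\<close>). This solves the equation above. For
  the inf-sup condition, \<open>v\<close> is chosen such that \<open>D v\<close> is \<open>K T\<^sub>\<theta> w\<close> minus its mean: then \<open>A(w,v)\<close> is the
  squared norm of \<open>D v\<close>, and the mean is controlled by \<open>D v\<close> by means of an annihilator of the range.
\<close>

section \<open>Square integrable functions\<close>

definition L2 :: "'a measure \<Rightarrow> ('a \<Rightarrow> real) set" where
  "L2 M = {f \<in> borel_measurable M. integrable M (\<lambda>x. (f x)\<^sup>2)}"

definition ip :: "'a measure \<Rightarrow> ('a \<Rightarrow> real) \<Rightarrow> ('a \<Rightarrow> real) \<Rightarrow> real" where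
  "ip M f g = (LINT x|M. f x * g x)"

definition normsq :: "'a measure \<Rightarrow> ('a \<Rightarrow> real) \<Rightarrow> real" where
  "normsq M f = (LINT x|M. (f x)\<^sup>2)"

lemma L2_measurable: "f \<in> L2 M \<Longrightarrow> f \<in> borel_measurable M"
  by (simp add: L2_def)

lemma L2_integrable_mult:
  assumes "f \<in> L2 M" "g \<in> L2 M"
  shows "integrable M (\<lambda>x. f x * g x)"
proof (rule Bochner_Integration.integrable_bound)
  show "integrable M (\<lambda>x. (f x)\<^sup>2 + (g x)\<^sup>2)"
    using assms by (auto simp: L2_def)
  show "(\<lambda>x. f x * g x) \<in> borel_measurable M"
    using assms by (auto simp: L2_def)
  show "AE x in M. norm (f x * g x) \<le> norm ((f x)\<^sup>2 + (g x)\<^sup>2)"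
  proof (rule AE_I2)
    fix x
    have "2 * \<bar>f x\<bar> * \<bar>g x\<bar> \<le> \<bar>f x\<bar>\<^sup>2 + \<bar>g x\<bar>\<^sup>2"
      by (rule sum_squares_bound)
    moreover have "0 \<le> \<bar>f x\<bar> * \<bar>g x\<bar>" by simp
    ultimately show "norm (f x * g x) \<le> norm ((f x)\<^sup>2 + (g x)\<^sup>2)"
      unfolding real_norm_def abs_mult power2_abs by (intro order_trans[OF _ abs_ge_self]) linarith
  qed
qed

lemma L2_scale: "f \<in> L2 M \<Longrightarrow> (\<lambda>x. c * f x) \<in> L2 M"
  by (auto simp: L2_def power_mult_distrib)

lemma L2_add:
  assumes "f \<in> L2 M" "g \<in> L2 M"
  shows "(\<lambda>x. f x + g x) \<in> L2 M"
proof -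
  have "integrable M (\<lambda>x. (f x)\<^sup>2 + (g x)\<^sup>2 + 2 * (f x * g x))"
    using assms L2_integrable_mult[OF assms] by (auto simp: L2_def)
  then show ?thesis
    using assms by (auto simp: L2_def power2_sum mult.assoc)
qed

lemma L2_diff:
  assumes "f \<in> L2 M" "g \<in> L2 M"
  shows "(\<lambda>x. f x - g x) \<in> L2 M"
  using L2_add[OF assms(1) L2_scale[OF assms(2), of "-1"]] by simp

lemma L2_AE_cong:
  assumes "f \<in> L2 M" "g \<in> borel_measurable M" "AE x in M. f x = g x"
  shows "g \<in> L2 M"
proof -
  have "integrable M (\<lambda>x. (g x)\<^sup>2)"
  proof (rule integrable_cong_AE_imp)
    show "integrable M (\<lambda>x. (f x)\<^sup>2)"
      using assms(1) by (simp add: L2_def)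
    show "AE x in M. (f x)\<^sup>2 = (g x)\<^sup>2"
      using assms(3) by auto
    show "(\<lambda>x. (g x)\<^sup>2) \<in> borel_measurable M"
      using assms(2) by simp
  qed
  then show ?thesis using assms by (simp add: L2_def)
qed

lemma normsq_eq_ip: "normsq M f = ip M f f"
  by (simp add: normsq_def ip_def power2_eq_square)

lemma normsq_nonneg: "0 \<le> normsq M f"
  by (simp add: normsq_def)

lemma ip_commute: "ip M f g = ip M g f"
  by (simp add: ip_def mult.commute)

lemma ip_add_left:
  "f \<in> L2 M \<Longrightarrow> g \<in> L2 M \<Longrightarrow> h \<in> L2 M \<Longrightarrow> ip M (\<lambda>x. f x + g x) h = ip M f h + ip M g h"
  unfolding ip_def
  by (subst Bochner_Integration.integral_add[symmetric])
     (auto intro!: L2_integrable_mult simp: algebra_simps)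

lemma ip_scale_left: "ip M (\<lambda>x. c * f x) h = c * ip M f h"
  unfolding ip_def by (simp add: mult.assoc)

lemma ip_diff_left:
  "f \<in> L2 M \<Longrightarrow> g \<in> L2 M \<Longrightarrow> h \<in> L2 M \<Longrightarrow> ip M (\<lambda>x. f x - g x) h = ip M f h - ip M g h"
  unfolding ip_def
  by (subst Bochner_Integration.integral_diff[symmetric])
     (auto intro!: L2_integrable_mult simp: algebra_simps)

lemma ip_add_right:
  "f \<in> L2 M \<Longrightarrow> g \<in> L2 M \<Longrightarrow> h \<in> L2 M \<Longrightarrow> ip M h (\<lambda>x. f x + g x) = ip M h f + ip M h g"
  by (simp add: ip_commute[of M h] ip_add_left)

lemma ip_scale_right: "ip M h (\<lambda>x. c * f x) = c * ip M h f"
  by (simp add: ip_commute[of M h] ip_scale_left)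

lemma ip_diff_right:
  "f \<in> L2 M \<Longrightarrow> g \<in> L2 M \<Longrightarrow> h \<in> L2 M \<Longrightarrow> ip M h (\<lambda>x. f x - g x) = ip M h f - ip M h g"
  by (simp add: ip_commute[of M h] ip_diff_left)

lemma ip_AE_cong:
  assumes "f \<in> borel_measurable M" "f' \<in> borel_measurable M" "g \<in> borel_measurable M"
    "AE x in M. f x = f' x"
  shows "ip M f g = ip M f' g"
  unfolding ip_def using assms by (intro integral_cong_AE) auto

lemma normsq_AE_cong:
  assumes "f \<in> borel_measurable M" "f' \<in> borel_measurable M" "AE x in M. f x = f' x"
  shows "normsq M f = normsq M f'"
  unfolding normsq_def using assms by (intro integral_cong_AE) auto

lemma normsq_scale: "normsq M (\<lambda>x. c * f x) = c\<^sup>2 * normsq M f"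
  unfolding normsq_def by (simp add: power_mult_distrib)

lemma normsq_minus_commute: "normsq M (\<lambda>x. f x - g x) = normsq M (\<lambda>x. g x - f x)"
  unfolding normsq_def by (simp add: power2_commute)

lemma normsq_add:
  "f \<in> L2 M \<Longrightarrow> g \<in> L2 M \<Longrightarrow>
    normsq M (\<lambda>x. f x + g x) = normsq M f + 2 * ip M f g + normsq M g"
  by (simp add: normsq_eq_ip ip_add_left ip_add_right L2_add ip_commute[of M g f])

lemma normsq_diff:
  "f \<in> L2 M \<Longrightarrow> g \<in> L2 M \<Longrightarrow>
    normsq M (\<lambda>x. f x - g x) = normsq M f - 2 * ip M f g + normsq M g"
  by (simp add: normsq_eq_ip ip_diff_left ip_diff_right L2_diff ip_commute[of M g f])

lemma normsq_add_le:
  assumes "f \<in> L2 M" "g \<in> L2 M"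
  shows "normsq M (\<lambda>x. f x + g x) \<le> 2 * normsq M f + 2 * normsq M g"
  using normsq_add[OF assms] normsq_diff[OF assms] normsq_nonneg[of M "\<lambda>x. f x - g x"] by simp

lemma normsq_diff_le:
  assumes "f \<in> L2 M" "g \<in> L2 M"
  shows "normsq M (\<lambda>x. f x - g x) \<le> 2 * normsq M f + 2 * normsq M g"
  using normsq_add[OF assms] normsq_diff[OF assms] normsq_nonneg[of M "\<lambda>x. f x + g x"] by simp

lemma normsq_0_iff:
  assumes "f \<in> L2 M"
  shows "normsq M f = 0 \<longleftrightarrow> (AE x in M. f x = 0)"
  using integral_nonneg_eq_0_iff_AE[of M "\<lambda>x. (f x)\<^sup>2"] assms
  by (simp add: L2_def normsq_def)

lemma Cauchy_Schwarz_L2: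
  assumes "f \<in> L2 M" "g \<in> L2 M"
  shows "(ip M f g)\<^sup>2 \<le> normsq M f * normsq M g"
proof -
  have 1: "0 \<le> normsq M f - 2 * t * ip M f g + t\<^sup>2 * normsq M g" for t
    using normsq_diff[OF assms(1) L2_scale[OF assms(2), of t]]
      normsq_nonneg[of M "\<lambda>x. f x - t * g x"]
    by (simp add: normsq_scale ip_scale_right)
  show ?thesis
  proof (cases "normsq M g = 0")
    case True
    then have "AE x in M. f x * g x = 0"
      using normsq_0_iff[OF assms(2)] by auto
    then have "ip M f g = 0"
      unfolding ip_def by (intro integral_eq_zero_AE) auto
    then show ?thesis using True by simp
  next
    case False
    then have pos: "normsq M g > 0" using normsq_nonneg[of M g] by simp
    from 1[of "ip M f g / normsq M g"] pos have
      "0 \<le> normsq M f - (ip M f g)\<^sup>2 / normsq M g"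
      by (simp add: field_simps power2_eq_square)
    then show ?thesis using pos by (simp add: field_simps)
  qed
qed

lemma abs_ip_le:
  assumes "f \<in> L2 M" "g \<in> L2 M"
  shows "\<bar>ip M f g\<bar> \<le> sqrt (normsq M f) * sqrt (normsq M g)"
  using real_sqrt_le_mono[OF Cauchy_Schwarz_L2[OF assms]] by (simp add: real_sqrt_mult)

lemma ip_tendsto_left:
  assumes "\<And>n. f n \<in> L2 M" "h \<in> L2 M" "g \<in> L2 M"
    "(\<lambda>n. normsq M (\<lambda>x. f n x - h x)) \<longlonglongrightarrow> 0"
  shows "(\<lambda>n. ip M (f n) g) \<longlonglongrightarrow> ip M h g"
proof -
  have "(\<lambda>n. ip M (\<lambda>x. f n x - h x) g) \<longlonglongrightarrow> 0"
  proof (rule Lim_null_comparison)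
    show "\<forall>\<^sub>F n in sequentially. norm (ip M (\<lambda>x. f n x - h x) g)
        \<le> sqrt (normsq M (\<lambda>x. f n x - h x)) * sqrt (normsq M g)"
      using abs_ip_le[OF L2_diff[OF assms(1,2)] assms(3)] by auto
    have "(\<lambda>n. sqrt (normsq M (\<lambda>x. f n x - h x)) * sqrt (normsq M g))
        \<longlonglongrightarrow> sqrt 0 * sqrt (normsq M g)"
      by (intro tendsto_intros assms)
    then show "(\<lambda>n. sqrt (normsq M (\<lambda>x. f n x - h x)) * sqrt (normsq M g)) \<longlonglongrightarrow> 0"
      by simp
  qed
  then have "(\<lambda>n. ip M (f n) g - ip M h g) \<longlonglongrightarrow> 0"
    by (simp add: ip_diff_left assms)
  then show ?thesis by (simp add: LIM_zero_iff)
qed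

lemma ip_tendsto:
  assumes f: "\<And>n. f n \<in> L2 M" "h \<in> L2 M" "(\<lambda>n. normsq M (\<lambda>x. f n x - h x)) \<longlonglongrightarrow> 0"
    and g: "\<And>n. g n \<in> L2 M" "k \<in> L2 M" "(\<lambda>n. normsq M (\<lambda>x. g n x - k x)) \<longlonglongrightarrow> 0"
  shows "(\<lambda>n. ip M (f n) (g n)) \<longlonglongrightarrow> ip M h k"
proof -
  have "(\<lambda>n. ip M (\<lambda>x. f n x - h x) (\<lambda>x. g n x - k x)) \<longlonglongrightarrow> 0"
  proof (rule Lim_null_comparison)
    show "\<forall>\<^sub>F n in sequentially. norm (ip M (\<lambda>x. f n x - h x) (\<lambda>x. g n x - k x))
        \<le> sqrt (normsq M (\<lambda>x. f n x - h x)) * sqrt (normsq M (\<lambda>x. g n x - k x))"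
      using abs_ip_le[OF L2_diff[OF f(1,2)] L2_diff[OF g(1,2)]] by auto
    have "(\<lambda>n. sqrt (normsq M (\<lambda>x. f n x - h x)) * sqrt (normsq M (\<lambda>x. g n x - k x)))
        \<longlonglongrightarrow> sqrt 0 * sqrt 0"
      by (intro tendsto_intros f g)
    then show "(\<lambda>n. sqrt (normsq M (\<lambda>x. f n x - h x)) * sqrt (normsq M (\<lambda>x. g n x - k x)))
        \<longlonglongrightarrow> 0" by simp
  qed
  moreover have "ip M (\<lambda>x. f n x - h x) (\<lambda>x. g n x - k x)
      = ip M (f n) (g n) - ip M (f n) k - ip M h (g n) + ip M h k" for n
    by (simp add: ip_diff_left ip_diff_right L2_diff f g)
  ultimately have "(\<lambda>n. ip M (f n) (g n) - ip M (f n) k - ip M h (g n) + ip M h k) \<longlonglongrightarrow> 0"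
    by simp
  moreover have "(\<lambda>n. ip M (f n) k) \<longlonglongrightarrow> ip M h k"
    by (rule ip_tendsto_left) (use f g in auto)
  moreover have "(\<lambda>n. ip M h (g n)) \<longlonglongrightarrow> ip M h k"
    by (subst (1 2) ip_commute, rule ip_tendsto_left) (use f g in auto)
  ultimately have "(\<lambda>n. (ip M (f n) (g n) - ip M (f n) k - ip M h (g n) + ip M h k)
      + ip M (f n) k + ip M h (g n) - ip M h k) \<longlonglongrightarrow> 0 + ip M h k + ip M h k - ip M h k"
    by (intro tendsto_intros)
  then show ?thesis by simp
qed

lemma normsq_tendsto:
  assumes "\<And>n. f n \<in> L2 M" "h \<in> L2 M" "(\<lambda>n. normsq M (\<lambda>x. f n x - h x)) \<longlonglongrightarrow> 0"
  shows "(\<lambda>n. normsq M (f n)) \<longlonglongrightarrow> normsq M h"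
  unfolding normsq_eq_ip using ip_tendsto assms by blast

lemma nn_integral_eq_normsq:
  "f \<in> L2 M \<Longrightarrow> (\<integral>\<^sup>+x. ennreal ((f x)\<^sup>2) \<partial>M) = ennreal (normsq M f)"
  unfolding normsq_def by (rule nn_integral_eq_integral) (auto simp: L2_def)

lemma L2_I_nn:
  assumes "f \<in> borel_measurable M" "(\<integral>\<^sup>+x. ennreal ((f x)\<^sup>2) \<partial>M) < \<infinity>"
  shows "f \<in> L2 M"
  unfolding L2_def using assms by (auto intro!: integrableI_nonneg)

lemma normsq_le_nn:
  assumes "f \<in> borel_measurable M" "(\<integral>\<^sup>+x. ennreal ((f x)\<^sup>2) \<partial>M) \<le> ennreal c" "0 \<le> c"
  shows "f \<in> L2 M" "normsq M f \<le> c"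
proof -
  show 1: "f \<in> L2 M"
    by (rule L2_I_nn[OF assms(1)]) (use assms(2) in \<open>auto intro: le_less_trans\<close>)
  show "normsq M f \<le> c"
    using assms nn_integral_eq_normsq[OF 1] by simp
qed

context finite_measure
begin

lemma L2_integrable: "f \<in> L2 M \<Longrightarrow> integrable M f"
  by (rule square_integrable_imp_integrable) (simp_all add: L2_def)

lemma L2_const: "(\<lambda>x. c) \<in> L2 M"
  by (simp add: L2_def)

lemma L2_bounded:
  assumes "f \<in> borel_measurable M" "AE x in M. \<bar>f x\<bar> \<le> C"
  shows "f \<in> L2 M"
proof -
  have "integrable M (\<lambda>x. (f x)\<^sup>2)"
  proof (rule integrable_const_bound)
    show "AE x in M. norm ((f x)\<^sup>2) \<le> C\<^sup>2"
      using assms(2)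
    proof eventually_elim
      case (elim x)
      then have "\<bar>f x\<bar>\<^sup>2 \<le> C\<^sup>2" by (intro power_mono) auto
      then show ?case by simp
    qed
  qed (use assms in auto)
  then show ?thesis using assms by (simp add: L2_def)
qed

lemma L1_le_L2:
  assumes "f \<in> L2 M"
  shows "(LINT x|M. \<bar>f x\<bar>) \<le> sqrt (normsq M f) * sqrt (measure M (space M))"
proof -
  have a: "(\<lambda>x. \<bar>f x\<bar>) \<in> L2 M"
    using assms by (auto simp: L2_def)
  have "\<bar>ip M (\<lambda>x. \<bar>f x\<bar>) (\<lambda>x. 1)\<bar> \<le> sqrt (normsq M (\<lambda>x. \<bar>f x\<bar>)) * sqrt (normsq M (\<lambda>x. 1))"
    by (rule abs_ip_le[OF a L2_const])
  then show ?thesis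
    by (simp add: ip_def normsq_def)
qed

text \<open>
  The Riesz--Fischer theorem. A subsequence with summable increments converges almost everywhere,
  since on a finite measure space the increments are also summable in mean; Fatou's lemma turns
  its pointwise limit into a limit in mean square.
\<close>

lemma L2_complete:
  assumes f: "\<And>n. f n \<in> L2 M"
    and cauchy: "\<And>e. e > 0 \<Longrightarrow> \<exists>N. \<forall>m\<ge>N. \<forall>n\<ge>N. normsq M (\<lambda>x. f m x - f n x) \<le> e"
  obtains h where "h \<in> L2 M" "(\<lambda>n. normsq M (\<lambda>x. f n x - h x)) \<longlonglongrightarrow> 0"
proof -
  have [measurable]: "f n \<in> borel_measurable M" for n using f L2_measurable by blast
  have "\<exists>N. \<forall>m\<ge>N. \<forall>n\<ge>N. normsq M (\<lambda>x. f m x - f n x) \<le> (1/4)^k" for k :: nat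
    by (rule cauchy) simp
  then obtain N where N: "\<And>k m n. N k \<le> m \<Longrightarrow> N k \<le> n \<Longrightarrow>
      normsq M (\<lambda>x. f m x - f n x) \<le> (1/4)^k" by metis
  define r where "r k = k + (\<Sum>j\<le>k. N j)" for k
  have rN: "N k \<le> r k" for k unfolding r_def by (rule trans_le_add2, rule member_le_sum) auto
  have rmono: "r k \<le> r (Suc k)" for k unfolding r_def by simp
  define d where "d k x = f (r (Suc k)) x - f (r k) x" for k x
  have [measurable]: "d k \<in> borel_measurable M" for k unfolding d_def by measurable
  have dL2: "d k \<in> L2 M" for k unfolding d_def by (intro L2_diff f)
  have dn: "normsq M (d k) \<le> (1/4)^k" for k
    unfolding d_def by (rule N) (use rN[of k] rmono[of k] in auto)
  let ?C = "sqrt (measure M (space M))"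
  have d1: "(LINT x|M. \<bar>d k x\<bar>) \<le> (1/2)^k * ?C" for k
  proof -
    have "sqrt (normsq M (d k)) \<le> sqrt ((1/4)^k)" using dn by simp
    also have "\<dots> = (1/2)^k" by (simp add: real_sqrt_power real_sqrt_divide)
    finally show ?thesis
      using L1_le_L2[OF dL2[of k]] by (meson mult_right_mono order_trans real_sqrt_ge_zero measure_nonneg)
  qed
  have "(\<integral>\<^sup>+x. (\<Sum>k. ennreal \<bar>d k x\<bar>) \<partial>M) = (\<Sum>k. \<integral>\<^sup>+x. ennreal \<bar>d k x\<bar> \<partial>M)"
    by (rule nn_integral_suminf) measurable
  also have "\<dots> \<le> (\<Sum>k. ennreal ((1/2)^k * ?C))"
  proof (rule suminf_le)
    show "(\<integral>\<^sup>+x. ennreal \<bar>d k x\<bar> \<partial>M) \<le> ennreal ((1/2)^k * ?C)" for k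
      using nn_integral_eq_integral[of M "\<lambda>x. \<bar>d k x\<bar>"] L2_integrable[OF dL2[of k]] d1[of k]
      by (simp add: ennreal_leI)
  qed auto
  also have "\<dots> = ennreal (\<Sum>k. (1/2)^k * ?C)"
    by (rule suminf_ennreal2) (auto intro!: summable_mult2 summable_geometric)
  also have "\<dots> < \<infinity>" by simp
  finally have "(\<integral>\<^sup>+x. (\<Sum>k. ennreal \<bar>d k x\<bar>) \<partial>M) \<noteq> \<infinity>" by simp
  then have "AE x in M. (\<Sum>k. ennreal \<bar>d k x\<bar>) \<noteq> \<infinity>"
    by (intro nn_integral_PInf_AE) measurable
  then have AEconv: "AE x in M. convergent (\<lambda>k. f (r k) x)"
  proof eventually_elim
    case (elim x)
    then have "summable (\<lambda>k. \<bar>d k x\<bar>)"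
      by (intro summable_suminf_not_top) auto
    then have "summable (\<lambda>k. d k x)" by (rule summable_rabs_cancel)
    then have "convergent (\<lambda>n. \<Sum>k<n. d k x)" by (simp add: summable_iff_convergent)
    moreover have "(\<Sum>k<n. d k x) = f (r n) x - f (r 0) x" for n
      unfolding d_def by (rule sum_lessThan_telescope)
    ultimately have "convergent (\<lambda>n. f (r n) x - f (r 0) x)" by simp
    then have "convergent (\<lambda>n. (f (r n) x - f (r 0) x) + f (r 0) x)"
      by (intro convergent_add convergent_const)
    then show ?case by simp
  qed
  define h where "h x = lim (\<lambda>k. f (r k) x)" for x
  have [measurable]: "h \<in> borel_measurable M" unfolding h_def by measurable
  have lim: "AE x in M. (\<lambda>k. f (r k) x) \<longlonglongrightarrow> h x"
    using AEconv unfolding h_def by eventually_elim (simp add: convergent_LIMSEQ_iff)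
  have est: "(\<integral>\<^sup>+x. ennreal ((f n x - h x)\<^sup>2) \<partial>M) \<le> ennreal e"
    if n: "n \<ge> L"
      and L: "\<forall>m\<ge>L. \<forall>n\<ge>L. normsq M (\<lambda>x. f m x - f n x) \<le> e" for e n L
  proof -
    have "(\<integral>\<^sup>+x. ennreal ((f n x - h x)\<^sup>2) \<partial>M)
        = (\<integral>\<^sup>+x. liminf (\<lambda>k. ennreal ((f n x - f (r k) x)\<^sup>2)) \<partial>M)"
    proof (rule nn_integral_cong_AE)
      show "AE x in M. ennreal ((f n x - h x)\<^sup>2) = liminf (\<lambda>k. ennreal ((f n x - f (r k) x)\<^sup>2))"
        using lim
      proof eventually_elim
        case (elim x)
        have "(\<lambda>k. ennreal ((f n x - f (r k) x)\<^sup>2)) \<longlonglongrightarrow> ennreal ((f n x - h x)\<^sup>2)"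
          by (intro tendsto_intros elim)
        from lim_imp_Liminf[OF _ this] show ?case by simp
      qed
    qed
    also have "\<dots> \<le> liminf (\<lambda>k. \<integral>\<^sup>+x. ennreal ((f n x - f (r k) x)\<^sup>2) \<partial>M)"
      by (rule nn_integral_liminf) measurable
    also have "\<dots> \<le> liminf (\<lambda>k::nat. ennreal e)"
    proof (rule Liminf_mono)
      show "\<forall>\<^sub>F k in sequentially. (\<integral>\<^sup>+x. ennreal ((f n x - f (r k) x)\<^sup>2) \<partial>M) \<le> ennreal e"
        using eventually_ge_at_top[of L]
      proof eventually_elim
        case (elim k)
        then have "r k \<ge> L" by (simp add: r_def)
        then show ?case
          using L n nn_integral_eq_normsq[OF L2_diff[OF f[of n] f[of "r k"]]]
          by (simp add: ennreal_leI)
      qed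
    qed
    also have "\<dots> = ennreal e" by (simp add: Liminf_const)
    finally show ?thesis .
  qed
  have hL2: "h \<in> L2 M"
  proof -
    obtain L where L: "\<forall>m\<ge>L. \<forall>n\<ge>L. normsq M (\<lambda>x. f m x - f n x) \<le> 1"
      using cauchy[of 1] by auto
    have "(\<lambda>x. f L x - h x) \<in> L2 M"
      by (rule normsq_le_nn(1)[of _ _ 1]) (use est[OF order_refl L] in auto)
    from L2_diff[OF f[of L] this] show ?thesis by simp
  qed
  have "(\<lambda>n. normsq M (\<lambda>x. f n x - h x)) \<longlonglongrightarrow> 0"
  proof (rule LIMSEQ_I)
    fix e :: real assume e: "e > 0"
    obtain L where L: "\<forall>m\<ge>L. \<forall>n\<ge>L. normsq M (\<lambda>x. f m x - f n x) \<le> e/2"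
      using cauchy[of "e/2"] e by auto
    have le: "normsq M (\<lambda>x. f n x - h x) \<le> e/2" if "n \<ge> L" for n
      by (rule normsq_le_nn(2)) (use est[OF that L] e in auto)
    show "\<exists>no. \<forall>n\<ge>no. norm (normsq M (\<lambda>x. f n x - h x) - 0) < e"
    proof (intro exI[of _ L] allI impI)
      fix n assume "L \<le> n"
      from le[OF this] normsq_nonneg[of M "\<lambda>x. f n x - h x"] e
      show "norm (normsq M (\<lambda>x. f n x - h x) - 0) < e" by simp
    qed
  qed
  with hL2 show ?thesis by (rule that)
qed

text \<open>
  The projection theorem: the parallelogram law makes a sequence of elements of \<open>V\<close> that minimises
  the distance to \<open>g\<close> a Cauchy sequence, and its limit is the foot of the perpendicular.
\<close>

lemma L2_projection:
  assumes V: "V \<subseteq> L2 M" "V \<noteq> {}"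
    and add: "\<And>f g. f \<in> V \<Longrightarrow> g \<in> V \<Longrightarrow> (\<lambda>x. f x + g x) \<in> V"
    and scale: "\<And>f c. f \<in> V \<Longrightarrow> (\<lambda>x. c * f x) \<in> V"
    and closed: "\<And>f h. (\<And>n::nat. f n \<in> V) \<Longrightarrow> h \<in> L2 M \<Longrightarrow>
        (\<lambda>n. normsq M (\<lambda>x. f n x - h x)) \<longlonglongrightarrow> 0 \<Longrightarrow> h \<in> V"
    and g: "g \<in> L2 M"
  obtains m where "m \<in> V" "\<And>v. v \<in> V \<Longrightarrow> ip M (\<lambda>x. g x - m x) v = 0"
proof -
  define D where "D = (INF v\<in>V. normsq M (\<lambda>x. g x - v x))"
  have bdd: "bdd_below ((\<lambda>v. normsq M (\<lambda>x. g x - v x)) ` V)"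
    by (rule bdd_belowI2[of _ 0]) (rule normsq_nonneg)
  have D_le: "D \<le> normsq M (\<lambda>x. g x - v x)" if "v \<in> V" for v
    unfolding D_def by (rule cINF_lower[OF bdd that])
  have "\<exists>v\<in>V. normsq M (\<lambda>x. g x - v x) < D + 1 / Suc n" for n
    using cINF_less_iff[OF V(2) bdd, of "D + 1 / Suc n"] by (simp add: D_def)
  then obtain v where vV: "\<And>n. v n \<in> V"
    and v: "\<And>n. normsq M (\<lambda>x. g x - v n x) < D + 1 / Suc n" by metis
  have vL: "v n \<in> L2 M" for n using vV V by auto
  have par: "normsq M (\<lambda>x. v m x - v n x) \<le> 2 * (1 / Suc m) + 2 * (1 / Suc n)" for m n
  proof -
    let ?a = "\<lambda>x. g x - v m x" and ?b = "\<lambda>x. g x - v n x"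
    have L: "?a \<in> L2 M" "?b \<in> L2 M" by (intro L2_diff g vL)+
    have "(\<lambda>x. (1/2) * (v m x + v n x)) \<in> V" by (intro scale add vV)
    from D_le[OF this] have "D \<le> normsq M (\<lambda>x. (1/2) * (?a x + ?b x))"
      by (simp add: field_simps)
    then have "4 * D \<le> normsq M (\<lambda>x. ?a x + ?b x)"
      unfolding normsq_scale by (simp add: power2_eq_square)
    moreover have "normsq M (\<lambda>x. v m x - v n x) = normsq M (\<lambda>x. ?a x - ?b x)"
      by (subst normsq_minus_commute) simp
    ultimately show ?thesis
      using normsq_add[OF L] normsq_diff[OF L] v[of m] v[of n] by simp
  qed
  have "\<exists>N. \<forall>m\<ge>N. \<forall>n\<ge>N. normsq M (\<lambda>x. v m x - v n x) \<le> e" if e: "e > 0" for e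
  proof -
    obtain N where N: "1 / real (Suc N) < e / 4"
      using nat_approx_posE[of "e/4"] e by auto
    have le: "1 / real (Suc m) \<le> 1 / real (Suc N)" if "m \<ge> N" for m
      using that by (simp add: frac_le)
    show ?thesis
    proof (intro exI[of _ N] allI impI)
      fix m n assume "N \<le> m" "N \<le> n"
      from this[THEN le] show "normsq M (\<lambda>x. v m x - v n x) \<le> e"
        using par[of m n] N by linarith
    qed
  qed
  then obtain m where mL: "m \<in> L2 M" and lim: "(\<lambda>n. normsq M (\<lambda>x. v n x - m x)) \<longlonglongrightarrow> 0"
    by (rule L2_complete[OF vL])
  have mV: "m \<in> V" by (rule closed[OF vV mL lim])
  have "normsq M (\<lambda>x. g x - m x) \<le> D"
  proof (rule LIMSEQ_le)
    show "(\<lambda>n. normsq M (\<lambda>x. g x - v n x)) \<longlonglongrightarrow> normsq M (\<lambda>x. g x - m x)"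
      by (rule normsq_tendsto)
         (use lim in \<open>auto intro!: L2_diff g vL mL simp: normsq_minus_commute[of _ m]\<close>)
    have "(\<lambda>n. D + 1 / Suc n) \<longlonglongrightarrow> D + 0"
      by (intro tendsto_intros LIMSEQ_Suc[OF lim_1_over_n])
    then show "(\<lambda>n. D + 1 / Suc n) \<longlonglongrightarrow> D" by simp
  qed (use v in \<open>auto intro: less_imp_le\<close>)
  then have min: "normsq M (\<lambda>x. g x - m x) \<le> normsq M (\<lambda>x. g x - u x)" if "u \<in> V" for u
    using D_le[OF that] by simp
  have "ip M (\<lambda>x. g x - m x) u = 0" if u: "u \<in> V" for u
  proof -
    let ?e = "\<lambda>x. g x - m x"
    have uL: "u \<in> L2 M" and eL: "?e \<in> L2 M" using u V g mL by (auto intro: L2_diff)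
    have 1: "0 \<le> t\<^sup>2 * normsq M u - 2 * t * ip M ?e u" for t
    proof -
      have "normsq M ?e \<le> normsq M (\<lambda>x. g x - (m x + t * u x))"
        by (rule min) (intro add scale u mV)
      also have "\<dots> = normsq M (\<lambda>x. ?e x - t * u x)" by (simp add: algebra_simps)
      finally show ?thesis
        using normsq_diff[OF eL L2_scale[OF uL, of t]] by (simp add: normsq_scale ip_scale_right)
    qed
    define s where "s = 1 / (normsq M u + 1)"
    have s: "0 < s" "s * normsq M u < 1"
      using normsq_nonneg[of M u] by (auto simp: s_def field_simps)
    from 1[of "s * ip M ?e u"] have "0 \<le> s * (ip M ?e u)\<^sup>2 * (s * normsq M u - 2)"
      by (simp add: algebra_simps power2_eq_square)
    then have "(ip M ?e u)\<^sup>2 * (s * (2 - s * normsq M u)) \<le> 0"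
      by (simp add: algebra_simps)
    moreover have "0 < s * (2 - s * normsq M u)"
      using s by (intro mult_pos_pos) auto
    ultimately have "(ip M ?e u)\<^sup>2 \<le> 0"
      using mult_pos_pos[of "(ip M ?e u)\<^sup>2" "s * (2 - s * normsq M u)"] by (auto simp del: zero_less_power2 simp flip: not_less)
    then show ?thesis by simp
  qed
  with mV show ?thesis by (rule that)
qed

end


section \<open>Test functions\<close>

definition smooth :: "(real \<Rightarrow> real) \<Rightarrow> bool" where
  "smooth f \<longleftrightarrow> (\<forall>n x. (deriv ^^ n) f field_differentiable at x)"

lemma smooth_differentiable: "smooth f \<Longrightarrow> f field_differentiable at x"
  unfolding smooth_def by (drule spec[of _ 0]) simp

lemma smooth_deriv: "smooth f \<Longrightarrow> smooth (deriv f)"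
  unfolding smooth_def
proof (intro allI)
  fix n x
  assume "\<forall>n x. (deriv ^^ n) f field_differentiable at x"
  then have "(deriv ^^ Suc n) f field_differentiable at x" by blast
  then show "(deriv ^^ n) (deriv f) field_differentiable at x"
    by (simp only: funpow_Suc_right o_def)
qed

text \<open>
  Smoothness is established coinductively: a family of differentiable functions consists of smooth
  functions if the derivative of each member is a combination, by sums and products, of members.
\<close>

inductive_set algebra_of :: "(real \<Rightarrow> real) set \<Rightarrow> (real \<Rightarrow> real) set" for S where
  base: "f \<in> S \<Longrightarrow> f \<in> algebra_of S"
| add: "f \<in> algebra_of S \<Longrightarrow> g \<in> algebra_of S \<Longrightarrow> (\<lambda>x. f x + g x) \<in> algebra_of S"
| mult: "f \<in> algebra_of S \<Longrightarrow> g \<in> algebra_of S \<Longrightarrow> (\<lambda>x. f x * g x) \<in> algebra_of S"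

lemma algebra_of_deriv:
  assumes S: "\<And>f x. f \<in> S \<Longrightarrow> f field_differentiable at x" "\<And>f. f \<in> S \<Longrightarrow> deriv f \<in> algebra_of S"
    and "f \<in> algebra_of S"
  shows "(\<forall>x. f field_differentiable at x) \<and> deriv f \<in> algebra_of S"
  using assms(3)
proof induction
  case (base f)
  then show ?case using S by blast
next
  case (add f g)
  then have "deriv (\<lambda>x. f x + g x) = (\<lambda>x. deriv f x + deriv g x)"
    by (intro ext deriv_add) auto
  with add show ?case by (auto intro!: algebra_of.add field_differentiable_add)
next
  case (mult f g)
  then have "deriv (\<lambda>x. f x * g x) = (\<lambda>x. f x * deriv g x + deriv f x * g x)"
    by (intro ext deriv_mult) auto
  with mult show ?case
    by (auto intro!: algebra_of.add algebra_of.mult field_differentiable_mult)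
qed

lemma smooth_algebra_of:
  assumes S: "\<And>f x. f \<in> S \<Longrightarrow> f field_differentiable at x" "\<And>f. f \<in> S \<Longrightarrow> deriv f \<in> algebra_of S"
    and f: "f \<in> algebra_of S"
  shows "smooth f"
proof -
  have "(deriv ^^ n) f \<in> algebra_of S" for n
    by (induction n) (use f algebra_of_deriv[OF S] in auto)
  then show ?thesis
    unfolding smooth_def using algebra_of_deriv[OF S] by blast
qed

lemma
  assumes "smooth f" "smooth g"
  shows smooth_add: "smooth (\<lambda>x. f x + g x)"
    and smooth_mult: "smooth (\<lambda>x. f x * g x)"
proof -
  have *: "h \<in> algebra_of (Collect smooth) \<Longrightarrow> smooth h" for h
    by (rule smooth_algebra_of[of "Collect smooth"])
      (auto intro: smooth_differentiable smooth_deriv algebra_of.base)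
  show "smooth (\<lambda>x. f x + g x)" "smooth (\<lambda>x. f x * g x)"
    by (intro * algebra_of.add algebra_of.mult algebra_of.base; simp add: assms)+
qed

lemma smooth_const: "smooth (\<lambda>x. c)"
proof (rule smooth_algebra_of[of "range (\<lambda>c x. c)"])
  fix f :: "real \<Rightarrow> real" assume "f \<in> range (\<lambda>c x. c)"
  then obtain c where f: "f = (\<lambda>x. c)" by blast
  show "f field_differentiable at x" for x unfolding f by simp
  have "deriv f = (\<lambda>x. 0)" unfolding f by (rule ext) simp
  then show "deriv f \<in> algebra_of (range (\<lambda>c x. c))" by (auto intro: algebra_of.base)
qed (auto intro: algebra_of.base)

lemma smooth_power: "smooth f \<Longrightarrow> smooth (\<lambda>x. f x ^ n)"
  by (induction n) (auto intro: smooth_mult smooth_const)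

text \<open>
  The functions \<open>flat_exp k\<close> span a space that is closed under derivatives; \<open>flat_exp 0\<close> is the
  classical smooth function that vanishes on a half-line only.
\<close>

definition flat_exp :: "nat \<Rightarrow> real \<Rightarrow> real" where
  "flat_exp k x = (if 0 < x then exp (- 1 / x) / x ^ k else 0)"

lemma flat_exp_tendsto_0: "(flat_exp k \<longlongrightarrow> 0) (at 0)"
proof -
  have "((\<lambda>x::real. (1/x) ^ k / exp (1/x)) \<longlongrightarrow> 0) (at_right 0)"
    using filterlim_compose[OF tendsto_power_div_exp_0 filterlim_inverse_at_top_right, of k]
    by (simp add: inverse_eq_divide)
  moreover have "\<forall>\<^sub>F x in at_right 0. (1/x) ^ k / exp (1/x) = flat_exp k x"
    unfolding eventually_at_right_field
    by (intro exI[of _ 1]) (auto simp: flat_exp_def exp_minus field_simps)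
  ultimately have r: "(flat_exp k \<longlongrightarrow> 0) (at_right 0)"
    by (rule Lim_transform_eventually)
  have "\<forall>\<^sub>F x in at_left 0. 0 = flat_exp k x"
    unfolding eventually_at_left_field
    by (intro exI[of _ "-1"]) (auto simp: flat_exp_def)
  then have l: "(flat_exp k \<longlongrightarrow> 0) (at_left 0)"
    by (rule Lim_transform_eventually[OF tendsto_const])
  show ?thesis using l r by (rule filterlim_split_at_real)
qed

lemma flat_exp_deriv:
  "(flat_exp k has_real_derivative flat_exp (k+2) x - real k * flat_exp (k+1) x) (at x)"
proof -
  consider "x > 0" | "x < 0" | "x = 0" by linarith
  then show ?thesis
  proof cases
    case 1
    have "((\<lambda>x. exp (- 1 / x) / x ^ k) has_real_derivative
        flat_exp (k+2) x - real k * flat_exp (k+1) x) (at x)"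
    proof (cases k)
      case 0
      then show ?thesis
        using 1 by (auto intro!: derivative_eq_intros simp: flat_exp_def power2_eq_square)
    next
      case (Suc m)
      have pw: "((\<lambda>x. x ^ Suc m) has_real_derivative real (Suc m) * x ^ m) (at x)"
        using DERIV_pow[of "Suc m" x] by simp
      have ex: "((\<lambda>x. exp (- 1 / x)) has_real_derivative exp (- 1 / x) * (1 / x\<^sup>2)) (at x)"
        using 1 by (auto intro!: derivative_eq_intros simp: power2_eq_square)
      have "((\<lambda>x. exp (- 1 / x) / x ^ Suc m) has_real_derivative
          (exp (- 1 / x) * (1 / x\<^sup>2) * x ^ Suc m - exp (- 1 / x) * (real (Suc m) * x ^ m))
            / (x ^ Suc m * x ^ Suc m)) (at x)"
        using 1 by (intro DERIV_divide[OF ex pw]) simp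
      moreover have "(exp (- 1 / x) * (1 / x\<^sup>2) * x ^ Suc m - exp (- 1 / x) * (real (Suc m) * x ^ m))
            / (x ^ Suc m * x ^ Suc m) = flat_exp (k+2) x - real k * flat_exp (k+1) x"
        using 1 unfolding Suc by (simp add: flat_exp_def field_simps power2_eq_square)
      ultimately show ?thesis unfolding Suc by simp
    qed
    moreover have ev: "\<forall>\<^sub>F y in nhds x. exp (- 1 / y) / y ^ k = flat_exp k y"
      using eventually_nhds_in_open[of "{0<..}" x] 1
      by (auto elim!: eventually_mono simp: flat_exp_def)
    ultimately show ?thesis
      by (simp only: DERIV_cong_ev[OF refl ev refl])
  next
    case 2
    have "((\<lambda>x. 0) has_real_derivative flat_exp (k+2) x - real k * flat_exp (k+1) x) (at x)"
      using 2 by (simp add: flat_exp_def)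
    moreover have ev: "\<forall>\<^sub>F y in nhds x. 0 = flat_exp k y"
      using eventually_nhds_in_open[of "{..<0}" x] 2
      by (auto elim!: eventually_mono simp: flat_exp_def)
    ultimately show ?thesis
      by (simp only: DERIV_cong_ev[OF refl ev refl])
  next
    case 3
    have "((\<lambda>h. flat_exp k h / h) \<longlongrightarrow> 0) (at 0)"
      by (rule Lim_transform_eventually[OF flat_exp_tendsto_0[of "Suc k"]])
        (auto simp: flat_exp_def eventually_at_filter)
    then show ?thesis
      unfolding 3 has_field_derivative_iff by (simp add: flat_exp_def)
  qed
qed

lemma smooth_flat_exp: "smooth (\<lambda>x. flat_exp k (p * x + q))"
proof -
  define S where "S = range (\<lambda>c x. c::real) \<union> {\<lambda>x. flat_exp k (p * x + q) | k. True}"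
  have const: "(\<lambda>x. c) \<in> algebra_of S" for c
    by (rule algebra_of.base) (auto simp: S_def)
  have fe: "(\<lambda>x. flat_exp k (p * x + q)) \<in> algebra_of S" for k
    by (rule algebra_of.base) (auto simp: S_def)
  have der: "((\<lambda>x. flat_exp k (p * x + q)) has_real_derivative
      p * flat_exp (k+2) (p * x + q) + (- real k * p) * flat_exp (k+1) (p * x + q)) (at x)" for k x
    by (rule DERIV_cong[OF DERIV_chain2[OF flat_exp_deriv]])
      (auto intro!: derivative_eq_intros simp: algebra_simps)
  show ?thesis
  proof (rule smooth_algebra_of[of S])
    fix f assume "f \<in> S"
    then consider c where "f = (\<lambda>x. c)" | k where "f = (\<lambda>x. flat_exp k (p * x + q))"
      by (auto simp: S_def)
    then have "(\<forall>x. f field_differentiable at x) \<and> deriv f \<in> algebra_of S"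
    proof cases
      case 1
      then have "deriv f = (\<lambda>x. 0)" by (intro ext) simp
      then show ?thesis using const[of 0] 1 by simp
    next
      case 2
      have "deriv f = (\<lambda>x. p * flat_exp (k+2) (p * x + q) + (- real k * p) * flat_exp (k+1) (p * x + q))"
        unfolding 2 by (intro ext DERIV_imp_deriv der)
      moreover have "\<dots> \<in> algebra_of S"
        by (intro algebra_of.add algebra_of.mult const fe)
      ultimately show ?thesis
        using der unfolding 2 field_differentiable_def by metis
    qed
    then show "f field_differentiable at x" "deriv f \<in> algebra_of S" for x by auto
  qed (rule fe)
qed

lemma test_functionI:
  assumes "smooth \<phi>" "0 < a" "b < 1" "\<And>x. x \<notin> {a..b} \<Longrightarrow> \<phi> x = 0"
  shows "test_function \<phi>"
proof -
  have "closure {x. \<phi> x \<noteq> 0} \<subseteq> {a..b}"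
    using assms(4) by (intro closure_minimal closed_atLeastAtMost) blast
  then show ?thesis
    using assms unfolding test_function_def smooth_def by force
qed

lemma test_function_smooth: "test_function \<phi> \<Longrightarrow> smooth \<phi>"
  unfolding test_function_def smooth_def by blast

lemma test_function_support:
  assumes "test_function \<phi>"
  obtains a b where "0 < a" "a < b" "b < 1" "\<And>x. x \<notin> {a..b} \<Longrightarrow> \<phi> x = 0"
proof -
  define S where "S = closure {x. \<phi> x \<noteq> 0}"
  have S: "S \<subseteq> {0<..<1}" using assms by (auto simp: test_function_def S_def)
  have z: "\<phi> x = 0" if "x \<notin> S" for x
    using that closure_subset[of "{x. \<phi> x \<noteq> 0}"] unfolding S_def by auto
  show ?thesis
  proof (cases "S = {}")
    case True
    show ?thesis by (rule that[of "1/3" "1/2"]) (use z True in auto)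
  next
    case False
    have "bounded S" by (rule bounded_subset[OF _ S]) simp
    then have c: "compact S" unfolding compact_eq_bounded_closed by (simp add: S_def)
    obtain p where p: "p \<in> S" "\<And>x. x \<in> S \<Longrightarrow> p \<le> x"
      using compact_attains_inf[OF c False] by auto
    obtain q where q: "q \<in> S" "\<And>x. x \<in> S \<Longrightarrow> x \<le> q"
      using compact_attains_sup[OF c False] by auto
    have pq: "0 < p" "p < 1" "0 < q" "q < 1" using p(1) q(1) S by auto
    show ?thesis
    proof (rule that[of p "(q + 1) / 2"])
      show "p < (q + 1) / 2" using p(2)[OF q(1)] pq by simp
      fix x assume "x \<notin> {p..(q + 1) / 2}"
      then have "x \<notin> S" using p(2)[of x] q(2)[of x] pq by auto
      then show "\<phi> x = 0" by (rule z)
    qed (use pq in auto)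
  qed
qed

lemma test_function_eq_0: "test_function \<phi> \<Longrightarrow> x \<notin> {0<..<1} \<Longrightarrow> \<phi> x = 0"
  by (erule test_function_support) auto

lemma test_function_DERIV: "test_function \<phi> \<Longrightarrow> (\<phi> has_real_derivative deriv \<phi> x) (at x)"
  by (simp add: DERIV_deriv_iff_field_differentiable test_function_smooth smooth_differentiable)

lemma test_function_deriv:
  assumes "test_function \<phi>"
  shows "test_function (deriv \<phi>)"
proof -
  obtain a b where ab: "0 < a" "a < b" "b < 1" "\<And>x. x \<notin> {a..b} \<Longrightarrow> \<phi> x = 0"
    using test_function_support[OF assms] by metis
  show ?thesis
  proof (rule test_functionI[OF _ ab(1,3)])
    show "smooth (deriv \<phi>)" using assms by (intro smooth_deriv test_function_smooth)
    fix x assume "x \<notin> {a..b}"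
    then have "\<forall>\<^sub>F y in nhds x. y \<in> - {a..b}"
      by (intro eventually_nhds_in_open open_Compl closed_atLeastAtMost) blast
    then have "\<forall>\<^sub>F y in nhds x. \<phi> y = 0"
      by (rule eventually_mono) (use ab(4) in blast)
    then have "deriv \<phi> x = deriv (\<lambda>x. 0) x"
      by (rule deriv_cong_ev) (rule refl)
    then show "deriv \<phi> x = 0" by simp
  qed
qed

lemma test_function_mult_smooth:
  assumes "test_function \<phi>" "smooth f"
  shows "test_function (\<lambda>x. f x * \<phi> x)"
  by (rule test_function_support[OF assms(1)], rule test_functionI)
    (use assms in \<open>auto intro: smooth_mult test_function_smooth\<close>)

lemma test_function_scale: "test_function \<phi> \<Longrightarrow> test_function (\<lambda>x. c * \<phi> x)"
  using test_function_mult_smooth[OF _ smooth_const] .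

lemma test_function_add:
  assumes "test_function \<phi>" "test_function \<psi>"
  shows "test_function (\<lambda>x. \<phi> x + \<psi> x)"
proof -
  obtain a b where ab: "0 < a" "a < b" "b < 1" "\<And>x. x \<notin> {a..b} \<Longrightarrow> \<phi> x = 0"
    using test_function_support[OF assms(1)] by metis
  obtain c d where cd: "0 < c" "c < d" "d < 1" "\<And>x. x \<notin> {c..d} \<Longrightarrow> \<psi> x = 0"
    using test_function_support[OF assms(2)] by metis
  show ?thesis
  proof (rule test_functionI[of _ "min a c" "max b d"])
    show "smooth (\<lambda>x. \<phi> x + \<psi> x)" using assms by (intro smooth_add test_function_smooth)
    fix x assume "x \<notin> {min a c..max b d}"
    then have "x \<notin> {a..b}" "x \<notin> {c..d}" by auto
    then show "\<phi> x + \<psi> x = 0" using ab cd by auto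
  qed (use ab cd in auto)
qed

lemma test_function_diff:
  assumes "test_function \<phi>" "test_function \<psi>"
  shows "test_function (\<lambda>x. \<phi> x - \<psi> x)"
  using test_function_add[OF assms(1) test_function_scale[OF assms(2), of "-1"]] by simp

lemma test_function_continuous: "test_function \<phi> \<Longrightarrow> continuous_on A \<phi>"
  by (meson DERIV_isCont continuous_at_imp_continuous_on test_function_DERIV)

lemma test_function_borel: "test_function \<phi> \<Longrightarrow> \<phi> \<in> borel_measurable borel"
  by (intro borel_measurable_continuous_onI test_function_continuous)

lemma test_function_bounded:
  assumes "test_function \<phi>"
  obtains C where "0 \<le> C" "\<And>x. \<bar>\<phi> x\<bar> \<le> C"
proof -
  have "compact (\<phi> ` {0..1})"
    by (intro compact_continuous_image test_function_continuous assms) simp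
  then obtain C where C: "\<And>x. x \<in> {0..1} \<Longrightarrow> \<bar>\<phi> x\<bar> \<le> C"
    by (fastforce dest: compact_imp_bounded simp: bounded_iff)
  show ?thesis
  proof (rule that[of "max C 0"])
    fix x show "\<bar>\<phi> x\<bar> \<le> max C 0"
      using C[of x] test_function_eq_0[OF assms, of x] by (cases "x \<in> {0<..<1}") auto
  qed simp
qed

text \<open>
  With a bump \<open>b\<close> that takes values in \<open>(0,1)\<close> on an interval and vanishes elsewhere, the test
  functions \<open>1 - (1 - b)\<^sup>n\<close> increase to the indicator function of that interval.
\<close>

lemma test_functions_tendsto_indicator:
  assumes "0 < a" "b < 1"
  obtains \<phi> :: "nat \<Rightarrow> real \<Rightarrow> real" where "\<And>n. test_function (\<phi> n)"
    "\<And>n x. 0 \<le> \<phi> n x" "\<And>n x. \<phi> n x \<le> 1" "\<And>n x. x \<notin> {a<..<b} \<Longrightarrow> \<phi> n x = 0"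
    "\<And>x. (\<lambda>n. \<phi> n x) \<longlonglongrightarrow> indicator {a<..<b} x"
proof -
  define f where "f x = flat_exp 0 (1 * x + - a) * flat_exp 0 (-1 * x + b)" for x
  have f0: "f x = 0" if "x \<notin> {a<..<b}" for x
    using that by (auto simp: f_def flat_exp_def)
  have f1: "0 < f x" "f x < 1" if "x \<in> {a<..<b}" for x
  proof -
    have "0 < flat_exp 0 (1 * x + - a)" "flat_exp 0 (1 * x + - a) < 1"
      "0 < flat_exp 0 (-1 * x + b)" "flat_exp 0 (-1 * x + b) < 1"
      using that by (auto simp: flat_exp_def)
    then show "0 < f x" "f x < 1"
      unfolding f_def
      using mult_strict_mono[of "flat_exp 0 (1 * x + - a)" 1 "flat_exp 0 (-1 * x + b)" 1]
      by (simp_all only: mult_pos_pos) simp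
  qed
  have f01: "0 \<le> f x" "f x \<le> 1" for x using f0[of x] f1[of x] by force+
  define \<phi> where "\<phi> n x = 1 + (-1) * (1 + (-1) * f x) ^ n" for n x
  show ?thesis
  proof (rule that[of \<phi>])
    show "test_function (\<phi> n)" for n
    proof (rule test_functionI[OF _ assms])
      show "smooth (\<phi> n)"
        unfolding \<phi>_def f_def
        by (intro smooth_add smooth_mult smooth_power smooth_const smooth_flat_exp)
      show "\<phi> n x = 0" if "x \<notin> {a..b}" for x
        using that by (subst \<phi>_def, subst f0) auto
    qed
    show "0 \<le> \<phi> n x" for n x using f01[of x] by (auto simp: \<phi>_def intro!: power_le_one)
    show "\<phi> n x \<le> 1" for n x using f01[of x] by (auto simp: \<phi>_def)
    show "x \<notin> {a<..<b} \<Longrightarrow> \<phi> n x = 0" for n x by (simp add: \<phi>_def f0)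
    show "(\<lambda>n. \<phi> n x) \<longlonglongrightarrow> indicator {a<..<b} x" for x
    proof (cases "x \<in> {a<..<b}")
      case True
      have "(\<lambda>n. 1 + (-1) * (1 + (-1) * f x) ^ n) \<longlonglongrightarrow> 1 + (-1) * 0"
        by (intro tendsto_intros LIMSEQ_realpow_zero) (use f1[OF True] in auto)
      then show ?thesis using True by (simp add: \<phi>_def)
    next
      case False
      then show ?thesis by (simp add: \<phi>_def f0)
    qed
  qed
qed


section \<open>Integration against test functions\<close>

lemma indicator_mult_support:
  fixes f :: "'a \<Rightarrow> real"
  assumes "\<And>x. x \<notin> A \<Longrightarrow> f x = 0"
  shows "(\<lambda>x. indicator A x * f x) = f" "(\<lambda>x. f x * indicator A x) = f"
    "(\<lambda>x. indicator A x *\<^sub>R f x) = f"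
proof -
  have "indicator A x * f x = f x" for x using assms[of x] by (cases "x \<in> A") auto
  then show "(\<lambda>x. indicator A x * f x) = f" "(\<lambda>x. f x * indicator A x) = f"
    "(\<lambda>x. indicator A x *\<^sub>R f x) = f" by (auto simp: mult.commute)
qed

lemma integrable_mult_bounded:
  fixes f g :: "'a \<Rightarrow> real"
  assumes "f \<in> borel_measurable M" "\<And>x. \<bar>f x\<bar> \<le> C" "integrable M g"
  shows "integrable M (\<lambda>x. f x * g x)"
proof (rule Bochner_Integration.integrable_bound)
  show "integrable M (\<lambda>x. C * g x)" using assms by simp
  show "AE x in M. norm (f x * g x) \<le> norm (C * g x)"
    using assms(2) by (auto simp: abs_mult intro!: mult_right_mono order_trans[OF assms(2) abs_ge_self])
qed (use assms in auto)

abbreviation unit_meas :: "real measure" where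
  "unit_meas \<equiv> restrict_space lborel {0<..<1}"

lemma emeasure_unit_meas: "emeasure unit_meas (space unit_meas) = 1"
  by (simp add: space_restrict_space emeasure_restrict_space)

interpretation unit_meas: finite_measure unit_meas
  by (rule finite_measureI) (simp add: emeasure_unit_meas del: space_restrict_space2)

lemma measure_unit_meas: "measure unit_meas (space unit_meas) = 1"
  using emeasure_unit_meas by (simp add: measure_def)

lemma unit_meas_measurable:
  "f \<in> borel_measurable borel \<Longrightarrow> f \<in> borel_measurable unit_meas"
  by (rule measurable_restrict_space1) simp

lemma set_integral_unit_meas: "(LINT x:{0<..<1}|lborel. f x) = (LINT x|unit_meas. f x)"
  for f :: "real \<Rightarrow> real"
  by (simp add: set_lebesgue_integral_def integral_restrict_space)

lemma set_integrable_unit_meas: "set_integrable lborel {0<..<1} f \<longleftrightarrow> integrable unit_meas f"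
  for f :: "real \<Rightarrow> real"
  by (simp add: set_integrable_def integrable_restrict_space)

lemma integral_unit_meas:
  fixes f :: "real \<Rightarrow> real"
  assumes "\<And>x. x \<notin> {0<..<1} \<Longrightarrow> f x = 0"
  shows "(LINT x|unit_meas. f x) = (LINT x|lborel. f x)"
proof -
  have "(\<lambda>x. indicator {0<..<1} x *\<^sub>R f x) = f"
    using assms by (rule indicator_mult_support)
  then show ?thesis by (simp add: integral_restrict_space)
qed

lemma integrable_unit_meas:
  fixes f :: "real \<Rightarrow> real"
  assumes "\<And>x. x \<notin> {0<..<1} \<Longrightarrow> f x = 0"
  shows "integrable unit_meas f \<longleftrightarrow> integrable lborel f"
proof -
  have "(\<lambda>x. indicator {0<..<1} x *\<^sub>R f x) = f"
    using assms by (rule indicator_mult_support)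
  then show ?thesis by (simp add: integrable_restrict_space)
qed

lemma nn_integral_unit_meas:
  assumes "\<And>x. x \<notin> {0<..<1} \<Longrightarrow> f x = 0"
  shows "(\<integral>\<^sup>+x. f x \<partial>unit_meas) = (\<integral>\<^sup>+x. f x \<partial>lborel)"
proof -
  have "f x * indicator {0<..<1} x = f x" for x
    using assms[of x] by (cases "x \<in> {0<..<1}") auto
  then show ?thesis by (simp add: nn_integral_restrict_space)
qed

lemma AE_unit_meas: "(AE x in unit_meas. P x) \<longleftrightarrow> (AE x in lborel. x \<in> {0<..<1} \<longrightarrow> P x)"
  by (rule AE_restrict_space_iff) simp

lemma integrable_bounded_support:
  fixes f :: "real \<Rightarrow> real"
  assumes "f \<in> borel_measurable borel" "\<And>x. \<bar>f x\<bar> \<le> C" "\<And>x. x \<notin> {0<..<1} \<Longrightarrow> f x = 0"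
  shows "integrable lborel f"
proof -
  have "integrable unit_meas f"
    using assms by (intro unit_meas.integrable_const_bound[of _ C] unit_meas_measurable) auto
  then show ?thesis using integrable_unit_meas assms(3) by blast
qed

lemma test_function_integrable: "test_function \<phi> \<Longrightarrow> integrable lborel \<phi>"
  by (metis integrable_bounded_support test_function_borel test_function_bounded test_function_eq_0)

lemma test_function_L2: "test_function \<phi> \<Longrightarrow> \<phi> \<in> L2 unit_meas"
  by (metis (no_types, lifting) AE_I2 test_function_borel test_function_bounded unit_meas.L2_bounded
      unit_meas_measurable)

lemma integral_deriv_eq_0:
  fixes F f :: "real \<Rightarrow> real"
  assumes "\<And>x. (F has_real_derivative f x) (at x)" "continuous_on UNIV f"
    "F a = F b" "a \<le> b" "\<And>x. x \<notin> {a..b} \<Longrightarrow> f x = 0"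
  shows "integrable lborel f" "(LINT x|lborel. f x) = 0"
proof -
  have "has_bochner_integral lborel (\<lambda>x. f x * indicator {a..b} x) (F b - F a)"
    using assms by (intro has_bochner_integral_FTC_Icc_real) (auto simp: continuous_on_eq_continuous_at)
  moreover have "(\<lambda>x. f x * indicator {a..b} x) = f"
    using assms(5) by (rule indicator_mult_support)
  ultimately show "integrable lborel f" "(LINT x|lborel. f x) = 0"
    using assms(3) by (auto simp: has_bochner_integral_iff)
qed

lemma integrable_mult_test_function:
  fixes g :: "real \<Rightarrow> real"
  assumes g: "\<And>a b. 0 < a \<Longrightarrow> b < 1 \<Longrightarrow> set_integrable lborel {a..b} g"
    and \<phi>: "test_function \<phi>"
  shows "integrable lborel (\<lambda>x. g x * \<phi> x)"
proof -
  obtain a b where ab: "0 < a" "b < 1" "\<And>x. x \<notin> {a..b} \<Longrightarrow> \<phi> x = 0"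
    using test_function_support[OF \<phi>] by metis
  obtain C where C: "\<And>x. \<bar>\<phi> x\<bar> \<le> C" using test_function_bounded[OF \<phi>] by metis
  have i: "integrable lborel (\<lambda>x. indicator {a..b} x * g x)"
    using g[OF ab(1,2)] by (simp add: set_integrable_def)
  have "integrable lborel (\<lambda>x. \<phi> x * (indicator {a..b} x * g x))"
    by (rule integrable_mult_bounded[OF _ C i]) (simp add: test_function_borel[OF \<phi>])
  moreover have "(\<lambda>x. \<phi> x * (indicator {a..b} x * g x)) = (\<lambda>x. (indicator {a..b} x * \<phi> x) * g x)"
    by (simp add: ac_simps)
  moreover have "(\<lambda>x. indicator {a..b} x * \<phi> x) = \<phi>"
    using ab(3) by (rule indicator_mult_support)
  then have "indicator {a..b} x * \<phi> x = \<phi> x" for x by metis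
  ultimately show ?thesis by (simp add: mult.commute[of "g _"])
qed

lemma integrable_continuous_mult_test_function:
  assumes "continuous_on UNIV f" "test_function \<phi>"
  shows "integrable lborel (\<lambda>x. f x * \<phi> x)"
proof (rule integrable_mult_test_function[OF _ assms(2)])
  show "set_integrable lborel {a..b} f" for a b
    unfolding set_integrable_def
    by (rule borel_integrable_compact) (auto intro: continuous_on_subset[OF assms(1)])
qed

lemma integration_by_parts:
  fixes f f' :: "real \<Rightarrow> real"
  assumes f: "\<And>x. (f has_real_derivative f' x) (at x)" "continuous_on UNIV f'"
    and \<phi>: "test_function \<phi>"
  shows "(LINT x|lborel. f x * deriv \<phi> x) = - (LINT x|lborel. f' x * \<phi> x)"
proof -
  have fc: "continuous_on UNIV f"
    using f(1) DERIV_isCont by (intro continuous_at_imp_continuous_on) blast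
  have t: "integrable lborel (\<lambda>x. f' x * \<phi> x)" "integrable lborel (\<lambda>x. f x * deriv \<phi> x)"
    by (intro integrable_continuous_mult_test_function fc f \<phi> test_function_deriv)+
  have "(LINT x|lborel. f' x * \<phi> x + f x * deriv \<phi> x) = 0"
  proof (rule integral_deriv_eq_0(2)[of "\<lambda>x. f x * \<phi> x" _ 0 1])
    show "((\<lambda>x. f x * \<phi> x) has_real_derivative f' x * \<phi> x + f x * deriv \<phi> x) (at x)" for x
      by (rule DERIV_cong[OF DERIV_mult[OF f(1) test_function_DERIV[OF \<phi>]]]) simp
    show "continuous_on UNIV (\<lambda>x. f' x * \<phi> x + f x * deriv \<phi> x)"
      by (intro continuous_on_add continuous_on_mult f(2) fc test_function_continuous \<phi> test_function_deriv)
    have z: "\<phi> x = 0" "deriv \<phi> x = 0" if "x \<notin> {0<..<1}" for x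
      using that \<phi> by (auto intro: test_function_eq_0 test_function_deriv)
    show "f 0 * \<phi> 0 = f 1 * \<phi> 1" using z[of 0] z[of 1] by simp
    show "f' x * \<phi> x + f x * deriv \<phi> x = 0" if "x \<notin> {0..1}" for x
    proof -
      have "x \<notin> {0<..<1}" using that by auto
      from z[OF this] show ?thesis by simp
    qed
  qed simp
  then show ?thesis using t by simp
qed

lemma integral_deriv_test_function:
  "test_function \<phi> \<Longrightarrow> (LINT x|lborel. deriv \<phi> x) = 0"
  using integration_by_parts[of "\<lambda>x. 1" "\<lambda>x. 0" \<phi>] by simp

text \<open>
  The positive and the negative part of \<open>G\<close> are densities of finite measures that agree on the
  half-lines, a generator of the Borel sets; so these measures and their densities are equal.
\<close>

lemma AE_0_if_interval_integrals_0:
  fixes G :: "real \<Rightarrow> real"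
  assumes G: "integrable lborel G" and 0: "\<And>x. (LINT y|lborel. indicator {x<..} y * G y) = 0"
  shows "AE x in lborel. G x = 0"
proof -
  have [measurable]: "G \<in> borel_measurable borel" using G by auto
  let ?P = "\<lambda>x. ennreal (max 0 (G x))" and ?N = "\<lambda>x. ennreal (max 0 (- G x))"
  have int: "integrable lborel (\<lambda>y. indicator {x<..} y * max 0 (G y))"
      "integrable lborel (\<lambda>y. indicator {x<..} y * max 0 (- G y))" for x
    by (rule Bochner_Integration.integrable_bound[OF G]; auto simp: indicator_def)+
  have P: "emeasure (density lborel ?P) {x<..} = ennreal (LINT y|lborel. indicator {x<..} y * max 0 (G y))" for x
    by (subst emeasure_density, simp, simp, subst nn_integral_eq_integral[OF int(1), symmetric])
       (auto intro!: nn_integral_cong simp: indicator_def)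
  have N: "emeasure (density lborel ?N) {x<..} = ennreal (LINT y|lborel. indicator {x<..} y * max 0 (- G y))" for x
    by (subst emeasure_density, simp, simp, subst nn_integral_eq_integral[OF int(2), symmetric])
       (auto intro!: nn_integral_cong simp: indicator_def)
  have "density lborel ?P = density lborel ?N"
  proof (rule measure_eqI_lessThan)
    fix x
    have "(LINT y|lborel. indicator {x<..} y * max 0 (G y))
        - (LINT y|lborel. indicator {x<..} y * max 0 (- G y)) = 0"
    proof -
      have "(\<lambda>y. indicator {x<..} y * max 0 (G y) - indicator {x<..} y * max 0 (- G y))
          = (\<lambda>y. indicator {x<..} y * G y)"
        by (auto simp: max_def indicator_def)
      then show ?thesis
        unfolding Bochner_Integration.integral_diff[OF int, symmetric] using 0[of x] by simp
    qed
    then show "emeasure (density lborel ?P) {x<..} = emeasure (density lborel ?N) {x<..}"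
      unfolding P N by simp
    show "emeasure (density lborel ?P) {x<..} < \<infinity>" unfolding P by simp
  qed auto
  moreover have "sigma_finite_measure (density lborel ?P)"
  proof -
    have "integrable lborel (\<lambda>y. max 0 (G y))"
      by (rule Bochner_Integration.integrable_bound[OF G]) auto
    then have "finite_measure (density lborel ?P)"
      by (intro finite_measureI)
         (simp add: emeasure_density nn_integral_eq_integral del: max_0L max_0R ennreal_max_0 ennreal_max_0')
    then show ?thesis by (simp add: finite_measure.axioms(1))
  qed
  ultimately have "AE x in lborel. ?P x = ?N x"
    by (subst (asm) sigma_finite_density_unique) auto
  then show ?thesis
  proof eventually_elim
    case (elim x)
    then have "max 0 (G x) = max 0 (- G x)" by (simp add: max_def split: if_splits)
    then show ?case by (auto simp: max_def split: if_splits)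
  qed
qed

text \<open>
  The fundamental lemma of the calculus of variations: bounded limits of test functions include the
  indicator functions of intervals.
\<close>

lemma AE_0_if_test_integrals_0:
  fixes g :: "real \<Rightarrow> real"
  assumes g: "\<And>a b. 0 < a \<Longrightarrow> b < 1 \<Longrightarrow> set_integrable lborel {a..b} g"
    and 0: "\<And>\<phi>. test_function \<phi> \<Longrightarrow> (LINT x|unit_meas. g x * \<phi> x) = 0"
  shows "AE x in unit_meas. g x = 0"
proof -
  have interval: "(LINT y|lborel. indicator {a<..<b} y * g y) = 0" if ab: "0 < a" "b < 1" for a b
  proof -
    obtain \<phi> :: "nat \<Rightarrow> real \<Rightarrow> real" where \<phi>: "\<And>n. test_function (\<phi> n)"
      "\<And>n x. 0 \<le> \<phi> n x" "\<And>n x. \<phi> n x \<le> 1" "\<And>n x. x \<notin> {a<..<b} \<Longrightarrow> \<phi> n x = 0"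
      "\<And>x. (\<lambda>n. \<phi> n x) \<longlonglongrightarrow> indicator {a<..<b} x"
      using test_functions_tendsto_indicator[OF ab] by metis
    let ?h = "\<lambda>x. indicator {a..b} x * g x"
    have i: "integrable lborel ?h"
      using g[OF ab] by (simp add: set_integrable_def)
    have eq: "(LINT x|lborel. \<phi> n x * ?h x) = 0" for n
    proof -
      have "(LINT x|lborel. \<phi> n x * ?h x) = (LINT x|lborel. g x * \<phi> n x)"
      proof (intro Bochner_Integration.integral_cong refl)
        show "\<phi> n x * ?h x = g x * \<phi> n x" for x
          using \<phi>(4)[of x n] by (cases "x \<in> {a..b}") auto
      qed
      also have "\<dots> = (LINT x|unit_meas. g x * \<phi> n x)"
        by (rule integral_unit_meas[symmetric]) (use test_function_eq_0[OF \<phi>(1)] in auto)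
      also have "\<dots> = 0" by (rule 0[OF \<phi>(1)])
      finally show ?thesis .
    qed
    have "(\<lambda>n. LINT x|lborel. \<phi> n x * ?h x) \<longlonglongrightarrow> (LINT x|lborel. indicator {a<..<b} x * ?h x)"
    proof (rule integral_dominated_convergence)
      show "integrable lborel (\<lambda>x. \<bar>?h x\<bar>)" using i by (rule integrable_abs)
      show "AE x in lborel. (\<lambda>n. \<phi> n x * ?h x) \<longlonglongrightarrow> indicator {a<..<b} x * ?h x"
        by (intro AE_I2 tendsto_mult \<phi>(5) tendsto_const)
      show "AE x in lborel. norm (\<phi> n x * ?h x) \<le> \<bar>?h x\<bar>" for n
        unfolding real_norm_def abs_mult[of "\<phi> n _"] using \<phi>(2,3)
        by (intro AE_I2 mult_left_le_one_le) (auto simp: abs_le_iff)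
      show "(\<lambda>x. \<phi> n x * ?h x) \<in> borel_measurable lborel" for n
        using i test_function_borel[OF \<phi>(1)[of n]] by auto
      show "(\<lambda>x. indicator {a<..<b} x * ?h x) \<in> borel_measurable lborel"
        using i by auto
    qed
    then have "(LINT x|lborel. indicator {a<..<b} x * ?h x) = 0"
      unfolding eq by (simp add: LIMSEQ_const_iff)
    moreover have "(\<lambda>x. indicator {a<..<b} x * ?h x) = (\<lambda>x. indicator {a<..<b} x * g x)"
      by (auto simp: indicator_def)
    ultimately show ?thesis by simp
  qed
  define J where "J n = {1 / real (n+2)<..<1 - 1 / real (n+2)}" for n :: nat
  have "AE x in lborel. \<forall>n. indicator (J n) x * g x = 0"
  proof (subst AE_all_countable, rule allI, rule AE_0_if_interval_integrals_0)
    fix n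
    let ?a = "1 / real (n+2)" and ?b = "1 - 1 / real (n+2)"
    have ab: "0 < ?a" "?b < 1" by auto
    have "integrable lborel (\<lambda>x. indicator (J n) x *\<^sub>R (indicator {?a..?b} x * g x))"
      by (rule integrable_mult_indicator) (use g[OF ab] in \<open>auto simp: J_def set_integrable_def\<close>)
    moreover have "(\<lambda>x. indicator (J n) x *\<^sub>R (indicator {?a..?b} x * g x)) = (\<lambda>x. indicator (J n) x * g x)"
      by (auto simp: indicator_def J_def)
    ultimately show "integrable lborel (\<lambda>x. indicator (J n) x * g x)" by simp
    fix x
    have "(\<lambda>y. indicator {x<..} y * (indicator (J n) y * g y)) = (\<lambda>y. indicator {max x ?a<..<?b} y * g y)"
      by (auto simp: indicator_def J_def)
    then show "(LINT y|lborel. indicator {x<..} y * (indicator (J n) y * g y)) = 0"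
      using interval[OF less_le_trans[OF ab(1) max.cobounded2] ab(2)] by (simp only:)
  qed
  then have "AE x in lborel. x \<in> {0<..<1} \<longrightarrow> g x = 0"
  proof eventually_elim
    case (elim x)
    show ?case
    proof
      assume x: "x \<in> {0<..<1}"
      obtain n where n: "1 / real (Suc n) < min x (1 - x)"
        using nat_approx_posE[of "min x (1 - x)"] x by auto
      have "1 / real (n + 2) \<le> 1 / real (Suc n)" by (simp add: frac_le)
      then have "x \<in> J n" using n by (auto simp: J_def)
      then show "g x = 0" using elim[rule_format, of n] by simp
    qed
  qed
  then show ?thesis by (simp add: AE_unit_meas)
qed

text \<open>
  The lemma of du Bois-Reymond: a test function \<open>\<psi>\<close> minus the multiple of a fixed bump \<open>\<rho>\<close> with the
  same mean is the derivative of a test function.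
\<close>

lemma AE_const_if_test_deriv_integrals_0:
  fixes g :: "real \<Rightarrow> real"
  assumes g: "integrable unit_meas g"
    and 0: "\<And>\<phi>. test_function \<phi> \<Longrightarrow> (LINT x|unit_meas. g x * deriv \<phi> x) = 0"
  obtains c where "AE x in unit_meas. g x = c"
proof -
  have quarter: "0 < (1 / 4 :: real)" "(3 / 4 :: real) < 1" by simp_all
  obtain \<phi> :: "nat \<Rightarrow> real \<Rightarrow> real" where \<phi>: "\<And>n. test_function (\<phi> n)"
      "\<And>n x. 0 \<le> \<phi> n x" "\<And>n x. \<phi> n x \<le> 1" "\<And>n x. x \<notin> {1/4<..<3/4} \<Longrightarrow> \<phi> n x = 0"
      "\<And>x. (\<lambda>n. \<phi> n x) \<longlonglongrightarrow> indicator {1/4<..<3/4 :: real} x"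
    using test_functions_tendsto_indicator[OF quarter] by metis
  have "\<exists>n. (LINT x|lborel. \<phi> n x) \<noteq> 0"
  proof (rule ccontr)
    assume "\<not> ?thesis"
    then have z: "(LINT x|lborel. \<phi> n x) = 0" for n by simp
    have "(\<lambda>n. LINT x|lborel. \<phi> n x) \<longlonglongrightarrow> (LINT x|lborel. indicator {1/4<..<3/4 :: real} x)"
    proof (rule integral_dominated_convergence)
      show "integrable lborel (indicator {1/4<..<3/4 :: real} :: real \<Rightarrow> real)"
        by (intro integrable_real_indicator emeasure_bounded_finite) simp_all
      show "AE x in lborel. norm (\<phi> n x) \<le> indicator {1/4<..<3/4} x" for n
      proof (rule AE_I2)
        fix x show "norm (\<phi> n x) \<le> indicator {1/4<..<3/4} x"
          using \<phi>(2,3)[of n x] \<phi>(4)[of x n] by (cases "x \<in> {1/4<..<3/4}") (simp_all del: greaterThanLessThan_iff)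
      qed
    qed (use \<phi>(1,5) test_function_borel in auto)
    then show False unfolding z by (simp add: LIMSEQ_const_iff)
  qed
  then obtain n where n: "(LINT x|lborel. \<phi> n x) \<noteq> 0" by blast
  define \<rho> where "\<rho> x = (1 / (LINT x|lborel. \<phi> n x)) * \<phi> n x" for x
  have \<rho>: "test_function \<rho>" unfolding \<rho>_def by (intro test_function_scale \<phi>)
  have \<rho>1: "(LINT x|lborel. \<rho> x) = 1" using n by (simp add: \<rho>_def)
  have gi: "set_integrable lborel {a..b} g" if "0 < a" "b < 1" for a b
    by (rule set_integrable_subset[of _ "{0<..<1}"]) (use g that in \<open>auto simp: set_integrable_unit_meas\<close>)
  define c where "c = (LINT x|unit_meas. g x * \<rho> x)"
  have mult_i: "integrable unit_meas (\<lambda>x. g x * \<psi> x)" if "test_function \<psi>" for \<psi>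
    using integrable_mult_test_function[OF gi that] test_function_eq_0[OF that]
    by (subst integrable_unit_meas) auto
  have ti: "integrable unit_meas \<psi>" "(LINT x|unit_meas. \<psi> x) = (LINT x|lborel. \<psi> x)"
    if "test_function \<psi>" for \<psi>
    using test_function_integrable[OF that] integrable_unit_meas[OF test_function_eq_0[OF that]]
      integral_unit_meas[OF test_function_eq_0[OF that]] by simp_all
  have "AE x in unit_meas. g x - c = 0"
  proof (rule AE_0_if_test_integrals_0)
    show "set_integrable lborel {a..b} (\<lambda>x. g x - c)" if "0 < a" "b < 1" for a b
    proof (intro set_integral_diff gi that)
      have "integrable lborel (indicator {a..b} :: real \<Rightarrow> real)"
        by (intro integrable_real_indicator emeasure_bounded_finite) auto
      then show "set_integrable lborel {a..b} (\<lambda>x. c)" by (simp add: set_integrable_def)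
    qed
    fix \<psi> assume \<psi>: "test_function \<psi>"
    define m where "m = (LINT x|lborel. \<psi> x)"
    define \<eta> where "\<eta> x = \<psi> x - m * \<rho> x" for x
    have \<eta>: "test_function \<eta>" unfolding \<eta>_def by (intro test_function_diff test_function_scale \<psi> \<rho>)
    have \<eta>0: "(LINT x|lborel. \<eta> x) = 0"
      using test_function_integrable[OF \<psi>] test_function_integrable[OF \<rho>]
      by (simp add: \<eta>_def m_def \<rho>1)
    obtain a b where ab: "0 < a" "a < b" "b < 1" "\<And>x. x \<notin> {a..b} \<Longrightarrow> \<eta> x = 0"
      using test_function_support[OF \<eta>] by metis
    define F where "F x = integral {a..x} \<eta>" for x
    have \<eta>i: "\<eta> integrable_on {p..q}" for p q
      by (intro integrable_continuous_interval test_function_continuous \<eta>)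
    have F_left: "F x = 0" if "x \<le> a" for x
    proof (cases "x < a")
      case True then show ?thesis by (simp add: F_def)
    next
      case False then have "x = a" using that by simp
      then show ?thesis by (simp add: F_def)
    qed
    have F_alt: "F x = integral {0..x} \<eta>" for x
    proof (cases "x < a")
      case True
      have "integral {0..x} \<eta> = integral {0..x} (\<lambda>x. 0)"
        by (rule integral_cong) (use True ab(4) in auto)
      then show ?thesis using F_left True by simp
    next
      case False
      have "integral {0..a} \<eta> + integral {a..x} \<eta> = integral {0..x} \<eta>"
        by (rule Henstock_Kurzweil_Integration.integral_combine) (use False ab \<eta>i in auto)
      moreover have "integral {0..a} \<eta> = integral {0..a} (\<lambda>x. 0)"
        by (rule integral_spike[of "{a}"]) (use ab(4) in auto)
      ultimately show ?thesis by (simp add: F_def)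
    qed
    have F': "(F has_real_derivative \<eta> x) (at x)" for x
    proof (cases "x > 0")
      case True
      have "((\<lambda>u. integral {0..u} \<eta>) has_real_derivative \<eta> x) (at x within {0..x+1})"
        by (rule integral_has_real_derivative) (use True in \<open>auto intro: test_function_continuous \<eta>\<close>)
      moreover have "x \<in> interior {0..x+1}" using True by simp
      moreover have "F = (\<lambda>u. integral {0..u} \<eta>)"
        by (rule ext) (rule F_alt)
      ultimately show ?thesis
        by (simp only: at_within_interior)
    next
      case False
      then have "\<forall>\<^sub>F y in nhds x. y \<in> {..<a}" using ab by (intro eventually_nhds_in_open) auto
      then have ev: "\<forall>\<^sub>F y in nhds x. F y = 0" by (rule eventually_mono) (simp add: F_left)
      have "\<eta> x = 0" using ab False by (intro ab(4)) auto
      then show ?thesis by (simp add: DERIV_cong_ev[OF refl ev refl])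
    qed
    have dF: "deriv F = \<eta>" by (intro ext DERIV_imp_deriv F')
    have F_right: "F x = 0" if "x > b" for x
    proof -
      have "(\<eta> has_integral 0) UNIV"
        using has_integral_integral_lborel[OF test_function_integrable[OF \<eta>]] \<eta>0 by simp
      moreover have "(\<lambda>y. if y \<in> {a..x} then \<eta> y else 0) = \<eta>"
        using ab that by (intro ext) (auto intro: ab(4)[symmetric])
      ultimately have "(\<eta> has_integral 0) {a..x}"
        using has_integral_restrict_UNIV[of "{a..x}" \<eta> 0] by simp
      then show ?thesis by (simp add: F_def integral_unique)
    qed
    have F: "test_function F"
    proof (rule test_functionI[OF _ ab(1,3)])
      show "smooth F" unfolding smooth_def
      proof (intro allI)
        fix n x
        show "(deriv ^^ n) F field_differentiable at x"
        proof (cases n)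
          case 0
          then show ?thesis using F' by (auto simp: field_differentiable_def)
        next
          case (Suc k)
          then show ?thesis
            using test_function_smooth[OF \<eta>] unfolding Suc funpow_Suc_right o_def dF smooth_def by blast
        qed
      qed
      show "F x = 0" if "x \<notin> {a..b}" for x
        using F_left[of x] F_right[of x] that by (cases "x < a") auto
    qed
    have "0 = (LINT x|unit_meas. g x * \<eta> x)" using 0[OF F] by (simp add: dF)
    also have "\<dots> = (LINT x|unit_meas. g x * \<psi> x - m * (g x * \<rho> x))"
      by (simp add: \<eta>_def algebra_simps)
    also have "\<dots> = (LINT x|unit_meas. g x * \<psi> x) - m * c"
      by (subst Bochner_Integration.integral_diff) (auto intro!: mult_i \<psi> \<rho> simp: c_def)
    finally have "(LINT x|unit_meas. g x * \<psi> x) = m * c" by simp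
    moreover have "(LINT x|unit_meas. (g x - c) * \<psi> x)
        = (LINT x|unit_meas. g x * \<psi> x - c * \<psi> x)" by (simp add: algebra_simps)
    moreover have "\<dots> = (LINT x|unit_meas. g x * \<psi> x) - c * m"
      using mult_i[OF \<psi>] ti[OF \<psi>] by (simp add: m_def)
    ultimately show "(LINT x|unit_meas. (g x - c) * \<psi> x) = 0" by simp
  qed
  then show ?thesis by (intro that[of c]) auto
qed


section \<open>Plancherel's theorem and the Riesz energy\<close>

lemma borel_measurable_fst_snd [measurable]:
  "fst \<in> (borel :: (real \<times> real) measure) \<rightarrow>\<^sub>M borel"
  "snd \<in> (borel :: (real \<times> real) measure) \<rightarrow>\<^sub>M borel"
  by (intro borel_measurable_continuous_onI continuous_intros)+

lemma Fubini_lborel: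
  fixes f :: "'a::euclidean_space \<Rightarrow> 'b::euclidean_space \<Rightarrow> 'c::{banach,second_countable_topology}"
  assumes [measurable]: "case_prod f \<in> borel_measurable (lborel \<Otimes>\<^sub>M lborel)"
    and fin: "(\<integral>\<^sup>+x. \<integral>\<^sup>+y. ennreal (norm (f x y)) \<partial>lborel \<partial>lborel) < \<infinity>"
  shows Fubini_lborel_swap:
      "(LINT x|lborel. LINT y|lborel. f x y) = (LINT y|lborel. LINT x|lborel. f x y)"
    and AE_integrable_snd_lborel: "AE y in lborel. integrable lborel (\<lambda>x. f x y)"
    and integrable_integral_fst_lborel: "integrable lborel (\<lambda>x. LINT y|lborel. f x y)"
    and integrable_integral_snd_lborel: "integrable lborel (\<lambda>y. LINT x|lborel. f x y)"
proof -
  have i: "integrable (lborel \<Otimes>\<^sub>M lborel) (case_prod f)"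
  proof (rule integrableI_bounded)
    have "(\<integral>\<^sup>+z. ennreal (norm (case_prod f z)) \<partial>(lborel \<Otimes>\<^sub>M lborel))
        = (\<integral>\<^sup>+x. \<integral>\<^sup>+y. ennreal (norm (f x y)) \<partial>lborel \<partial>lborel)"
      by (subst lborel.nn_integral_fst[symmetric]) auto
    then show "(\<integral>\<^sup>+z. ennreal (norm (case_prod f z)) \<partial>(lborel \<Otimes>\<^sub>M lborel)) < \<infinity>"
      using fin by simp
  qed fact
  show "(LINT x|lborel. LINT y|lborel. f x y) = (LINT y|lborel. LINT x|lborel. f x y)"
    by (rule lborel_pair.Fubini_integral[OF i, symmetric])

  show "AE y in lborel. integrable lborel (\<lambda>x. f x y)"
    by (rule lborel_pair.AE_integrable_snd[OF i])
  show "integrable lborel (\<lambda>x. LINT y|lborel. f x y)"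
    by (rule lborel_pair.integrable_fst[OF i])
  show "integrable lborel (\<lambda>y. LINT x|lborel. f x y)"
    by (rule lborel_pair.integrable_snd[OF i])
qed

lemma nn_integral_lborel_pair:
  fixes h :: "real \<times> real \<Rightarrow> ennreal"
  assumes [measurable]: "h \<in> borel_measurable borel"
  shows "(\<integral>\<^sup>+z. h z \<partial>lborel) = (\<integral>\<^sup>+x. \<integral>\<^sup>+y. h (x, y) \<partial>lborel \<partial>lborel)"
  by (subst lborel.nn_integral_fst) (simp_all add: lborel_prod)

lemma integral_lborel_pair:
  fixes h :: "real \<times> real \<Rightarrow> 'c::{banach,second_countable_topology}"
  assumes "integrable lborel h"
  shows "(LINT z|lborel. h z) = (LINT x|lborel. LINT y|lborel. h (x, y))"
  using lborel_pair.integral_fst'[of h] assms by (simp add: lborel_prod)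

lemma integrable_lborel_pair_mult:
  fixes f g :: "real \<Rightarrow> 'c::{banach,second_countable_topology,real_normed_field}"
  assumes f: "integrable lborel f" and g: "integrable lborel g"
  shows "integrable lborel (\<lambda>z::real\<times>real. f (fst z) * g (snd z))"
    and "(LINT z|lborel. f (fst z) * g (snd z)) = (LINT x|lborel. f x) * (LINT x|lborel. g x)"
proof -
  have [measurable]: "f \<in> borel_measurable borel" "g \<in> borel_measurable borel" using f g by auto
  show i: "integrable lborel (\<lambda>z::real\<times>real. f (fst z) * g (snd z))"
  proof (rule integrableI_bounded)
    have "(\<integral>\<^sup>+z. ennreal (norm (f (fst z) * g (snd z))) \<partial>lborel)
        = (\<integral>\<^sup>+x. \<integral>\<^sup>+y. ennreal (norm (f x)) * ennreal (norm (g y)) \<partial>lborel \<partial>lborel)"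
      by (subst nn_integral_lborel_pair) (measurable, simp add: norm_mult ennreal_mult)
    also have "\<dots> = (\<integral>\<^sup>+x. ennreal (norm (f x)) \<partial>lborel) * (\<integral>\<^sup>+y. ennreal (norm (g y)) \<partial>lborel)"
      by (subst nn_integral_cmult, simp, subst nn_integral_multc) auto
    also have "\<dots> < \<infinity>"
      using f g by (auto simp: integrable_iff_bounded ennreal_mult_less_top)
    finally show "(\<integral>\<^sup>+z. ennreal (norm (f (fst z) * g (snd z))) \<partial>lborel) < \<infinity>" .
  qed measurable
  show "(LINT z|lborel. f (fst z) * g (snd z)) = (LINT x|lborel. f x) * (LINT x|lborel. g x)"
    unfolding integral_lborel_pair[OF i] using f g by simp
qed

lemma fourier_measurable [measurable]:
  assumes [measurable]: "w \<in> borel_measurable borel"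
  shows "fourier w \<in> borel_measurable borel"
  unfolding fourier_def by measurable

lemma fourier_integrand_integrable:
  assumes "integrable lborel w"
  shows "integrable lborel (\<lambda>x. exp (- (\<i> * complex_of_real (\<omega> * x))) * complex_of_real (w x))"
proof (rule Bochner_Integration.integrable_bound[OF assms])
  show "(\<lambda>x. exp (- (\<i> * complex_of_real (\<omega> * x))) * complex_of_real (w x)) \<in> borel_measurable lborel"
    using assms by (auto simp del: of_real_mult intro!: borel_measurable_times)
qed (simp add: norm_mult)

lemma norm_fourier_le:
  assumes "integrable lborel w"
  shows "cmod (fourier w \<omega>) \<le> (LINT x|lborel. \<bar>w x\<bar>)"
proof -
  have "cmod (LINT x|lborel. exp (- (\<i> * complex_of_real (\<omega> * x))) * complex_of_real (w x))
      \<le> (LINT x|lborel. cmod (exp (- (\<i> * complex_of_real (\<omega> * x))) * complex_of_real (w x)))"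
    by (rule integral_norm_bound)
  also have "\<dots> = (LINT x|lborel. \<bar>w x\<bar>)"
    by (simp add: norm_mult)
  finally have 1: "cmod (LINT x|lborel. exp (- (\<i> * complex_of_real (\<omega> * x))) * complex_of_real (w x))
      \<le> (LINT x|lborel. \<bar>w x\<bar>)" .
  have "1 \<le> sqrt (2 * pi)" using pi_gt3 by (intro real_le_rsqrt) simp
  then have "1 / sqrt (2 * pi) \<le> 1" by simp
  moreover have "0 \<le> (LINT x|lborel. \<bar>w x\<bar>)" by simp
  ultimately show ?thesis
    unfolding fourier_def norm_mult
    using mult_mono[OF _ 1, of "cmod (complex_of_real (1 / sqrt (2 * pi)))" 1] by (simp add: norm_divide)
qed

lemma fourier_diff:
  assumes "integrable lborel w" "integrable lborel z"
  shows "fourier (\<lambda>x. w x - z x) \<omega> = fourier w \<omega> - fourier z \<omega>"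
  unfolding fourier_def
  using fourier_integrand_integrable[OF assms(1), of \<omega>] fourier_integrand_integrable[OF assms(2), of \<omega>]
  by (simp add: algebra_simps del: of_real_mult)

lemma fourier_scale: "fourier (\<lambda>x. c * w x) \<omega> = complex_of_real c * fourier w \<omega>"
proof -
  have "(LINT x|lborel. exp (- (\<i> * complex_of_real (\<omega> * x))) * complex_of_real (c * w x))
      = (LINT x|lborel. complex_of_real c * (exp (- (\<i> * complex_of_real (\<omega> * x))) * complex_of_real (w x)))"
    by (intro Bochner_Integration.integral_cong) auto
  then show ?thesis unfolding fourier_def by simp
qed

lemma fourier_deriv:
  assumes \<phi>: "test_function \<phi>"
  shows "fourier (deriv \<phi>) \<omega> = \<i> * complex_of_real \<omega> * fourier \<phi> \<omega>"
proof -
  let ?e = "\<lambda>x. exp (- (\<i> * complex_of_real (\<omega> * x)))"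
  let ?F = "\<lambda>x. ?e x * complex_of_real (\<phi> x)"
  let ?f = "\<lambda>x. ?e x * complex_of_real (deriv \<phi> x) - \<i> * complex_of_real \<omega> * (?e x * complex_of_real (\<phi> x))"
  have z: "\<phi> x = 0" "deriv \<phi> x = 0" if "x \<notin> {0<..<1}" for x
    using that \<phi> by (auto intro: test_function_eq_0 test_function_deriv)
  have c: "continuous_on UNIV \<phi>" "continuous_on UNIV (deriv \<phi>)"
    using \<phi> by (auto intro: test_function_continuous test_function_deriv)
  have "has_bochner_integral lborel (\<lambda>x. indicator {0..1} x *\<^sub>R ?f x) (?F 1 - ?F 0)"
  proof (rule has_bochner_integral_FTC_Icc)
    show "continuous_on {0..1} ?f"
      by (intro continuous_intros continuous_on_subset[OF c(1)] continuous_on_subset[OF c(2)]) auto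
    fix x :: real
    have "(?F has_vector_derivative ?f x) (at x)"
    proof (rule has_vector_derivative_eq_rhs[OF has_vector_derivative_mult])
      have "((\<lambda>z. exp (- (\<i> * (complex_of_real \<omega> * z)))) has_field_derivative
          - (\<i> * complex_of_real \<omega>) * ?e x) (at (complex_of_real x))"
        by (auto intro!: derivative_eq_intros)
      from has_vector_derivative_real_field[OF this]
      show "(?e has_vector_derivative - (\<i> * complex_of_real \<omega>) * ?e x) (at x)"
        by simp
      show "((\<lambda>x. complex_of_real (\<phi> x)) has_vector_derivative complex_of_real (deriv \<phi> x)) (at x)"
        by (rule has_vector_derivative_of_real[OF test_function_DERIV[OF \<phi>]])
    qed (simp add: algebra_simps)
    then show "(?F has_vector_derivative ?f x) (at x within {0..1})"
      by (rule has_vector_derivative_at_within)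
  qed simp
  moreover have "indicator {0..1} x *\<^sub>R ?f x = ?f x" for x
  proof (cases "x \<in> {0..1}")
    case False
    then have "x \<notin> {0<..<1}" by auto
    from z[OF this] show ?thesis by simp
  qed simp
  ultimately have "(LINT x|lborel. ?f x) = 0"
    using z[of 0] z[of 1] by (simp add: has_bochner_integral_iff)
  moreover have "(LINT x|lborel. ?f x) = (LINT x|lborel. ?e x * complex_of_real (deriv \<phi> x))
      - \<i> * complex_of_real \<omega> * (LINT x|lborel. ?F x)"
    using fourier_integrand_integrable[OF test_function_integrable[OF \<phi>], of \<omega>]
      fourier_integrand_integrable[OF test_function_integrable[OF test_function_deriv[OF \<phi>]], of \<omega>]
    by (subst Bochner_Integration.integral_diff) simp_all
  ultimately show ?thesis unfolding fourier_def by simp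
qed

text \<open>
  The Gaussian is the characteristic function of the normal distribution; so a Gaussian interaction
  energy is a Gaussian average of \<open>\<bar>fourier g\<bar>\<^sup>2\<close>. All the relations between norms and
  Fourier transforms below are superpositions or limits of this identity.
\<close>

lemma Gaussian_energy:
  fixes g :: "real \<Rightarrow> real"
  assumes g: "integrable lborel g"
  shows "(LINT z|lborel. g (fst z) * g (snd z) * exp (- (\<sigma> * (fst z - snd z))\<^sup>2 / 2))
    = 2 * pi * (LINT u|lborel. std_normal_density u * (cmod (fourier g (\<sigma> * u)))\<^sup>2)"
proof -
  have [measurable]: "g \<in> borel_measurable borel" using g by auto
  define h where "h z u = complex_of_real (g (fst z) * g (snd z)) *
      (complex_of_real (std_normal_density u) * exp (\<i> * complex_of_real (- \<sigma> * (fst z - snd z) * u)))"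
    for z :: "real \<times> real" and u :: real
  have hm: "case_prod h \<in> borel_measurable (lborel \<Otimes>\<^sub>M lborel)"
    unfolding h_def by measurable
  have fin: "(\<integral>\<^sup>+z. \<integral>\<^sup>+u. ennreal (norm (h z u)) \<partial>lborel \<partial>lborel) < \<infinity>"
  proof -
    have nh: "ennreal (norm (h z u)) = ennreal \<bar>g (fst z) * g (snd z)\<bar> * ennreal (std_normal_density u)" for z u
      unfolding h_def by (simp add: norm_mult abs_mult ennreal_mult[symmetric])
    have n1: "(\<integral>\<^sup>+u. ennreal (std_normal_density u) \<partial>lborel) = 1"
      using nn_integral_eq_integral[OF integrable_normal_moment[of 1 0 0]]
        integral_normal_moment_even[of 1 0 0]
      by simp
    have "(\<integral>\<^sup>+z. ennreal \<bar>g (fst z) * g (snd z)\<bar> \<partial>lborel) < \<infinity>"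
      using integrable_lborel_pair_mult(1)[OF g g] by (simp add: integrable_iff_bounded)
    then show ?thesis
      unfolding nh by (subst nn_integral_cmult) (simp_all add: n1)
  qed
  have "(LINT z|lborel. LINT u|lborel. h z u) = (LINT u|lborel. LINT z|lborel. h z u)"
    by (rule Fubini_lborel_swap[OF hm fin])
  moreover have "(LINT u|lborel. h z u)
      = complex_of_real (g (fst z) * g (snd z) * exp (- (\<sigma> * (fst z - snd z))\<^sup>2 / 2))" for z
  proof -
    have "char std_normal_distribution (- \<sigma> * (fst z - snd z))
        = complex_of_real (exp (- (\<sigma> * (fst z - snd z))\<^sup>2 / 2))"
      by (simp add: char_std_normal_distribution)
    moreover have "char std_normal_distribution (- \<sigma> * (fst z - snd z))
        = (LINT u|lborel. complex_of_real (std_normal_density u) * exp (\<i> * complex_of_real (- \<sigma> * (fst z - snd z) * u)))"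
      unfolding char_def
      by (subst integral_density) (auto simp: scaleR_conv_of_real)
    ultimately show ?thesis unfolding h_def by simp
  qed
  moreover have "(LINT z|lborel. h z u)
      = complex_of_real (2 * pi * (std_normal_density u * (cmod (fourier g (\<sigma> * u)))\<^sup>2))" for u
  proof -
    define a where "a x = exp (- (\<i> * complex_of_real (\<sigma> * u * x))) * complex_of_real (g x)" for x
    have ia: "integrable lborel a"
      unfolding a_def by (rule fourier_integrand_integrable[OF g])
    have ib: "integrable lborel (\<lambda>x. cnj (a x))" using ia by simp
    have "h z u = complex_of_real (std_normal_density u) * (a (fst z) * cnj (a (snd z)))" for z
      unfolding h_def a_def
      by (simp add: exp_cnj exp_add[symmetric] exp_diff exp_minus field_simps)
    then have "(LINT z|lborel. h z u)
        = complex_of_real (std_normal_density u) * ((LINT x|lborel. a x) * cnj (LINT x|lborel. a x))"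
      using integrable_lborel_pair_mult(2)[OF ia ib] by simp
    also have "(LINT x|lborel. a x) * cnj (LINT x|lborel. a x)
        = complex_of_real ((cmod (LINT x|lborel. a x))\<^sup>2)"
      by (rule complex_norm_square[symmetric])
    also have "(cmod (LINT x|lborel. a x))\<^sup>2 = 2 * pi * (cmod (fourier g (\<sigma> * u)))\<^sup>2"
      unfolding fourier_def norm_mult power_mult_distrib a_def by (simp add: norm_divide power_divide)
    finally show ?thesis by simp
  qed
  ultimately have "(LINT z|lborel. complex_of_real (g (fst z) * g (snd z) * exp (- (\<sigma> * (fst z - snd z))\<^sup>2 / 2)))
      = (LINT u|lborel. complex_of_real (2 * pi * (std_normal_density u * (cmod (fourier g (\<sigma> * u)))\<^sup>2)))"
    by simp
  then show ?thesis
    unfolding integral_complex_of_real of_real_eq_iff by simp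
qed


lemma nn_integral_powr_unit_interval:
  assumes "-1 < a"
  shows "(\<integral>\<^sup>+x. ennreal (indicator {0..1} x * x powr a) \<partial>lborel) = ennreal (1 / (a + 1))"
proof (rule nn_integral_has_integral_lborel)
  have "((\<lambda>x. x powr a) has_integral 1 powr (a+1) / (a+1)) {0..1}"
    by (rule has_integral_powr_from_0) (use assms in auto)
  then have "((\<lambda>x. if x \<in> {0..1} then x powr a else 0) has_integral 1 / (a + 1)) UNIV"
    by (simp only: has_integral_restrict_UNIV powr_one_eq_one)
  moreover have "(\<lambda>x. if x \<in> {0..1} then x powr a else 0) = (\<lambda>x. indicator {0..1} x * x powr a)"
    by (auto simp: indicator_def)
  ultimately show "((\<lambda>x. indicator {0..1} x * x powr a) has_integral 1 / (a + 1)) UNIV"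
    by simp
qed auto

lemma nn_integral_abs_powr_finite:
  assumes "-1 < a"
  shows "(\<integral>\<^sup>+x. ennreal (indicator {-1..1} x * \<bar>x\<bar> powr a) \<partial>lborel) < \<infinity>"
proof -
  let ?f = "\<lambda>x. ennreal (indicator {0..1} x * x powr a)"
  have "(\<integral>\<^sup>+x. ennreal (indicator {-1..1} x * \<bar>x\<bar> powr a) \<partial>lborel)
      \<le> (\<integral>\<^sup>+x. ?f x + ?f (0 + (-1) * x) \<partial>lborel)"
    by (intro nn_integral_mono) (auto simp: indicator_def)
  also have "\<dots> = (\<integral>\<^sup>+x. ?f x \<partial>lborel) + (\<integral>\<^sup>+x. ?f (0 + (-1) * x) \<partial>lborel)"
    by (rule nn_integral_add) auto
  also have "(\<integral>\<^sup>+x. ?f (0 + (-1) * x) \<partial>lborel) = (\<integral>\<^sup>+x. ?f x \<partial>lborel)"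
    using nn_integral_real_affine[of ?f "-1" 0] by simp
  also have "(\<integral>\<^sup>+x. ?f x \<partial>lborel) + (\<integral>\<^sup>+x. ?f x \<partial>lborel) < \<infinity>"
    unfolding nn_integral_powr_unit_interval[OF assms] by simp
  finally show ?thesis .
qed

lemma nn_integral_std_normal_density: "(\<integral>\<^sup>+u. ennreal (std_normal_density u) \<partial>lborel) = 1"
  using nn_integral_eq_integral[OF integrable_normal_moment[of 1 0 0]]
    integral_normal_moment_even[of 1 0 0] by simp

lemma std_normal_density_decreasing:
  assumes "\<bar>x\<bar> \<le> \<bar>y\<bar>"
  shows "std_normal_density y \<le> std_normal_density x"
proof -
  have "x\<^sup>2 \<le> y\<^sup>2" using assms by (simp add: abs_le_square_iff)
  then show ?thesis by (simp add: std_normal_density_def divide_right_mono)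
qed

lemma exp_eq_std_normal_density: "exp (- t\<^sup>2 / 2) = sqrt (2 * pi) * std_normal_density t"
  by (simp add: std_normal_density_def)

definition normal_moment :: "real \<Rightarrow> ennreal" where
  "normal_moment a = (\<integral>\<^sup>+u. ennreal (\<bar>u\<bar> powr a * std_normal_density u) \<partial>lborel)"

text \<open>
  For an exponent between \<open>-1\<close> and \<open>0\<close> the density controls the integrand at infinity and the
  power is integrable at the origin.
\<close>

lemma normal_moment_bounds:
  assumes "-1 < a" "a < 0"
  shows "0 < normal_moment a" "normal_moment a < \<infinity>"
proof -
  have "normal_moment a \<le> (\<integral>\<^sup>+x. ennreal (indicator {-1..1} x * \<bar>x\<bar> powr a) + ennreal (std_normal_density x) \<partial>lborel)"
    unfolding normal_moment_def
  proof (intro nn_integral_mono)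
    fix x :: real
    have d1: "std_normal_density x \<le> 1"
    proof -
      have "std_normal_density x \<le> std_normal_density 0"
        by (rule std_normal_density_decreasing) simp
      also have "\<dots> \<le> 1"
      proof -
        have "1 \<le> sqrt (2 * pi)" using pi_gt3 by (intro real_le_rsqrt) simp
        then show ?thesis by (simp add: std_normal_density_def)
      qed
      finally show ?thesis .
    qed
    have "\<bar>x\<bar> powr a * std_normal_density x \<le> indicator {-1..1} x * \<bar>x\<bar> powr a + std_normal_density x"
    proof (cases "x \<in> {-1..1}")
      case True
      have "\<bar>x\<bar> powr a * std_normal_density x \<le> \<bar>x\<bar> powr a * 1"
        by (rule mult_left_mono[OF d1]) simp
      then show ?thesis using True by (simp add: add_increasing2)
    next
      case False
      then have "\<bar>x\<bar> powr a \<le> \<bar>x\<bar> powr 0" using assms by (intro powr_mono) auto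
      moreover have "x \<noteq> 0" using False by auto
      ultimately have "\<bar>x\<bar> powr a \<le> 1" by simp
      from mult_right_mono[OF this, of "std_normal_density x"] show ?thesis using False by simp
    qed
    then have "ennreal (\<bar>x\<bar> powr a * std_normal_density x)
        \<le> ennreal (indicator {-1..1} x * \<bar>x\<bar> powr a + std_normal_density x)"
      by (rule ennreal_leI)
    also have "\<dots> = ennreal (indicator {-1..1} x * \<bar>x\<bar> powr a) + ennreal (std_normal_density x)"
      by (rule ennreal_plus) auto
    finally show "ennreal (\<bar>x\<bar> powr a * std_normal_density x)
        \<le> ennreal (indicator {-1..1} x * \<bar>x\<bar> powr a) + ennreal (std_normal_density x)" .
  qed
  also have "\<dots> = (\<integral>\<^sup>+x. ennreal (indicator {-1..1} x * \<bar>x\<bar> powr a) \<partial>lborel) + 1"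
    by (subst nn_integral_add) (auto simp: nn_integral_std_normal_density)
  also have "\<dots> < \<infinity>" using nn_integral_abs_powr_finite[OF assms(1)] by simp
  finally show "normal_moment a < \<infinity>" .
  have "ennreal (std_normal_density 1) = (\<integral>\<^sup>+u. ennreal (std_normal_density 1) * indicator {0<..1::real} u \<partial>lborel)"
    by (subst nn_integral_cmult_indicator) auto
  also have "\<dots> \<le> normal_moment a"
    unfolding normal_moment_def
  proof (intro nn_integral_mono)
    fix u :: real
    show "ennreal (std_normal_density 1) * indicator {0<..1} u \<le> ennreal (\<bar>u\<bar> powr a * std_normal_density u)"
    proof (cases "u \<in> {0<..1}")
      case True
      have "1 powr a \<le> u powr a" using True assms by (intro powr_mono2') auto
      then have "1 * std_normal_density 1 \<le> \<bar>u\<bar> powr a * std_normal_density u"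
        using True by (intro mult_mono std_normal_density_decreasing) auto
      then show ?thesis using True by (simp add: ennreal_leI)
    qed simp
  qed
  finally have "ennreal (std_normal_density 1) \<le> normal_moment a" .
  moreover have "0 < ennreal (std_normal_density 1)"
    by (simp add: std_normal_density_def)
  ultimately show "0 < normal_moment a" by (rule less_le_trans[rotated])
qed

lemma nn_integral_abs_powr_scale:
  assumes [measurable]: "F \<in> borel_measurable borel" and u: "u \<noteq> 0"
  shows "(\<integral>\<^sup>+\<sigma>. ennreal (\<bar>\<sigma>\<bar> powr a) * F (\<sigma> * u) \<partial>lborel)
    = ennreal (\<bar>u\<bar> powr (- a - 1)) * (\<integral>\<^sup>+\<omega>. ennreal (\<bar>\<omega>\<bar> powr a) * F \<omega> \<partial>lborel)"
proof -
  have "(\<integral>\<^sup>+\<sigma>. ennreal (\<bar>\<sigma>\<bar> powr a) * F (\<sigma> * u) \<partial>lborel)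
      = ennreal \<bar>1 / u\<bar> * (\<integral>\<^sup>+\<omega>. ennreal (\<bar>0 + (1 / u) * \<omega>\<bar> powr a) * F ((0 + (1 / u) * \<omega>) * u) \<partial>lborel)"
    by (rule nn_integral_real_affine) (use u in auto)
  also have "\<dots> = ennreal \<bar>1 / u\<bar> * (\<integral>\<^sup>+\<omega>. ennreal (\<bar>u\<bar> powr (- a)) * (ennreal (\<bar>\<omega>\<bar> powr a) * F \<omega>) \<partial>lborel)"
  proof (intro arg_cong[where f="\<lambda>x. _ * x"] nn_integral_cong)
    fix \<omega> :: real
    have "\<bar>0 + (1 / u) * \<omega>\<bar> powr a = \<bar>u\<bar> powr (- a) * \<bar>\<omega>\<bar> powr a"
      using u by (simp add: abs_mult powr_mult powr_divide powr_minus_divide)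
    then show "ennreal (\<bar>0 + (1 / u) * \<omega>\<bar> powr a) * F ((0 + (1 / u) * \<omega>) * u)
        = ennreal (\<bar>u\<bar> powr (- a)) * (ennreal (\<bar>\<omega>\<bar> powr a) * F \<omega>)"
      using u by (simp add: ennreal_mult mult.assoc)
  qed
  also have "\<dots> = ennreal \<bar>1 / u\<bar> * ennreal (\<bar>u\<bar> powr (- a)) * (\<integral>\<^sup>+\<omega>. ennreal (\<bar>\<omega>\<bar> powr a) * F \<omega> \<partial>lborel)"
    by (subst nn_integral_cmult) (auto simp: mult.assoc)
  also have "ennreal \<bar>1 / u\<bar> * ennreal (\<bar>u\<bar> powr (- a)) = ennreal (\<bar>u\<bar> powr (- a - 1))"
    using u by (subst ennreal_mult[symmetric]) (auto simp: powr_diff)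
  finally show ?thesis .
qed

definition riesz_energy :: "real \<Rightarrow> (real \<Rightarrow> real) \<Rightarrow> real" where
  "riesz_energy \<alpha> g =
    (LINT z|lborel. g (fst z) * g (snd z) * \<bar>fst z - snd z\<bar> powr (\<alpha> - 1))"

lemma bounded_support_nn_integral_abs_powr:
  fixes g h :: "real \<Rightarrow> real"
  assumes [measurable]: "g \<in> borel_measurable borel" "h \<in> borel_measurable borel"
    and "0 < \<alpha>" and h: "\<And>x. \<bar>h x\<bar> \<le> C" "\<And>x. x \<notin> {0<..<1} \<Longrightarrow> h x = 0"
    and g: "integrable lborel g" "\<And>x. x \<notin> {0<..<1} \<Longrightarrow> g x = 0"
  shows "(\<integral>\<^sup>+x. \<integral>\<^sup>+y. ennreal (\<bar>g x * h y\<bar> * \<bar>x - y\<bar> powr (\<alpha> - 1)) \<partial>lborel \<partial>lborel) < \<infinity>"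
proof -
  let ?k = "\<lambda>t. ennreal (indicator {-1..1} t * \<bar>t\<bar> powr (\<alpha> - 1))"
  have C: "0 \<le> C" using h(1)[of 0] by simp
  have "(\<integral>\<^sup>+x. \<integral>\<^sup>+y. ennreal (\<bar>g x * h y\<bar> * \<bar>x - y\<bar> powr (\<alpha> - 1)) \<partial>lborel \<partial>lborel)
      \<le> (\<integral>\<^sup>+x. \<integral>\<^sup>+y. ennreal \<bar>g x\<bar> * (ennreal C * ?k (x + (-1) * y)) \<partial>lborel \<partial>lborel)"
  proof (intro nn_integral_mono)
    fix x y :: real
    show "ennreal (\<bar>g x * h y\<bar> * \<bar>x - y\<bar> powr (\<alpha> - 1)) \<le> ennreal \<bar>g x\<bar> * (ennreal C * ?k (x + (-1) * y))"
    proof (cases "x \<in> {0<..<1} \<and> y \<in> {0<..<1}")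
      case True
      have "ennreal (\<bar>g x * h y\<bar> * \<bar>x - y\<bar> powr (\<alpha> - 1)) \<le> ennreal (\<bar>g x\<bar> * (C * \<bar>x - y\<bar> powr (\<alpha> - 1)))"
        unfolding abs_mult mult.assoc using h(1)[of y]
        by (intro ennreal_leI mult_left_mono mult_right_mono) auto
      also have "\<dots> = ennreal \<bar>g x\<bar> * (ennreal C * ?k (x + (-1) * y))"
        using True C by (simp add: ennreal_mult indicator_def)
      finally show ?thesis .
    next
      case False
      then have "g x * h y = 0" using h(2)[of y] g(2)[of x] by (metis mult_eq_0_iff)
      then show ?thesis by (simp only:) simp
    qed
  qed
  also have "\<dots> = (\<integral>\<^sup>+x. ennreal \<bar>g x\<bar> * (ennreal C * (\<integral>\<^sup>+y. ?k y \<partial>lborel)) \<partial>lborel)"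
  proof (intro nn_integral_cong)
    fix x
    have "(\<integral>\<^sup>+y. ?k (x + (-1) * y) \<partial>lborel) = (\<integral>\<^sup>+y. ?k y \<partial>lborel)"
      using nn_integral_real_affine[of ?k "-1" x] by simp
    then show "(\<integral>\<^sup>+y. ennreal \<bar>g x\<bar> * (ennreal C * ?k (x + (-1) * y)) \<partial>lborel)
        = ennreal \<bar>g x\<bar> * (ennreal C * (\<integral>\<^sup>+y. ?k y \<partial>lborel))"
      by (subst nn_integral_cmult, simp, subst nn_integral_cmult, simp) simp
  qed
  also have "\<dots> = (\<integral>\<^sup>+x. ennreal \<bar>g x\<bar> \<partial>lborel) * (ennreal C * (\<integral>\<^sup>+y. ?k y \<partial>lborel))"
    by (rule nn_integral_multc) auto
  also have "\<dots> < \<infinity>"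
    using g(1) nn_integral_abs_powr_finite[of "\<alpha> - 1"] \<open>0 < \<alpha>\<close>
    by (auto simp: integrable_iff_bounded ennreal_mult_less_top)
  finally show ?thesis .
qed

lemma AE_fst_neq_snd: "AE z in lborel. fst z \<noteq> (snd z :: real)"
proof -
  have "AE z in (lborel :: real measure) \<Otimes>\<^sub>M lborel. fst z \<noteq> (snd z :: real)"
  proof (rule lborel_pair.AE_pair_measure)
    show "{z \<in> space ((lborel :: real measure) \<Otimes>\<^sub>M lborel). fst z \<noteq> (snd z :: real)}
        \<in> sets (lborel \<Otimes>\<^sub>M lborel)" by measurable
    have "AE y in lborel. fst (x, y) \<noteq> snd (x, y)" for x :: real
      using AE_lborel_singleton[of x] by eventually_elim auto
    then show "AE x in lborel. AE y in lborel. fst (x :: real, y) \<noteq> (snd (x, y) :: real)"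
      by simp
  qed
  then show ?thesis unfolding lborel_prod .
qed

text \<open>
  The Riesz kernel \<open>\<bar>t\<bar> powr (\<alpha> - 1)\<close> is a superposition of Gaussians in \<open>t\<close>, and by
  homogeneity the same superposition on the Fourier side is a multiple of \<open>\<bar>\<omega>\<bar> powr (- \<alpha>)\<close>.
  The factor \<open>c\<close> comes from moments of the normal density and does not depend on \<open>g\<close>. In particular
  the energy is nonnegative.
\<close>

lemma riesz_energy_Fourier:
  assumes \<alpha>: "0 < \<alpha>" "\<alpha> < 1"
  obtains c where "0 < c"
    "\<And>g C. g \<in> borel_measurable borel \<Longrightarrow> (\<And>x. \<bar>g x\<bar> \<le> C) \<Longrightarrow> (\<And>x. x \<notin> {0<..<1} \<Longrightarrow> g x = 0) \<Longrightarrow>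
      0 \<le> riesz_energy \<alpha> g \<and>
      ennreal (riesz_energy \<alpha> g)
        = ennreal c * (\<integral>\<^sup>+\<omega>. ennreal (\<bar>\<omega>\<bar> powr (- \<alpha>)) * ennreal ((cmod (fourier g \<omega>))\<^sup>2) \<partial>lborel)"
proof -
  have m: "-1 < - \<alpha>" "- \<alpha> < 0" "-1 < \<alpha> - 1" "\<alpha> - 1 < 0" using \<alpha> by auto
  define A where "A = enn2real (normal_moment (- \<alpha>))"
  define B where "B = enn2real (normal_moment (\<alpha> - 1))"
  have A: "0 < A" "normal_moment (- \<alpha>) = ennreal A"
    using normal_moment_bounds[OF m(1,2)] by (auto simp: A_def enn2real_positive_iff)
  have B: "0 < B" "normal_moment (\<alpha> - 1) = ennreal B"
    using normal_moment_bounds[OF m(3,4)] by (auto simp: B_def enn2real_positive_iff)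
  show ?thesis
  proof (rule that[of "sqrt (2 * pi) * B / A"])
    show "0 < sqrt (2 * pi) * B / A" using A B by simp
    fix g :: "real \<Rightarrow> real" and C
    assume gm [measurable]: "g \<in> borel_measurable borel"
      and gb: "\<And>x. \<bar>g x\<bar> \<le> C" and g0: "\<And>x. x \<notin> {0<..<1} \<Longrightarrow> g x = 0"
    have gi: "integrable lborel g" by (rule integrable_bounded_support[OF gm gb g0])
    let ?r = "\<lambda>z. g (fst z) * g (snd z) * \<bar>fst z - snd z\<bar> powr (\<alpha> - 1)"
    define f where "f z \<sigma> = g (fst z) * g (snd z) * (\<bar>\<sigma>\<bar> powr (- \<alpha>) * std_normal_density (\<sigma> * (fst z - snd z)))"
      for z :: "real \<times> real" and \<sigma> :: real
    have fm: "case_prod f \<in> borel_measurable (lborel \<Otimes>\<^sub>M lborel)"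
      unfolding f_def std_normal_density_def by measurable
    have inner: "(\<integral>\<^sup>+\<sigma>. ennreal (\<bar>\<sigma>\<bar> powr (- \<alpha>) * std_normal_density (\<sigma> * t)) \<partial>lborel)
        = ennreal (\<bar>t\<bar> powr (\<alpha> - 1) * A)" if "t \<noteq> 0" for t
      using nn_integral_abs_powr_scale[of "\<lambda>x. ennreal (std_normal_density x)" t "- \<alpha>"] that A
      by (simp add: normal_moment_def ennreal_mult)
    have inner_i: "integrable lborel (\<lambda>\<sigma>. \<bar>\<sigma>\<bar> powr (- \<alpha>) * std_normal_density (\<sigma> * t))"
      "(LINT \<sigma>|lborel. \<bar>\<sigma>\<bar> powr (- \<alpha>) * std_normal_density (\<sigma> * t)) = \<bar>t\<bar> powr (\<alpha> - 1) * A"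
      if "t \<noteq> 0" for t
    proof -
      show i: "integrable lborel (\<lambda>\<sigma>. \<bar>\<sigma>\<bar> powr (- \<alpha>) * std_normal_density (\<sigma> * t))"
        using inner[OF that] by (intro integrableI_nonneg) auto
      show "(LINT \<sigma>|lborel. \<bar>\<sigma>\<bar> powr (- \<alpha>) * std_normal_density (\<sigma> * t)) = \<bar>t\<bar> powr (\<alpha> - 1) * A"
        using inner[OF that] A by (subst integral_eq_nn_integral) auto
    qed
    have rfin: "(\<integral>\<^sup>+z. ennreal \<bar>?r z\<bar> \<partial>lborel) < \<infinity>"
      using bounded_support_nn_integral_abs_powr[OF gm gm \<alpha>(1) gb g0 gi g0]
      by (subst nn_integral_lborel_pair) (auto simp: abs_mult)
    have fin: "(\<integral>\<^sup>+z. \<integral>\<^sup>+\<sigma>. ennreal (norm (f z \<sigma>)) \<partial>lborel \<partial>lborel) < \<infinity>"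
    proof -
      have "(\<integral>\<^sup>+z. \<integral>\<^sup>+\<sigma>. ennreal (norm (f z \<sigma>)) \<partial>lborel \<partial>lborel) = (\<integral>\<^sup>+z. ennreal \<bar>?r z\<bar> * ennreal A \<partial>lborel)"
      proof (rule nn_integral_cong_AE)
        show "AE z in lborel. (\<integral>\<^sup>+\<sigma>. ennreal (norm (f z \<sigma>)) \<partial>lborel) = ennreal \<bar>?r z\<bar> * ennreal A"
          using AE_fst_neq_snd
        proof eventually_elim
          case (elim z)
          have "(\<integral>\<^sup>+\<sigma>. ennreal (norm (f z \<sigma>)) \<partial>lborel)
              = (\<integral>\<^sup>+\<sigma>. ennreal \<bar>g (fst z) * g (snd z)\<bar> * ennreal (\<bar>\<sigma>\<bar> powr (- \<alpha>) * std_normal_density (\<sigma> * (fst z - snd z))) \<partial>lborel)"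
            unfolding f_def by (intro nn_integral_cong) (simp add: abs_mult ennreal_mult[symmetric])
          also have "\<dots> = ennreal \<bar>g (fst z) * g (snd z)\<bar> * ennreal (\<bar>fst z - snd z\<bar> powr (\<alpha> - 1) * A)"
            using elim by (subst nn_integral_cmult) (auto simp: inner)
          also have "\<dots> = ennreal \<bar>?r z\<bar> * ennreal A"
            using A by (simp add: abs_mult ennreal_mult[symmetric] mult.assoc)
          finally show ?case .
        qed
      qed
      also have "\<dots> = (\<integral>\<^sup>+z. ennreal \<bar>?r z\<bar> \<partial>lborel) * ennreal A"
        by (rule nn_integral_multc) measurable
      finally show ?thesis using rfin by (simp add: ennreal_mult_less_top)
    qed
    \<comment> \<open>The Gaussian energy at the scale \<open>\<sigma>\<close>, with its weight in the superposition: integrated over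
      \<open>\<sigma>\<close> it gives the Riesz energy, and the Gaussian identity turns it into a Fourier average.\<close>
    define s where "s \<sigma> = (LINT z|lborel. f z \<sigma>)" for \<sigma>
    have s_i: "integrable lborel s"
      unfolding s_def by (rule integrable_integral_snd_lborel[OF fm fin])
    have s_eq: "s \<sigma> = sqrt (2 * pi) * \<bar>\<sigma>\<bar> powr (- \<alpha>) * (LINT u|lborel. std_normal_density u * (cmod (fourier g (\<sigma> * u)))\<^sup>2)" for \<sigma>
    proof -
      have "s \<sigma> = (LINT z|lborel. (\<bar>\<sigma>\<bar> powr (- \<alpha>) / sqrt (2 * pi)) * (g (fst z) * g (snd z) * exp (- (\<sigma> * (fst z - snd z))\<^sup>2 / 2)))"
        unfolding s_def f_def exp_eq_std_normal_density
        by (intro Bochner_Integration.integral_cong) auto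
      also have "\<dots> = (\<bar>\<sigma>\<bar> powr (- \<alpha>) / sqrt (2 * pi)) * (2 * pi * (LINT u|lborel. std_normal_density u * (cmod (fourier g (\<sigma> * u)))\<^sup>2))"
        by (simp only: integral_mult_right_zero Gaussian_energy[OF gi])
      also have "\<dots> = (2 * pi / sqrt (2 * pi)) * \<bar>\<sigma>\<bar> powr (- \<alpha>) * (LINT u|lborel. std_normal_density u * (cmod (fourier g (\<sigma> * u)))\<^sup>2)"
        by simp
      also have "2 * pi / sqrt (2 * pi) = sqrt (2 * pi)"
        by (rule real_div_sqrt) simp
      finally show ?thesis .
    qed
    have s0: "0 \<le> s \<sigma>" for \<sigma> unfolding s_eq by (intro mult_nonneg_nonneg integral_nonneg_AE) auto
    have rA: "riesz_energy \<alpha> g * A = (LINT \<sigma>|lborel. s \<sigma>)"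
    proof -
      have "(LINT \<sigma>|lborel. s \<sigma>) = (LINT z|lborel. LINT \<sigma>|lborel. f z \<sigma>)"
        unfolding s_def by (rule Fubini_lborel_swap[OF fm fin, symmetric])
      also have "\<dots> = (LINT z|lborel. ?r z * A)"
      proof (rule integral_cong_AE)
        show "AE z in lborel. (LINT \<sigma>|lborel. f z \<sigma>) = ?r z * A"
          using AE_fst_neq_snd
        proof eventually_elim
          case (elim z)
          then show ?case unfolding f_def by (simp add: inner_i(2))
        qed
        show "(\<lambda>z. LINT \<sigma>|lborel. f z \<sigma>) \<in> borel_measurable lborel"
          using integrable_integral_fst_lborel[OF fm fin] by auto
      qed measurable
      finally show ?thesis by (simp add: riesz_energy_def)
    qed
    have "0 \<le> riesz_energy \<alpha> g * A" unfolding rA by (intro integral_nonneg_AE) (simp add: s0)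
    then have r0: "0 \<le> riesz_energy \<alpha> g" using A(1) by (simp add: zero_le_mult_iff)
    let ?F = "\<lambda>\<omega>. ennreal ((cmod (fourier g \<omega>))\<^sup>2)"
    let ?S = "\<integral>\<^sup>+\<omega>. ennreal (\<bar>\<omega>\<bar> powr (- \<alpha>)) * ?F \<omega> \<partial>lborel"
    have enn_s: "ennreal (s \<sigma>) = (\<integral>\<^sup>+u. ennreal (sqrt (2 * pi)) * (ennreal (std_normal_density u) * (ennreal (\<bar>\<sigma>\<bar> powr (- \<alpha>)) * ?F (\<sigma> * u))) \<partial>lborel)" for \<sigma>
    proof -
      have "integrable lborel (\<lambda>u. (cmod (fourier g (\<sigma> * u)))\<^sup>2 * std_normal_density u)"
      proof (rule integrable_mult_bounded)
        show "\<bar>(cmod (fourier g (\<sigma> * u)))\<^sup>2\<bar> \<le> (LINT x|lborel. \<bar>g x\<bar>)\<^sup>2" for u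
          using norm_fourier_le[OF gi, of "\<sigma> * u"] by (simp add: power_mono)
        show "integrable lborel std_normal_density"
          using integrable_normal_moment[of 1 0 0] by simp
      qed measurable
      then have "ennreal (LINT u|lborel. std_normal_density u * (cmod (fourier g (\<sigma> * u)))\<^sup>2)
          = (\<integral>\<^sup>+u. ennreal (std_normal_density u) * ?F (\<sigma> * u) \<partial>lborel)"
        by (subst nn_integral_eq_integral[symmetric]) (auto simp: mult.commute ennreal_mult)
      then have "ennreal (s \<sigma>) = ennreal (sqrt (2 * pi) * \<bar>\<sigma>\<bar> powr (- \<alpha>)) * (\<integral>\<^sup>+u. ennreal (std_normal_density u) * ?F (\<sigma> * u) \<partial>lborel)"
        unfolding s_eq by (subst ennreal_mult) auto
      also have "\<dots> = (\<integral>\<^sup>+u. ennreal (sqrt (2 * pi) * \<bar>\<sigma>\<bar> powr (- \<alpha>)) * (ennreal (std_normal_density u) * ?F (\<sigma> * u)) \<partial>lborel)"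
        by (rule nn_integral_cmult[symmetric]) measurable
      finally show ?thesis by (simp add: ennreal_mult ac_simps)
    qed
    have "ennreal (riesz_energy \<alpha> g * A) = (\<integral>\<^sup>+\<sigma>. ennreal (s \<sigma>) \<partial>lborel)"
      unfolding rA by (rule nn_integral_eq_integral[OF s_i, symmetric]) (simp add: s0)
    also have "\<dots> = (\<integral>\<^sup>+\<sigma>. \<integral>\<^sup>+u. ennreal (sqrt (2 * pi)) * (ennreal (std_normal_density u) * (ennreal (\<bar>\<sigma>\<bar> powr (- \<alpha>)) * ?F (\<sigma> * u))) \<partial>lborel \<partial>lborel)"
      unfolding enn_s ..
    also have "\<dots> = (\<integral>\<^sup>+u. \<integral>\<^sup>+\<sigma>. ennreal (sqrt (2 * pi)) * (ennreal (std_normal_density u) * (ennreal (\<bar>\<sigma>\<bar> powr (- \<alpha>)) * ?F (\<sigma> * u))) \<partial>lborel \<partial>lborel)"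
      by (rule lborel_pair.Fubini') measurable
    also have "\<dots> = (\<integral>\<^sup>+u. ennreal (sqrt (2 * pi)) * (ennreal (std_normal_density u) * (ennreal (\<bar>u\<bar> powr (\<alpha> - 1)) * ?S)) \<partial>lborel)"
    proof (rule nn_integral_cong_AE)
      show "AE u in lborel. (\<integral>\<^sup>+\<sigma>. ennreal (sqrt (2 * pi)) * (ennreal (std_normal_density u) * (ennreal (\<bar>\<sigma>\<bar> powr (- \<alpha>)) * ?F (\<sigma> * u))) \<partial>lborel)
          = ennreal (sqrt (2 * pi)) * (ennreal (std_normal_density u) * (ennreal (\<bar>u\<bar> powr (\<alpha> - 1)) * ?S))"
        using AE_lborel_singleton[of "0::real"]
      proof eventually_elim
        case (elim u)
        then show ?case
          using nn_integral_abs_powr_scale[of ?F u "- \<alpha>"]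
          by (subst nn_integral_cmult, simp, subst nn_integral_cmult, simp) simp
      qed
    qed
    also have "\<dots> = (\<integral>\<^sup>+u. ennreal (sqrt (2 * pi)) * (ennreal (\<bar>u\<bar> powr (\<alpha> - 1) * std_normal_density u) * ?S) \<partial>lborel)"
      by (intro nn_integral_cong) (simp add: ennreal_mult ac_simps)
    also have "\<dots> = ennreal (sqrt (2 * pi)) * (normal_moment (\<alpha> - 1) * ?S)"
      by (subst nn_integral_cmult, simp, subst nn_integral_multc) (auto simp: normal_moment_def)
    finally have "ennreal (riesz_energy \<alpha> g * A) * ennreal (1 / A)
        = ennreal (sqrt (2 * pi)) * (ennreal B * ?S) * ennreal (1 / A)"
      by (simp only: B)
    moreover have "ennreal (riesz_energy \<alpha> g * A) * ennreal (1 / A) = ennreal (riesz_energy \<alpha> g)"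
      using r0 A(1) by (subst ennreal_mult[symmetric]) auto
    moreover have "ennreal (sqrt (2 * pi)) * (ennreal B * ?S) * ennreal (1 / A)
        = (ennreal (sqrt (2 * pi)) * ennreal B * ennreal (1 / A)) * ?S"
      by (simp only: ac_simps)
    moreover have "ennreal (sqrt (2 * pi)) * ennreal B * ennreal (1 / A) = ennreal (sqrt (2 * pi) * B / A)"
      using A(1) B(1) by (simp add: ennreal_mult[symmetric])
    ultimately show "0 \<le> riesz_energy \<alpha> g \<and> ennreal (riesz_energy \<alpha> g) = ennreal (sqrt (2 * pi) * B / A) * ?S"
      using r0 by simp
  qed
qed


text \<open>
  Plancherel's theorem: in the Gaussian energy, multiplied by \<open>\<sigma>\<close>, the kernel becomes an
  approximate identity as \<open>\<sigma>\<close> tends to infinity, while the weight on the Fourier side increases to a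
  constant. The scales \<open>p n\<close> are the values of \<open>\<sigma>\<close>.
\<close>

lemma Plancherel_test_function:
  assumes \<phi>: "test_function \<phi>"
  shows "(\<integral>\<^sup>+\<omega>. ennreal ((cmod (fourier \<phi> \<omega>))\<^sup>2) \<partial>lborel) = ennreal (LINT x|lborel. (\<phi> x)\<^sup>2)"
proof -
  have gi: "integrable lborel \<phi>" by (rule test_function_integrable[OF \<phi>])
  have [measurable]: "\<phi> \<in> borel_measurable borel" by (rule test_function_borel[OF \<phi>])
  obtain C where C: "0 \<le> C" "\<And>x. \<bar>\<phi> x\<bar> \<le> C" using test_function_bounded[OF \<phi>] by metis
  have cont: "isCont \<phi> x" for x
    using test_function_continuous[OF \<phi>, of UNIV] by (simp add: continuous_on_eq_continuous_at)
  have Ni: "integrable lborel std_normal_density" using integrable_normal_moment[of 1 0 0] by simp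
  have N1: "(LINT u|lborel. std_normal_density u) = 1" using integral_normal_moment_even[of 1 0 0] by simp
  define p where "p n = real (Suc n)" for n
  have p: "0 < p n" for n by (simp add: p_def)
  have pinf: "(\<lambda>n. v / p n) \<longlonglongrightarrow> 0" for v
    unfolding p_def using tendsto_mult[OF tendsto_const[of v] LIMSEQ_Suc[OF lim_1_over_n]] by simp
  let ?F = "\<lambda>\<omega>. (cmod (fourier \<phi> \<omega>))\<^sup>2"
  let ?J = "\<lambda>n. LINT x|lborel. \<phi> x * (LINT v|lborel. \<phi> (x + v / p n) * std_normal_density v)"
  have inner_bound: "\<bar>LINT v|lborel. \<phi> (x + v / p n) * std_normal_density v\<bar> \<le> C" for x n
  proof -
    have "\<bar>LINT v|lborel. \<phi> (x + v / p n) * std_normal_density v\<bar>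
        \<le> (LINT v|lborel. C * std_normal_density v)"
      using integrable_mult_bounded[OF _ C(2), of "\<lambda>v. x + v / p n" lborel std_normal_density]
      by (intro integral_abs_bound_integral)
         (auto simp: Ni abs_mult C intro!: mult_right_mono integrable_mult_bounded[OF _ C(2) Ni])
    then show ?thesis using N1 by simp
  qed
  have lim_inner: "(\<lambda>n. LINT v|lborel. \<phi> (x + v / p n) * std_normal_density v) \<longlonglongrightarrow> \<phi> x" for x
  proof -
    have "(\<lambda>n. LINT v|lborel. \<phi> (x + v / p n) * std_normal_density v)
        \<longlonglongrightarrow> (LINT v|lborel. \<phi> x * std_normal_density v)"
    proof (rule integral_dominated_convergence)
      show "integrable lborel (\<lambda>v. C * std_normal_density v)" using Ni by simp
      show "AE v in lborel. (\<lambda>n. \<phi> (x + v / p n) * std_normal_density v) \<longlonglongrightarrow> \<phi> x * std_normal_density v"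
      proof (rule AE_I2)
        fix v
        have "(\<lambda>n. x + v / p n) \<longlonglongrightarrow> x + 0" by (intro tendsto_intros pinf)
        then have "(\<lambda>n. \<phi> (x + v / p n)) \<longlonglongrightarrow> \<phi> x"
          using cont[of x] by (intro isCont_tendsto_compose[of x \<phi>]) simp_all
        then show "(\<lambda>n. \<phi> (x + v / p n) * std_normal_density v) \<longlonglongrightarrow> \<phi> x * std_normal_density v"
          by (intro tendsto_intros)
      qed
      show "AE v in lborel. norm (\<phi> (x + v / p n) * std_normal_density v) \<le> C * std_normal_density v" for n
        by (auto simp: abs_mult C intro!: mult_right_mono)
    qed measurable
    then show ?thesis using N1 by simp
  qed
  have "?J \<longlonglongrightarrow> (LINT x|lborel. \<phi> x * \<phi> x)"
  proof (rule integral_dominated_convergence)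
    show "integrable lborel (\<lambda>x. \<bar>\<phi> x\<bar> * C)" using gi by simp
    show "AE x in lborel. (\<lambda>n. \<phi> x * (LINT v|lborel. \<phi> (x + v / p n) * std_normal_density v)) \<longlonglongrightarrow> \<phi> x * \<phi> x"
      by (intro AE_I2 tendsto_mult tendsto_const lim_inner)
    show "AE x in lborel. norm (\<phi> x * (LINT v|lborel. \<phi> (x + v / p n) * std_normal_density v)) \<le> \<bar>\<phi> x\<bar> * C" for n
      unfolding real_norm_def abs_mult by (intro AE_I2 mult_left_mono inner_bound) simp
  qed measurable
  then have L1: "(\<lambda>n. ennreal (?J n)) \<longlonglongrightarrow> ennreal (LINT x|lborel. (\<phi> x)\<^sup>2)"
    by (simp add: power2_eq_square)
  have J: "ennreal (?J n) = (\<integral>\<^sup>+\<omega>. ennreal (exp (- (\<omega> / p n)\<^sup>2 / 2)) * ennreal (?F \<omega>) \<partial>lborel)" for n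
  proof -
    let ?e = "\<lambda>z. \<phi> (fst z) * \<phi> (snd z) * exp (- (p n * (fst z - snd z))\<^sup>2 / 2)"
    have ei: "integrable lborel ?e"
    proof -
      have "integrable lborel (\<lambda>z::real\<times>real. exp (- (p n * (fst z - snd z))\<^sup>2 / 2) * (\<phi> (fst z) * \<phi> (snd z)))"
        by (rule integrable_mult_bounded[of _ _ 1]) (auto intro: integrable_lborel_pair_mult(1) gi)
      then show ?thesis by (simp add: mult.commute)
    qed
    have inner: "(LINT y|lborel. \<phi> y * exp (- (p n * (x - y))\<^sup>2 / 2))
        = (sqrt (2 * pi) / p n) * (LINT v|lborel. \<phi> (x + v / p n) * std_normal_density v)" for x
    proof -
      have "(LINT y|lborel. \<phi> y * exp (- (p n * (x - y))\<^sup>2 / 2))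
          = \<bar>1 / p n\<bar> *\<^sub>R (LINT v|lborel. \<phi> (x + (1 / p n) * v) * exp (- (p n * (x - (x + (1 / p n) * v)))\<^sup>2 / 2))"
        by (rule lborel_integral_real_affine) (use p[of n] in simp)
      also have "(LINT v|lborel. \<phi> (x + (1 / p n) * v) * exp (- (p n * (x - (x + (1 / p n) * v)))\<^sup>2 / 2))
          = (LINT v|lborel. sqrt (2 * pi) * (\<phi> (x + v / p n) * std_normal_density v))"
      proof (intro Bochner_Integration.integral_cong refl)
        fix v
        have "p n * (x - (x + (1 / p n) * v)) = - v" using p[of n] by simp
        then show "\<phi> (x + (1 / p n) * v) * exp (- (p n * (x - (x + (1 / p n) * v)))\<^sup>2 / 2)
            = sqrt (2 * pi) * (\<phi> (x + v / p n) * std_normal_density v)"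
          by (simp add: std_normal_density_def)
      qed
      finally show ?thesis using p[of n] by simp
    qed
    have "(LINT z|lborel. ?e z) = (LINT x|lborel. \<phi> x * (LINT y|lborel. \<phi> y * exp (- (p n * (x - y))\<^sup>2 / 2)))"
      unfolding integral_lborel_pair[OF ei] by (simp add: mult.assoc)
    also have "\<dots> = (sqrt (2 * pi) / p n) * ?J n"
      unfolding inner
      by (subst integral_mult_right_zero[symmetric]) (intro Bochner_Integration.integral_cong, auto)
    finally have eq: "(sqrt (2 * pi) / p n) * ?J n = 2 * pi * (LINT u|lborel. std_normal_density u * ?F (p n * u))"
      unfolding Gaussian_energy[OF gi] ..
    have sq: "sqrt (2 * pi) * sqrt (2 * pi) = 2 * pi" by simp
    have aux: "J = q * s * G" if "(s / q) * J = s * s * G" "0 < q" "0 < s" for J q s G :: real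
      using that by (simp add: field_simps)
    have "?J n = p n * sqrt (2 * pi) * (LINT u|lborel. std_normal_density u * ?F (p n * u))"
      by (rule aux, unfold sq, rule eq, rule p) simp
    also have "(LINT u|lborel. std_normal_density u * ?F (p n * u))
        = (1 / p n) * (LINT \<omega>|lborel. std_normal_density (\<omega> / p n) * ?F \<omega>)"
      using lborel_integral_real_affine[of "1 / p n" "\<lambda>u. std_normal_density u * ?F (p n * u)" 0] p[of n] by simp
    also have "p n * sqrt (2 * pi) * ((1 / p n) * (LINT \<omega>|lborel. std_normal_density (\<omega> / p n) * ?F \<omega>))
        = (LINT \<omega>|lborel. exp (- (\<omega> / p n)\<^sup>2 / 2) * ?F \<omega>)"
      using p[of n] unfolding exp_eq_std_normal_density by (simp add: mult.assoc)
    finally have J1: "?J n = (LINT \<omega>|lborel. exp (- (\<omega> / p n)\<^sup>2 / 2) * ?F \<omega>)" .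
    have "integrable lborel (\<lambda>\<omega>. ?F \<omega> * exp (- (\<omega> / p n)\<^sup>2 / 2))"
    proof (rule integrable_mult_bounded)
      show "\<bar>?F \<omega>\<bar> \<le> (LINT x|lborel. \<bar>\<phi> x\<bar>)\<^sup>2" for \<omega>
        using norm_fourier_le[OF gi, of \<omega>] by (simp add: power_mono)
      have "integrable lborel (\<lambda>\<omega>. std_normal_density (0 + (1 / p n) * \<omega>))"
        by (rule lborel_integrable_real_affine[OF Ni]) (use p[of n] in simp)
      then show "integrable lborel (\<lambda>\<omega>. exp (- (\<omega> / p n)\<^sup>2 / 2))"
        unfolding exp_eq_std_normal_density by simp
    qed measurable
    then show ?thesis unfolding J1
      by (subst nn_integral_eq_integral[symmetric]) (auto simp: mult.commute ennreal_mult)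
  qed
  have "(\<lambda>n. \<integral>\<^sup>+\<omega>. ennreal (exp (- (\<omega> / p n)\<^sup>2 / 2)) * ennreal (?F \<omega>) \<partial>lborel)
      \<longlonglongrightarrow> (\<integral>\<^sup>+\<omega>. ennreal (?F \<omega>) \<partial>lborel)"
  proof (rule nn_integral_LIMSEQ)
    show "incseq (\<lambda>n \<omega>. ennreal (exp (- (\<omega> / p n)\<^sup>2 / 2)) * ennreal (?F \<omega>))"
    proof (intro incseq_SucI le_funI mult_right_mono ennreal_leI)
      fix n \<omega>
      have "\<bar>\<omega> / p (Suc n)\<bar> \<le> \<bar>\<omega> / p n\<bar>"
        unfolding abs_divide by (intro divide_left_mono) (auto simp: p_def)
      then have "(\<omega> / p (Suc n))\<^sup>2 \<le> (\<omega> / p n)\<^sup>2" by (simp only: abs_le_square_iff)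
      then show "exp (- (\<omega> / p n)\<^sup>2 / 2) \<le> exp (- (\<omega> / p (Suc n))\<^sup>2 / 2)" by simp
    qed simp
    fix \<omega>
    have "(\<lambda>n. exp (- (\<omega> / p n)\<^sup>2 / 2)) \<longlonglongrightarrow> exp (- 0\<^sup>2 / 2)"
      by (intro tendsto_intros pinf) simp
    then have "(\<lambda>n. ennreal (exp (- (\<omega> / p n)\<^sup>2 / 2) * ?F \<omega>)) \<longlonglongrightarrow> ennreal (1 * ?F \<omega>)"
      by (intro tendsto_intros) simp
    then show "(\<lambda>n. ennreal (exp (- (\<omega> / p n)\<^sup>2 / 2)) * ennreal (?F \<omega>)) \<longlonglongrightarrow> ennreal (?F \<omega>)"
      by (simp add: ennreal_mult)
  qed measurable
  then show ?thesis
    using L1 unfolding J by (rule LIMSEQ_unique)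
qed

definition fourier_seminorm_sq :: "real \<Rightarrow> (real \<Rightarrow> real) \<Rightarrow> ennreal" where
  "fourier_seminorm_sq \<mu> w =
    (\<integral>\<^sup>+ \<omega>. ennreal ((\<bar>\<omega>\<bar> powr \<mu> * cmod (fourier w \<omega>))\<^sup>2) \<partial>lborel)"

lemma Hnorm_sq_alt:
  "Hnorm_sq \<mu> w = (\<integral>\<^sup>+ x. ennreal ((w x)\<^sup>2) \<partial>lborel) + fourier_seminorm_sq \<mu> w"
  by (simp add: Hnorm_sq_def fourier_seminorm_sq_def)

lemma test_function_normsq: "test_function \<phi> \<Longrightarrow> normsq unit_meas \<phi> = (LINT x|lborel. (\<phi> x)\<^sup>2)"
  unfolding normsq_def by (rule integral_unit_meas) (simp add: test_function_eq_0)


lemma abs_powr_square: "(\<bar>\<omega>\<bar> powr \<mu>)\<^sup>2 = \<bar>\<omega>::real\<bar> powr (2 * \<mu>)"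
  by (simp add: power2_eq_square powr_add[symmetric])

lemma fourier_seminorm_deriv:
  assumes \<phi>: "test_function \<phi>"
  shows "fourier_seminorm_sq 1 \<phi> = ennreal (normsq unit_meas (deriv \<phi>))"
proof -
  have "fourier_seminorm_sq 1 \<phi> = (\<integral>\<^sup>+\<omega>. ennreal ((cmod (fourier (deriv \<phi>) \<omega>))\<^sup>2) \<partial>lborel)"
    unfolding fourier_seminorm_sq_def fourier_deriv[OF \<phi>]
    by (intro nn_integral_cong) (simp add: norm_mult)
  then show ?thesis
    using Plancherel_test_function[OF test_function_deriv[OF \<phi>]]
      test_function_normsq[OF test_function_deriv[OF \<phi>]] by simp
qed

text \<open>
  A derivative contributes \<open>\<omega>\<^sup>2\<close> on the Fourier side, so the energy of order \<open>\<alpha>\<close> of \<open>deriv \<phi>\<close> has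
  the weight \<open>\<bar>\<omega>\<bar> powr (2 - \<alpha>)\<close>, which is that of the Sobolev exponent \<open>1 - \<alpha> / 2\<close>.
\<close>

lemma riesz_energy_deriv:
  assumes \<alpha>: "0 < \<alpha>" "\<alpha> < 1"
  obtains c where "0 < c" "\<And>\<phi>. test_function \<phi> \<Longrightarrow> 0 \<le> riesz_energy \<alpha> (deriv \<phi>) \<and>
      ennreal (riesz_energy \<alpha> (deriv \<phi>)) = ennreal c * fourier_seminorm_sq (1 - \<alpha> / 2) \<phi>"
proof (rule riesz_energy_Fourier[OF \<alpha>])
  fix c assume c: "0 < c"
    "\<And>g C. g \<in> borel_measurable borel \<Longrightarrow> (\<And>x. \<bar>g x\<bar> \<le> C) \<Longrightarrow> (\<And>x. x \<notin> {0<..<1} \<Longrightarrow> g x = 0) \<Longrightarrow>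
      0 \<le> riesz_energy \<alpha> g \<and>
      ennreal (riesz_energy \<alpha> g)
        = ennreal c * (\<integral>\<^sup>+\<omega>. ennreal (\<bar>\<omega>\<bar> powr (- \<alpha>)) * ennreal ((cmod (fourier g \<omega>))\<^sup>2) \<partial>lborel)"
  show ?thesis
  proof (rule that[OF c(1)])
    fix \<phi> assume \<phi>: "test_function \<phi>"
    note d = test_function_deriv[OF \<phi>]
    obtain C where C: "\<And>x. \<bar>deriv \<phi> x\<bar> \<le> C" using test_function_bounded[OF d] by metis
    have "(\<integral>\<^sup>+\<omega>. ennreal (\<bar>\<omega>\<bar> powr (- \<alpha>)) * ennreal ((cmod (fourier (deriv \<phi>) \<omega>))\<^sup>2) \<partial>lborel)
        = fourier_seminorm_sq (1 - \<alpha> / 2) \<phi>"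
      unfolding fourier_seminorm_sq_def
    proof (intro nn_integral_cong)
      fix \<omega> :: real
      have "\<bar>\<omega>\<bar> powr (- \<alpha>) * \<omega>\<^sup>2 = (\<bar>\<omega>\<bar> powr (1 - \<alpha> / 2))\<^sup>2"
      proof (cases "\<omega> = 0")
        case False
        have "\<bar>\<omega>\<bar> powr (- \<alpha>) * \<omega>\<^sup>2 = \<bar>\<omega>\<bar> powr (- \<alpha>) * \<bar>\<omega>\<bar> powr 2"
          using False by (simp add: powr_numeral)
        also have "\<dots> = (\<bar>\<omega>\<bar> powr (1 - \<alpha> / 2))\<^sup>2"
          unfolding abs_powr_square powr_add[symmetric] by (simp add: algebra_simps)
        finally show ?thesis .
      qed simp
      then show "ennreal (\<bar>\<omega>\<bar> powr (- \<alpha>)) * ennreal ((cmod (fourier (deriv \<phi>) \<omega>))\<^sup>2)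
          = ennreal ((\<bar>\<omega>\<bar> powr (1 - \<alpha> / 2) * cmod (fourier \<phi> \<omega>))\<^sup>2)"
        unfolding fourier_deriv[OF \<phi>] power_mult_distrib
        by (simp add: norm_mult power_mult_distrib ennreal_mult[symmetric] mult.assoc[symmetric])
    qed
    then show "0 \<le> riesz_energy \<alpha> (deriv \<phi>) \<and>
      ennreal (riesz_energy \<alpha> (deriv \<phi>)) = ennreal c * fourier_seminorm_sq (1 - \<alpha> / 2) \<phi>"
      using c(2)[OF test_function_borel[OF d] C test_function_eq_0[OF d]] by simp
  qed
qed

text \<open>
  Poincare's inequality. The Fourier transform of a function that is supported in the unit interval
  is bounded by the \<open>L\<^sup>2\<close> norm, so frequencies below \<open>1/4\<close> carry at most half of this norm.
\<close>

lemma Poincare: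
  assumes \<mu>: "0 < \<mu>"
  obtains C where "0 < C"
    "\<And>\<phi>. test_function \<phi> \<Longrightarrow> ennreal (normsq unit_meas \<phi>) \<le> ennreal C * fourier_seminorm_sq \<mu> \<phi>"
proof -
  define K where "K = (1 / 4) powr (- 2 * \<mu>)"
  have K: "0 < K" by (simp add: K_def)
  show ?thesis
  proof (rule that[of "2 * K"])
    fix \<phi> assume \<phi>: "test_function \<phi>"
    let ?n = "normsq unit_meas \<phi>" and ?F = "\<lambda>\<omega>. (cmod (fourier \<phi> \<omega>))\<^sup>2"
    have [measurable]: "\<phi> \<in> borel_measurable borel" by (rule test_function_borel[OF \<phi>])
    have F_le: "?F \<omega> \<le> ?n" for \<omega>
    proof -
      have "cmod (fourier \<phi> \<omega>) \<le> (LINT x|lborel. \<bar>\<phi> x\<bar>)"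
        by (rule norm_fourier_le[OF test_function_integrable[OF \<phi>]])
      also have "\<dots> = (LINT x|unit_meas. \<bar>\<phi> x\<bar>)"
        by (rule integral_unit_meas[symmetric]) (simp add: test_function_eq_0[OF \<phi>])
      also have "\<dots> \<le> sqrt ?n"
        using unit_meas.L1_le_L2[OF test_function_L2[OF \<phi>]] unfolding measure_unit_meas by simp
      finally have "(cmod (fourier \<phi> \<omega>))\<^sup>2 \<le> (sqrt ?n)\<^sup>2" by (intro power_mono) auto
      then show ?thesis by (simp add: normsq_nonneg)
    qed
    have "ennreal ?n = (\<integral>\<^sup>+\<omega>. ennreal (?F \<omega>) \<partial>lborel)"
      unfolding Plancherel_test_function[OF \<phi>] test_function_normsq[OF \<phi>] ..
    also have "\<dots> \<le> (\<integral>\<^sup>+\<omega>. ennreal ?n * indicator {-1/4..1/4::real} \<omega>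
        + ennreal K * ennreal ((\<bar>\<omega>\<bar> powr \<mu> * cmod (fourier \<phi> \<omega>))\<^sup>2) \<partial>lborel)"
    proof (intro nn_integral_mono)
      fix \<omega> :: real
      show "ennreal (?F \<omega>) \<le> ennreal ?n * indicator {-1/4..1/4} \<omega>
        + ennreal K * ennreal ((\<bar>\<omega>\<bar> powr \<mu> * cmod (fourier \<phi> \<omega>))\<^sup>2)"
      proof (cases "\<omega> \<in> {-1/4..1/4}")
        case True
        then show ?thesis using ennreal_leI[OF F_le[of \<omega>]] by (simp add: add_increasing2)
      next
        case False
        then have "(1 / 4) powr (2 * \<mu>) \<le> \<bar>\<omega>\<bar> powr (2 * \<mu>)"
          using \<mu> by (intro powr_mono2) auto
        then have "1 \<le> K * \<bar>\<omega>\<bar> powr (2 * \<mu>)"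
          by (simp add: K_def powr_minus field_simps)
        then have "1 * ?F \<omega> \<le> (K * \<bar>\<omega>\<bar> powr (2 * \<mu>)) * ?F \<omega>"
          by (rule mult_right_mono) simp
        also have "\<dots> = K * (\<bar>\<omega>\<bar> powr \<mu> * cmod (fourier \<phi> \<omega>))\<^sup>2"
          by (simp add: power_mult_distrib abs_powr_square)
        finally have "ennreal (?F \<omega>) \<le> ennreal (K * (\<bar>\<omega>\<bar> powr \<mu> * cmod (fourier \<phi> \<omega>))\<^sup>2)"
          by (intro ennreal_leI) simp
        also have "\<dots> = ennreal K * ennreal ((\<bar>\<omega>\<bar> powr \<mu> * cmod (fourier \<phi> \<omega>))\<^sup>2)"
          using K by (intro ennreal_mult) auto
        finally show ?thesis by (simp add: add_increasing)
      qed
    qed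
    also have "\<dots> = ennreal ?n * emeasure lborel {-1/4..1/4::real} + ennreal K * fourier_seminorm_sq \<mu> \<phi>"
      unfolding fourier_seminorm_sq_def
      by (subst nn_integral_add, simp, simp, subst nn_integral_cmult_indicator, simp, subst nn_integral_cmult) auto
    also have "ennreal ?n * emeasure lborel {-1/4..1/4::real} = ennreal (?n / 2)"
      by (simp add: ennreal_mult[symmetric] normsq_nonneg del: ennreal_half)
    finally have *: "ennreal ?n \<le> ennreal (?n / 2) + ennreal K * fourier_seminorm_sq \<mu> \<phi>" .
    show "ennreal ?n \<le> ennreal (2 * K) * fourier_seminorm_sq \<mu> \<phi>"
    proof (cases "fourier_seminorm_sq \<mu> \<phi>")
      case (real s)
      have "ennreal ?n \<le> ennreal (?n / 2 + K * s)"
        using * K real normsq_nonneg[of unit_meas \<phi>] by (simp add: ennreal_mult[symmetric] ennreal_plus[symmetric] del: ennreal_plus)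
      then have "?n \<le> ?n / 2 + K * s"
        using K real normsq_nonneg[of unit_meas \<phi>] by (subst (asm) ennreal_le_iff) auto
      then show ?thesis using K real by (simp add: ennreal_mult[symmetric] ennreal_leI)
    next
      case top
      then show ?thesis using K by (simp add: ennreal_mult_top)
    qed
  qed (use K in simp)
qed


section \<open>Fractional integrals\<close>

definition frac_kernel :: "real \<Rightarrow> real \<Rightarrow> real" where
  "frac_kernel \<beta> t = (if 0 < t then t powr (\<beta> - 1) else 0)"

definition left_conv :: "real \<Rightarrow> (real \<Rightarrow> real) \<Rightarrow> real \<Rightarrow> real" where
  "left_conv \<beta> w x = (LINT s|lborel. w s * frac_kernel \<beta> (x - s))"

definition right_conv :: "real \<Rightarrow> (real \<Rightarrow> real) \<Rightarrow> real \<Rightarrow> real" where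
  "right_conv \<beta> w x = (LINT s|lborel. w s * frac_kernel \<beta> (s - x))"

lemma frac_kernel_nonneg [simp]: "0 \<le> frac_kernel \<beta> t"
  by (simp add: frac_kernel_def)

lemma frac_kernel_le: "frac_kernel \<beta> t \<le> \<bar>t\<bar> powr (\<beta> - 1)"
  by (simp add: frac_kernel_def)

lemma frac_kernel_measurable [measurable]: "frac_kernel \<beta> \<in> borel_measurable borel"
  unfolding frac_kernel_def by measurable

lemma frac_kernel_scale: "0 < d \<Longrightarrow> frac_kernel \<beta> (d * t) = d powr (\<beta> - 1) * frac_kernel \<beta> t"
  by (simp add: frac_kernel_def powr_mult zero_less_mult_iff)

lemma frac_kernel_symmetric_sum:
  "t \<noteq> 0 \<Longrightarrow> frac_kernel \<beta> t + frac_kernel \<beta> (- t) = \<bar>t\<bar> powr (\<beta> - 1)"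
  by (auto simp: frac_kernel_def)

lemma left_conv_measurable [measurable]:
  assumes [measurable]: "w \<in> borel_measurable borel"
  shows "left_conv \<beta> w \<in> borel_measurable borel"
  unfolding left_conv_def by measurable

lemma right_conv_measurable [measurable]:
  assumes [measurable]: "w \<in> borel_measurable borel"
  shows "right_conv \<beta> w \<in> borel_measurable borel"
  unfolding right_conv_def by measurable

lemma frac_int_eq_conv:
  assumes w: "\<And>x. x \<notin> {0<..<1} \<Longrightarrow> w x = 0"
  shows "frac_int \<beta> \<theta> w x = 1 / Gamma \<beta> * (\<theta> * left_conv \<beta> w x + (1 - \<theta>) * right_conv \<beta> w x)"
proof -
  have "left_frac_int \<beta> w x = 1 / Gamma \<beta> * left_conv \<beta> w x"
    unfolding left_frac_int_def left_conv_def set_lebesgue_integral_def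
  proof (intro arg_cong[where f="\<lambda>y. _ * y"] Bochner_Integration.integral_cong refl)
    fix s
    show "indicator {0<..<x} s *\<^sub>R (w s / (x - s) powr (1 - \<beta>)) = w s * frac_kernel \<beta> (x - s)"
    proof (cases "0 < s")
      case True
      then show ?thesis
        by (auto simp: frac_kernel_def indicator_def powr_minus_divide[of _ "1 - \<beta>", simplified])
    next
      case False
      then have "w s = 0" by (intro w) simp
      then show ?thesis by simp
    qed
  qed
  moreover have "right_frac_int \<beta> w x = 1 / Gamma \<beta> * right_conv \<beta> w x"
    unfolding right_frac_int_def right_conv_def set_lebesgue_integral_def
  proof (intro arg_cong[where f="\<lambda>y. _ * y"] Bochner_Integration.integral_cong refl)
    fix s
    show "indicator {x<..<1} s *\<^sub>R (w s / (s - x) powr (1 - \<beta>)) = w s * frac_kernel \<beta> (s - x)"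
    proof (cases "s < 1")
      case True
      then show ?thesis
        by (auto simp: frac_kernel_def indicator_def powr_minus_divide[of _ "1 - \<beta>", simplified])
    next
      case False
      then have "w s = 0" by (intro w) simp
      then show ?thesis by simp
    qed
  qed
  ultimately show ?thesis
    unfolding frac_int_def by (simp only: distrib_left mult.left_commute)
qed

lemma left_conv_eq_0:
  assumes "\<And>x. x \<notin> {0<..<1} \<Longrightarrow> w x = 0" "x \<le> 0"
  shows "left_conv \<beta> w x = 0"
proof -
  have "w s * frac_kernel \<beta> (x - s) = 0" for s
    using assms(1)[of s] assms(2) by (cases "0 < s") (auto simp: frac_kernel_def)
  then show ?thesis by (simp only: left_conv_def Bochner_Integration.integral_zero)
qed

lemma right_conv_eq_0:
  assumes "\<And>x. x \<notin> {0<..<1} \<Longrightarrow> w x = 0" "1 \<le> x"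
  shows "right_conv \<beta> w x = 0"
proof -
  have "w s * frac_kernel \<beta> (s - x) = 0" for s
    using assms(1)[of s] assms(2) by (cases "s < 1") (auto simp: frac_kernel_def)
  then show ?thesis by (simp only: right_conv_def Bochner_Integration.integral_zero)
qed

text \<open>
  Two fractional kernels with singularities at \<open>y\<close> and \<open>z\<close> are integrated against each other by
  mapping the singularities to \<open>0\<close> and \<open>\<plusminus>1\<close>. The resulting constants are Beta integrals.
\<close>

definition kernel_const_same :: "real \<Rightarrow> ennreal" where
  "kernel_const_same \<beta> = (\<integral>\<^sup>+s. ennreal (frac_kernel \<beta> s * frac_kernel \<beta> (s + 1)) \<partial>lborel)"

definition kernel_const_opposite :: "real \<Rightarrow> real \<Rightarrow> ennreal" where
  "kernel_const_opposite a b = (\<integral>\<^sup>+s. ennreal (frac_kernel a s * frac_kernel b (1 - s)) \<partial>lborel)"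

text \<open>
  At infinity the integrand decays like \<open>s powr (2 * \<beta> - 2)\<close>: this is where \<open>\<beta> < 1/2\<close> enters.
\<close>

lemma kernel_const_same_finite:
  assumes "0 < \<beta>" "\<beta> < 1/2"
  shows "kernel_const_same \<beta> < \<infinity>"
proof -
  have inf: "(\<integral>\<^sup>+s. ennreal (indicator {1..} s * s powr (2 * \<beta> - 2)) \<partial>lborel)
      = ennreal (- (1 powr (2 * \<beta> - 2 + 1)) / (2 * \<beta> - 2 + 1))"
  proof (rule nn_integral_has_integral_lborel)
    have "((\<lambda>s. s powr (2 * \<beta> - 2)) has_integral - (1 powr (2 * \<beta> - 2 + 1)) / (2 * \<beta> - 2 + 1)) {1..}"
      by (rule has_integral_powr_to_inf) (use assms in auto)
    then have "((\<lambda>s. if s \<in> {1..} then s powr (2 * \<beta> - 2) else 0)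
        has_integral - (1 powr (2 * \<beta> - 2 + 1)) / (2 * \<beta> - 2 + 1)) UNIV"
      by (simp only: has_integral_restrict_UNIV)
    moreover have "(\<lambda>s. if s \<in> {1..} then s powr (2 * \<beta> - 2) else 0) = (\<lambda>s. indicator {1..} s * s powr (2 * \<beta> - 2))"
      by (auto simp: indicator_def)
    ultimately show "((\<lambda>s. indicator {1..} s * s powr (2 * \<beta> - 2))
        has_integral - (1 powr (2 * \<beta> - 2 + 1)) / (2 * \<beta> - 2 + 1)) UNIV" by simp
  qed auto
  have "kernel_const_same \<beta> \<le> (\<integral>\<^sup>+s. ennreal (indicator {0..1} s * s powr (\<beta> - 1))
      + ennreal (indicator {1..} s * s powr (2 * \<beta> - 2)) \<partial>lborel)"
    unfolding kernel_const_same_def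
  proof (intro nn_integral_mono)
    fix s :: real
    have "frac_kernel \<beta> s * frac_kernel \<beta> (s + 1) \<le> indicator {0..1} s * s powr (\<beta> - 1)
        + indicator {1..} s * s powr (2 * \<beta> - 2)"
    proof (cases "0 < s")
      case True
      show ?thesis
      proof (cases "s \<le> 1")
        case s: True
        have "(s + 1) powr (\<beta> - 1) \<le> 1 powr (\<beta> - 1)"
          using True assms by (intro powr_mono2') auto
        then have "s powr (\<beta> - 1) * (s + 1) powr (\<beta> - 1) \<le> s powr (\<beta> - 1) * 1"
          by (intro mult_left_mono) auto
        then show ?thesis using True s by (simp add: frac_kernel_def add_increasing2)
      next
        case False
        have "(s + 1) powr (\<beta> - 1) \<le> s powr (\<beta> - 1)"
          using True assms by (intro powr_mono2') auto
        then have "s powr (\<beta> - 1) * (s + 1) powr (\<beta> - 1) \<le> s powr (\<beta> - 1) * s powr (\<beta> - 1)"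
          by (intro mult_left_mono) auto
        also have "\<dots> = s powr (2 * \<beta> - 2)" by (simp add: powr_add[symmetric])
        finally show ?thesis using True False by (simp add: frac_kernel_def)
      qed
    qed (simp add: frac_kernel_def)
    then have "ennreal (frac_kernel \<beta> s * frac_kernel \<beta> (s + 1)) \<le> ennreal (indicator {0..1} s * s powr (\<beta> - 1)
        + indicator {1..} s * s powr (2 * \<beta> - 2))" by (rule ennreal_leI)
    also have "\<dots> = ennreal (indicator {0..1} s * s powr (\<beta> - 1))
      + ennreal (indicator {1..} s * s powr (2 * \<beta> - 2))" by (rule ennreal_plus) auto
    finally show "ennreal (frac_kernel \<beta> s * frac_kernel \<beta> (s + 1))
      \<le> ennreal (indicator {0..1} s * s powr (\<beta> - 1)) + ennreal (indicator {1..} s * s powr (2 * \<beta> - 2))" .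
  qed
  also have "\<dots> = (\<integral>\<^sup>+s. ennreal (indicator {0..1} s * s powr (\<beta> - 1)) \<partial>lborel)
      + (\<integral>\<^sup>+s. ennreal (indicator {1..} s * s powr (2 * \<beta> - 2)) \<partial>lborel)"
    by (rule nn_integral_add) auto
  also have "\<dots> < \<infinity>"
    using nn_integral_powr_unit_interval[of "\<beta> - 1"] assms unfolding inf by simp
  finally show ?thesis .
qed

lemma kernel_const_opposite_bounds:
  assumes "0 < a" "a < 1" "0 < b" "b < 1"
  shows "0 < kernel_const_opposite a b" "kernel_const_opposite a b < \<infinity>"
proof -
  have half: "(1/2::real) powr (c - 1) \<le> 2" if "0 < c" "c < 1" for c
  proof -
    have "(1/2::real) powr (c - 1) = 2 powr (1 - c)" by (simp add: powr_divide powr_minus_divide[symmetric])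
    also have "\<dots> \<le> 2 powr 1" using that by (intro powr_mono) auto
    finally show ?thesis by simp
  qed
  let ?f = "\<lambda>c s. ennreal (indicator {0..1} s * s powr (c - 1))"
  have "kernel_const_opposite a b \<le> (\<integral>\<^sup>+s. 2 * ?f a s + 2 * ?f b (1 + (-1) * s) \<partial>lborel)"
    unfolding kernel_const_opposite_def
  proof (intro nn_integral_mono)
    fix s :: real
    have "frac_kernel a s * frac_kernel b (1 - s) \<le> 2 * (indicator {0..1} s * s powr (a - 1))
        + 2 * (indicator {0..1} (1 + (-1) * s) * (1 + (-1) * s) powr (b - 1))"
    proof (cases "0 < s \<and> s < 1")
      case True
      show ?thesis
      proof (cases "s \<le> 1/2")
        case s: True
        have "(1 - s) powr (b - 1) \<le> (1/2) powr (b - 1)"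
          using True s assms by (intro powr_mono2') auto
        then have "s powr (a - 1) * (1 - s) powr (b - 1) \<le> s powr (a - 1) * 2"
          using half[of b] assms by (intro mult_left_mono) auto
        then show ?thesis using True s by (simp add: frac_kernel_def add_increasing2)
      next
        case False
        have "s powr (a - 1) \<le> (1/2) powr (a - 1)"
          using True False assms by (intro powr_mono2') auto
        then have "s powr (a - 1) * (1 - s) powr (b - 1) \<le> 2 * (1 - s) powr (b - 1)"
          using half[of a] assms by (intro mult_right_mono) auto
        then show ?thesis using True False by (simp add: frac_kernel_def add_increasing)
      qed
    qed (auto simp: frac_kernel_def)
    then have "ennreal (frac_kernel a s * frac_kernel b (1 - s))
        \<le> ennreal (2 * (indicator {0..1} s * s powr (a - 1))
        + 2 * (indicator {0..1} (1 + (-1) * s) * (1 + (-1) * s) powr (b - 1)))" by (rule ennreal_leI)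
    also have "\<dots> = ennreal (2 * (indicator {0..1} s * s powr (a - 1)))
        + ennreal (2 * (indicator {0..1} (1 + (-1) * s) * (1 + (-1) * s) powr (b - 1)))"
      by (rule ennreal_plus) auto
    finally show "ennreal (frac_kernel a s * frac_kernel b (1 - s)) \<le> 2 * ?f a s + 2 * ?f b (1 + (-1) * s)"
      by (simp add: ennreal_mult)
  qed
  also have "\<dots> = 2 * (\<integral>\<^sup>+s. ?f a s \<partial>lborel) + 2 * (\<integral>\<^sup>+s. ?f b (1 + (-1) * s) \<partial>lborel)"
    by (subst nn_integral_add, simp, simp, subst nn_integral_cmult, simp, subst nn_integral_cmult) auto
  also have "(\<integral>\<^sup>+s. ?f b (1 + (-1) * s) \<partial>lborel) = (\<integral>\<^sup>+s. ?f b s \<partial>lborel)"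
    using nn_integral_real_affine[of "?f b" "-1" 1] by simp
  also have "2 * (\<integral>\<^sup>+s. ?f a s \<partial>lborel) + 2 * (\<integral>\<^sup>+s. ?f b s \<partial>lborel) < \<infinity>"
    using nn_integral_powr_unit_interval[of "a - 1"] nn_integral_powr_unit_interval[of "b - 1"] assms
    by (simp add: ennreal_mult_less_top)
  finally show "kernel_const_opposite a b < \<infinity>" .
  have "1 = (\<integral>\<^sup>+s. indicator {0<..<1::real} s \<partial>lborel)" by simp
  also have "\<dots> \<le> kernel_const_opposite a b"
    unfolding kernel_const_opposite_def
  proof (intro nn_integral_mono)
    fix s :: real
    show "indicator {0<..<1} s \<le> ennreal (frac_kernel a s * frac_kernel b (1 - s))"
    proof (cases "0 < s \<and> s < 1")
      case True
      have "1 powr (a - 1) \<le> s powr (a - 1)" "1 powr (b - 1) \<le> (1 - s) powr (b - 1)"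
        using True assms by (intro powr_mono2'; simp)+
      then have "1 * 1 \<le> s powr (a - 1) * (1 - s) powr (b - 1)"
        by (intro mult_mono) auto
      then show ?thesis using True by (simp add: frac_kernel_def)
    qed auto
  qed
  finally show "0 < kernel_const_opposite a b" by (rule less_le_trans[OF zero_less_one])
qed

lemma nn_integral_kernels_same:
  assumes "y \<noteq> z"
  shows "(\<integral>\<^sup>+x. ennreal (frac_kernel \<beta> (x - y) * frac_kernel \<beta> (x - z)) \<partial>lborel)
    = ennreal (\<bar>y - z\<bar> powr (2 * \<beta> - 1)) * kernel_const_same \<beta>"
proof -
  have *: "(\<integral>\<^sup>+x. ennreal (frac_kernel \<beta> (x - y) * frac_kernel \<beta> (x - z)) \<partial>lborel)
      = ennreal ((z - y) powr (2 * \<beta> - 1)) * kernel_const_same \<beta>" if "y < z" for y z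
  proof -
    define d where "d = z - y"
    have d: "0 < d" using that by (simp add: d_def)
    have "(\<integral>\<^sup>+x. ennreal (frac_kernel \<beta> (x - y) * frac_kernel \<beta> (x - z)) \<partial>lborel)
        = ennreal \<bar>d\<bar> * (\<integral>\<^sup>+s. ennreal (frac_kernel \<beta> (z + d * s - y) * frac_kernel \<beta> (z + d * s - z)) \<partial>lborel)"
      by (rule nn_integral_real_affine) (use d in auto)
    also have "(\<integral>\<^sup>+s. ennreal (frac_kernel \<beta> (z + d * s - y) * frac_kernel \<beta> (z + d * s - z)) \<partial>lborel)
        = (\<integral>\<^sup>+s. ennreal (d powr (2 * \<beta> - 2)) * ennreal (frac_kernel \<beta> s * frac_kernel \<beta> (s + 1)) \<partial>lborel)"
    proof (intro nn_integral_cong)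
      fix s
      have e: "z + d * s - y = d * (s + 1)" "z + d * s - z = d * s" by (simp_all add: d_def algebra_simps)
      have p: "d powr (\<beta> - 1) * d powr (\<beta> - 1) = d powr (2 * \<beta> - 2)" by (simp add: powr_add[symmetric])
      have "frac_kernel \<beta> (z + d * s - y) * frac_kernel \<beta> (z + d * s - z)
          = (d powr (\<beta> - 1) * d powr (\<beta> - 1)) * (frac_kernel \<beta> s * frac_kernel \<beta> (s + 1))"
        unfolding e frac_kernel_scale[OF d] by (simp only: ac_simps)
      then show "ennreal (frac_kernel \<beta> (z + d * s - y) * frac_kernel \<beta> (z + d * s - z))
          = ennreal (d powr (2 * \<beta> - 2)) * ennreal (frac_kernel \<beta> s * frac_kernel \<beta> (s + 1))"
        unfolding p by (simp add: ennreal_mult)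
    qed
    also have "\<dots> = ennreal (d powr (2 * \<beta> - 2)) * kernel_const_same \<beta>"
      unfolding kernel_const_same_def by (rule nn_integral_cmult) measurable
    also have "ennreal \<bar>d\<bar> * (ennreal (d powr (2 * \<beta> - 2)) * kernel_const_same \<beta>)
        = ennreal (d powr 1 * d powr (2 * \<beta> - 2)) * kernel_const_same \<beta>"
      using d by (simp add: ennreal_mult mult.assoc)
    also have "d powr 1 * d powr (2 * \<beta> - 2) = d powr (2 * \<beta> - 1)"
      by (simp only: powr_add[symmetric]) (simp add: algebra_simps)
    finally show ?thesis by (simp add: d_def)
  qed
  show ?thesis
  proof (cases "y < z")
    case True then show ?thesis using *[OF True] by simp
  next
    case False
    then have "z < y" using assms by simp
    from *[OF this] show ?thesis using \<open>z < y\<close> by (simp add: mult.commute)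
  qed
qed

lemma nn_integral_kernels_same':
  assumes "y \<noteq> z"
  shows "(\<integral>\<^sup>+x. ennreal (frac_kernel \<beta> (y - x) * frac_kernel \<beta> (z - x)) \<partial>lborel)
    = ennreal (\<bar>y - z\<bar> powr (2 * \<beta> - 1)) * kernel_const_same \<beta>"
proof -
  have "(\<integral>\<^sup>+x. ennreal (frac_kernel \<beta> (y - x) * frac_kernel \<beta> (z - x)) \<partial>lborel)
      = ennreal \<bar>-1\<bar> * (\<integral>\<^sup>+x. ennreal (frac_kernel \<beta> (y - (0 + (-1) * x)) * frac_kernel \<beta> (z - (0 + (-1) * x))) \<partial>lborel)"
    by (rule nn_integral_real_affine) auto
  also have "\<dots> = (\<integral>\<^sup>+x. ennreal (frac_kernel \<beta> (x - (- y)) * frac_kernel \<beta> (x - (- z))) \<partial>lborel)"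
    by (simp add: add.commute)
  also have "\<dots> = ennreal (\<bar>- y - - z\<bar> powr (2 * \<beta> - 1)) * kernel_const_same \<beta>"
    by (rule nn_integral_kernels_same) (use assms in simp)
  finally show ?thesis by (simp add: abs_minus_commute)
qed

lemma nn_integral_kernels_opposite:
  "(\<integral>\<^sup>+x. ennreal (frac_kernel a (x - y) * frac_kernel b (z - x)) \<partial>lborel)
    = ennreal (frac_kernel (a + b) (z - y)) * kernel_const_opposite a b"
proof (cases "y < z")
  case True
  define d where "d = z - y"
  have d: "0 < d" using True by (simp add: d_def)
  have "(\<integral>\<^sup>+x. ennreal (frac_kernel a (x - y) * frac_kernel b (z - x)) \<partial>lborel)
      = ennreal \<bar>d\<bar> * (\<integral>\<^sup>+s. ennreal (frac_kernel a (y + d * s - y) * frac_kernel b (z - (y + d * s))) \<partial>lborel)"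
    by (rule nn_integral_real_affine) (use d in auto)
  also have "(\<integral>\<^sup>+s. ennreal (frac_kernel a (y + d * s - y) * frac_kernel b (z - (y + d * s))) \<partial>lborel)
      = (\<integral>\<^sup>+s. ennreal (d powr (a + b - 2)) * ennreal (frac_kernel a s * frac_kernel b (1 - s)) \<partial>lborel)"
  proof (intro nn_integral_cong)
    fix s
    have e: "y + d * s - y = d * s" "z - (y + d * s) = d * (1 - s)" by (simp_all add: d_def algebra_simps)
    have p: "d powr (a - 1) * d powr (b - 1) = d powr (a + b - 2)"
      by (simp only: powr_add[symmetric]) (simp add: algebra_simps)
    have "frac_kernel a (y + d * s - y) * frac_kernel b (z - (y + d * s))
        = (d powr (a - 1) * d powr (b - 1)) * (frac_kernel a s * frac_kernel b (1 - s))"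
      unfolding e frac_kernel_scale[OF d] by (simp only: ac_simps)
    then show "ennreal (frac_kernel a (y + d * s - y) * frac_kernel b (z - (y + d * s)))
        = ennreal (d powr (a + b - 2)) * ennreal (frac_kernel a s * frac_kernel b (1 - s))"
      unfolding p by (simp add: ennreal_mult)
  qed
  also have "\<dots> = ennreal (d powr (a + b - 2)) * kernel_const_opposite a b"
    unfolding kernel_const_opposite_def by (rule nn_integral_cmult) measurable
  also have "ennreal \<bar>d\<bar> * (ennreal (d powr (a + b - 2)) * kernel_const_opposite a b)
      = ennreal (d powr 1 * d powr (a + b - 2)) * kernel_const_opposite a b"
    using d by (simp add: ennreal_mult mult.assoc)
  also have "d powr 1 * d powr (a + b - 2) = d powr (a + b - 1)"
    by (simp only: powr_add[symmetric]) (simp add: algebra_simps)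
  finally show ?thesis using d by (simp add: d_def frac_kernel_def)
next
  case False
  then have "frac_kernel a (x - y) * frac_kernel b (z - x) = 0" for x
    by (simp add: frac_kernel_def)
  then have "(\<integral>\<^sup>+x. ennreal (frac_kernel a (x - y) * frac_kernel b (z - x)) \<partial>lborel) = 0"
    by (simp only: ennreal_0 nn_integral_const mult_zero_left)
  then show ?thesis using False by (simp add: frac_kernel_def)
qed


text \<open>
  Fubini's theorem for the inner product of two integral transforms. The composed kernel \<open>\<kappa>\<close> is
  needed off the diagonal only, a null set of the plane, on which a fractional kernel composed with
  itself is infinite.
\<close>

lemma integral_transform_product:
  fixes a b :: "real \<Rightarrow> real \<Rightarrow> real" and g h :: "real \<Rightarrow> real" and \<kappa> :: "real \<Rightarrow> real \<Rightarrow> real"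
  assumes am: "case_prod a \<in> borel_measurable (borel \<Otimes>\<^sub>M borel)"
    and bm: "case_prod b \<in> borel_measurable (borel \<Otimes>\<^sub>M borel)"
    and gm [measurable]: "g \<in> borel_measurable borel" "h \<in> borel_measurable borel"
    and \<kappa>m: "(\<lambda>z. \<kappa> (fst z) (snd z)) \<in> borel_measurable borel"
    and nonneg: "\<And>x y. 0 \<le> a x y" "\<And>x y. 0 \<le> b x y" "\<And>y z. 0 \<le> \<kappa> y z"
    and prod: "\<And>y z. y \<noteq> z \<Longrightarrow> (\<integral>\<^sup>+x. ennreal (a x y * b x z) \<partial>lborel) = ennreal (\<kappa> y z)"
    and fin: "(\<integral>\<^sup>+y. \<integral>\<^sup>+z. ennreal (\<bar>g y * h z\<bar> * \<kappa> y z) \<partial>lborel \<partial>lborel) < \<infinity>"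
  shows "integrable lborel (\<lambda>x. (LINT y|lborel. g y * a x y) * (LINT z|lborel. h z * b x z))"
    and "(LINT x|lborel. (LINT y|lborel. g y * a x y) * (LINT z|lborel. h z * b x z))
      = (LINT z|lborel. g (fst z) * h (snd z) * \<kappa> (fst z) (snd z))"
proof -
  note [measurable] = \<kappa>m
  have meas: "(\<lambda>z::real\<times>real. ennreal (\<bar>g (fst z) * h (snd z)\<bar> * \<kappa> (fst z) (snd z))) \<in> borel_measurable borel"
    by measurable
  have [measurable]: "(\<lambda>x. a (p x) (q x)) \<in> borel_measurable M"
    if "p \<in> borel_measurable M" "q \<in> borel_measurable M" for p q :: "'z \<Rightarrow> real" and M
    using measurable_compose[OF measurable_Pair[OF that] am] by simp
  have [measurable]: "(\<lambda>x. b (p x) (q x)) \<in> borel_measurable M"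
    if "p \<in> borel_measurable M" "q \<in> borel_measurable M" for p q :: "'z \<Rightarrow> real" and M
    using measurable_compose[OF measurable_Pair[OF that] bm] by simp
  define f where "f z x = g (fst z) * h (snd z) * (a x (fst z) * b x (snd z))" for z :: "real \<times> real" and x
  have fm: "case_prod f \<in> borel_measurable (lborel \<Otimes>\<^sub>M lborel)"
    unfolding f_def by measurable
  have inner: "integrable lborel (\<lambda>x. a x y * b x z)" "(LINT x|lborel. a x y * b x z) = \<kappa> y z"
    if "y \<noteq> z" for y z
  proof -
    show "integrable lborel (\<lambda>x. a x y * b x z)"
      using prod[OF that] nonneg by (intro integrableI_nonneg) auto
    show "(LINT x|lborel. a x y * b x z) = \<kappa> y z"
      using prod[OF that] nonneg by (subst integral_eq_nn_integral) auto
  qed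
  have "(\<integral>\<^sup>+z. \<integral>\<^sup>+x. ennreal (norm (f z x)) \<partial>lborel \<partial>lborel)
      = (\<integral>\<^sup>+z. ennreal (\<bar>g (fst z) * h (snd z)\<bar> * \<kappa> (fst z) (snd z)) \<partial>lborel)"
  proof (rule nn_integral_cong_AE)
    show "AE z in lborel. (\<integral>\<^sup>+x. ennreal (norm (f z x)) \<partial>lborel)
        = ennreal (\<bar>g (fst z) * h (snd z)\<bar> * \<kappa> (fst z) (snd z))"
      using AE_fst_neq_snd
    proof eventually_elim
      case (elim z)
      have "(\<integral>\<^sup>+x. ennreal (norm (f z x)) \<partial>lborel)
          = (\<integral>\<^sup>+x. ennreal \<bar>g (fst z) * h (snd z)\<bar> * ennreal (a x (fst z) * b x (snd z)) \<partial>lborel)"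
        unfolding f_def by (intro nn_integral_cong) (simp add: abs_mult nonneg ennreal_mult[symmetric])
      also have "\<dots> = ennreal \<bar>g (fst z) * h (snd z)\<bar> * ennreal (\<kappa> (fst z) (snd z))"
        unfolding prod[OF elim, symmetric] by (rule nn_integral_cmult) measurable
      finally show ?case by (simp add: ennreal_mult nonneg)
    qed
  qed
  also have "\<dots> = (\<integral>\<^sup>+y. \<integral>\<^sup>+z. ennreal (\<bar>g y * h z\<bar> * \<kappa> y z) \<partial>lborel \<partial>lborel)"
    by (subst nn_integral_lborel_pair[OF meas]) simp
  also note fin
  finally have ffin: "(\<integral>\<^sup>+z. \<integral>\<^sup>+x. ennreal (norm (f z x)) \<partial>lborel \<partial>lborel) < \<infinity>" .
  have "AE x in lborel. (LINT z|lborel. f z x) = (LINT y|lborel. g y * a x y) * (LINT z|lborel. h z * b x z)"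
    using AE_integrable_snd_lborel[OF fm ffin]
  proof eventually_elim
    case (elim x)
    have "(LINT z|lborel. f z x) = (LINT y|lborel. LINT z|lborel. (g y * a x y) * (h z * b x z))"
      unfolding integral_lborel_pair[OF elim] by (simp add: f_def ac_simps)
    then show ?case by simp
  qed
  then have AE: "AE x in lborel. (LINT y|lborel. g y * a x y) * (LINT z|lborel. h z * b x z) = (LINT z|lborel. f z x)"
    by eventually_elim simp
  have pm: "(\<lambda>x. (LINT y|lborel. g y * a x y) * (LINT z|lborel. h z * b x z)) \<in> borel_measurable lborel"
    by measurable
  have fi: "integrable lborel (\<lambda>x. LINT z|lborel. f z x)"
    by (rule integrable_integral_snd_lborel[OF fm ffin])
  show "integrable lborel (\<lambda>x. (LINT y|lborel. g y * a x y) * (LINT z|lborel. h z * b x z))"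
    using fi AE pm by (subst integrable_cong_AE) auto
  have "(LINT x|lborel. (LINT y|lborel. g y * a x y) * (LINT z|lborel. h z * b x z)) = (LINT x|lborel. LINT z|lborel. f z x)"
    using fi AE pm by (intro integral_cong_AE) auto
  also have "\<dots> = (LINT z|lborel. LINT x|lborel. f z x)"
    by (rule Fubini_lborel_swap[OF fm ffin, symmetric])
  also have "\<dots> = (LINT z|lborel. g (fst z) * h (snd z) * \<kappa> (fst z) (snd z))"
  proof (rule integral_cong_AE)
    show "AE z in lborel. (LINT x|lborel. f z x) = g (fst z) * h (snd z) * \<kappa> (fst z) (snd z)"
      using AE_fst_neq_snd
    proof eventually_elim
      case (elim z)
      then show ?case unfolding f_def by (simp add: inner(2))
    qed
    show "(\<lambda>z. LINT x|lborel. f z x) \<in> borel_measurable lborel"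
      using integrable_integral_fst_lborel[OF fm ffin] by auto
  qed measurable
  finally show "(LINT x|lborel. (LINT y|lborel. g y * a x y) * (LINT z|lborel. h z * b x z))
      = (LINT z|lborel. g (fst z) * h (snd z) * \<kappa> (fst z) (snd z))" .
qed


definition bdd_unit :: "(real \<Rightarrow> real) \<Rightarrow> bool" where
  "bdd_unit g \<longleftrightarrow> g \<in> borel_measurable borel \<and> (\<exists>C. \<forall>x. \<bar>g x\<bar> \<le> C) \<and> (\<forall>x. x \<notin> {0<..<1} \<longrightarrow> g x = 0)"

lemma bdd_unit_measurable: "bdd_unit g \<Longrightarrow> g \<in> borel_measurable borel"
  by (simp add: bdd_unit_def)

lemma bdd_unit_eq_0: "bdd_unit g \<Longrightarrow> x \<notin> {0<..<1} \<Longrightarrow> g x = 0"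
  unfolding bdd_unit_def by blast

lemma bdd_unit_integrable: "bdd_unit g \<Longrightarrow> integrable lborel g"
  unfolding bdd_unit_def by (metis integrable_bounded_support)

lemma bdd_unit_test_function: "test_function \<phi> \<Longrightarrow> bdd_unit \<phi>"
  unfolding bdd_unit_def
  by (meson test_function_borel test_function_bounded test_function_eq_0)

lemma kernel_integrand_finite:
  assumes g: "integrable lborel g" "\<And>x. x \<notin> {0<..<1} \<Longrightarrow> g x = 0" and h: "bdd_unit h" and \<alpha>: "0 < \<alpha>"
    and k: "\<And>x y. 0 \<le> k x y" "\<And>x y. k x y \<le> \<bar>x - y\<bar> powr (\<alpha> - 1)"
  shows "(\<integral>\<^sup>+x. \<integral>\<^sup>+y. ennreal (\<bar>g x * h y\<bar> * k x y) \<partial>lborel \<partial>lborel) < \<infinity>"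
proof -
  have gm: "g \<in> borel_measurable borel" using g(1) by auto
  obtain C where C: "\<And>x. \<bar>h x\<bar> \<le> C" using h unfolding bdd_unit_def by blast
  have "(\<integral>\<^sup>+x. \<integral>\<^sup>+y. ennreal (\<bar>g x * h y\<bar> * k x y) \<partial>lborel \<partial>lborel)
      \<le> (\<integral>\<^sup>+x. \<integral>\<^sup>+y. ennreal (\<bar>g x * h y\<bar> * \<bar>x - y\<bar> powr (\<alpha> - 1)) \<partial>lborel \<partial>lborel)"
    by (intro nn_integral_mono ennreal_leI mult_left_mono k) simp
  also have "\<dots> < \<infinity>"
    by (rule bounded_support_nn_integral_abs_powr[OF gm bdd_unit_measurable[OF h] \<alpha> C bdd_unit_eq_0[OF h] g])
  finally show ?thesis .
qed

lemma riesz_energy_integrable: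
  assumes "bdd_unit g" "0 < \<alpha>"
  shows "integrable lborel (\<lambda>z. g (fst z) * g (snd z) * \<bar>fst z - snd z\<bar> powr (\<alpha> - 1))"
proof (rule integrableI_bounded)
  note [measurable] = bdd_unit_measurable[OF assms(1)]
  show "(\<lambda>z. g (fst z) * g (snd z) * \<bar>fst z - snd z\<bar> powr (\<alpha> - 1)) \<in> borel_measurable lborel"
    by measurable
  have "(\<integral>\<^sup>+x. \<integral>\<^sup>+y. ennreal (\<bar>g x * g y\<bar> * \<bar>x - y\<bar> powr (\<alpha> - 1)) \<partial>lborel \<partial>lborel) < \<infinity>"
    by (rule kernel_integrand_finite)
       (use assms bdd_unit_integrable bdd_unit_eq_0 in auto)
  then show "(\<integral>\<^sup>+z. ennreal (norm (g (fst z) * g (snd z) * \<bar>fst z - snd z\<bar> powr (\<alpha> - 1))) \<partial>lborel) < \<infinity>"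
    by (subst nn_integral_lborel_pair) (measurable, simp add: abs_mult)
qed

text \<open>
  The Riesz kernel is the sum of the two one-sided kernels, which are exchanged by the symmetry of
  the plane.
\<close>

lemma half_riesz_energy:
  assumes g: "bdd_unit g" and \<alpha>: "0 < \<alpha>"
  shows "integrable lborel (\<lambda>z. g (fst z) * g (snd z) * frac_kernel \<alpha> (snd z - fst z))"
    and "(LINT z|lborel. g (fst z) * g (snd z) * frac_kernel \<alpha> (snd z - fst z)) = riesz_energy \<alpha> g / 2"
    and "integrable lborel (\<lambda>z. g (fst z) * g (snd z) * frac_kernel \<alpha> (fst z - snd z))"
    and "(LINT z|lborel. g (fst z) * g (snd z) * frac_kernel \<alpha> (fst z - snd z)) = riesz_energy \<alpha> g / 2"
proof -
  note [measurable] = bdd_unit_measurable[OF g]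
  note ri = riesz_energy_integrable[OF g \<alpha>]
  let ?A = "\<lambda>z. g (fst z) * g (snd z) * frac_kernel \<alpha> (snd z - fst z)"
  let ?B = "\<lambda>z. g (fst z) * g (snd z) * frac_kernel \<alpha> (fst z - snd z)"
  have le: "frac_kernel \<alpha> (s - t) \<le> \<bar>t - s\<bar> powr (\<alpha> - 1)" for s t
    using frac_kernel_le[of \<alpha> "s - t"] by (simp add: abs_minus_commute)
  show iA: "integrable lborel ?A"
    by (rule Bochner_Integration.integrable_bound[OF ri])
       (auto simp: abs_mult intro!: mult_left_mono le)
  show iB: "integrable lborel ?B"
    by (rule Bochner_Integration.integrable_bound[OF ri])
       (auto simp: abs_mult intro!: mult_left_mono frac_kernel_le)
  have "(LINT z|lborel. ?A z) + (LINT z|lborel. ?B z) = (LINT z|lborel. ?A z + ?B z)"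
    by (rule Bochner_Integration.integral_add[OF iA iB, symmetric])
  also have "\<dots> = riesz_energy \<alpha> g"
    unfolding riesz_energy_def
  proof (rule integral_cong_AE)
    show "AE z in lborel. ?A z + ?B z = g (fst z) * g (snd z) * \<bar>fst z - snd z\<bar> powr (\<alpha> - 1)"
      using AE_fst_neq_snd
    proof eventually_elim
      case (elim z)
      then show ?case
        using frac_kernel_symmetric_sum[of "fst z - snd z" \<alpha>]
        by (simp add: distrib_left[symmetric] add.commute)
    qed
  qed measurable
  finally have sum: "(LINT z|lborel. ?A z) + (LINT z|lborel. ?B z) = riesz_energy \<alpha> g" .
  have "(LINT z|lborel. ?A z) = (LINT x|lborel. LINT y|lborel. ?A (x, y))"
    by (rule integral_lborel_pair[OF iA])
  also have "\<dots> = (LINT y|lborel. LINT x|lborel. ?A (x, y))"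
    by (rule lborel_pair.Fubini_integral[symmetric]) (use iA in \<open>simp add: lborel_prod split_beta'\<close>)
  also have "\<dots> = (LINT z|lborel. ?B z)"
    unfolding integral_lborel_pair[OF iB] by (simp add: mult.commute)
  finally show "(LINT z|lborel. ?A z) = riesz_energy \<alpha> g / 2" "(LINT z|lborel. ?B z) = riesz_energy \<alpha> g / 2"
    using sum by auto
qed

text \<open>
  Every quadratic form in the one-sided integrals of \<open>g\<close> that is needed is a multiple of a Riesz
  energy of \<open>g\<close>. The squares are integrated over the whole line, which gives upper bounds on the
  unit interval. The decisive form is the mixed product: the left convolution vanishes to the left
  of the unit interval and the right one to the right of it, so that the integral over the interval
  is the integral over the line, and it has the same sign as the energy.
\<close>

context
  fixes \<beta> :: real and g :: "real \<Rightarrow> real"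
  assumes \<beta>: "0 < \<beta>" "\<beta> < 1/2" and g: "bdd_unit g"
begin

lemma kernel_shift_measurable:
  "(\<lambda>(x, y). frac_kernel \<beta> (x - y)) \<in> borel_measurable (borel \<Otimes>\<^sub>M borel)"
  "(\<lambda>(x, y). frac_kernel \<beta> (y - x)) \<in> borel_measurable (borel \<Otimes>\<^sub>M borel)"
  by measurable

lemma conv_normsq:
  fixes a :: "real \<Rightarrow> real \<Rightarrow> real"
  assumes am: "case_prod a \<in> borel_measurable (borel \<Otimes>\<^sub>M borel)" and a: "\<And>x y. 0 \<le> a x y"
    and same: "\<And>y z. y \<noteq> z \<Longrightarrow> (\<integral>\<^sup>+x. ennreal (a x y * a x z) \<partial>lborel)
      = ennreal (\<bar>y - z\<bar> powr (2 * \<beta> - 1)) * kernel_const_same \<beta>"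
  shows "integrable lborel (\<lambda>x. (LINT y|lborel. g y * a x y)\<^sup>2)"
    and "(LINT x|lborel. (LINT y|lborel. g y * a x y)\<^sup>2)
      = enn2real (kernel_const_same \<beta>) * riesz_energy (2 * \<beta>) g"
proof -
  note [measurable] = bdd_unit_measurable[OF g]
  let ?c = "enn2real (kernel_const_same \<beta>)"
  have c: "kernel_const_same \<beta> = ennreal ?c"
    using kernel_const_same_finite[OF \<beta>] by simp
  have ri: "(\<integral>\<^sup>+y. \<integral>\<^sup>+z. ennreal (\<bar>g y * g z\<bar> * (?c * \<bar>y - z\<bar> powr (2 * \<beta> - 1))) \<partial>lborel \<partial>lborel) < \<infinity>"
  proof -
    have i: "integrable lborel (\<lambda>z. ?c * (g (fst z) * g (snd z) * \<bar>fst z - snd z\<bar> powr (2 * \<beta> - 1)))"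
      using riesz_energy_integrable[OF g, of "2 * \<beta>"] \<beta> by simp
    then have "(\<integral>\<^sup>+z. ennreal (norm (?c * (g (fst z) * g (snd z) * \<bar>fst z - snd z\<bar> powr (2 * \<beta> - 1)))) \<partial>lborel) < \<infinity>"
      unfolding integrable_iff_bounded by blast
    then show ?thesis
      by (subst (asm) nn_integral_lborel_pair) (measurable, simp add: abs_mult ac_simps)
  qed
  have prod: "(\<integral>\<^sup>+x. ennreal (a x y * a x z) \<partial>lborel) = ennreal (?c * \<bar>y - z\<bar> powr (2 * \<beta> - 1))"
    if "y \<noteq> z" for y z
    unfolding same[OF that] by (subst c) (simp add: ennreal_mult mult.commute)
  have \<kappa>m: "(\<lambda>z. ?c * \<bar>fst z - snd z\<bar> powr (2 * \<beta> - 1)) \<in> borel_measurable borel" by measurable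
  note * = integral_transform_product[where a = a and b = a and g = g and h = g
      and \<kappa> = "\<lambda>y z. ?c * \<bar>y - z\<bar> powr (2 * \<beta> - 1)", OF am am _ _ \<kappa>m _ _ _ prod ri]
  show "integrable lborel (\<lambda>x. (LINT y|lborel. g y * a x y)\<^sup>2)"
    unfolding power2_eq_square by (rule *(1)) (auto simp: a)
  have "(LINT x|lborel. (LINT y|lborel. g y * a x y)\<^sup>2)
      = (LINT z|lborel. g (fst z) * g (snd z) * (?c * \<bar>fst z - snd z\<bar> powr (2 * \<beta> - 1)))"
    unfolding power2_eq_square by (rule *(2)) (auto simp: a)
  also have "\<dots> = (LINT z|lborel. ?c * (g (fst z) * g (snd z) * \<bar>fst z - snd z\<bar> powr (2 * \<beta> - 1)))"
    by (simp only: ac_simps)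
  finally show "(LINT x|lborel. (LINT y|lborel. g y * a x y)\<^sup>2) = ?c * riesz_energy (2 * \<beta>) g"
    by (simp add: riesz_energy_def)
qed

lemma left_conv_normsq:
  "integrable lborel (\<lambda>x. (left_conv \<beta> g x)\<^sup>2)"
  "(LINT x|lborel. (left_conv \<beta> g x)\<^sup>2) = enn2real (kernel_const_same \<beta>) * riesz_energy (2 * \<beta>) g"
  unfolding left_conv_def
  by (rule conv_normsq[OF kernel_shift_measurable(1) frac_kernel_nonneg nn_integral_kernels_same]; assumption)+

lemma right_conv_normsq:
  "integrable lborel (\<lambda>x. (right_conv \<beta> g x)\<^sup>2)"
  "(LINT x|lborel. (right_conv \<beta> g x)\<^sup>2) = enn2real (kernel_const_same \<beta>) * riesz_energy (2 * \<beta>) g"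
  unfolding right_conv_def
  by (rule conv_normsq[OF kernel_shift_measurable(2) frac_kernel_nonneg nn_integral_kernels_same']; assumption)+

lemma left_conv_times_right_conv:
  "(LINT x|unit_meas. left_conv \<beta> g x * right_conv \<beta> g x)
    = enn2real (kernel_const_opposite \<beta> \<beta>) / 2 * riesz_energy (2 * \<beta>) g"
proof -
  note [measurable] = bdd_unit_measurable[OF g]
  let ?c = "enn2real (kernel_const_opposite \<beta> \<beta>)"
  have c: "kernel_const_opposite \<beta> \<beta> = ennreal ?c"
    using kernel_const_opposite_bounds[of \<beta> \<beta>] \<beta> by simp
  have \<beta>2: "0 < 2 * \<beta>" using \<beta> by simp
  have ri: "(\<integral>\<^sup>+y. \<integral>\<^sup>+z. ennreal (\<bar>g y * g z\<bar> * (?c * frac_kernel (2 * \<beta>) (z - y))) \<partial>lborel \<partial>lborel) < \<infinity>"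
  proof -
    have i: "integrable lborel (\<lambda>z. ?c * (g (fst z) * g (snd z) * frac_kernel (2 * \<beta>) (snd z - fst z)))"
      using half_riesz_energy(1)[OF g \<beta>2] by simp
    then have "(\<integral>\<^sup>+z. ennreal (norm (?c * (g (fst z) * g (snd z) * frac_kernel (2 * \<beta>) (snd z - fst z)))) \<partial>lborel) < \<infinity>"
      unfolding integrable_iff_bounded by blast
    then show ?thesis
      by (subst (asm) nn_integral_lborel_pair) (measurable, simp add: abs_mult ac_simps)
  qed
  have prod: "(\<integral>\<^sup>+x. ennreal (frac_kernel \<beta> (x - y) * frac_kernel \<beta> (z - x)) \<partial>lborel)
      = ennreal (?c * frac_kernel (2 * \<beta>) (z - y))" for y z
    unfolding nn_integral_kernels_opposite by (subst c) (simp add: ennreal_mult mult.commute)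
  have \<kappa>m: "(\<lambda>z. ?c * frac_kernel (2 * \<beta>) (snd z - fst z)) \<in> borel_measurable borel" by measurable
  note * = integral_transform_product[OF kernel_shift_measurable(1) kernel_shift_measurable(2) _ _ \<kappa>m _ _ _ prod ri]
  have "(LINT x|unit_meas. left_conv \<beta> g x * right_conv \<beta> g x) = (LINT x|lborel. left_conv \<beta> g x * right_conv \<beta> g x)"
  proof (rule integral_unit_meas)
    fix x :: real assume "x \<notin> {0<..<1}"
    then have "x \<le> 0 \<or> 1 \<le> x" by auto
    then show "left_conv \<beta> g x * right_conv \<beta> g x = 0"
      using left_conv_eq_0[OF bdd_unit_eq_0[OF g]] right_conv_eq_0[OF bdd_unit_eq_0[OF g]] by auto
  qed
  also have "\<dots> = (LINT z|lborel. g (fst z) * g (snd z) * (?c * frac_kernel (2 * \<beta>) (snd z - fst z)))"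
    unfolding left_conv_def right_conv_def by (rule *(2)) auto
  also have "\<dots> = (LINT z|lborel. ?c * (g (fst z) * g (snd z) * frac_kernel (2 * \<beta>) (snd z - fst z)))"
    by (simp only: ac_simps)
  finally show ?thesis
    using half_riesz_energy(2)[OF g \<beta>2] by simp
qed

lemma conv_times_self:
  "(LINT x|unit_meas. left_conv \<beta> g x * g x) = riesz_energy \<beta> g / 2"
  "(LINT x|unit_meas. right_conv \<beta> g x * g x) = riesz_energy \<beta> g / 2"
proof -
  note h = half_riesz_energy[OF g \<beta>(1)]
  have "(LINT x|unit_meas. left_conv \<beta> g x * g x) = (LINT x|lborel. left_conv \<beta> g x * g x)"
    by (rule integral_unit_meas) (use bdd_unit_eq_0[OF g] in auto)
  also have "\<dots> = (LINT z|lborel. g (fst z) * g (snd z) * frac_kernel \<beta> (fst z - snd z))"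
    unfolding integral_lborel_pair[OF h(3)] left_conv_def
    by (subst integral_mult_left_zero[symmetric]) (simp add: ac_simps)
  finally show "(LINT x|unit_meas. left_conv \<beta> g x * g x) = riesz_energy \<beta> g / 2"
    by (simp add: h)
  have "(LINT x|unit_meas. right_conv \<beta> g x * g x) = (LINT x|lborel. right_conv \<beta> g x * g x)"
    by (rule integral_unit_meas) (use bdd_unit_eq_0[OF g] in auto)
  also have "\<dots> = (LINT z|lborel. g (fst z) * g (snd z) * frac_kernel \<beta> (snd z - fst z))"
    unfolding integral_lborel_pair[OF h(1)] right_conv_def
    by (subst integral_mult_left_zero[symmetric]) (simp add: ac_simps)
  finally show "(LINT x|unit_meas. right_conv \<beta> g x * g x) = riesz_energy \<beta> g / 2"
    by (simp add: h)
qed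

end


text \<open>
  For the two one-sided kernels, transposition exchanges the left and the right integral. This moves
  the integrals of functions that are merely integrable onto test functions.
\<close>

lemma conv_duality:
  fixes k :: "real \<Rightarrow> real \<Rightarrow> real"
  assumes km: "case_prod k \<in> borel_measurable (borel \<Otimes>\<^sub>M borel)"
    and k: "\<And>s x. 0 \<le> k s x" "\<And>s x. k s x \<le> \<bar>s - x\<bar> powr (\<beta> - 1)" and \<beta>: "0 < \<beta>"
    and w: "integrable lborel w" "\<And>x. x \<notin> {0<..<1} \<Longrightarrow> w x = 0" and \<psi>: "bdd_unit \<psi>"
  shows "integrable lborel (\<lambda>x. (LINT s|lborel. w s * k s x) * \<psi> x)"
    and "integrable lborel (\<lambda>s. w s * (LINT x|lborel. \<psi> x * k s x))"
    and "(LINT x|lborel. (LINT s|lborel. w s * k s x) * \<psi> x)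
      = (LINT s|lborel. w s * (LINT x|lborel. \<psi> x * k s x))"
proof -
  note [measurable] = bdd_unit_measurable[OF \<psi>]
  have [measurable]: "w \<in> borel_measurable borel" using w by auto
  have [measurable]: "(\<lambda>x. k (p x) (q x)) \<in> borel_measurable M"
    if "p \<in> borel_measurable M" "q \<in> borel_measurable M" for p q :: "'z \<Rightarrow> real" and M
    using measurable_compose[OF measurable_Pair[OF that] km] by simp
  define f where "f s x = w s * \<psi> x * k s x" for s x
  have fm: "case_prod f \<in> borel_measurable (lborel \<Otimes>\<^sub>M lborel)" unfolding f_def by measurable
  have "(\<integral>\<^sup>+s. \<integral>\<^sup>+x. ennreal (\<bar>w s * \<psi> x\<bar> * k s x) \<partial>lborel \<partial>lborel) < \<infinity>"
    by (rule kernel_integrand_finite[OF w \<psi> \<beta> k])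
  then have fin: "(\<integral>\<^sup>+s. \<integral>\<^sup>+x. ennreal (norm (f s x)) \<partial>lborel \<partial>lborel) < \<infinity>"
    unfolding f_def by (simp add: abs_mult k)
  have 1: "(LINT s|lborel. f s x) = (LINT s|lborel. w s * k s x) * \<psi> x" for x
    unfolding f_def integral_mult_left_zero[symmetric] by (simp add: ac_simps)
  have 2: "(LINT x|lborel. f s x) = w s * (LINT x|lborel. \<psi> x * k s x)" for s
    unfolding f_def integral_mult_right_zero[symmetric] by (simp add: ac_simps)
  show "integrable lborel (\<lambda>x. (LINT s|lborel. w s * k s x) * \<psi> x)"
    using integrable_integral_snd_lborel[OF fm fin] unfolding 1 .
  show "integrable lborel (\<lambda>s. w s * (LINT x|lborel. \<psi> x * k s x))"
    using integrable_integral_fst_lborel[OF fm fin] unfolding 2 .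
  show "(LINT x|lborel. (LINT s|lborel. w s * k s x) * \<psi> x)
      = (LINT s|lborel. w s * (LINT x|lborel. \<psi> x * k s x))"
    using Fubini_lborel_swap[OF fm fin] unfolding 1 2 by simp
qed

lemma frac_kernel_shift_measurable:
  "(\<lambda>(s, x). frac_kernel \<beta> (x - s)) \<in> borel_measurable (borel \<Otimes>\<^sub>M borel)"
  "(\<lambda>(s, x). frac_kernel \<beta> (s - x)) \<in> borel_measurable (borel \<Otimes>\<^sub>M borel)"
  by measurable

lemma frac_kernel_le': "frac_kernel \<beta> (x - s) \<le> \<bar>s - x\<bar> powr (\<beta> - 1)"
  using frac_kernel_le[of \<beta> "x - s"] by (simp add: abs_minus_commute)

lemmas left_conv_duality =
  conv_duality[OF frac_kernel_shift_measurable(1) frac_kernel_nonneg frac_kernel_le',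
    folded left_conv_def right_conv_def]

lemmas right_conv_duality =
  conv_duality[OF frac_kernel_shift_measurable(2) frac_kernel_nonneg frac_kernel_le,
    folded left_conv_def right_conv_def]

lemma left_conv_integration_by_parts:
  assumes \<phi>: "test_function \<phi>" and \<psi>: "test_function \<psi>" and \<beta>: "0 < \<beta>"
  shows "(LINT x|lborel. left_conv \<beta> \<phi> x * deriv \<psi> x) = - (LINT x|lborel. left_conv \<beta> (deriv \<phi>) x * \<psi> x)"
proof -
  have shift: "(LINT x|lborel. left_conv \<beta> w x * \<eta> x)
      = (LINT t|lborel. frac_kernel \<beta> t * (LINT x|lborel. w (x - t) * \<eta> x))"
    if w: "test_function w" and \<eta>: "test_function \<eta>" for w \<eta>
  proof -
    note [measurable] = test_function_borel[OF w] test_function_borel[OF \<eta>]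
    define f where "f x t = w (x - t) * frac_kernel \<beta> t * \<eta> x" for x t
    have fm: "case_prod f \<in> borel_measurable (lborel \<Otimes>\<^sub>M lborel)" unfolding f_def by measurable
    have "(\<integral>\<^sup>+x. \<integral>\<^sup>+t. ennreal (norm (f x t)) \<partial>lborel \<partial>lborel)
        = (\<integral>\<^sup>+x. \<integral>\<^sup>+s. ennreal (\<bar>\<eta> x * w s\<bar> * frac_kernel \<beta> (x - s)) \<partial>lborel \<partial>lborel)"
    proof (rule nn_integral_cong)
      fix x
      have "(\<integral>\<^sup>+s. ennreal (\<bar>\<eta> x * w s\<bar> * frac_kernel \<beta> (x - s)) \<partial>lborel)
          = ennreal \<bar>-1\<bar> * (\<integral>\<^sup>+t. ennreal (\<bar>\<eta> x * w (x + (-1) * t)\<bar> * frac_kernel \<beta> (x - (x + (-1) * t))) \<partial>lborel)"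
        by (rule nn_integral_real_affine) auto
      then show "(\<integral>\<^sup>+t. ennreal (norm (f x t)) \<partial>lborel) = (\<integral>\<^sup>+s. ennreal (\<bar>\<eta> x * w s\<bar> * frac_kernel \<beta> (x - s)) \<partial>lborel)"
        by (simp add: f_def abs_mult ac_simps)
    qed
    also have "\<dots> < \<infinity>"
      by (rule kernel_integrand_finite[OF test_function_integrable[OF \<eta>] test_function_eq_0[OF \<eta>]
            bdd_unit_test_function[OF w] \<beta> frac_kernel_nonneg frac_kernel_le])
    finally have fin: "(\<integral>\<^sup>+x. \<integral>\<^sup>+t. ennreal (norm (f x t)) \<partial>lborel \<partial>lborel) < \<infinity>" .
    have "(LINT t|lborel. f x t) = left_conv \<beta> w x * \<eta> x" for x
    proof -
      have "left_conv \<beta> w x = \<bar>-1\<bar> *\<^sub>R (LINT t|lborel. w (x + (-1) * t) * frac_kernel \<beta> (x - (x + (-1) * t)))"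
        unfolding left_conv_def by (rule lborel_integral_real_affine) simp
      then show ?thesis by (simp add: f_def)
    qed
    moreover have "(LINT x|lborel. f x t) = frac_kernel \<beta> t * (LINT x|lborel. w (x - t) * \<eta> x)" for t
      unfolding f_def integral_mult_right_zero[symmetric] by (simp add: ac_simps)
    ultimately show ?thesis using Fubini_lborel_swap[OF fm fin] by simp
  qed
  have "(LINT x|lborel. \<phi> (x - t) * deriv \<psi> x) = - (LINT x|lborel. deriv \<phi> (x - t) * \<psi> x)" for t
  proof (rule integration_by_parts[OF _ _ \<psi>])
    show "((\<lambda>x. \<phi> (x - t)) has_real_derivative deriv \<phi> (x - t)) (at x)" for x
      by (rule DERIV_cong[OF DERIV_chain2[OF test_function_DERIV[OF \<phi>]]])
         (auto intro!: derivative_eq_intros)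
    show "continuous_on UNIV (\<lambda>x. deriv \<phi> (x - t))"
      by (rule continuous_on_compose2[OF test_function_continuous[OF test_function_deriv[OF \<phi>], of UNIV]])
         (auto intro: continuous_intros)
  qed
  then show ?thesis
    unfolding shift[OF \<phi> test_function_deriv[OF \<psi>]] shift[OF test_function_deriv[OF \<phi>] \<psi>] by simp
qed

lemma right_conv_integration_by_parts:
  assumes \<phi>: "test_function \<phi>" and \<psi>: "test_function \<psi>" and \<beta>: "0 < \<beta>"
  shows "(LINT x|lborel. right_conv \<beta> \<phi> x * deriv \<psi> x) = - (LINT x|lborel. right_conv \<beta> (deriv \<phi>) x * \<psi> x)"
proof -
  note d = test_function_deriv[OF \<phi>] test_function_deriv[OF \<psi>]
  have dual: "(LINT x|lborel. right_conv \<beta> w x * \<eta> x) = (LINT x|lborel. left_conv \<beta> \<eta> x * w x)"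
    if "test_function w" "test_function \<eta>" for w \<eta>
    using right_conv_duality(3)[OF \<beta> test_function_integrable[OF that(1)] test_function_eq_0[OF that(1)]
        bdd_unit_test_function[OF that(2)]]
    by (simp add: mult.commute)
  show ?thesis
    unfolding dual[OF \<phi> d(2)] dual[OF d(1) \<psi>] left_conv_integration_by_parts[OF \<psi> \<phi> \<beta>] by simp
qed

lemma weighted_mean_mult:
  "(1 / c * (t * a + (1 - t) * b)) * d = t / c * (a * d) + (1 - t) / c * (b * d)" for a b c d t :: real
  by (cases "c = 0") (simp_all add: field_simps)

lemma integral_linear_combination:
  fixes f g :: "'a \<Rightarrow> real"
  assumes "integrable M f" "integrable M g"
  shows "(LINT x|M. a * f x + b * g x) = a * (LINT x|M. f x) + b * (LINT x|M. g x)"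
  using assms by simp

lemma frac_int_duality:
  assumes \<beta>: "0 < \<beta>" and w: "integrable lborel w" "\<And>x. x \<notin> {0<..<1} \<Longrightarrow> w x = 0" and \<psi>: "bdd_unit \<psi>"
  shows "integrable lborel (\<lambda>x. frac_int \<beta> \<theta> w x * \<psi> x)"
    and "(LINT x|lborel. frac_int \<beta> \<theta> w x * \<psi> x) = (LINT x|lborel. w x * frac_int \<beta> (1 - \<theta>) \<psi> x)"
proof -
  have l: "integrable lborel (\<lambda>x. left_conv \<beta> w x * \<psi> x)"
      "integrable lborel (\<lambda>x. w x * right_conv \<beta> \<psi> x)"
      "(LINT x|lborel. left_conv \<beta> w x * \<psi> x) = (LINT x|lborel. w x * right_conv \<beta> \<psi> x)"
    by (rule left_conv_duality[OF \<beta> w \<psi>]; assumption)+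
  have r: "integrable lborel (\<lambda>x. right_conv \<beta> w x * \<psi> x)"
      "integrable lborel (\<lambda>x. w x * left_conv \<beta> \<psi> x)"
      "(LINT x|lborel. right_conv \<beta> w x * \<psi> x) = (LINT x|lborel. w x * left_conv \<beta> \<psi> x)"
    by (rule right_conv_duality[OF \<beta> w \<psi>]; assumption)+
  have eq: "frac_int \<beta> \<theta> w x * \<psi> x = \<theta> / Gamma \<beta> * (left_conv \<beta> w x * \<psi> x) + (1 - \<theta>) / Gamma \<beta> * (right_conv \<beta> w x * \<psi> x)"
    "w x * frac_int \<beta> (1 - \<theta>) \<psi> x = \<theta> / Gamma \<beta> * (w x * right_conv \<beta> \<psi> x) + (1 - \<theta>) / Gamma \<beta> * (w x * left_conv \<beta> \<psi> x)" for x
  proof -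
    have fw: "frac_int \<beta> \<theta> w x = 1 / Gamma \<beta> * (\<theta> * left_conv \<beta> w x + (1 - \<theta>) * right_conv \<beta> w x)"
      by (rule frac_int_eq_conv) (rule w(2))
    show "frac_int \<beta> \<theta> w x * \<psi> x = \<theta> / Gamma \<beta> * (left_conv \<beta> w x * \<psi> x) + (1 - \<theta>) / Gamma \<beta> * (right_conv \<beta> w x * \<psi> x)"
      unfolding fw by (rule weighted_mean_mult)
    have f\<psi>: "frac_int \<beta> (1 - \<theta>) \<psi> x = 1 / Gamma \<beta> * (\<theta> * right_conv \<beta> \<psi> x + (1 - \<theta>) * left_conv \<beta> \<psi> x)"
      by (subst frac_int_eq_conv) (auto simp: bdd_unit_eq_0[OF \<psi>])
    show "w x * frac_int \<beta> (1 - \<theta>) \<psi> x = \<theta> / Gamma \<beta> * (w x * right_conv \<beta> \<psi> x) + (1 - \<theta>) / Gamma \<beta> * (w x * left_conv \<beta> \<psi> x)"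
      unfolding f\<psi> mult.commute[of "w x"] by (rule weighted_mean_mult)
  qed
  show "integrable lborel (\<lambda>x. frac_int \<beta> \<theta> w x * \<psi> x)"
    unfolding eq by (intro Bochner_Integration.integrable_add integrable_mult_right l r)
  show "(LINT x|lborel. frac_int \<beta> \<theta> w x * \<psi> x) = (LINT x|lborel. w x * frac_int \<beta> (1 - \<theta>) \<psi> x)"
    unfolding eq integral_linear_combination[OF l(1) r(1)] integral_linear_combination[OF l(2) r(2)] l(3) r(3) ..
qed

lemma frac_int_integrable:
  assumes "0 < \<beta>" "integrable lborel w" "\<And>x. x \<notin> {0<..<1} \<Longrightarrow> w x = 0"
  shows "integrable unit_meas (frac_int \<beta> \<theta> w)"
proof -
  have "bdd_unit (indicator {0<..<1})"
    unfolding bdd_unit_def by (auto intro!: exI[of _ 1] simp: indicator_def)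
  from frac_int_duality(1)[OF assms this] show ?thesis
    by (simp add: integrable_restrict_space mult.commute)
qed

lemma frac_int_integration_by_parts:
  assumes \<beta>: "0 < \<beta>" and \<phi>: "test_function \<phi>" and \<psi>: "test_function \<psi>"
  shows "(LINT x|unit_meas. frac_int \<beta> \<theta> \<phi> x * deriv \<psi> x) = - (LINT x|unit_meas. frac_int \<beta> \<theta> (deriv \<phi>) x * \<psi> x)"
proof -
  note d = test_function_deriv[OF \<phi>] test_function_deriv[OF \<psi>]
  have *: "(LINT x|unit_meas. frac_int \<beta> \<theta> w x * \<eta> x)
      = \<theta> / Gamma \<beta> * (LINT x|lborel. left_conv \<beta> w x * \<eta> x) + (1 - \<theta>) / Gamma \<beta> * (LINT x|lborel. right_conv \<beta> w x * \<eta> x)"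
    if w: "test_function w" and \<eta>: "test_function \<eta>" for w \<eta>
  proof -
    have l: "integrable lborel (\<lambda>x. left_conv \<beta> w x * \<eta> x)"
      by (rule left_conv_duality[OF \<beta> test_function_integrable[OF w] test_function_eq_0[OF w] bdd_unit_test_function[OF \<eta>]])
    have r: "integrable lborel (\<lambda>x. right_conv \<beta> w x * \<eta> x)"
      by (rule right_conv_duality[OF \<beta> test_function_integrable[OF w] test_function_eq_0[OF w] bdd_unit_test_function[OF \<eta>]])
    have eq: "frac_int \<beta> \<theta> w x * \<eta> x = \<theta> / Gamma \<beta> * (left_conv \<beta> w x * \<eta> x) + (1 - \<theta>) / Gamma \<beta> * (right_conv \<beta> w x * \<eta> x)" for x
    proof -
      have fw: "frac_int \<beta> \<theta> w x = 1 / Gamma \<beta> * (\<theta> * left_conv \<beta> w x + (1 - \<theta>) * right_conv \<beta> w x)"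
        by (rule frac_int_eq_conv) (rule test_function_eq_0[OF w])
      show ?thesis unfolding fw by (rule weighted_mean_mult)
    qed
    have "(LINT x|unit_meas. frac_int \<beta> \<theta> w x * \<eta> x) = (LINT x|lborel. frac_int \<beta> \<theta> w x * \<eta> x)"
      by (rule integral_unit_meas) (simp add: test_function_eq_0[OF \<eta>])
    also have "\<dots> = \<theta> / Gamma \<beta> * (LINT x|lborel. left_conv \<beta> w x * \<eta> x) + (1 - \<theta>) / Gamma \<beta> * (LINT x|lborel. right_conv \<beta> w x * \<eta> x)"
      unfolding eq by (rule integral_linear_combination[OF l r])
    finally show ?thesis .
  qed
  show ?thesis
    unfolding *[OF \<phi> d(2)] *[OF d(1) \<psi>] left_conv_integration_by_parts[OF \<phi> \<psi> \<beta>]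
      right_conv_integration_by_parts[OF \<phi> \<psi> \<beta>] by simp
qed

lemma conv_L2:
  assumes "0 < \<beta>" "\<beta> < 1/2" "bdd_unit g"
  shows "left_conv \<beta> g \<in> L2 unit_meas" "right_conv \<beta> g \<in> L2 unit_meas"
    and "normsq unit_meas (left_conv \<beta> g) \<le> enn2real (kernel_const_same \<beta>) * riesz_energy (2 * \<beta>) g"
    and "normsq unit_meas (right_conv \<beta> g) \<le> enn2real (kernel_const_same \<beta>) * riesz_energy (2 * \<beta>) g"
proof -
  note l = left_conv_normsq[OF assms] and r = right_conv_normsq[OF assms]
  have *: "f \<in> L2 unit_meas" "normsq unit_meas f \<le> (LINT x|lborel. (f x)\<^sup>2)"
    if "integrable lborel (\<lambda>x. (f x)\<^sup>2)" "f \<in> borel_measurable borel" for f :: "real \<Rightarrow> real"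
  proof -
    have "integrable lborel (\<lambda>x. indicator {0<..<1} x *\<^sub>R (f x)\<^sup>2)"
      by (rule integrable_mult_indicator) (use that in auto)
    then show "f \<in> L2 unit_meas"
      unfolding L2_def using that(2) unit_meas_measurable by (auto simp: integrable_restrict_space)
    have "normsq unit_meas f = (LINT x|lborel. indicator {0<..<1} x *\<^sub>R (f x)\<^sup>2)"
      unfolding normsq_def by (simp add: integral_restrict_space)
    also have "\<dots> \<le> (LINT x|lborel. (f x)\<^sup>2)"
      by (rule integral_mono) (use that \<open>integrable lborel (\<lambda>x. indicator {0<..<1} x *\<^sub>R (f x)\<^sup>2)\<close> in \<open>auto simp: indicator_def\<close>)
    finally show "normsq unit_meas f \<le> (LINT x|lborel. (f x)\<^sup>2)" .
  qed
  note [measurable] = bdd_unit_measurable[OF assms(3)]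
  show "left_conv \<beta> g \<in> L2 unit_meas" "right_conv \<beta> g \<in> L2 unit_meas"
    "normsq unit_meas (left_conv \<beta> g) \<le> enn2real (kernel_const_same \<beta>) * riesz_energy (2 * \<beta>) g"
    "normsq unit_meas (right_conv \<beta> g) \<le> enn2real (kernel_const_same \<beta>) * riesz_energy (2 * \<beta>) g"
    using *[OF l(1)] *[OF r(1)] l(2) r(2) by auto
qed

lemma frac_int_fun_eq:
  "bdd_unit g \<Longrightarrow> frac_int \<beta> \<theta> g
    = (\<lambda>x. 1 / Gamma \<beta> * (\<theta> * left_conv \<beta> g x + (1 - \<theta>) * right_conv \<beta> g x))"
  by (rule ext) (rule frac_int_eq_conv[OF bdd_unit_eq_0])

lemma frac_int_L2:
  assumes "0 < \<beta>" "\<beta> < 1/2" "bdd_unit g"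
  shows "frac_int \<beta> \<theta> g \<in> L2 unit_meas"
  unfolding frac_int_fun_eq[OF assms(3)] by (intro L2_scale L2_add conv_L2 assms)

lemma normsq_frac_int_le:
  assumes \<beta>: "0 < \<beta>" "\<beta> < 1/2" and \<theta>: "0 \<le> \<theta>" "\<theta> \<le> 1" and g: "bdd_unit g"
  shows "normsq unit_meas (frac_int \<beta> \<theta> g)
    \<le> 4 / (Gamma \<beta>)\<^sup>2 * enn2real (kernel_const_same \<beta>) * riesz_energy (2 * \<beta>) g"
proof -
  note L = conv_L2[OF \<beta> g]
  let ?e = "enn2real (kernel_const_same \<beta>) * riesz_energy (2 * \<beta>) g"
  have e0: "0 \<le> ?e" using L(3) normsq_nonneg[of unit_meas "left_conv \<beta> g"] by linarith
  have sq: "\<theta>\<^sup>2 \<le> 1" "(1 - \<theta>)\<^sup>2 \<le> 1" using \<theta> by (auto intro!: power_le_one)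
  have "normsq unit_meas (\<lambda>x. \<theta> * left_conv \<beta> g x + (1 - \<theta>) * right_conv \<beta> g x)
      \<le> 2 * (\<theta>\<^sup>2 * normsq unit_meas (left_conv \<beta> g)) + 2 * ((1 - \<theta>)\<^sup>2 * normsq unit_meas (right_conv \<beta> g))"
    using normsq_add_le[OF L2_scale[OF L(1), of \<theta>] L2_scale[OF L(2), of "1 - \<theta>"]] by (simp add: normsq_scale)
  also have "\<dots> \<le> 2 * (1 * ?e) + 2 * (1 * ?e)"
    by (intro add_mono mult_left_mono mult_mono L sq e0 normsq_nonneg) auto
  finally have "(1 / Gamma \<beta>)\<^sup>2 * normsq unit_meas (\<lambda>x. \<theta> * left_conv \<beta> g x + (1 - \<theta>) * right_conv \<beta> g x)
      \<le> (1 / Gamma \<beta>)\<^sup>2 * (4 * ?e)"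
    by (intro mult_left_mono) auto
  then show ?thesis
    unfolding frac_int_fun_eq[OF g] normsq_scale by (simp add: power_divide)
qed

text \<open>
  Up to a positive factor the product is the mean of the two squares, with the weights \<open>\<theta>\<close> and
  \<open>1 - \<theta>\<close>, plus the mixed product. The squares are dropped; as the second parameter is \<open>1/2\<close>, the
  coefficient of the mixed product is the same for all \<open>\<theta>\<close>.
\<close>

lemma ip_frac_int_half_ge:
  assumes \<beta>: "0 < \<beta>" "\<beta> < 1/2" and \<theta>: "0 \<le> \<theta>" "\<theta> \<le> 1" and g: "bdd_unit g"
  shows "enn2real (kernel_const_opposite \<beta> \<beta>) / (4 * (Gamma \<beta>)\<^sup>2) * riesz_energy (2 * \<beta>) g
    \<le> ip unit_meas (frac_int \<beta> \<theta> g) (frac_int \<beta> (1/2) g)"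
proof -
  note L = conv_L2[OF \<beta> g]
  let ?l = "left_conv \<beta> g" and ?r = "right_conv \<beta> g"
  have "ip unit_meas (frac_int \<beta> \<theta> g) (frac_int \<beta> (1/2) g)
      = (1 / Gamma \<beta>)\<^sup>2 * (1/2) * ip unit_meas (\<lambda>x. \<theta> * ?l x + (1 - \<theta>) * ?r x) (\<lambda>x. ?l x + ?r x)"
  proof -
    have "(\<lambda>x. 1 / Gamma \<beta> * (1 / 2 * ?l x + (1 - 1 / 2) * ?r x)) = (\<lambda>x. (1 / Gamma \<beta> * (1/2)) * (?l x + ?r x))"
      by (simp add: algebra_simps)
    then show ?thesis
      unfolding frac_int_fun_eq[OF g] by (simp only: ip_scale_left ip_scale_right) (simp add: power2_eq_square)
  qed
  also have "ip unit_meas (\<lambda>x. \<theta> * ?l x + (1 - \<theta>) * ?r x) (\<lambda>x. ?l x + ?r x)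
      = \<theta> * normsq unit_meas ?l + (1 - \<theta>) * normsq unit_meas ?r + ip unit_meas ?l ?r"
    unfolding ip_add_left[OF L2_scale[OF L(1)] L2_scale[OF L(2)] L2_add[OF L(1,2)]]
      ip_add_right[OF L(1) L(2) L(1)] ip_add_right[OF L(1) L(2) L(2)] ip_scale_left normsq_eq_ip
      ip_commute[of _ ?r ?l]
    by (simp add: algebra_simps)
  finally have eq: "ip unit_meas (frac_int \<beta> \<theta> g) (frac_int \<beta> (1/2) g) = (1 / Gamma \<beta>)\<^sup>2 * (1/2)
      * (\<theta> * normsq unit_meas ?l + (1 - \<theta>) * normsq unit_meas ?r + ip unit_meas ?l ?r)" .
  have "ip unit_meas ?l ?r \<le> \<theta> * normsq unit_meas ?l + (1 - \<theta>) * normsq unit_meas ?r + ip unit_meas ?l ?r"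
    using \<theta> by (simp add: normsq_nonneg)
  from mult_left_mono[OF this, of "(1 / Gamma \<beta>)\<^sup>2 * (1/2)"]
  have "(1 / Gamma \<beta>)\<^sup>2 * (1/2) * ip unit_meas ?l ?r \<le> ip unit_meas (frac_int \<beta> \<theta> g) (frac_int \<beta> (1/2) g)"
    unfolding eq by simp
  moreover have "(1 / Gamma \<beta>)\<^sup>2 * (1/2) * ip unit_meas ?l ?r
      = enn2real (kernel_const_opposite \<beta> \<beta>) / (4 * (Gamma \<beta>)\<^sup>2) * riesz_energy (2 * \<beta>) g"
    unfolding ip_def left_conv_times_right_conv[OF \<beta> g] by (simp add: power_divide)
  ultimately show ?thesis by simp
qed

lemma ip_frac_int_self:
  assumes \<beta>: "0 < \<beta>" "\<beta> < 1/2" and g: "bdd_unit g" "g \<in> L2 unit_meas"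
  shows "ip unit_meas (frac_int \<beta> \<theta> g) g = riesz_energy \<beta> g / (2 * Gamma \<beta>)"
proof -
  note L = conv_L2[OF \<beta> g(1)]
  have "ip unit_meas (frac_int \<beta> \<theta> g) g
      = 1 / Gamma \<beta> * (\<theta> * ip unit_meas (left_conv \<beta> g) g + (1 - \<theta>) * ip unit_meas (right_conv \<beta> g) g)"
    unfolding frac_int_fun_eq[OF g(1)] by (simp only: ip_scale_left ip_add_left[OF L2_scale[OF L(1)] L2_scale[OF L(2)] g(2)])
  also have "\<dots> = 1 / Gamma \<beta> * (riesz_energy \<beta> g / 2)"
    unfolding ip_def conv_times_self[OF \<beta> g(1)] by (simp only: distrib_right[symmetric]) simp
  finally show ?thesis by simp
qed

text \<open>
  The range of \<open>D I\<^sup>\<beta>\<close> with the left-sided integral is not dense: it is orthogonal to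
  \<open>(1 - x) powr (- \<beta>)\<close>, whose right-sided integral of order \<open>\<beta>\<close> is constant.
\<close>

lemma left_range_annihilator:
  assumes \<beta>: "0 < \<beta>" "\<beta> < 1/2"
  obtains z where "z \<in> L2 unit_meas" "0 < normsq unit_meas z"
    "\<And>\<phi>. test_function \<phi> \<Longrightarrow> ip unit_meas (frac_int \<beta> 1 (deriv \<phi>)) z = 0"
proof -
  define z where "z x = frac_kernel (1 - \<beta>) (1 - x)" for x
  have zm [measurable]: "z \<in> borel_measurable borel" unfolding z_def by measurable
  let ?f = "\<lambda>x. ennreal (indicator {0..1} x * x powr (- 2 * \<beta>))"
  have "(\<integral>\<^sup>+x. ennreal ((z x)\<^sup>2) \<partial>unit_meas) \<le> (\<integral>\<^sup>+x. ?f (1 + (-1) * x) \<partial>lborel)"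
  proof -
    have "(\<integral>\<^sup>+x. ennreal ((z x)\<^sup>2) \<partial>unit_meas) = (\<integral>\<^sup>+x. ennreal ((z x)\<^sup>2) * indicator {0<..<1} x \<partial>lborel)"
      by (simp add: nn_integral_restrict_space)
    also have "\<dots> \<le> (\<integral>\<^sup>+x. ?f (1 + (-1) * x) \<partial>lborel)"
      by (intro nn_integral_mono)
         (auto simp: z_def frac_kernel_def indicator_def power2_eq_square powr_add[symmetric])
    finally show ?thesis .
  qed
  also have "\<dots> = (\<integral>\<^sup>+x. ?f x \<partial>lborel)"
    using nn_integral_real_affine[of ?f "-1" 1] by simp
  also have "\<dots> < \<infinity>"
    using nn_integral_powr_unit_interval[of "- 2 * \<beta>"] \<beta> by simp
  finally have zL: "z \<in> L2 unit_meas"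
    by (intro L2_I_nn unit_meas_measurable zm) simp
  have "normsq unit_meas z \<noteq> 0"
  proof
    assume "normsq unit_meas z = 0"
    then have "AE x in unit_meas. z x = 0" using normsq_0_iff[OF zL] by simp
    moreover have "AE x in unit_meas. x \<in> {0<..<1}" by (simp add: AE_unit_meas)
    ultimately have "AE x in unit_meas. False"
      by eventually_elim (auto simp: z_def frac_kernel_def)
    moreover have "{x \<in> space unit_meas. \<not> False} = space unit_meas" by blast
    ultimately have "emeasure unit_meas (space unit_meas) = 0"
      using AE_iff_measurable[OF sets.top, of unit_meas "\<lambda>_. False"] by blast
    then show False by (simp only: emeasure_unit_meas) simp
  qed
  then have zpos: "0 < normsq unit_meas z" using normsq_nonneg[of unit_meas z] by simp
  define C where "C = enn2real (kernel_const_opposite \<beta> (1 - \<beta>))"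
  have C: "kernel_const_opposite \<beta> (1 - \<beta>) = ennreal C" "0 \<le> C"
    using kernel_const_opposite_bounds[of \<beta> "1 - \<beta>"] \<beta> by (auto simp: C_def)
  have "ip unit_meas (frac_int \<beta> 1 (deriv \<phi>)) z = 0" if \<phi>: "test_function \<phi>" for \<phi>
  proof -
    note d = test_function_deriv[OF \<phi>] and bd = bdd_unit_test_function[OF test_function_deriv[OF \<phi>]]
    note [measurable] = test_function_borel[OF d]
    define f where "f s x = deriv \<phi> s * (frac_kernel \<beta> (x - s) * z x)" for s x
    have fm: "case_prod f \<in> borel_measurable (lborel \<Otimes>\<^sub>M lborel)" unfolding f_def by measurable
    have inner: "(\<integral>\<^sup>+x. ennreal (frac_kernel \<beta> (x - s) * z x) \<partial>lborel) = ennreal C" if "s < 1" for s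
      using nn_integral_kernels_opposite[of \<beta> s "1 - \<beta>" 1] that unfolding z_def C
      by (simp add: frac_kernel_def)
    have z0: "0 \<le> z x" for x by (simp add: z_def)
    have "(\<integral>\<^sup>+s. \<integral>\<^sup>+x. ennreal (norm (f s x)) \<partial>lborel \<partial>lborel) = (\<integral>\<^sup>+s. ennreal \<bar>deriv \<phi> s\<bar> * ennreal C \<partial>lborel)"
    proof (intro nn_integral_cong)
      fix s
      have "(\<integral>\<^sup>+x. ennreal (norm (f s x)) \<partial>lborel) = (\<integral>\<^sup>+x. ennreal \<bar>deriv \<phi> s\<bar> * ennreal (frac_kernel \<beta> (x - s) * z x) \<partial>lborel)"
        unfolding f_def by (intro nn_integral_cong) (simp add: abs_mult z0 ennreal_mult[symmetric])
      also have "\<dots> = ennreal \<bar>deriv \<phi> s\<bar> * (\<integral>\<^sup>+x. ennreal (frac_kernel \<beta> (x - s) * z x) \<partial>lborel)"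
        by (rule nn_integral_cmult) measurable
      also have "\<dots> = ennreal \<bar>deriv \<phi> s\<bar> * ennreal C"
      proof (cases "s < 1")
        case True then show ?thesis by (simp add: inner)
      next
        case False
        then have "deriv \<phi> s = 0" by (intro test_function_eq_0[OF d]) simp
        then show ?thesis by simp
      qed
      finally show "(\<integral>\<^sup>+x. ennreal (norm (f s x)) \<partial>lborel) = ennreal \<bar>deriv \<phi> s\<bar> * ennreal C" .
    qed
    also have "\<dots> = (\<integral>\<^sup>+s. ennreal \<bar>deriv \<phi> s\<bar> \<partial>lborel) * ennreal C"
      by (rule nn_integral_multc) measurable
    also have "\<dots> < \<infinity>"
      using test_function_integrable[OF d] by (auto simp: integrable_iff_bounded ennreal_mult_less_top)
    finally have fin: "(\<integral>\<^sup>+s. \<integral>\<^sup>+x. ennreal (norm (f s x)) \<partial>lborel \<partial>lborel) < \<infinity>" .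
    have 1: "(LINT x|lborel. f s x) = deriv \<phi> s * C" for s
    proof (cases "s < 1")
      case True
      have "(LINT x|lborel. frac_kernel \<beta> (x - s) * z x) = C"
        using inner[OF True] C(2) z0 by (subst integral_eq_nn_integral) auto
      then show ?thesis by (simp add: f_def)
    next
      case False
      then have "deriv \<phi> s = 0" by (intro test_function_eq_0[OF d]) simp
      then show ?thesis by (simp add: f_def)
    qed
    have 2: "(LINT s|lborel. f s x) = left_conv \<beta> (deriv \<phi>) x * z x" for x
      unfolding left_conv_def f_def integral_mult_left_zero[symmetric] by (simp add: ac_simps)
    have "(LINT x|lborel. left_conv \<beta> (deriv \<phi>) x * z x) = (LINT s|lborel. deriv \<phi> s * C)"
      using Fubini_lborel_swap[OF fm fin] unfolding 1 2 by simp
    also have "\<dots> = 0" using integral_deriv_test_function[OF \<phi>] by simp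
    finally have "(LINT x|unit_meas. left_conv \<beta> (deriv \<phi>) x * z x) = 0"
    proof (subst integral_unit_meas)
      fix x :: real assume "x \<notin> {0<..<1}"
      then have "x \<le> 0 \<or> 1 \<le> x" by auto
      then show "left_conv \<beta> (deriv \<phi>) x * z x = 0"
        using left_conv_eq_0[OF bdd_unit_eq_0[OF bd]] by (auto simp: z_def frac_kernel_def)
    qed simp
    then show ?thesis
      unfolding frac_int_fun_eq[OF bd] ip_scale_left by (simp add: ip_def)
  qed
  with zL zpos show ?thesis by (rule that)
qed


section \<open>The spaces \<open>H\<^sup>\<mu>\<^sub>0(0,1)\<close>\<close>

definition unit_L2 :: "(real \<Rightarrow> real) set" where
  "unit_L2 = {w \<in> borel_measurable borel. (\<forall>x. x \<notin> {0<..<1} \<longrightarrow> w x = 0) \<and> w \<in> L2 unit_meas}"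

lemma unit_L2_D:
  assumes "w \<in> unit_L2"
  shows "w \<in> borel_measurable borel" "x \<notin> {0<..<1} \<Longrightarrow> w x = 0" "w \<in> L2 unit_meas"
  using assms unfolding unit_L2_def by blast+

lemma unit_L2_add: "w \<in> unit_L2 \<Longrightarrow> z \<in> unit_L2 \<Longrightarrow> (\<lambda>x. w x + z x) \<in> unit_L2"
  unfolding unit_L2_def by (auto intro: L2_add)

lemma unit_L2_scale: "w \<in> unit_L2 \<Longrightarrow> (\<lambda>x. c * w x) \<in> unit_L2"
  unfolding unit_L2_def by (auto intro: L2_scale)

lemma unit_L2_diff: "w \<in> unit_L2 \<Longrightarrow> z \<in> unit_L2 \<Longrightarrow> (\<lambda>x. w x - z x) \<in> unit_L2"
  unfolding unit_L2_def by (auto intro: L2_diff)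

lemma unit_L2_test_function: "test_function \<phi> \<Longrightarrow> \<phi> \<in> unit_L2"
  unfolding unit_L2_def using test_function_borel test_function_eq_0 test_function_L2 by blast

lemma unit_L2_integrable:
  assumes "w \<in> unit_L2"
  shows "integrable lborel w" "(LINT x|lborel. \<bar>w x\<bar>) \<le> sqrt (normsq unit_meas w)"
proof -
  note D = unit_L2_D[OF assms]
  show "integrable lborel w"
    using unit_meas.L2_integrable[OF D(3)] integrable_unit_meas[of w] D(2) by blast
  have "(LINT x|lborel. \<bar>w x\<bar>) = (LINT x|unit_meas. \<bar>w x\<bar>)"
  proof (rule integral_unit_meas[symmetric])
    fix x :: real assume "x \<notin> {0<..<1}"
    from D(2)[OF this] show "\<bar>w x\<bar> = 0" by simp
  qed
  also have "\<dots> \<le> sqrt (normsq unit_meas w)"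
    using unit_meas.L1_le_L2[OF D(3)] unfolding measure_unit_meas by simp
  finally show "(LINT x|lborel. \<bar>w x\<bar>) \<le> sqrt (normsq unit_meas w)" .
qed

lemma unit_L2_nn_integral:
  assumes "w \<in> unit_L2"
  shows "(\<integral>\<^sup>+x. ennreal ((w x)\<^sup>2) \<partial>lborel) = ennreal (normsq unit_meas w)"
  unfolding nn_integral_eq_normsq[OF unit_L2_D(3)[OF assms], symmetric]
proof (rule nn_integral_unit_meas[symmetric])
  fix x :: real assume "x \<notin> {0<..<1}"
  from unit_L2_D(2)[OF assms this] show "ennreal ((w x)\<^sup>2) = 0" by simp
qed

lemma Hnorm_sq_unit_L2:
  "w \<in> unit_L2 \<Longrightarrow> Hnorm_sq \<mu> w = ennreal (normsq unit_meas w) + fourier_seminorm_sq \<mu> w"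
  by (simp add: Hnorm_sq_alt unit_L2_nn_integral)

lemma normsq_le_Hnorm_sq: "w \<in> unit_L2 \<Longrightarrow> ennreal (normsq unit_meas w) \<le> Hnorm_sq \<mu> w"
  by (simp add: Hnorm_sq_unit_L2)

lemma Hnorm_sq_scale: "Hnorm_sq \<mu> (\<lambda>x. c * w x) = ennreal (c\<^sup>2) * Hnorm_sq \<mu> w"
  if [measurable]: "w \<in> borel_measurable borel"
proof -
  have "(\<integral>\<^sup>+ x. ennreal ((c * w x)\<^sup>2) \<partial>lborel) = ennreal (c\<^sup>2) * (\<integral>\<^sup>+ x. ennreal ((w x)\<^sup>2) \<partial>lborel)"
    by (subst nn_integral_cmult[symmetric]) (auto simp: power_mult_distrib ennreal_mult)
  moreover have "(\<integral>\<^sup>+ \<omega>. ennreal ((\<bar>\<omega>\<bar> powr \<mu> * cmod (fourier (\<lambda>x. c * w x) \<omega>))\<^sup>2) \<partial>lborel)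
      = ennreal (c\<^sup>2) * (\<integral>\<^sup>+ \<omega>. ennreal ((\<bar>\<omega>\<bar> powr \<mu> * cmod (fourier w \<omega>))\<^sup>2) \<partial>lborel)"
    unfolding fourier_scale
    by (subst nn_integral_cmult[symmetric]) (auto simp: norm_mult power_mult_distrib ennreal_mult[symmetric] ac_simps)
  ultimately show ?thesis by (simp add: Hnorm_sq_def distrib_left)
qed

lemma Hnorm_sq_diff_le:
  assumes w: "w \<in> unit_L2" and z: "z \<in> unit_L2"
  shows "Hnorm_sq \<mu> (\<lambda>x. w x - z x) \<le> 2 * Hnorm_sq \<mu> w + 2 * Hnorm_sq \<mu> z"
proof -
  note [measurable] = unit_L2_D(1)[OF w] unit_L2_D(1)[OF z]
  have sq: "ennreal ((a - b)\<^sup>2) \<le> 2 * ennreal (a\<^sup>2) + 2 * ennreal (b\<^sup>2)" for a b :: real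
  proof -
    have "(a - b)\<^sup>2 \<le> 2 * a\<^sup>2 + 2 * b\<^sup>2"
      using zero_le_power2[of "a + b"] by (simp add: power2_eq_square algebra_simps)
    then have "ennreal ((a - b)\<^sup>2) \<le> ennreal (2 * a\<^sup>2 + 2 * b\<^sup>2)" by (rule ennreal_leI)
    also have "\<dots> = ennreal (2 * a\<^sup>2) + ennreal (2 * b\<^sup>2)" by (rule ennreal_plus) auto
    finally show ?thesis by (simp add: ennreal_mult)
  qed
  have 1: "(\<integral>\<^sup>+ x. ennreal ((w x - z x)\<^sup>2) \<partial>lborel)
      \<le> 2 * (\<integral>\<^sup>+ x. ennreal ((w x)\<^sup>2) \<partial>lborel) + 2 * (\<integral>\<^sup>+ x. ennreal ((z x)\<^sup>2) \<partial>lborel)"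
  proof -
    have "(\<integral>\<^sup>+ x. ennreal ((w x - z x)\<^sup>2) \<partial>lborel)
        \<le> (\<integral>\<^sup>+ x. 2 * ennreal ((w x)\<^sup>2) + 2 * ennreal ((z x)\<^sup>2) \<partial>lborel)"
      by (intro nn_integral_mono sq)
    also have "\<dots> = 2 * (\<integral>\<^sup>+ x. ennreal ((w x)\<^sup>2) \<partial>lborel) + 2 * (\<integral>\<^sup>+ x. ennreal ((z x)\<^sup>2) \<partial>lborel)"
      by (subst nn_integral_add, simp, simp, subst nn_integral_cmult, simp, subst nn_integral_cmult) auto
    finally show ?thesis .
  qed
  let ?F = "\<lambda>u. \<lambda>\<omega>. ennreal ((\<bar>\<omega>\<bar> powr \<mu> * cmod (fourier u \<omega>))\<^sup>2)"
  have 2: "fourier_seminorm_sq \<mu> (\<lambda>x. w x - z x) \<le> 2 * fourier_seminorm_sq \<mu> w + 2 * fourier_seminorm_sq \<mu> z"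
  proof -
    have "?F (\<lambda>x. w x - z x) \<omega> \<le> 2 * ?F w \<omega> + 2 * ?F z \<omega>" for \<omega>
    proof -
      have "cmod (fourier (\<lambda>x. w x - z x) \<omega>) \<le> cmod (fourier w \<omega>) + cmod (fourier z \<omega>)"
        unfolding fourier_diff[OF unit_L2_integrable(1)[OF w] unit_L2_integrable(1)[OF z]]
        by (rule norm_triangle_ineq4)
      then have "\<bar>\<omega>\<bar> powr \<mu> * cmod (fourier (\<lambda>x. w x - z x) \<omega>)
          \<le> \<bar>\<omega>\<bar> powr \<mu> * cmod (fourier w \<omega>) - (- (\<bar>\<omega>\<bar> powr \<mu> * cmod (fourier z \<omega>)))"
        by (simp add: distrib_left[symmetric] mult_left_mono)
      then have "ennreal ((\<bar>\<omega>\<bar> powr \<mu> * cmod (fourier (\<lambda>x. w x - z x) \<omega>))\<^sup>2)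
          \<le> ennreal ((\<bar>\<omega>\<bar> powr \<mu> * cmod (fourier w \<omega>) - (- (\<bar>\<omega>\<bar> powr \<mu> * cmod (fourier z \<omega>))))\<^sup>2)"
        by (intro ennreal_leI power_mono) auto
      also have "\<dots> \<le> 2 * ?F w \<omega> + 2 * ?F z \<omega>"
        by (rule order_trans[OF sq]) simp
      finally show ?thesis .
    qed
    then have "fourier_seminorm_sq \<mu> (\<lambda>x. w x - z x) \<le> (\<integral>\<^sup>+\<omega>. 2 * ?F w \<omega> + 2 * ?F z \<omega> \<partial>lborel)"
      unfolding fourier_seminorm_sq_def by (intro nn_integral_mono)
    also have "\<dots> = 2 * fourier_seminorm_sq \<mu> w + 2 * fourier_seminorm_sq \<mu> z"
      unfolding fourier_seminorm_sq_def
      by (subst nn_integral_add, simp, simp, subst nn_integral_cmult, simp, subst nn_integral_cmult) auto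
    finally show ?thesis .
  qed
  show ?thesis
    using add_mono[OF 1 2] unfolding Hnorm_sq_alt by (simp add: distrib_left ac_simps)
qed

lemma Hnorm_sq_triangle:
  assumes "u \<in> unit_L2" "v \<in> unit_L2" "w \<in> unit_L2"
  shows "Hnorm_sq \<mu> (\<lambda>x. u x - w x) \<le> 2 * Hnorm_sq \<mu> (\<lambda>x. u x - v x) + 2 * Hnorm_sq \<mu> (\<lambda>x. w x - v x)"
  using Hnorm_sq_diff_le[OF unit_L2_diff[OF assms(1,2)] unit_L2_diff[OF assms(3,2)], of \<mu>] by simp

lemma H0_approx:
  assumes "w \<in> H0 \<mu>"
  obtains \<phi> where "\<And>n::nat. test_function (\<phi> n)" "(\<lambda>n. Hnorm_sq \<mu> (\<lambda>x. w x - \<phi> n x)) \<longlonglongrightarrow> 0"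
  using assms unfolding H0_def by blast

lemma H0_unit_L2:
  assumes "w \<in> H0 \<mu>"
  shows "w \<in> unit_L2"
proof -
  have wm: "w \<in> borel_measurable borel" and w0: "\<And>x. x \<notin> {0<..<1} \<Longrightarrow> w x = 0"
    using assms unfolding H0_def by auto
  note [measurable] = wm
  obtain \<phi> where \<phi>: "\<And>n::nat. test_function (\<phi> n)" "(\<lambda>n. Hnorm_sq \<mu> (\<lambda>x. w x - \<phi> n x)) \<longlonglongrightarrow> 0"
    using H0_approx[OF assms] by metis
  have "\<forall>\<^sub>F n in sequentially. Hnorm_sq \<mu> (\<lambda>x. w x - \<phi> n x) < 1"
    by (rule order_tendstoD(2)[OF \<phi>(2)]) simp
  then obtain n where n: "Hnorm_sq \<mu> (\<lambda>x. w x - \<phi> n x) < 1"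
    by (auto simp: eventually_sequentially)
  note [measurable] = test_function_borel[OF \<phi>(1)[of n]]
  have "(\<integral>\<^sup>+x. ennreal ((w x - \<phi> n x)\<^sup>2) \<partial>unit_meas) = (\<integral>\<^sup>+x. ennreal ((w x - \<phi> n x)\<^sup>2) \<partial>lborel)"
  proof (rule nn_integral_unit_meas)
    fix x :: real assume x: "x \<notin> {0<..<1}"
    show "ennreal ((w x - \<phi> n x)\<^sup>2) = 0"
      unfolding w0[OF x] test_function_eq_0[OF \<phi>(1) x] by simp
  qed
  also have "\<dots> \<le> Hnorm_sq \<mu> (\<lambda>x. w x - \<phi> n x)" by (simp add: Hnorm_sq_def)
  also have "\<dots> < \<infinity>" using n by (rule less_trans) simp
  finally have "(\<lambda>x. w x - \<phi> n x) \<in> L2 unit_meas"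
    by (intro L2_I_nn unit_meas_measurable) measurable
  from L2_add[OF this test_function_L2[OF \<phi>(1)[of n]]] have "w \<in> L2 unit_meas" by simp
  then show ?thesis using wm w0 unfolding unit_L2_def by blast
qed

lemma test_function_H0: "test_function \<phi> \<Longrightarrow> \<phi> \<in> H0 \<mu>"
  unfolding H0_def using test_function_borel test_function_eq_0
  by (auto intro!: exI[of _ "\<lambda>_. \<phi>"] simp: Hnorm_sq_def fourier_def)

text \<open>A diagonal sequence of test functions shows that the closure is closed.\<close>

lemma H0_I:
  assumes w: "w \<in> unit_L2" and z: "\<And>n::nat. z n \<in> H0 \<mu>"
    and lim: "(\<lambda>n. Hnorm_sq \<mu> (\<lambda>x. z n x - w x)) \<longlonglongrightarrow> 0"
  shows "w \<in> H0 \<mu>"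
proof -
  have "\<exists>\<phi>. test_function \<phi> \<and> Hnorm_sq \<mu> (\<lambda>x. z n x - \<phi> x) < ennreal (1 / Suc n)" for n
  proof -
    obtain \<phi> where \<phi>: "\<And>k::nat. test_function (\<phi> k)" "(\<lambda>k. Hnorm_sq \<mu> (\<lambda>x. z n x - \<phi> k x)) \<longlonglongrightarrow> 0"
      using H0_approx[OF z] by metis
    have "\<forall>\<^sub>F k in sequentially. Hnorm_sq \<mu> (\<lambda>x. z n x - \<phi> k x) < ennreal (1 / Suc n)"
      by (rule order_tendstoD(2)[OF \<phi>(2)]) simp
    then show ?thesis using \<phi>(1) by (auto simp: eventually_sequentially)
  qed
  then obtain \<phi> where \<phi>: "\<And>n. test_function (\<phi> n)"
    "\<And>n. Hnorm_sq \<mu> (\<lambda>x. z n x - \<phi> n x) < ennreal (1 / Suc n)" by metis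
  have zL: "z n \<in> unit_L2" for n by (rule H0_unit_L2[OF z])
  have sym: "Hnorm_sq \<mu> (\<lambda>x. u x - v x) = Hnorm_sq \<mu> (\<lambda>x. v x - u x)"
    if "u \<in> unit_L2" "v \<in> unit_L2" for u v
    using Hnorm_sq_scale[OF unit_L2_D(1)[OF unit_L2_diff[OF that]], of \<mu> "-1"] by simp
  have "(\<lambda>n. Hnorm_sq \<mu> (\<lambda>x. w x - \<phi> n x)) \<longlonglongrightarrow> 0"
  proof (rule tendsto_sandwich[OF _ _ tendsto_const])
    show "\<forall>\<^sub>F n in sequentially. Hnorm_sq \<mu> (\<lambda>x. w x - \<phi> n x)
        \<le> 2 * Hnorm_sq \<mu> (\<lambda>x. z n x - w x) + 2 * ennreal (1 / Suc n)"
    proof (rule always_eventually, rule allI)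
      fix n
      have "Hnorm_sq \<mu> (\<lambda>x. w x - \<phi> n x)
          \<le> 2 * Hnorm_sq \<mu> (\<lambda>x. w x - z n x) + 2 * Hnorm_sq \<mu> (\<lambda>x. \<phi> n x - z n x)"
        by (rule Hnorm_sq_triangle[OF w zL unit_L2_test_function[OF \<phi>(1)]])
      also have "\<dots> \<le> 2 * Hnorm_sq \<mu> (\<lambda>x. z n x - w x) + 2 * ennreal (1 / Suc n)"
        unfolding sym[OF w zL] sym[OF unit_L2_test_function[OF \<phi>(1)] zL]
        using \<phi>(2)[of n] by (intro add_mono mult_left_mono) auto
      finally show "Hnorm_sq \<mu> (\<lambda>x. w x - \<phi> n x)
          \<le> 2 * Hnorm_sq \<mu> (\<lambda>x. z n x - w x) + 2 * ennreal (1 / Suc n)" .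
    qed
    have "(\<lambda>n. ennreal (1 / Suc n)) \<longlonglongrightarrow> ennreal 0"
      by (intro tendsto_ennrealI LIMSEQ_Suc[OF lim_1_over_n])
    then have "(\<lambda>n. 2 * Hnorm_sq \<mu> (\<lambda>x. z n x - w x) + 2 * ennreal (1 / Suc n)) \<longlonglongrightarrow> 2 * 0 + 2 * ennreal 0"
      by (intro tendsto_add ennreal_tendsto_cmult lim) auto
    then show "(\<lambda>n. 2 * Hnorm_sq \<mu> (\<lambda>x. z n x - w x) + 2 * ennreal (1 / Suc n)) \<longlonglongrightarrow> 0" by simp
  qed simp
  then show ?thesis
    unfolding H0_def using \<phi>(1) unit_L2_D(1,2)[OF w] by auto
qed

lemma H0_diff:
  assumes "w \<in> H0 \<mu>" "z \<in> H0 \<mu>"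
  shows "(\<lambda>x. w x - z x) \<in> H0 \<mu>"
proof -
  obtain \<phi> where \<phi>: "\<And>n::nat. test_function (\<phi> n)" "(\<lambda>n. Hnorm_sq \<mu> (\<lambda>x. w x - \<phi> n x)) \<longlonglongrightarrow> 0"
    using H0_approx[OF assms(1)] by metis
  obtain \<psi> where \<psi>: "\<And>n::nat. test_function (\<psi> n)" "(\<lambda>n. Hnorm_sq \<mu> (\<lambda>x. z x - \<psi> n x)) \<longlonglongrightarrow> 0"
    using H0_approx[OF assms(2)] by metis
  note L = H0_unit_L2[OF assms(1)] H0_unit_L2[OF assms(2)]
    unit_L2_test_function[OF \<phi>(1)] unit_L2_test_function[OF \<psi>(1)]
  have "(\<lambda>n. Hnorm_sq \<mu> (\<lambda>x. (w x - z x) - (\<phi> n x - \<psi> n x))) \<longlonglongrightarrow> 0"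
  proof (rule tendsto_sandwich[OF _ _ tendsto_const])
    show "\<forall>\<^sub>F n in sequentially. Hnorm_sq \<mu> (\<lambda>x. (w x - z x) - (\<phi> n x - \<psi> n x))
        \<le> 2 * Hnorm_sq \<mu> (\<lambda>x. w x - \<phi> n x) + 2 * Hnorm_sq \<mu> (\<lambda>x. z x - \<psi> n x)"
    proof (rule always_eventually, rule allI)
      fix n
      have "(\<lambda>x. (w x - z x) - (\<phi> n x - \<psi> n x)) = (\<lambda>x. (w x - \<phi> n x) - (z x - \<psi> n x))" by auto
      then show "Hnorm_sq \<mu> (\<lambda>x. (w x - z x) - (\<phi> n x - \<psi> n x))
        \<le> 2 * Hnorm_sq \<mu> (\<lambda>x. w x - \<phi> n x) + 2 * Hnorm_sq \<mu> (\<lambda>x. z x - \<psi> n x)"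
        using Hnorm_sq_diff_le[OF unit_L2_diff[OF L(1) L(3)[of n]] unit_L2_diff[OF L(2) L(4)[of n]]] by simp
    qed
    have "(\<lambda>n. 2 * Hnorm_sq \<mu> (\<lambda>x. w x - \<phi> n x) + 2 * Hnorm_sq \<mu> (\<lambda>x. z x - \<psi> n x)) \<longlonglongrightarrow> 2 * 0 + 2 * 0"
      by (intro tendsto_add ennreal_tendsto_cmult \<phi> \<psi>) auto
    then show "(\<lambda>n. 2 * Hnorm_sq \<mu> (\<lambda>x. w x - \<phi> n x) + 2 * Hnorm_sq \<mu> (\<lambda>x. z x - \<psi> n x)) \<longlonglongrightarrow> 0" by simp
  qed simp
  then show ?thesis
    unfolding H0_def using test_function_diff[OF \<phi>(1) \<psi>(1)] unit_L2_D(1,2)[OF unit_L2_diff[OF L(1,2)]]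
    by (auto intro!: exI[of _ "\<lambda>n x. \<phi> n x - \<psi> n x"])
qed

lemma H0_scale:
  assumes "w \<in> H0 \<mu>"
  shows "(\<lambda>x. c * w x) \<in> H0 \<mu>"
proof -
  obtain \<phi> where \<phi>: "\<And>n::nat. test_function (\<phi> n)" "(\<lambda>n. Hnorm_sq \<mu> (\<lambda>x. w x - \<phi> n x)) \<longlonglongrightarrow> 0"
    using H0_approx[OF assms(1)] by metis
  note L = H0_unit_L2[OF assms(1)] unit_L2_test_function[OF \<phi>(1)]
  have "Hnorm_sq \<mu> (\<lambda>x. c * w x - c * \<phi> n x) = ennreal (c\<^sup>2) * Hnorm_sq \<mu> (\<lambda>x. w x - \<phi> n x)" for n
    using Hnorm_sq_scale[OF unit_L2_D(1)[OF unit_L2_diff[OF L(1) L(2)[of n]]], of \<mu> c]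
    by (simp add: right_diff_distrib)
  moreover have "(\<lambda>n. ennreal (c\<^sup>2) * Hnorm_sq \<mu> (\<lambda>x. w x - \<phi> n x)) \<longlonglongrightarrow> ennreal (c\<^sup>2) * 0"
    by (intro ennreal_tendsto_cmult \<phi>) auto
  ultimately have "(\<lambda>n. Hnorm_sq \<mu> (\<lambda>x. c * w x - c * \<phi> n x)) \<longlonglongrightarrow> 0" by simp
  then show ?thesis
    unfolding H0_def using test_function_scale[OF \<phi>(1)] unit_L2_D(1,2)[OF unit_L2_scale[OF L(1)]]
    by (auto intro!: exI[of _ "\<lambda>n x. c * \<phi> n x"])
qed

lemma H0_add:
  assumes "w \<in> H0 \<mu>" "z \<in> H0 \<mu>"
  shows "(\<lambda>x. w x + z x) \<in> H0 \<mu>"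
  using H0_diff[OF assms(1) H0_scale[OF assms(2), of "-1"]] by simp

text \<open>
  Completeness. A Cauchy sequence converges in mean square; as all functions are supported in the
  unit interval, the Fourier transforms then converge pointwise, and Fatou's lemma applies.
\<close>

lemma H0_complete:
  assumes w: "\<And>n. w n \<in> H0 \<mu>"
    and cauchy: "\<And>e. 0 < e \<Longrightarrow> \<exists>N. \<forall>m\<ge>N. \<forall>n\<ge>N. Hnorm_sq \<mu> (\<lambda>x. w m x - w n x) \<le> ennreal e"
  obtains z where "z \<in> H0 \<mu>" "(\<lambda>n. Hnorm_sq \<mu> (\<lambda>x. w n x - z x)) \<longlonglongrightarrow> 0"
proof -
  have wU: "w n \<in> unit_L2" for n by (rule H0_unit_L2[OF w])
  have c2: "\<exists>N. \<forall>m\<ge>N. \<forall>n\<ge>N. normsq unit_meas (\<lambda>x. w m x - w n x) \<le> e" if e: "0 < e" for e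
  proof -
    obtain N where N: "\<forall>m\<ge>N. \<forall>n\<ge>N. Hnorm_sq \<mu> (\<lambda>x. w m x - w n x) \<le> ennreal e"
      using cauchy[OF e] by blast
    have "normsq unit_meas (\<lambda>x. w m x - w n x) \<le> e" if "N \<le> m" "N \<le> n" for m n
    proof -
      have "ennreal (normsq unit_meas (\<lambda>x. w m x - w n x)) \<le> ennreal e"
        using normsq_le_Hnorm_sq[OF unit_L2_diff[OF wU[of m] wU[of n]], of \<mu>] N that by (meson order_trans)
      then show ?thesis using e by (simp add: ennreal_le_iff)
    qed
    then show ?thesis by blast
  qed
  obtain v where v: "v \<in> L2 unit_meas" "(\<lambda>n. normsq unit_meas (\<lambda>x. w n x - v x)) \<longlonglongrightarrow> 0"
    by (rule unit_meas.L2_complete[OF unit_L2_D(3)[OF wU] c2])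
  define z where "z x = indicator {0<..<1} x * v x" for x
  have zm: "z \<in> borel_measurable borel"
    using L2_measurable[OF v(1)] unfolding z_def by (subst (asm) borel_measurable_restrict_space_iff) auto
  have zv: "AE x in unit_meas. v x = z x" by (simp add: AE_unit_meas z_def)
  have zL: "z \<in> L2 unit_meas"
    by (rule L2_AE_cong[OF v(1) unit_meas_measurable[OF zm] zv])
  have z: "z \<in> unit_L2" using zm zL unfolding unit_L2_def by (auto simp: z_def)
  have "normsq unit_meas (\<lambda>x. w n x - z x) = normsq unit_meas (\<lambda>x. w n x - v x)" for n
  proof (rule normsq_AE_cong)
    show "AE x in unit_meas. w n x - z x = w n x - v x" using zv by eventually_elim simp
  qed (auto intro!: L2_measurable L2_diff v zL unit_L2_D(3)[OF wU])
  then have lim: "(\<lambda>n. normsq unit_meas (\<lambda>x. w n x - z x)) \<longlonglongrightarrow> 0" using v(2) by simp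
  have F: "(\<lambda>m. fourier (w m) \<omega>) \<longlonglongrightarrow> fourier z \<omega>" for \<omega>
  proof -
    have "(\<lambda>m. fourier (w m) \<omega> - fourier z \<omega>) \<longlonglongrightarrow> 0"
    proof (rule Lim_null_comparison)
      show "\<forall>\<^sub>F m in sequentially. norm (fourier (w m) \<omega> - fourier z \<omega>) \<le> sqrt (normsq unit_meas (\<lambda>x. w m x - z x))"
      proof (rule always_eventually, rule allI)
        fix m
        show "norm (fourier (w m) \<omega> - fourier z \<omega>) \<le> sqrt (normsq unit_meas (\<lambda>x. w m x - z x))"
          unfolding fourier_diff[OF unit_L2_integrable(1)[OF wU] unit_L2_integrable(1)[OF z], symmetric]
          using norm_fourier_le[OF unit_L2_integrable(1)[OF unit_L2_diff[OF wU z]]]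
            unit_L2_integrable(2)[OF unit_L2_diff[OF wU z]] by (meson order_trans)
      qed
      show "(\<lambda>m. sqrt (normsq unit_meas (\<lambda>x. w m x - z x))) \<longlonglongrightarrow> 0"
        using tendsto_real_sqrt[OF lim] by simp
    qed
    then show ?thesis by (simp add: LIM_zero_iff)
  qed
  have fatou: "fourier_seminorm_sq \<mu> (\<lambda>x. w n x - z x) \<le> ennreal e"
    if n: "N \<le> n" and N: "\<forall>m\<ge>N. \<forall>n\<ge>N. Hnorm_sq \<mu> (\<lambda>x. w m x - w n x) \<le> ennreal e" for n N e
  proof -
    note [measurable] = unit_L2_D(1)[OF wU]
    have "fourier_seminorm_sq \<mu> (\<lambda>x. w n x - z x)
        = (\<integral>\<^sup>+\<omega>. liminf (\<lambda>m. ennreal ((\<bar>\<omega>\<bar> powr \<mu> * cmod (fourier (\<lambda>x. w n x - w m x) \<omega>))\<^sup>2)) \<partial>lborel)"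
      unfolding fourier_seminorm_sq_def
    proof (rule nn_integral_cong)
      fix \<omega>
      have "(\<lambda>m. ennreal ((\<bar>\<omega>\<bar> powr \<mu> * cmod (fourier (w n) \<omega> - fourier (w m) \<omega>))\<^sup>2))
          \<longlonglongrightarrow> ennreal ((\<bar>\<omega>\<bar> powr \<mu> * cmod (fourier (w n) \<omega> - fourier z \<omega>))\<^sup>2)"
        by (intro tendsto_intros F)
      then have "(\<lambda>m. ennreal ((\<bar>\<omega>\<bar> powr \<mu> * cmod (fourier (\<lambda>x. w n x - w m x) \<omega>))\<^sup>2))
          \<longlonglongrightarrow> ennreal ((\<bar>\<omega>\<bar> powr \<mu> * cmod (fourier (\<lambda>x. w n x - z x) \<omega>))\<^sup>2)"
        unfolding fourier_diff[OF unit_L2_integrable(1)[OF wU] unit_L2_integrable(1)[OF z]]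
          fourier_diff[OF unit_L2_integrable(1)[OF wU] unit_L2_integrable(1)[OF wU]] .
      from lim_imp_Liminf[OF _ this]
      show "ennreal ((\<bar>\<omega>\<bar> powr \<mu> * cmod (fourier (\<lambda>x. w n x - z x) \<omega>))\<^sup>2)
          = liminf (\<lambda>m. ennreal ((\<bar>\<omega>\<bar> powr \<mu> * cmod (fourier (\<lambda>x. w n x - w m x) \<omega>))\<^sup>2))" by simp
    qed
    also have "\<dots> \<le> liminf (\<lambda>m. fourier_seminorm_sq \<mu> (\<lambda>x. w n x - w m x))"
      unfolding fourier_seminorm_sq_def by (rule nn_integral_liminf) measurable
    also have "\<dots> \<le> liminf (\<lambda>m::nat. ennreal e)"
    proof (rule Liminf_mono)
      show "\<forall>\<^sub>F m in sequentially. fourier_seminorm_sq \<mu> (\<lambda>x. w n x - w m x) \<le> ennreal e"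
        using eventually_ge_at_top[of N]
      proof eventually_elim
        case (elim m)
        have "fourier_seminorm_sq \<mu> (\<lambda>x. w n x - w m x) \<le> Hnorm_sq \<mu> (\<lambda>x. w n x - w m x)"
          by (simp add: Hnorm_sq_alt)
        then show ?case using N n elim by (meson order_trans)
      qed
    qed
    also have "\<dots> = ennreal e" by (simp add: Liminf_const)
    finally show ?thesis .
  qed
  have Slim: "(\<lambda>n. fourier_seminorm_sq \<mu> (\<lambda>x. w n x - z x)) \<longlonglongrightarrow> 0"
  proof (rule order_tendstoI)
    fix a :: ennreal assume a: "0 < a"
    obtain e :: real where e: "0 < e" "ennreal e < a"
    proof -
      obtain b where b: "0 < b" "b < a" using dense[OF a] by blast
      then have "b < top" by (meson less_le_trans top_greatest)
      then show ?thesis using b that[of "enn2real b"] by (simp add: enn2real_positive_iff)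
    qed
    obtain N where N: "\<forall>m\<ge>N. \<forall>n\<ge>N. Hnorm_sq \<mu> (\<lambda>x. w m x - w n x) \<le> ennreal e"
      using cauchy[OF e(1)] by blast
    show "\<forall>\<^sub>F n in sequentially. fourier_seminorm_sq \<mu> (\<lambda>x. w n x - z x) < a"
      using eventually_ge_at_top[of N]
      by eventually_elim (rule le_less_trans[OF fatou[OF _ N] e(2)])
  qed simp
  have "(\<lambda>n. ennreal (normsq unit_meas (\<lambda>x. w n x - z x)) + fourier_seminorm_sq \<mu> (\<lambda>x. w n x - z x)) \<longlonglongrightarrow> ennreal 0 + 0"
    by (intro tendsto_add tendsto_ennrealI lim Slim)
  then have lim': "(\<lambda>n. Hnorm_sq \<mu> (\<lambda>x. w n x - z x)) \<longlonglongrightarrow> 0"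
    by (simp add: Hnorm_sq_unit_L2 unit_L2_diff wU z)
  show ?thesis by (rule that[OF H0_I[OF z w lim'] lim'])
qed


section \<open>Weak derivatives\<close>

definition weak_L2_deriv :: "(real \<Rightarrow> real) \<Rightarrow> (real \<Rightarrow> real) \<Rightarrow> bool" where
  "weak_L2_deriv u h \<longleftrightarrow> h \<in> L2 unit_meas \<and>
    (\<forall>\<psi>. test_function \<psi> \<longrightarrow> (LINT x|unit_meas. u x * deriv \<psi> x) = - ip unit_meas h \<psi>)"

lemma weak_L2_deriv_L2: "weak_L2_deriv u h \<Longrightarrow> h \<in> L2 unit_meas"
  by (simp add: weak_L2_deriv_def)

lemma weak_L2_deriv_eq:
  "weak_L2_deriv u h \<Longrightarrow> test_function \<psi> \<Longrightarrow> (LINT x|unit_meas. u x * deriv \<psi> x) = - ip unit_meas h \<psi>"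
  by (simp add: weak_L2_deriv_def)

lemma weak_L2_deriv_AE_cong:
  assumes "weak_L2_deriv u h" "k \<in> L2 unit_meas" "AE x in unit_meas. h x = k x"
  shows "weak_L2_deriv u k"
proof -
  have "ip unit_meas h \<psi> = ip unit_meas k \<psi>" if "test_function \<psi>" for \<psi>
    by (rule ip_AE_cong)
       (use assms that in \<open>auto intro: L2_measurable weak_L2_deriv_L2 test_function_L2\<close>)
  then show ?thesis using assms unfolding weak_L2_deriv_def by simp
qed

lemma set_integrable_compact_subinterval:
  fixes f :: "real \<Rightarrow> real"
  assumes "integrable unit_meas f" "0 < a" "b < 1"
  shows "set_integrable lborel {a..b} f"
  by (rule set_integrable_subset[of _ "{0<..<1}"])
     (use assms in \<open>auto simp: set_integrable_unit_meas\<close>)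

lemma has_weak_deriv_if_weak_L2_deriv:
  assumes "integrable unit_meas u" "weak_L2_deriv u h"
  shows "has_weak_deriv u h"
  unfolding has_weak_deriv_def
proof (intro conjI allI impI)
  fix a b :: real assume "0 < a \<and> b < 1"
  then show "set_integrable lborel {a..b} u" "set_integrable lborel {a..b} h"
    using assms unit_meas.L2_integrable[OF weak_L2_deriv_L2[OF assms(2)]]
    by (auto intro: set_integrable_compact_subinterval)
next
  fix \<phi> assume "test_function \<phi>"
  then show "(LINT x:{0<..<1}|lborel. u x * deriv \<phi> x) = - (LINT x:{0<..<1}|lborel. h x * \<phi> x)"
    using weak_L2_deriv_eq[OF assms(2)] unfolding set_integral_unit_meas ip_def by blast
qed

lemma locally_integrable_measurable:
  fixes g :: "real \<Rightarrow> real"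
  assumes g: "\<And>a b. 0 < a \<Longrightarrow> b < 1 \<Longrightarrow> set_integrable lborel {a..b} g"
  shows "g \<in> borel_measurable unit_meas"
proof -
  let ?J = "\<lambda>n. {1 / real (Suc n)..1 - 1 / real (Suc n)}"
  have m: "(\<lambda>x. indicator (?J n) x * g x) \<in> borel_measurable borel" for n
    using g[of "1 / real (Suc n)" "1 - 1 / real (Suc n)"] unfolding set_integrable_def by auto
  have "(\<lambda>x. indicator {0<..<1} x * g x) \<in> borel_measurable borel"
  proof (rule borel_measurable_LIMSEQ_real)
    show "(\<lambda>x. indicator {0<..<1} x * (indicator (?J n) x * g x)) \<in> borel_measurable borel" for n
      using m[of n] by measurable
    fix x :: real
    show "(\<lambda>n. indicator {0<..<1} x * (indicator (?J n) x * g x)) \<longlonglongrightarrow> indicator {0<..<1} x * g x"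
    proof (cases "x \<in> {0<..<1}")
      case True
      then obtain N where N: "1 / real (Suc N) < min x (1 - x)"
        using nat_approx_posE[of "min x (1 - x)"] by auto
      have "\<forall>\<^sub>F n in sequentially. indicator {0<..<1} x * g x = indicator {0<..<1} x * (indicator (?J n) x * g x)"
        using eventually_ge_at_top[of N]
      proof eventually_elim
        case (elim n)
        then have "1 / real (Suc n) \<le> 1 / real (Suc N)" by (simp add: frac_le)
        then have "x \<in> ?J n" using N by auto
        then show ?case by simp
      qed
      then show ?thesis by (rule Lim_transform_eventually[OF tendsto_const])
    qed simp
  qed
  then show ?thesis by (simp add: borel_measurable_restrict_space_iff)
qed

text \<open>
  Weak derivatives are unique, so the representative chosen by \<^const>\<open>weak_deriv\<close> is one in
  \<open>L\<^sup>2\<close> as soon as such a representative exists.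
\<close>

lemma has_weak_deriv_unique:
  assumes "has_weak_deriv u g" "has_weak_deriv u h"
  shows "AE x in unit_meas. g x = h x"
proof -
  have gi: "set_integrable lborel {a..b} g" and hi: "set_integrable lborel {a..b} h" if "0 < a" "b < 1" for a b
    using assms that unfolding has_weak_deriv_def by blast+
  have i: "integrable unit_meas (\<lambda>x. f x * \<phi> x)"
    if f: "\<And>a b. 0 < a \<Longrightarrow> b < 1 \<Longrightarrow> set_integrable lborel {a..b} f" and \<phi>: "test_function \<phi>" for f \<phi>
    using integrable_mult_test_function[OF f \<phi>] integrable_unit_meas[of "\<lambda>x. f x * \<phi> x"]
      test_function_eq_0[OF \<phi>] by (metis mult_zero_right)
  have "AE x in unit_meas. g x - h x = 0"
  proof (rule AE_0_if_test_integrals_0)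
    show "set_integrable lborel {a..b} (\<lambda>x. g x - h x)" if "0 < a" "b < 1" for a b
      using gi[OF that] hi[OF that] by (rule set_integral_diff(1))
    fix \<phi> assume \<phi>: "test_function \<phi>"
    have "(LINT x|unit_meas. u x * deriv \<phi> x) = - (LINT x|unit_meas. g x * \<phi> x)"
      using assms(1) \<phi> unfolding has_weak_deriv_def set_integral_unit_meas by blast
    moreover have "(LINT x|unit_meas. u x * deriv \<phi> x) = - (LINT x|unit_meas. h x * \<phi> x)"
      using assms(2) \<phi> unfolding has_weak_deriv_def set_integral_unit_meas by blast
    ultimately have "(LINT x|unit_meas. g x * \<phi> x) = (LINT x|unit_meas. h x * \<phi> x)"
      by linarith
    then show "(LINT x|unit_meas. (g x - h x) * \<phi> x) = 0"
      using i[OF gi \<phi>] i[OF hi \<phi>] by (simp add: left_diff_distrib)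
  qed
  then show ?thesis by eventually_elim simp
qed

lemma weak_deriv_L2:
  assumes "integrable unit_meas u" "weak_L2_deriv u h"
  shows "AE x in unit_meas. h x = weak_deriv u x" "weak_deriv u \<in> L2 unit_meas"
    and "weak_L2_deriv u (weak_deriv u)"
proof -
  have h: "has_weak_deriv u h" by (rule has_weak_deriv_if_weak_L2_deriv[OF assms])
  then have d: "has_weak_deriv u (weak_deriv u)"
    unfolding weak_deriv_def by (rule someI[of "has_weak_deriv u"])
  show AE: "AE x in unit_meas. h x = weak_deriv u x" by (rule has_weak_deriv_unique[OF h d])
  have "weak_deriv u \<in> borel_measurable unit_meas"
    using d unfolding has_weak_deriv_def by (intro locally_integrable_measurable) blast
  then show L: "weak_deriv u \<in> L2 unit_meas"
    by (rule L2_AE_cong[OF weak_L2_deriv_L2[OF assms(2)] _ AE])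
  show "weak_L2_deriv u (weak_deriv u)" by (rule weak_L2_deriv_AE_cong[OF assms(2) L AE])
qed

lemma weak_L2_deriv_unique:
  assumes "integrable unit_meas u" "weak_L2_deriv u h" "weak_L2_deriv u k"
  shows "AE x in unit_meas. h x = k x"
  using weak_deriv_L2(1)[OF assms(1,2)] weak_deriv_L2(1)[OF assms(1,3)] by eventually_elim simp

definition weak_range :: "real \<Rightarrow> ((real \<Rightarrow> real) \<Rightarrow> real \<Rightarrow> real) \<Rightarrow> (real \<Rightarrow> real) set" where
  "weak_range \<mu> J = {h. \<exists>w\<in>H0 \<mu>. weak_L2_deriv (J w) h}"

text \<open>
  An operator \<open>J\<close> such that the weak derivative of \<open>J w\<close> controls \<open>w\<close> in \<open>H\<^sup>\<mu>\<^sub>0(0,1)\<close> and conversely.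
  On test functions the weak derivative is given by \<open>A\<close>, and the two-sided estimate is required only
  there. The instances are the identity with \<open>\<mu> = 1\<close> and the fractional integral of order \<open>\<beta>\<close> with
  \<open>\<mu> = 1 - \<beta>\<close>.
\<close>

locale weak_operator =
  fixes \<mu> c C :: real and J A :: "(real \<Rightarrow> real) \<Rightarrow> real \<Rightarrow> real"
  assumes c: "0 < c" and C: "0 < C"
    and J_integrable: "w \<in> unit_L2 \<Longrightarrow> integrable unit_meas (J w)"
    and J_dual: "test_function \<psi> \<Longrightarrow>
      \<exists>\<eta>\<in>L2 unit_meas. \<forall>w\<in>unit_L2. (LINT x|unit_meas. J w x * deriv \<psi> x) = ip unit_meas w \<eta>"
    and A: "test_function \<phi> \<Longrightarrow> weak_L2_deriv (J \<phi>) (A \<phi>)"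
    and lower: "test_function \<phi> \<Longrightarrow> ennreal c * Hnorm_sq \<mu> \<phi> \<le> ennreal (normsq unit_meas (A \<phi>))"
    and upper: "test_function \<phi> \<Longrightarrow> ennreal (normsq unit_meas (A \<phi>)) \<le> ennreal C * Hnorm_sq \<mu> \<phi>"
begin

lemma weak_deriv_add:
  assumes "w \<in> unit_L2" "z \<in> unit_L2" "weak_L2_deriv (J w) h" "weak_L2_deriv (J z) k"
  shows "weak_L2_deriv (J (\<lambda>x. w x + z x)) (\<lambda>x. h x + k x)"
  unfolding weak_L2_deriv_def
proof (intro conjI allI impI)
  note L = weak_L2_deriv_L2[OF assms(3)] weak_L2_deriv_L2[OF assms(4)]
  show "(\<lambda>x. h x + k x) \<in> L2 unit_meas" by (intro L2_add L)
  fix \<psi> assume \<psi>: "test_function \<psi>"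
  obtain \<eta> where \<eta>: "\<eta> \<in> L2 unit_meas"
    "\<And>w. w \<in> unit_L2 \<Longrightarrow> (LINT x|unit_meas. J w x * deriv \<psi> x) = ip unit_meas w \<eta>"
    using J_dual[OF \<psi>] by blast
  show "(LINT x|unit_meas. J (\<lambda>x. w x + z x) x * deriv \<psi> x) = - ip unit_meas (\<lambda>x. h x + k x) \<psi>"
    using \<eta>(2)[OF unit_L2_add[OF assms(1,2)]] \<eta>(2)[OF assms(1)] \<eta>(2)[OF assms(2)]
      weak_L2_deriv_eq[OF assms(3) \<psi>] weak_L2_deriv_eq[OF assms(4) \<psi>]
    by (simp add: ip_add_left L unit_L2_D(3)[OF assms(1)] unit_L2_D(3)[OF assms(2)] \<eta>(1) test_function_L2[OF \<psi>])
qed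

lemma weak_deriv_scale:
  assumes "w \<in> unit_L2" "weak_L2_deriv (J w) h"
  shows "weak_L2_deriv (J (\<lambda>x. a * w x)) (\<lambda>x. a * h x)"
  unfolding weak_L2_deriv_def
proof (intro conjI allI impI)
  show "(\<lambda>x. a * h x) \<in> L2 unit_meas" by (intro L2_scale weak_L2_deriv_L2[OF assms(2)])
  fix \<psi> assume \<psi>: "test_function \<psi>"
  obtain \<eta> where \<eta>: "\<And>w. w \<in> unit_L2 \<Longrightarrow> (LINT x|unit_meas. J w x * deriv \<psi> x) = ip unit_meas w \<eta>"
    using J_dual[OF \<psi>] by blast
  show "(LINT x|unit_meas. J (\<lambda>x. a * w x) x * deriv \<psi> x) = - ip unit_meas (\<lambda>x. a * h x) \<psi>"
    using \<eta>[OF unit_L2_scale[OF assms(1), of a]] \<eta>[OF assms(1)] weak_L2_deriv_eq[OF assms(2) \<psi>]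
    unfolding ip_scale_left by (metis mult_minus_right)
qed

lemma weak_deriv_diff:
  assumes "w \<in> unit_L2" "z \<in> unit_L2" "weak_L2_deriv (J w) h" "weak_L2_deriv (J z) k"
  shows "weak_L2_deriv (J (\<lambda>x. w x - z x)) (\<lambda>x. h x - k x)"
  using weak_deriv_add[OF assms(1) unit_L2_scale[OF assms(2), of "-1"] assms(3) weak_deriv_scale[OF assms(2,4), of "-1"]]
  by simp

lemma A_diff:
  assumes "test_function \<phi>" "test_function \<psi>"
  shows "normsq unit_meas (\<lambda>x. A \<phi> x - A \<psi> x) = normsq unit_meas (A (\<lambda>x. \<phi> x - \<psi> x))"
proof (rule normsq_AE_cong)
  note U = unit_L2_test_function[OF assms(1)] unit_L2_test_function[OF assms(2)]
  have d: "weak_L2_deriv (J (\<lambda>x. \<phi> x - \<psi> x)) (\<lambda>x. A \<phi> x - A \<psi> x)"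
    by (intro weak_deriv_diff U A assms)
  have a: "weak_L2_deriv (J (\<lambda>x. \<phi> x - \<psi> x)) (A (\<lambda>x. \<phi> x - \<psi> x))"
    by (intro A test_function_diff assms)
  show "AE x in unit_meas. A \<phi> x - A \<psi> x = A (\<lambda>x. \<phi> x - \<psi> x) x"
    by (rule weak_L2_deriv_unique[OF J_integrable[OF unit_L2_diff[OF U]] d a])
  show "(\<lambda>x. A \<phi> x - A \<psi> x) \<in> borel_measurable unit_meas" "A (\<lambda>x. \<phi> x - \<psi> x) \<in> borel_measurable unit_meas"
    using d a by (auto intro: L2_measurable weak_L2_deriv_L2)
qed

lemma A_L2: "test_function \<phi> \<Longrightarrow> A \<phi> \<in> L2 unit_meas"
  by (rule weak_L2_deriv_L2[OF A])

text \<open>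
  The extension from test functions by continuity. For the passage to the limit in the estimates the
  inequality \<open>(a + b)\<^sup>2 \<le> 2 a\<^sup>2 + 2 b\<^sup>2\<close> is good enough, at the price of a factor 2.
\<close>

lemma extension:
  assumes w: "w \<in> H0 \<mu>" and \<phi>: "\<And>n::nat. test_function (\<phi> n)"
    and lim: "(\<lambda>n. Hnorm_sq \<mu> (\<lambda>x. w x - \<phi> n x)) \<longlonglongrightarrow> 0"
  obtains h where "weak_L2_deriv (J w) h" "(\<lambda>n. normsq unit_meas (\<lambda>x. A (\<phi> n) x - h x)) \<longlonglongrightarrow> 0"
    "ennreal c * Hnorm_sq \<mu> w \<le> ennreal (2 * normsq unit_meas h)"
    "ennreal (normsq unit_meas h) \<le> ennreal (2 * C) * Hnorm_sq \<mu> w"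
proof -
  have wU: "w \<in> unit_L2" by (rule H0_unit_L2[OF w])
  have \<phi>U: "\<phi> n \<in> unit_L2" for n by (rule unit_L2_test_function[OF \<phi>])
  have sym: "Hnorm_sq \<mu> (\<lambda>x. \<phi> n x - w x) = Hnorm_sq \<mu> (\<lambda>x. w x - \<phi> n x)" for n
    using Hnorm_sq_scale[OF unit_L2_D(1)[OF unit_L2_diff[OF wU \<phi>U]], of \<mu> "-1" n] by simp
  have "\<exists>N. \<forall>m\<ge>N. \<forall>n\<ge>N. normsq unit_meas (\<lambda>x. A (\<phi> m) x - A (\<phi> n) x) \<le> e" if e: "0 < e" for e
  proof -
    define d where "d = ennreal (e / (4 * C))"
    have "0 < d" using e C by (simp add: d_def)
    then have "\<forall>\<^sub>F n in sequentially. Hnorm_sq \<mu> (\<lambda>x. w x - \<phi> n x) < d"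
      by (rule order_tendstoD(2)[OF lim])
    then obtain N where N: "\<And>n. N \<le> n \<Longrightarrow> Hnorm_sq \<mu> (\<lambda>x. w x - \<phi> n x) < d"
      by (auto simp: eventually_sequentially)
    have "normsq unit_meas (\<lambda>x. A (\<phi> m) x - A (\<phi> n) x) \<le> e" if "N \<le> m" "N \<le> n" for m n
    proof -
      have "ennreal (normsq unit_meas (\<lambda>x. A (\<phi> m) x - A (\<phi> n) x))
          \<le> ennreal C * Hnorm_sq \<mu> (\<lambda>x. \<phi> m x - \<phi> n x)"
        unfolding A_diff[OF \<phi> \<phi>] by (intro upper test_function_diff \<phi>)
      also have "\<dots> \<le> ennreal C * (2 * Hnorm_sq \<mu> (\<lambda>x. \<phi> m x - w x) + 2 * Hnorm_sq \<mu> (\<lambda>x. \<phi> n x - w x))"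
        by (intro mult_left_mono Hnorm_sq_triangle \<phi>U wU) simp
      also have "\<dots> \<le> ennreal C * (2 * d + 2 * d)"
        unfolding sym using N[OF that(1)] N[OF that(2)]
        by (intro mult_left_mono add_mono) auto
      also have "2 * d + 2 * d = ennreal (e / C)"
      proof -
        have "2 * d + 2 * d = ennreal 4 * d"
          by (simp add: distrib_right[symmetric])
        also have "\<dots> = ennreal (4 * (e / (4 * C)))"
          unfolding d_def using e C by (intro ennreal_mult[symmetric]) auto
        finally show ?thesis by simp
      qed
      also have "ennreal C * ennreal (e / C) = ennreal e"
        using e C by (simp add: ennreal_mult[symmetric])
      finally show ?thesis using e by (simp add: ennreal_le_iff)
    qed
    then show ?thesis by blast
  qed
  then obtain h where h: "h \<in> L2 unit_meas" "(\<lambda>n. normsq unit_meas (\<lambda>x. A (\<phi> n) x - h x)) \<longlonglongrightarrow> 0"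
    by (rule unit_meas.L2_complete[OF A_L2[OF \<phi>]])
  have wlim: "(\<lambda>n. normsq unit_meas (\<lambda>x. \<phi> n x - w x)) \<longlonglongrightarrow> 0"
  proof -
    have "(\<lambda>n. ennreal (normsq unit_meas (\<lambda>x. \<phi> n x - w x))) \<longlonglongrightarrow> ennreal 0"
    proof (rule tendsto_sandwich[OF _ _ tendsto_const])
      show "\<forall>\<^sub>F n in sequentially. ennreal (normsq unit_meas (\<lambda>x. \<phi> n x - w x)) \<le> Hnorm_sq \<mu> (\<lambda>x. w x - \<phi> n x)"
        unfolding sym[symmetric] by (intro always_eventually allI normsq_le_Hnorm_sq unit_L2_diff \<phi>U wU)
      show "(\<lambda>n. Hnorm_sq \<mu> (\<lambda>x. w x - \<phi> n x)) \<longlonglongrightarrow> ennreal 0" using lim by simp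
    qed simp
    then show ?thesis by (subst (asm) tendsto_ennreal_iff) (auto simp: normsq_nonneg)
  qed
  have 1: "weak_L2_deriv (J w) h"
    unfolding weak_L2_deriv_def
  proof (intro conjI allI impI h(1))
    fix \<psi> assume \<psi>: "test_function \<psi>"
    obtain \<eta> where \<eta>: "\<eta> \<in> L2 unit_meas"
      "\<And>w. w \<in> unit_L2 \<Longrightarrow> (LINT x|unit_meas. J w x * deriv \<psi> x) = ip unit_meas w \<eta>"
      using J_dual[OF \<psi>] by blast
    have "(\<lambda>n. ip unit_meas (\<phi> n) \<eta>) \<longlonglongrightarrow> ip unit_meas w \<eta>"
      by (rule ip_tendsto_left[OF unit_L2_D(3)[OF \<phi>U] unit_L2_D(3)[OF wU] \<eta>(1) wlim])
    moreover have "ip unit_meas (\<phi> n) \<eta> = - ip unit_meas (A (\<phi> n)) \<psi>" for n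
      using \<eta>(2)[OF \<phi>U] weak_L2_deriv_eq[OF A[OF \<phi>] \<psi>] by simp
    moreover have "(\<lambda>n. - ip unit_meas (A (\<phi> n)) \<psi>) \<longlonglongrightarrow> - ip unit_meas h \<psi>"
      by (intro tendsto_minus ip_tendsto_left A_L2 \<phi> h test_function_L2 \<psi>)
    ultimately show "(LINT x|unit_meas. J w x * deriv \<psi> x) = - ip unit_meas h \<psi>"
      unfolding \<eta>(2)[OF wU] by (metis (no_types, lifting) LIMSEQ_unique ext)
  qed
  have hlim: "(\<lambda>n. ennreal (normsq unit_meas (A (\<phi> n)))) \<longlonglongrightarrow> ennreal (normsq unit_meas h)"
    by (intro tendsto_ennrealI normsq_tendsto A_L2 \<phi> h)
  have 2: "ennreal (normsq unit_meas h) \<le> ennreal (2 * C) * Hnorm_sq \<mu> w"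
  proof (rule LIMSEQ_le[OF hlim])
    have "(\<lambda>n. ennreal C * (2 * Hnorm_sq \<mu> w + 2 * Hnorm_sq \<mu> (\<lambda>x. w x - \<phi> n x)))
        \<longlonglongrightarrow> ennreal C * (2 * Hnorm_sq \<mu> w + 2 * 0)"
      by (intro ennreal_tendsto_cmult tendsto_add tendsto_const lim) auto
    moreover have "ennreal C * (2 * Hnorm_sq \<mu> w + 2 * 0) = ennreal (2 * C) * Hnorm_sq \<mu> w"
      using C by (simp add: ennreal_mult ac_simps)
    ultimately show "(\<lambda>n. ennreal C * (2 * Hnorm_sq \<mu> w + 2 * Hnorm_sq \<mu> (\<lambda>x. w x - \<phi> n x)))
        \<longlonglongrightarrow> ennreal (2 * C) * Hnorm_sq \<mu> w" by simp
    have "ennreal (normsq unit_meas (A (\<phi> n)))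
        \<le> ennreal C * (2 * Hnorm_sq \<mu> w + 2 * Hnorm_sq \<mu> (\<lambda>x. w x - \<phi> n x))" for n
    proof -
      have "Hnorm_sq \<mu> (\<phi> n) \<le> 2 * Hnorm_sq \<mu> w + 2 * Hnorm_sq \<mu> (\<lambda>x. w x - \<phi> n x)"
        using Hnorm_sq_diff_le[OF wU unit_L2_diff[OF wU \<phi>U[of n]], of \<mu>] by simp
      then show ?thesis using upper[OF \<phi>[of n]] by (meson mult_left_mono order_trans zero_le)
    qed
    then show "\<exists>N. \<forall>n\<ge>N. ennreal (normsq unit_meas (A (\<phi> n)))
        \<le> ennreal C * (2 * Hnorm_sq \<mu> w + 2 * Hnorm_sq \<mu> (\<lambda>x. w x - \<phi> n x))" by blast
  qed
  have 3: "ennreal c * Hnorm_sq \<mu> w \<le> ennreal (2 * normsq unit_meas h)"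
  proof (rule LIMSEQ_le[OF tendsto_const])
    have "(\<lambda>n. 2 * ennreal (normsq unit_meas (A (\<phi> n))) + ennreal c * (2 * Hnorm_sq \<mu> (\<lambda>x. w x - \<phi> n x)))
        \<longlonglongrightarrow> 2 * ennreal (normsq unit_meas h) + ennreal c * (2 * 0)"
      by (intro ennreal_tendsto_cmult tendsto_add hlim lim) auto
    then show "(\<lambda>n. 2 * ennreal (normsq unit_meas (A (\<phi> n))) + ennreal c * (2 * Hnorm_sq \<mu> (\<lambda>x. w x - \<phi> n x)))
        \<longlonglongrightarrow> ennreal (2 * normsq unit_meas h)"
      by (simp add: ennreal_mult normsq_nonneg)
    have "ennreal c * Hnorm_sq \<mu> w
        \<le> 2 * ennreal (normsq unit_meas (A (\<phi> n))) + ennreal c * (2 * Hnorm_sq \<mu> (\<lambda>x. w x - \<phi> n x))" for n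
    proof -
      have "Hnorm_sq \<mu> w \<le> 2 * Hnorm_sq \<mu> (\<phi> n) + 2 * Hnorm_sq \<mu> (\<lambda>x. w x - \<phi> n x)"
        using Hnorm_sq_diff_le[OF \<phi>U[of n] unit_L2_diff[OF \<phi>U[of n] wU], of \<mu>] unfolding sym by simp
      then have "ennreal c * Hnorm_sq \<mu> w \<le> ennreal c * (2 * Hnorm_sq \<mu> (\<phi> n) + 2 * Hnorm_sq \<mu> (\<lambda>x. w x - \<phi> n x))"
        by (rule mult_left_mono) simp
      also have "\<dots> = 2 * (ennreal c * Hnorm_sq \<mu> (\<phi> n)) + ennreal c * (2 * Hnorm_sq \<mu> (\<lambda>x. w x - \<phi> n x))"
        by (simp add: distrib_left ac_simps)
      also have "\<dots> \<le> 2 * ennreal (normsq unit_meas (A (\<phi> n))) + ennreal c * (2 * Hnorm_sq \<mu> (\<lambda>x. w x - \<phi> n x))"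
        by (intro add_mono mult_left_mono lower \<phi>) auto
      finally show ?thesis .
    qed
    then show "\<exists>N. \<forall>n\<ge>N. ennreal c * Hnorm_sq \<mu> w
        \<le> 2 * ennreal (normsq unit_meas (A (\<phi> n))) + ennreal c * (2 * Hnorm_sq \<mu> (\<lambda>x. w x - \<phi> n x))" by blast
  qed
  show ?thesis by (rule that[OF 1 h(2) 3 2])
qed

abbreviation T :: "(real \<Rightarrow> real) \<Rightarrow> real \<Rightarrow> real" where
  "T w \<equiv> weak_deriv (J w)"

lemma T_unique:
  assumes "w \<in> H0 \<mu>" "weak_L2_deriv (J w) h"
  shows "AE x in unit_meas. h x = T w x"
  by (rule weak_deriv_L2(1)[OF J_integrable[OF H0_unit_L2[OF assms(1)]] assms(2)])

lemma T:
  assumes "w \<in> H0 \<mu>"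
  shows "weak_L2_deriv (J w) (T w)" "T w \<in> L2 unit_meas" "has_L2_weak_deriv (J w)"
proof -
  obtain \<phi> where \<phi>: "\<And>n::nat. test_function (\<phi> n)" "(\<lambda>n. Hnorm_sq \<mu> (\<lambda>x. w x - \<phi> n x)) \<longlonglongrightarrow> 0"
    using H0_approx[OF assms] by metis
  obtain h where h: "weak_L2_deriv (J w) h"
    by (rule extension[OF assms \<phi>])
  note i = J_integrable[OF H0_unit_L2[OF assms]]
  show "weak_L2_deriv (J w) (T w)" "T w \<in> L2 unit_meas"
    by (rule weak_deriv_L2[OF i h])+
  show "has_L2_weak_deriv (J w)"
    unfolding has_L2_weak_deriv_def set_integrable_unit_meas
    using has_weak_deriv_if_weak_L2_deriv[OF i h] weak_L2_deriv_L2[OF h] by (auto simp: L2_def)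
qed

lemma T_approx:
  assumes w: "w \<in> H0 \<mu>" and \<phi>: "\<And>n::nat. test_function (\<phi> n)"
    and lim: "(\<lambda>n. Hnorm_sq \<mu> (\<lambda>x. w x - \<phi> n x)) \<longlonglongrightarrow> 0"
  shows "(\<lambda>n. normsq unit_meas (\<lambda>x. A (\<phi> n) x - T w x)) \<longlonglongrightarrow> 0"
    and "ennreal c * Hnorm_sq \<mu> w \<le> ennreal (2 * normsq unit_meas (T w))"
    and "ennreal (normsq unit_meas (T w)) \<le> ennreal (2 * C) * Hnorm_sq \<mu> w"
proof -
  obtain h where h: "weak_L2_deriv (J w) h" "(\<lambda>n. normsq unit_meas (\<lambda>x. A (\<phi> n) x - h x)) \<longlonglongrightarrow> 0"
    "ennreal c * Hnorm_sq \<mu> w \<le> ennreal (2 * normsq unit_meas h)"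
    "ennreal (normsq unit_meas h) \<le> ennreal (2 * C) * Hnorm_sq \<mu> w"
    by (rule extension[OF w \<phi> lim])
  note AE = T_unique[OF w h(1)]
  have eq: "normsq unit_meas (T w) = normsq unit_meas h"
    by (rule normsq_AE_cong) (use AE T(2)[OF w] weak_L2_deriv_L2[OF h(1)] in \<open>auto intro: L2_measurable\<close>)
  have "normsq unit_meas (\<lambda>x. A (\<phi> n) x - T w x) = normsq unit_meas (\<lambda>x. A (\<phi> n) x - h x)" for n
  proof (rule normsq_AE_cong)
    show "AE x in unit_meas. A (\<phi> n) x - T w x = A (\<phi> n) x - h x" using AE by eventually_elim simp
  qed (auto intro!: L2_measurable L2_diff A_L2 \<phi> T(2)[OF w] weak_L2_deriv_L2[OF h(1)])
  then show "(\<lambda>n. normsq unit_meas (\<lambda>x. A (\<phi> n) x - T w x)) \<longlonglongrightarrow> 0"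
    using h(2) by simp
  show "ennreal c * Hnorm_sq \<mu> w \<le> ennreal (2 * normsq unit_meas (T w))"
    "ennreal (normsq unit_meas (T w)) \<le> ennreal (2 * C) * Hnorm_sq \<mu> w"
    unfolding eq by (rule h)+
qed

lemma T_add:
  assumes "w \<in> H0 \<mu>" "z \<in> H0 \<mu>"
  shows "AE x in unit_meas. T w x + T z x = T (\<lambda>x. w x + z x) x"
  by (intro T_unique H0_add weak_deriv_add T assms H0_unit_L2[OF assms(1)] H0_unit_L2[OF assms(2)])

lemma T_scale:
  assumes "w \<in> H0 \<mu>"
  shows "AE x in unit_meas. a * T w x = T (\<lambda>x. a * w x) x"
  by (intro T_unique H0_scale weak_deriv_scale T assms H0_unit_L2[OF assms])


lemma Hnorm_finite:
  assumes "w \<in> H0 \<mu>"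
  shows "ennreal ((Hnorm \<mu> w)\<^sup>2) = Hnorm_sq \<mu> w"
proof -
  obtain \<phi> where \<phi>: "\<And>n::nat. test_function (\<phi> n)" "(\<lambda>n. Hnorm_sq \<mu> (\<lambda>x. w x - \<phi> n x)) \<longlonglongrightarrow> 0"
    using H0_approx[OF assms] by metis
  have "ennreal c * Hnorm_sq \<mu> w < \<infinity>"
    using T_approx(2)[OF assms \<phi>] by (rule le_less_trans) simp
  then have "Hnorm_sq \<mu> w < \<infinity>" using c by (auto simp: ennreal_mult_less_top)
  then show ?thesis by (simp add: Hnorm_def)
qed

lemma T_bounds:
  assumes "w \<in> H0 \<mu>"
  shows "c * (Hnorm \<mu> w)\<^sup>2 \<le> 2 * normsq unit_meas (T w)"
    and "normsq unit_meas (T w) \<le> 2 * C * (Hnorm \<mu> w)\<^sup>2"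
proof -
  obtain \<phi> where \<phi>: "\<And>n::nat. test_function (\<phi> n)" "(\<lambda>n. Hnorm_sq \<mu> (\<lambda>x. w x - \<phi> n x)) \<longlonglongrightarrow> 0"
    using H0_approx[OF assms] by metis
  have "ennreal (c * (Hnorm \<mu> w)\<^sup>2) \<le> ennreal (2 * normsq unit_meas (T w))"
    using T_approx(2)[OF assms \<phi>] c unfolding Hnorm_finite[OF assms, symmetric] by (simp add: ennreal_mult)
  then show "c * (Hnorm \<mu> w)\<^sup>2 \<le> 2 * normsq unit_meas (T w)"
    by (subst (asm) ennreal_le_iff) (simp_all add: normsq_nonneg)
  have "ennreal (normsq unit_meas (T w)) \<le> ennreal (2 * C * (Hnorm \<mu> w)\<^sup>2)"
    using T_approx(3)[OF assms \<phi>] C unfolding Hnorm_finite[OF assms, symmetric] by (simp add: ennreal_mult)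
  then show "normsq unit_meas (T w) \<le> 2 * C * (Hnorm \<mu> w)\<^sup>2"
    using C by (subst (asm) ennreal_le_iff) simp_all
qed

lemma Hnorm_eq_0_iff:
  assumes "w \<in> H0 \<mu>"
  shows "Hnorm \<mu> w = 0 \<longleftrightarrow> (AE x in lborel. w x = 0)"
proof
  note U = H0_unit_L2[OF assms]
  have AE: "(AE x in unit_meas. w x = 0) \<longleftrightarrow> (AE x in lborel. w x = 0)"
    unfolding AE_unit_meas using unit_L2_D(2)[OF U] by (intro AE_cong) blast
  show "AE x in lborel. w x = 0" if "Hnorm \<mu> w = 0"
  proof -
    have "ennreal (normsq unit_meas w) \<le> 0"
      using normsq_le_Hnorm_sq[OF U, of \<mu>] Hnorm_finite[OF assms] that by simp
    then have "normsq unit_meas w = 0" using normsq_nonneg[of unit_meas w] by simp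
    then show ?thesis using normsq_0_iff[OF unit_L2_D(3)[OF U]] AE by simp
  qed
  show "Hnorm \<mu> w = 0" if "AE x in lborel. w x = 0"
  proof -
    have "normsq unit_meas w = 0" using normsq_0_iff[OF unit_L2_D(3)[OF U]] AE that by simp
    moreover have "fourier w \<omega> = 0" for \<omega>
    proof -
      have "(LINT x|lborel. exp (- (\<i> * complex_of_real (\<omega> * x))) * complex_of_real (w x)) = 0"
        by (rule integral_eq_zero_AE) (use that in eventually_elim, simp)
      then show ?thesis by (simp add: fourier_def)
    qed
    then have "fourier_seminorm_sq \<mu> w = 0" by (simp add: fourier_seminorm_sq_def)
    ultimately have "Hnorm_sq \<mu> w = 0" by (simp add: Hnorm_sq_unit_L2[OF U])
    then show ?thesis by (simp add: Hnorm_def)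
  qed
qed

abbreviation range_T :: "(real \<Rightarrow> real) set" where
  "range_T \<equiv> weak_range \<mu> J"

text \<open>
  The range is closed because of the lower estimate: if the weak derivatives converge, then the
  functions form a Cauchy sequence.
\<close>

lemma range_T_closed:
  assumes P: "\<And>n::nat. w n \<in> H0 \<mu>" "\<And>n. weak_L2_deriv (J (w n)) (h n)"
    and k: "k \<in> L2 unit_meas" "(\<lambda>n. normsq unit_meas (\<lambda>x. h n x - k x)) \<longlonglongrightarrow> 0"
  obtains z where "z \<in> H0 \<mu>" "weak_L2_deriv (J z) k" "(\<lambda>n. Hnorm \<mu> (\<lambda>x. w n x - z x)) \<longlonglongrightarrow> 0"
proof -
  note wU = H0_unit_L2[OF P(1)] and hL = weak_L2_deriv_L2[OF P(2)]
  have le: "ennreal c * Hnorm_sq \<mu> u \<le> ennreal (2 * normsq unit_meas g)"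
    and le': "ennreal (normsq unit_meas g) \<le> ennreal (2 * C) * Hnorm_sq \<mu> u"
    if u: "u \<in> H0 \<mu>" and g: "weak_L2_deriv (J u) g" for u g
  proof -
    obtain \<phi> where \<phi>: "\<And>n::nat. test_function (\<phi> n)" "(\<lambda>n. Hnorm_sq \<mu> (\<lambda>x. u x - \<phi> n x)) \<longlonglongrightarrow> 0"
      using H0_approx[OF u] by metis
    have "normsq unit_meas (T u) = normsq unit_meas g"
      by (rule normsq_AE_cong) (use T_unique[OF u g] T(2)[OF u] weak_L2_deriv_L2[OF g] in \<open>auto intro: L2_measurable\<close>)
    then show "ennreal c * Hnorm_sq \<mu> u \<le> ennreal (2 * normsq unit_meas g)"
      "ennreal (normsq unit_meas g) \<le> ennreal (2 * C) * Hnorm_sq \<mu> u"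
      using T_approx(2,3)[OF u \<phi>] by simp_all
  qed
  have "\<exists>N. \<forall>m\<ge>N. \<forall>n\<ge>N. Hnorm_sq \<mu> (\<lambda>x. w m x - w n x) \<le> ennreal e" if e: "0 < e" for e
  proof -
    have "0 < c * e / 8" using c e by simp
    then have "\<forall>\<^sub>F n in sequentially. normsq unit_meas (\<lambda>x. h n x - k x) < c * e / 8"
      by (rule order_tendstoD(2)[OF k(2)])
    then obtain N where N: "\<And>n. N \<le> n \<Longrightarrow> normsq unit_meas (\<lambda>x. h n x - k x) < c * e / 8"
      by (auto simp: eventually_sequentially)
    have "Hnorm_sq \<mu> (\<lambda>x. w m x - w n x) \<le> ennreal e" if "N \<le> m" "N \<le> n" for m n
    proof -
      have "normsq unit_meas (\<lambda>x. h m x - h n x)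
          \<le> 2 * normsq unit_meas (\<lambda>x. h m x - k x) + 2 * normsq unit_meas (\<lambda>x. h n x - k x)"
        using normsq_diff_le[OF L2_diff[OF hL[of m] k(1)] L2_diff[OF hL[of n] k(1)]] by simp
      then have "2 * normsq unit_meas (\<lambda>x. h m x - h n x) \<le> c * e"
        using N[OF that(1)] N[OF that(2)] by simp
      then have "ennreal c * Hnorm_sq \<mu> (\<lambda>x. w m x - w n x) \<le> ennreal (c * e)"
        using le[OF H0_diff[OF P(1)[of m] P(1)[of n]] weak_deriv_diff[OF wU wU P(2)[of m] P(2)[of n]]]
        by (meson ennreal_leI order_trans)
      then have "ennreal (1 / c) * (ennreal c * Hnorm_sq \<mu> (\<lambda>x. w m x - w n x)) \<le> ennreal (1 / c) * ennreal (c * e)"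
        by (rule mult_left_mono) simp
      then show ?thesis using c e by (simp add: mult.assoc[symmetric] ennreal_mult[symmetric])
    qed
    then show ?thesis by blast
  qed
  then obtain z where z: "z \<in> H0 \<mu>" "(\<lambda>n. Hnorm_sq \<mu> (\<lambda>x. w n x - z x)) \<longlonglongrightarrow> 0"
    by (rule H0_complete[OF P(1)])
  have "(\<lambda>n. ennreal (normsq unit_meas (\<lambda>x. h n x - T z x))) \<longlonglongrightarrow> ennreal 0"
  proof (rule tendsto_sandwich[OF _ _ tendsto_const])
    show "\<forall>\<^sub>F n in sequentially. ennreal (normsq unit_meas (\<lambda>x. h n x - T z x))
        \<le> ennreal (2 * C) * Hnorm_sq \<mu> (\<lambda>x. w n x - z x)"
      by (intro always_eventually allI le' H0_diff P z weak_deriv_diff wU H0_unit_L2[OF z(1)] T)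
    have "(\<lambda>n. ennreal (2 * C) * Hnorm_sq \<mu> (\<lambda>x. w n x - z x)) \<longlonglongrightarrow> ennreal (2 * C) * 0"
      by (intro ennreal_tendsto_cmult z) simp
    then show "(\<lambda>n. ennreal (2 * C) * Hnorm_sq \<mu> (\<lambda>x. w n x - z x)) \<longlonglongrightarrow> ennreal 0" by simp
  qed simp
  then have lim: "(\<lambda>n. normsq unit_meas (\<lambda>x. h n x - T z x)) \<longlonglongrightarrow> 0"
    by (subst (asm) tendsto_ennreal_iff) (auto simp: normsq_nonneg)
  note TzL = T(2)[OF z(1)]
  have "normsq unit_meas (\<lambda>x. T z x - k x) \<le> 0"
  proof (rule LIMSEQ_le[OF tendsto_const])
    have "(\<lambda>n. 2 * normsq unit_meas (\<lambda>x. h n x - k x) + 2 * normsq unit_meas (\<lambda>x. h n x - T z x)) \<longlonglongrightarrow> 2 * 0 + 2 * 0"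
      by (intro tendsto_intros k lim)
    then show "(\<lambda>n. 2 * normsq unit_meas (\<lambda>x. h n x - k x) + 2 * normsq unit_meas (\<lambda>x. h n x - T z x)) \<longlonglongrightarrow> 0"
      by simp
    have "normsq unit_meas (\<lambda>x. T z x - k x)
        \<le> 2 * normsq unit_meas (\<lambda>x. h n x - k x) + 2 * normsq unit_meas (\<lambda>x. h n x - T z x)" for n
      using normsq_diff_le[OF L2_diff[OF hL[of n] k(1)] L2_diff[OF hL[of n] TzL]] by simp
    then show "\<exists>N. \<forall>n\<ge>N. normsq unit_meas (\<lambda>x. T z x - k x)
        \<le> 2 * normsq unit_meas (\<lambda>x. h n x - k x) + 2 * normsq unit_meas (\<lambda>x. h n x - T z x)" by blast
  qed
  then have "AE x in unit_meas. T z x - k x = 0"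
    using normsq_0_iff[OF L2_diff[OF TzL k(1)]] normsq_nonneg[of unit_meas "\<lambda>x. T z x - k x"] by simp
  then have "AE x in unit_meas. T z x = k x" by eventually_elim simp
  then have zk: "weak_L2_deriv (J z) k" by (rule weak_L2_deriv_AE_cong[OF T(1)[OF z(1)] k(1)])
  have "(\<lambda>n. ennreal ((Hnorm \<mu> (\<lambda>x. w n x - z x))\<^sup>2)) \<longlonglongrightarrow> ennreal 0"
    using z(2) by (simp add: Hnorm_finite H0_diff P(1) z(1))
  then have "(\<lambda>n. (Hnorm \<mu> (\<lambda>x. w n x - z x))\<^sup>2) \<longlonglongrightarrow> 0"
    by (subst (asm) tendsto_ennreal_iff) auto
  then have "(\<lambda>n. sqrt ((Hnorm \<mu> (\<lambda>x. w n x - z x))\<^sup>2)) \<longlonglongrightarrow> sqrt 0"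
    by (rule tendsto_real_sqrt)
  then have "(\<lambda>n. Hnorm \<mu> (\<lambda>x. w n x - z x)) \<longlonglongrightarrow> 0"
    by (simp add: Hnorm_def)
  from that[OF z(1) zk this] show ?thesis .
qed

lemma range_T_L2: "range_T \<subseteq> L2 unit_meas"
  unfolding weak_range_def using weak_L2_deriv_L2 by blast

lemma range_T_projection:
  assumes "g \<in> L2 unit_meas"
  obtains m where "m \<in> range_T" "\<And>v. v \<in> range_T \<Longrightarrow> ip unit_meas (\<lambda>x. g x - m x) v = 0"
proof (rule unit_meas.L2_projection[OF range_T_L2 _ _ _ _ assms])
  have "(\<lambda>x. 0) \<in> H0 \<mu>"
    by (rule test_function_H0) (rule test_functionI[of _ "1/2" "1/2"], auto intro: smooth_const)
  then show "range_T \<noteq> {}" unfolding weak_range_def using T(1) by blast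
  show "(\<lambda>x. f x + g x) \<in> range_T" if "f \<in> range_T" "g \<in> range_T" for f g
    using that unfolding weak_range_def by (blast intro: H0_add weak_deriv_add H0_unit_L2)
  show "(\<lambda>x. a * f x) \<in> range_T" if "f \<in> range_T" for f a
    using that unfolding weak_range_def by (blast intro: H0_scale weak_deriv_scale H0_unit_L2)
  show "h \<in> range_T" if "\<And>n::nat. f n \<in> range_T" "h \<in> L2 unit_meas"
    "(\<lambda>n. normsq unit_meas (\<lambda>x. f n x - h x)) \<longlonglongrightarrow> 0" for f h
  proof -
    have "\<forall>n. \<exists>w. w \<in> H0 \<mu> \<and> weak_L2_deriv (J w) (f n)"
      using that(1) unfolding weak_range_def by blast
    from choice[OF this] obtain w where w: "\<And>n. w n \<in> H0 \<mu>" "\<And>n. weak_L2_deriv (J (w n)) (f n)"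
      by blast
    show ?thesis
      by (rule range_T_closed[OF w that(2,3)]) (auto simp: weak_range_def)
  qed
qed (use that in blast)

lemma range_T_eq_L2:
  assumes "\<And>z. z \<in> L2 unit_meas \<Longrightarrow> (\<And>v. v \<in> range_T \<Longrightarrow> ip unit_meas z v = 0) \<Longrightarrow> normsq unit_meas z = 0"
  shows "range_T = L2 unit_meas"
proof (rule antisym[OF range_T_L2], rule subsetI)
  fix g assume g: "g \<in> L2 unit_meas"
  obtain m where m: "m \<in> range_T" "\<And>v. v \<in> range_T \<Longrightarrow> ip unit_meas (\<lambda>x. g x - m x) v = 0"
    using range_T_projection[OF g] by blast
  have mL: "m \<in> L2 unit_meas" using m(1) range_T_L2 by blast
  have "normsq unit_meas (\<lambda>x. g x - m x) = 0" by (rule assms[OF L2_diff[OF g mL] m(2)])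
  then have "AE x in unit_meas. g x - m x = 0" using normsq_0_iff[OF L2_diff[OF g mL]] by simp
  then have "AE x in unit_meas. m x = g x" by eventually_elim simp
  then show "g \<in> range_T"
    using m(1) weak_L2_deriv_AE_cong[OF _ g] unfolding weak_range_def by blast
qed

end


section \<open>Coercivity estimates\<close>

lemma ennreal_mult_assoc:
  "0 \<le> a \<Longrightarrow> 0 \<le> b \<Longrightarrow> ennreal a * (ennreal b * x) = ennreal (a * b) * x"
  by (simp add: ennreal_mult mult.assoc)

lemma Hnorm_sq_le_if_seminorm:
  assumes \<phi>: "test_function \<phi>" and C: "0 < C"
    and P: "ennreal (normsq unit_meas \<phi>) \<le> ennreal C * fourier_seminorm_sq \<mu> \<phi>"
  shows "Hnorm_sq \<mu> \<phi> \<le> ennreal (C + 1) * fourier_seminorm_sq \<mu> \<phi>"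
proof -
  have "Hnorm_sq \<mu> \<phi> \<le> ennreal C * fourier_seminorm_sq \<mu> \<phi> + fourier_seminorm_sq \<mu> \<phi>"
    unfolding Hnorm_sq_unit_L2[OF unit_L2_test_function[OF \<phi>]] by (intro add_right_mono P)
  also have "\<dots> = ennreal (C + 1) * fourier_seminorm_sq \<mu> \<phi>"
    using C by (simp add: distrib_right)
  finally show ?thesis .
qed

lemma weak_L2_deriv_test_function:
  assumes \<phi>: "test_function \<phi>"
  shows "weak_L2_deriv \<phi> (deriv \<phi>)"
  unfolding weak_L2_deriv_def ip_def
proof (intro conjI allI impI)
  show "deriv \<phi> \<in> L2 unit_meas" by (intro test_function_L2 test_function_deriv \<phi>)
  fix \<psi> assume \<psi>: "test_function \<psi>"
  note d = test_function_deriv[OF \<phi>] test_function_deriv[OF \<psi>]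
  have "(LINT x|lborel. \<phi> x * deriv \<psi> x) = - (LINT x|lborel. deriv \<phi> x * \<psi> x)"
    by (rule integration_by_parts[OF test_function_DERIV[OF \<phi>] test_function_continuous[OF d(1)] \<psi>])
  moreover have "(LINT x|unit_meas. \<phi> x * deriv \<psi> x) = (LINT x|lborel. \<phi> x * deriv \<psi> x)"
    by (rule integral_unit_meas) (simp add: test_function_eq_0[OF \<phi>])
  moreover have "(LINT x|unit_meas. deriv \<phi> x * \<psi> x) = (LINT x|lborel. deriv \<phi> x * \<psi> x)"
    by (rule integral_unit_meas) (simp add: test_function_eq_0[OF \<psi>])
  ultimately show "(LINT x|unit_meas. \<phi> x * deriv \<psi> x) = - (LINT x|unit_meas. deriv \<phi> x * \<psi> x)" by simp
qed

lemma weak_operator_deriv: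
  obtains c C where "weak_operator 1 c C (\<lambda>w. w) deriv"
proof (rule Poincare[of 1])
  fix P :: real
  assume P: "0 < P" "\<And>\<phi>. test_function \<phi> \<Longrightarrow> ennreal (normsq unit_meas \<phi>) \<le> ennreal P * fourier_seminorm_sq 1 \<phi>"
  have "weak_operator 1 (1 / (P + 1)) 1 (\<lambda>w. w) deriv"
  proof
    fix w assume "w \<in> unit_L2"
    then show "integrable unit_meas w" by (intro unit_meas.L2_integrable unit_L2_D(3))
  next
    fix \<psi> assume "test_function \<psi>"
    then show "\<exists>\<eta>\<in>L2 unit_meas. \<forall>w\<in>unit_L2. (LINT x|unit_meas. w x * deriv \<psi> x) = ip unit_meas w \<eta>"
      by (intro bexI[of _ "deriv \<psi>"]) (auto simp: ip_def intro: test_function_L2 test_function_deriv)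
  next
    fix \<phi> assume \<phi>: "test_function \<phi>"
    show "weak_L2_deriv \<phi> (deriv \<phi>)" by (rule weak_L2_deriv_test_function[OF \<phi>])
    note S = fourier_seminorm_deriv[OF \<phi>]
    have "Hnorm_sq 1 \<phi> \<le> ennreal (P + 1) * ennreal (normsq unit_meas (deriv \<phi>))"
      using Hnorm_sq_le_if_seminorm[OF \<phi> P(1) P(2)[OF \<phi>]] unfolding S .
    then have "ennreal (1 / (P + 1)) * Hnorm_sq 1 \<phi>
        \<le> ennreal (1 / (P + 1)) * (ennreal (P + 1) * ennreal (normsq unit_meas (deriv \<phi>)))"
      by (rule mult_left_mono) simp
    also have "\<dots> = ennreal (1 / (P + 1) * (P + 1)) * ennreal (normsq unit_meas (deriv \<phi>))"
      using P(1) by (intro ennreal_mult_assoc) auto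
    finally show "ennreal (1 / (P + 1)) * Hnorm_sq 1 \<phi> \<le> ennreal (normsq unit_meas (deriv \<phi>))"
      using P(1) by simp
    show "ennreal (normsq unit_meas (deriv \<phi>)) \<le> ennreal 1 * Hnorm_sq 1 \<phi>"
      unfolding Hnorm_sq_unit_L2[OF unit_L2_test_function[OF \<phi>]] S by simp
  qed (use P(1) in simp_all)
  then show ?thesis by (rule that)
qed simp

lemma weak_operator_frac_aux:
  assumes \<beta>: "0 < \<beta>" "\<beta> < 1/2" and \<theta>: "0 \<le> \<theta>" "\<theta> \<le> 1" and c: "0 < c" "0 < C"
    and lower: "\<And>\<phi>. test_function \<phi> \<Longrightarrow> ennreal c * Hnorm_sq \<mu> \<phi> \<le> ennreal (normsq unit_meas (frac_int \<beta> \<theta> (deriv \<phi>)))"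
    and upper: "\<And>\<phi>. test_function \<phi> \<Longrightarrow> ennreal (normsq unit_meas (frac_int \<beta> \<theta> (deriv \<phi>))) \<le> ennreal C * Hnorm_sq \<mu> \<phi>"
  shows "weak_operator \<mu> c C (frac_int \<beta> \<theta>) (\<lambda>\<phi>. frac_int \<beta> \<theta> (deriv \<phi>))"
proof
  fix w assume w: "w \<in> unit_L2"
  show "integrable unit_meas (frac_int \<beta> \<theta> w)"
    by (rule frac_int_integrable[OF \<beta>(1) unit_L2_integrable(1)[OF w] unit_L2_D(2)[OF w]])
next
  fix \<psi> assume \<psi>: "test_function \<psi>"
  note d = test_function_deriv[OF \<psi>]
  note bd = bdd_unit_test_function[OF d]
  show "\<exists>\<eta>\<in>L2 unit_meas. \<forall>w\<in>unit_L2. (LINT x|unit_meas. frac_int \<beta> \<theta> w x * deriv \<psi> x) = ip unit_meas w \<eta>"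
  proof (intro bexI[of _ "frac_int \<beta> (1 - \<theta>) (deriv \<psi>)"] ballI)
    show "frac_int \<beta> (1 - \<theta>) (deriv \<psi>) \<in> L2 unit_meas" by (rule frac_int_L2[OF \<beta> bd])
    fix w assume w: "w \<in> unit_L2"
    have "(LINT x|unit_meas. frac_int \<beta> \<theta> w x * deriv \<psi> x) = (LINT x|lborel. frac_int \<beta> \<theta> w x * deriv \<psi> x)"
      by (rule integral_unit_meas) (simp add: test_function_eq_0[OF d])
    also have "\<dots> = (LINT x|lborel. w x * frac_int \<beta> (1 - \<theta>) (deriv \<psi>) x)"
      by (rule frac_int_duality(2)[OF \<beta>(1) unit_L2_integrable(1)[OF w] unit_L2_D(2)[OF w] bd])
    also have "\<dots> = ip unit_meas w (frac_int \<beta> (1 - \<theta>) (deriv \<psi>))"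
      unfolding ip_def
    proof (rule integral_unit_meas[symmetric])
      fix x :: real assume "x \<notin> {0<..<1}"
      from unit_L2_D(2)[OF w this] show "w x * frac_int \<beta> (1 - \<theta>) (deriv \<psi>) x = 0" by simp
    qed
    finally show "(LINT x|unit_meas. frac_int \<beta> \<theta> w x * deriv \<psi> x)
      = ip unit_meas w (frac_int \<beta> (1 - \<theta>) (deriv \<psi>))" .
  qed
next
  fix \<phi> assume \<phi>: "test_function \<phi>"
  show "weak_L2_deriv (frac_int \<beta> \<theta> \<phi>) (frac_int \<beta> \<theta> (deriv \<phi>))"
    unfolding weak_L2_deriv_def ip_def
    using frac_int_L2[OF \<beta> bdd_unit_test_function[OF test_function_deriv[OF \<phi>]]]
      frac_int_integration_by_parts[OF \<beta>(1) \<phi>] by blast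
qed (rule c lower upper; assumption?)+

text \<open>
  Let \<open>E\<close> be the Riesz energy of order \<open>2 * \<beta>\<close> of \<open>deriv \<phi>\<close>. By Poincare's inequality it is
  equivalent to the square of the norm of \<open>\<phi>\<close> with the exponent \<open>1 - \<beta>\<close>; by the formulas for the
  quadratic forms it bounds the squared norm of \<open>T\<^sub>\<theta> \<phi>\<close> and is bounded by the product of \<open>T\<^sub>\<theta> \<phi>\<close> with
  \<open>T\<^sub>1\<^sub>/\<^sub>2 \<phi>\<close>.
\<close>

lemma frac_test_estimates:
  assumes \<beta>: "0 < \<beta>" "\<beta> < 1/2"
  obtains a b c d where "0 < a" "0 < b" "0 < c" "0 < d"
    "\<And>\<phi>. test_function \<phi> \<Longrightarrow> ennreal a * Hnorm_sq (1 - \<beta>) \<phi> \<le> ennreal (riesz_energy (2 * \<beta>) (deriv \<phi>))"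
    "\<And>\<phi>. test_function \<phi> \<Longrightarrow> ennreal (riesz_energy (2 * \<beta>) (deriv \<phi>)) \<le> ennreal b * Hnorm_sq (1 - \<beta>) \<phi>"
    "\<And>\<phi>. test_function \<phi> \<Longrightarrow> 0 \<le> riesz_energy (2 * \<beta>) (deriv \<phi>)"
    "\<And>\<phi> \<theta>. test_function \<phi> \<Longrightarrow> 0 \<le> \<theta> \<Longrightarrow> \<theta> \<le> 1 \<Longrightarrow>
      normsq unit_meas (frac_int \<beta> \<theta> (deriv \<phi>)) \<le> c * riesz_energy (2 * \<beta>) (deriv \<phi>)"
    "\<And>\<phi> \<theta>. test_function \<phi> \<Longrightarrow> 0 \<le> \<theta> \<Longrightarrow> \<theta> \<le> 1 \<Longrightarrow>
      d * riesz_energy (2 * \<beta>) (deriv \<phi>) \<le> ip unit_meas (frac_int \<beta> \<theta> (deriv \<phi>)) (frac_int \<beta> (1/2) (deriv \<phi>))"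
proof -
  have G: "0 < Gamma \<beta>" using \<beta> by (simp add: Gamma_real_pos)
  have \<alpha>: "0 < 2 * \<beta>" "2 * \<beta> < 1" and \<mu>: "0 < 1 - \<beta>" using \<beta> by auto
  show ?thesis
  proof (rule riesz_energy_deriv[OF \<alpha>], rule Poincare[OF \<mu>])
    fix r P :: real
    assume r: "0 < r" and R: "\<And>\<phi>. test_function \<phi> \<Longrightarrow> 0 \<le> riesz_energy (2 * \<beta>) (deriv \<phi>) \<and>
        ennreal (riesz_energy (2 * \<beta>) (deriv \<phi>)) = ennreal r * fourier_seminorm_sq (1 - 2 * \<beta> / 2) \<phi>"
      and P: "0 < P" "\<And>\<phi>. test_function \<phi> \<Longrightarrow> ennreal (normsq unit_meas \<phi>) \<le> ennreal P * fourier_seminorm_sq (1 - \<beta>) \<phi>"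
    \<comment> \<open>The summand 1 spares a proof that \<open>kernel_const_same \<beta>\<close> is positive.\<close>
    define c where "c = 4 / (Gamma \<beta>)\<^sup>2 * enn2real (kernel_const_same \<beta>) + 1"
    define d where "d = enn2real (kernel_const_opposite \<beta> \<beta>) / (4 * (Gamma \<beta>)\<^sup>2)"
    have Re: "0 \<le> riesz_energy (2 * \<beta>) (deriv \<phi>)"
        "ennreal (riesz_energy (2 * \<beta>) (deriv \<phi>)) = ennreal r * fourier_seminorm_sq (1 - \<beta>) \<phi>"
      if "test_function \<phi>" for \<phi>
      using R[OF that] by simp_all
    show ?thesis
    proof (rule that[of "r / (P + 1)" r c d])
      show "0 < r / (P + 1)" "0 < r" using r P by auto
      show "0 < c" by (simp add: c_def add_nonneg_pos)
      show "0 < d"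
        unfolding d_def
      proof (intro divide_pos_pos)
        show "0 < enn2real (kernel_const_opposite \<beta> \<beta>)"
          using kernel_const_opposite_bounds[of \<beta> \<beta>] \<beta> by (simp add: enn2real_positive_iff)
        show "0 < 4 * (Gamma \<beta>)\<^sup>2" using G by (intro mult_pos_pos zero_less_power) auto
      qed
      fix \<phi> assume \<phi>: "test_function \<phi>"
      note bd = bdd_unit_test_function[OF test_function_deriv[OF \<phi>]]
      show E: "0 \<le> riesz_energy (2 * \<beta>) (deriv \<phi>)" by (rule Re(1)[OF \<phi>])
      have "ennreal (r / (P + 1)) * Hnorm_sq (1 - \<beta>) \<phi>
          \<le> ennreal (r / (P + 1)) * (ennreal (P + 1) * fourier_seminorm_sq (1 - \<beta>) \<phi>)"
        by (intro mult_left_mono Hnorm_sq_le_if_seminorm \<phi> P) auto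
      also have "\<dots> = ennreal (r / (P + 1) * (P + 1)) * fourier_seminorm_sq (1 - \<beta>) \<phi>"
        using r P(1) by (intro ennreal_mult_assoc) auto
      also have "r / (P + 1) * (P + 1) = r" using P(1) by simp
      finally show "ennreal (r / (P + 1)) * Hnorm_sq (1 - \<beta>) \<phi> \<le> ennreal (riesz_energy (2 * \<beta>) (deriv \<phi>))"
        unfolding Re(2)[OF \<phi>] .
      show "ennreal (riesz_energy (2 * \<beta>) (deriv \<phi>)) \<le> ennreal r * Hnorm_sq (1 - \<beta>) \<phi>"
        unfolding Re(2)[OF \<phi>] Hnorm_sq_unit_L2[OF unit_L2_test_function[OF \<phi>]]
        by (intro mult_left_mono) auto
      fix \<theta> :: real assume \<theta>: "0 \<le> \<theta>" "\<theta> \<le> 1"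
      have "normsq unit_meas (frac_int \<beta> \<theta> (deriv \<phi>))
          \<le> 4 / (Gamma \<beta>)\<^sup>2 * enn2real (kernel_const_same \<beta>) * riesz_energy (2 * \<beta>) (deriv \<phi>)"
        by (rule normsq_frac_int_le[OF \<beta> \<theta> bd])
      also have "\<dots> \<le> c * riesz_energy (2 * \<beta>) (deriv \<phi>)"
        by (intro mult_right_mono E) (simp add: c_def)
      finally show "normsq unit_meas (frac_int \<beta> \<theta> (deriv \<phi>)) \<le> c * riesz_energy (2 * \<beta>) (deriv \<phi>)" .
      show "d * riesz_energy (2 * \<beta>) (deriv \<phi>) \<le> ip unit_meas (frac_int \<beta> \<theta> (deriv \<phi>)) (frac_int \<beta> (1/2) (deriv \<phi>))"
        unfolding d_def by (rule ip_frac_int_half_ge[OF \<beta> \<theta> bd])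
    qed
  qed
qed

text \<open>
  The lower estimate follows from the Cauchy--Schwarz inequality: the product of \<open>T\<^sub>\<theta> \<phi>\<close> and
  \<open>T\<^sub>1\<^sub>/\<^sub>2 \<phi>\<close> dominates the energy, while the norm of \<open>T\<^sub>1\<^sub>/\<^sub>2 \<phi>\<close> is at most of the order of its root.
  The constants are the same for all \<open>\<theta>\<close>.
\<close>

lemma weak_operator_frac:
  assumes \<beta>: "0 < \<beta>" "\<beta> < 1/2"
  obtains c C where "\<And>\<theta>. 0 \<le> \<theta> \<Longrightarrow> \<theta> \<le> 1 \<Longrightarrow>
    weak_operator (1 - \<beta>) c C (frac_int \<beta> \<theta>) (\<lambda>\<phi>. frac_int \<beta> \<theta> (deriv \<phi>))"
proof (rule frac_test_estimates[OF \<beta>])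
  fix a b c d :: real
  assume pos: "0 < a" "0 < b" "0 < c" "0 < d"
    and E: "\<And>\<phi>. test_function \<phi> \<Longrightarrow> ennreal a * Hnorm_sq (1 - \<beta>) \<phi> \<le> ennreal (riesz_energy (2 * \<beta>) (deriv \<phi>))"
      "\<And>\<phi>. test_function \<phi> \<Longrightarrow> ennreal (riesz_energy (2 * \<beta>) (deriv \<phi>)) \<le> ennreal b * Hnorm_sq (1 - \<beta>) \<phi>"
      "\<And>\<phi>. test_function \<phi> \<Longrightarrow> 0 \<le> riesz_energy (2 * \<beta>) (deriv \<phi>)"
    and up: "\<And>\<phi> \<theta>. test_function \<phi> \<Longrightarrow> 0 \<le> \<theta> \<Longrightarrow> \<theta> \<le> 1 \<Longrightarrow>
      normsq unit_meas (frac_int \<beta> \<theta> (deriv \<phi>)) \<le> c * riesz_energy (2 * \<beta>) (deriv \<phi>)"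
    and low: "\<And>\<phi> \<theta>. test_function \<phi> \<Longrightarrow> 0 \<le> \<theta> \<Longrightarrow> \<theta> \<le> 1 \<Longrightarrow>
      d * riesz_energy (2 * \<beta>) (deriv \<phi>) \<le> ip unit_meas (frac_int \<beta> \<theta> (deriv \<phi>)) (frac_int \<beta> (1/2) (deriv \<phi>))"
  show ?thesis
  proof (rule that[of "a * d\<^sup>2 / c" "c * b"])
    fix \<theta> :: real assume \<theta>: "0 \<le> \<theta>" "\<theta> \<le> 1"
    show "weak_operator (1 - \<beta>) (a * d\<^sup>2 / c) (c * b) (frac_int \<beta> \<theta>) (\<lambda>\<phi>. frac_int \<beta> \<theta> (deriv \<phi>))"
    proof (rule weak_operator_frac_aux[OF \<beta> \<theta>])
      show "0 < a * d\<^sup>2 / c" "0 < c * b" using pos by auto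
      fix \<phi> assume \<phi>: "test_function \<phi>"
      let ?E = "riesz_energy (2 * \<beta>) (deriv \<phi>)" and ?T = "frac_int \<beta> \<theta> (deriv \<phi>)" and ?H = "frac_int \<beta> (1/2) (deriv \<phi>)"
      note bd = bdd_unit_test_function[OF test_function_deriv[OF \<phi>]]
      have TL: "?T \<in> L2 unit_meas" "?H \<in> L2 unit_meas" by (rule frac_int_L2[OF \<beta> bd])+
      have E0: "0 \<le> ?E" by (rule E(3)[OF \<phi>])
      have "d\<^sup>2 * ?E \<le> c * normsq unit_meas ?T"
      proof (cases "?E = 0")
        case True
        then show ?thesis using pos by (simp add: normsq_nonneg)
      next
        case False
        then have Ep: "0 < ?E" using E0 by simp
        have "(d * ?E)\<^sup>2 \<le> (ip unit_meas ?T ?H)\<^sup>2"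
          by (rule power_mono[OF low[OF \<phi> \<theta>]]) (use pos E0 in simp)
        also have "\<dots> \<le> normsq unit_meas ?T * normsq unit_meas ?H" by (rule Cauchy_Schwarz_L2[OF TL])
        also have "\<dots> \<le> normsq unit_meas ?T * (c * ?E)"
          by (intro mult_left_mono up \<phi> normsq_nonneg) auto
        finally have "(d\<^sup>2 * ?E) * ?E \<le> (c * normsq unit_meas ?T) * ?E"
          by (simp add: power2_eq_square ac_simps)
        then show ?thesis using Ep by (rule mult_right_le_imp_le)
      qed
      then have le: "d\<^sup>2 / c * ?E \<le> normsq unit_meas ?T" using pos by (simp add: field_simps)
      have "ennreal (a * d\<^sup>2 / c) * Hnorm_sq (1 - \<beta>) \<phi> = ennreal (d\<^sup>2 / c) * (ennreal a * Hnorm_sq (1 - \<beta>) \<phi>)"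
        using pos by (simp add: mult.assoc[symmetric] ennreal_mult[symmetric] ac_simps)
      also have "\<dots> \<le> ennreal (d\<^sup>2 / c) * ennreal ?E"
        by (intro mult_left_mono E \<phi>) simp
      also have "\<dots> = ennreal (d\<^sup>2 / c * ?E)"
        using pos E0 by (intro ennreal_mult[symmetric]) auto
      also have "\<dots> \<le> ennreal (normsq unit_meas ?T)" by (rule ennreal_leI[OF le])
      finally show "ennreal (a * d\<^sup>2 / c) * Hnorm_sq (1 - \<beta>) \<phi> \<le> ennreal (normsq unit_meas ?T)" .
      have "ennreal (normsq unit_meas ?T) \<le> ennreal (c * ?E)" by (rule ennreal_leI[OF up[OF \<phi> \<theta>]])
      also have "\<dots> = ennreal c * ennreal ?E" using pos E0 by (intro ennreal_mult) auto
      also have "\<dots> \<le> ennreal c * (ennreal b * Hnorm_sq (1 - \<beta>) \<phi>)" by (intro mult_left_mono E \<phi>) simp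
      also have "\<dots> = ennreal (c * b) * Hnorm_sq (1 - \<beta>) \<phi>"
        using pos by (simp add: mult.assoc[symmetric] ennreal_mult[symmetric])
      finally show "ennreal (normsq unit_meas ?T) \<le> ennreal (c * b) * Hnorm_sq (1 - \<beta>) \<phi>" .
    qed
  qed
qed

text \<open>
  On test functions both sides are compared with the energy; both are continuous in the norm of the
  space.
\<close>

lemma frac_coercive:
  assumes \<beta>: "0 < \<beta>" "\<beta> < 1/2"
  obtains k where "\<And>\<theta> w. 0 \<le> \<theta> \<Longrightarrow> \<theta> \<le> 1 \<Longrightarrow> w \<in> H0 (1 - \<beta>) \<Longrightarrow>
    normsq unit_meas (weak_deriv (frac_int \<beta> \<theta> w))
      \<le> k * ip unit_meas (weak_deriv (frac_int \<beta> \<theta> w)) (weak_deriv (frac_int \<beta> (1/2) w))"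
proof (rule frac_test_estimates[OF \<beta>], rule weak_operator_frac[OF \<beta>])
  fix a b c d c' C' :: real
  assume pos: "0 < a" "0 < b" "0 < c" "0 < d"
    and up: "\<And>\<phi> \<theta>. test_function \<phi> \<Longrightarrow> 0 \<le> \<theta> \<Longrightarrow> \<theta> \<le> 1 \<Longrightarrow>
      normsq unit_meas (frac_int \<beta> \<theta> (deriv \<phi>)) \<le> c * riesz_energy (2 * \<beta>) (deriv \<phi>)"
    and low: "\<And>\<phi> \<theta>. test_function \<phi> \<Longrightarrow> 0 \<le> \<theta> \<Longrightarrow> \<theta> \<le> 1 \<Longrightarrow>
      d * riesz_energy (2 * \<beta>) (deriv \<phi>) \<le> ip unit_meas (frac_int \<beta> \<theta> (deriv \<phi>)) (frac_int \<beta> (1/2) (deriv \<phi>))"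
    and W: "\<And>\<theta>. 0 \<le> \<theta> \<Longrightarrow> \<theta> \<le> 1 \<Longrightarrow>
      weak_operator (1 - \<beta>) c' C' (frac_int \<beta> \<theta>) (\<lambda>\<phi>. frac_int \<beta> \<theta> (deriv \<phi>))"
  show ?thesis
  proof (rule that[of "c / d"])
    fix \<theta> :: real and w assume \<theta>: "0 \<le> \<theta>" "\<theta> \<le> 1" and w: "w \<in> H0 (1 - \<beta>)"
    interpret T: weak_operator "1 - \<beta>" c' C' "frac_int \<beta> \<theta>" "\<lambda>\<phi>. frac_int \<beta> \<theta> (deriv \<phi>)"
      by (rule W[OF \<theta>])
    interpret H: weak_operator "1 - \<beta>" c' C' "frac_int \<beta> (1/2)" "\<lambda>\<phi>. frac_int \<beta> (1/2) (deriv \<phi>)"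
      by (rule W) auto
    obtain \<phi> where \<phi>: "\<And>n::nat. test_function (\<phi> n)" "(\<lambda>n. Hnorm_sq (1 - \<beta>) (\<lambda>x. w x - \<phi> n x)) \<longlonglongrightarrow> 0"
      using H0_approx[OF w] by metis
    note lT = T.T_approx(1)[OF w \<phi>] and lH = H.T_approx(1)[OF w \<phi>]
    show "normsq unit_meas (weak_deriv (frac_int \<beta> \<theta> w))
      \<le> c / d * ip unit_meas (weak_deriv (frac_int \<beta> \<theta> w)) (weak_deriv (frac_int \<beta> (1/2) w))"
    proof (rule LIMSEQ_le)
      show "(\<lambda>n. normsq unit_meas (frac_int \<beta> \<theta> (deriv (\<phi> n)))) \<longlonglongrightarrow> normsq unit_meas (weak_deriv (frac_int \<beta> \<theta> w))"
        by (rule normsq_tendsto[OF T.A_L2[OF \<phi>(1)] T.T(2)[OF w] lT])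
      show "(\<lambda>n. c / d * ip unit_meas (frac_int \<beta> \<theta> (deriv (\<phi> n))) (frac_int \<beta> (1/2) (deriv (\<phi> n))))
          \<longlonglongrightarrow> c / d * ip unit_meas (weak_deriv (frac_int \<beta> \<theta> w)) (weak_deriv (frac_int \<beta> (1/2) w))"
        by (intro tendsto_mult tendsto_const ip_tendsto T.A_L2 H.A_L2 \<phi>(1) T.T(2) H.T(2) w lT lH)
      have "normsq unit_meas (frac_int \<beta> \<theta> (deriv (\<phi> n)))
          \<le> c / d * ip unit_meas (frac_int \<beta> \<theta> (deriv (\<phi> n))) (frac_int \<beta> (1/2) (deriv (\<phi> n)))" for n
      proof -
        have "normsq unit_meas (frac_int \<beta> \<theta> (deriv (\<phi> n))) \<le> c / d * (d * riesz_energy (2 * \<beta>) (deriv (\<phi> n)))"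
          using up[OF \<phi>(1) \<theta>, of n] pos by simp
        also have "\<dots> \<le> c / d * ip unit_meas (frac_int \<beta> \<theta> (deriv (\<phi> n))) (frac_int \<beta> (1/2) (deriv (\<phi> n)))"
          using pos by (intro mult_left_mono low \<phi>(1) \<theta>) auto
        finally show ?thesis .
      qed
      then show "\<exists>N. \<forall>n\<ge>N. normsq unit_meas (frac_int \<beta> \<theta> (deriv (\<phi> n)))
          \<le> c / d * ip unit_meas (frac_int \<beta> \<theta> (deriv (\<phi> n))) (frac_int \<beta> (1/2) (deriv (\<phi> n)))" by blast
    qed
  qed
qed

lemma Hnorm_sq_mono_exponent:
  assumes w: "w \<in> unit_L2" and \<mu>: "0 < \<mu>" "\<mu> \<le> 1"
  shows "Hnorm_sq \<mu> w \<le> 3 * Hnorm_sq 1 w"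
proof -
  note [measurable] = unit_L2_D(1)[OF w]
  let ?n = "normsq unit_meas w"
  have F: "(cmod (fourier w \<omega>))\<^sup>2 \<le> ?n" for \<omega>
  proof -
    have "cmod (fourier w \<omega>) \<le> sqrt ?n"
      using norm_fourier_le[OF unit_L2_integrable(1)[OF w]] unit_L2_integrable(2)[OF w] by (meson order_trans)
    then have "(cmod (fourier w \<omega>))\<^sup>2 \<le> (sqrt ?n)\<^sup>2" by (intro power_mono) auto
    then show ?thesis by (simp add: normsq_nonneg)
  qed
  have "fourier_seminorm_sq \<mu> w \<le> (\<integral>\<^sup>+\<omega>. ennreal ?n * indicator {-1..1::real} \<omega>
      + ennreal ((\<bar>\<omega>\<bar> powr 1 * cmod (fourier w \<omega>))\<^sup>2) \<partial>lborel)"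
    unfolding fourier_seminorm_sq_def
  proof (intro nn_integral_mono)
    fix \<omega> :: real
    show "ennreal ((\<bar>\<omega>\<bar> powr \<mu> * cmod (fourier w \<omega>))\<^sup>2) \<le> ennreal ?n * indicator {-1..1} \<omega>
      + ennreal ((\<bar>\<omega>\<bar> powr 1 * cmod (fourier w \<omega>))\<^sup>2)"
    proof (cases "\<omega> \<in> {-1..1}")
      case True
      have "\<bar>\<omega>\<bar> powr \<mu> \<le> 1 powr \<mu>" using True \<mu> by (intro powr_mono2) auto
      then have "(\<bar>\<omega>\<bar> powr \<mu> * cmod (fourier w \<omega>))\<^sup>2 \<le> (1 * cmod (fourier w \<omega>))\<^sup>2"
        by (intro power_mono mult_right_mono) auto
      also have "\<dots> \<le> ?n" using F by simp
      finally show ?thesis using True by (simp add: ennreal_leI add_increasing2)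
    next
      case False
      have "\<bar>\<omega>\<bar> powr \<mu> \<le> \<bar>\<omega>\<bar> powr 1" using False \<mu> by (intro powr_mono) auto
      then have "(\<bar>\<omega>\<bar> powr \<mu> * cmod (fourier w \<omega>))\<^sup>2 \<le> (\<bar>\<omega>\<bar> powr 1 * cmod (fourier w \<omega>))\<^sup>2"
        by (intro power_mono mult_right_mono) auto
      then show ?thesis by (intro add_increasing ennreal_leI) auto
    qed
  qed
  also have "\<dots> = ennreal ?n * emeasure lborel {-1..1::real} + fourier_seminorm_sq 1 w"
    unfolding fourier_seminorm_sq_def
    by (subst nn_integral_add, simp, simp, subst nn_integral_cmult_indicator) auto
  also have "\<dots> = ennreal ?n * 2 + fourier_seminorm_sq 1 w" by simp
  finally have "ennreal ?n + fourier_seminorm_sq \<mu> w \<le> ennreal ?n + (ennreal ?n * 2 + fourier_seminorm_sq 1 w)"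
    by (rule add_left_mono)
  also have "\<dots> = 3 * ennreal ?n + 1 * fourier_seminorm_sq 1 w"
  proof -
    have "(3::ennreal) = 1 + 2" by simp
    then show ?thesis by (simp only: distrib_right mult_1 mult.commute[of _ 2] add.assoc)
  qed
  also have "\<dots> \<le> 3 * ennreal ?n + 3 * fourier_seminorm_sq 1 w"
    by (intro add_left_mono mult_right_mono) auto
  finally show ?thesis by (simp add: Hnorm_sq_unit_L2[OF w] distrib_left)
qed

lemma Hnorm_sq_tendsto_mono_exponent:
  assumes "\<And>n. w n \<in> unit_L2" "0 < \<mu>" "\<mu> \<le> 1" "(\<lambda>n. Hnorm_sq 1 (w n)) \<longlonglongrightarrow> 0"
  shows "(\<lambda>n. Hnorm_sq \<mu> (w n)) \<longlonglongrightarrow> 0"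
proof (rule tendsto_sandwich[OF _ _ tendsto_const])
  show "\<forall>\<^sub>F n in sequentially. Hnorm_sq \<mu> (w n) \<le> 3 * Hnorm_sq 1 (w n)"
    by (intro always_eventually allI Hnorm_sq_mono_exponent assms)
  have "(\<lambda>n. 3 * Hnorm_sq 1 (w n)) \<longlonglongrightarrow> 3 * 0"
    by (intro ennreal_tendsto_cmult assms) simp
  then show "(\<lambda>n. 3 * Hnorm_sq 1 (w n)) \<longlonglongrightarrow> 0" by simp
qed simp

lemma H0_mono_exponent:
  assumes "v \<in> H0 1" "0 < \<mu>" "\<mu> \<le> 1"
  shows "v \<in> H0 \<mu>"
proof -
  obtain \<phi> where \<phi>: "\<And>n::nat. test_function (\<phi> n)" "(\<lambda>n. Hnorm_sq 1 (\<lambda>x. v x - \<phi> n x)) \<longlonglongrightarrow> 0"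
    using H0_approx[OF assms(1)] by metis
  note v = H0_unit_L2[OF assms(1)]
  have "(\<lambda>n. Hnorm_sq \<mu> (\<lambda>x. v x - \<phi> n x)) \<longlonglongrightarrow> 0"
    by (rule Hnorm_sq_tendsto_mono_exponent[OF unit_L2_diff[OF v unit_L2_test_function[OF \<phi>(1)]] assms(2,3) \<phi>(2)])
  then show ?thesis
    unfolding H0_def using \<phi>(1) unit_L2_D(1,2)[OF v] by auto
qed

text \<open>
  Tested with \<open>D v\<close> instead of \<open>T\<^sub>1\<^sub>/\<^sub>2 v\<close>, the operator gives the Riesz energy of order \<open>\<beta>\<close> of the
  derivative and is coercive with respect to the norm with the exponent \<open>1 - \<beta> / 2\<close>. Its \<open>L\<^sup>2\<close> part
  is enough to separate functions.
\<close>

lemma energy_coercive: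
  assumes \<beta>: "0 < \<beta>" "\<beta> < 1/2"
  obtains k where "\<And>\<theta> v. 0 \<le> \<theta> \<Longrightarrow> \<theta> \<le> 1 \<Longrightarrow> v \<in> H0 1 \<Longrightarrow>
    normsq unit_meas v \<le> k * ip unit_meas (weak_deriv (frac_int \<beta> \<theta> v)) (weak_deriv v)"
proof -
  have \<beta>1: "\<beta> < 1" and \<mu>: "0 < 1 - \<beta> / 2" and \<mu>': "0 < 1 - \<beta>" "1 - \<beta> \<le> 1" using \<beta> by auto
  have G: "0 < Gamma \<beta>" using \<beta> by (simp add: Gamma_real_pos)
  show ?thesis
  proof (rule riesz_energy_deriv[OF \<beta>(1) \<beta>1], rule Poincare[OF \<mu>], rule weak_operator_frac[OF \<beta>], rule weak_operator_deriv)
    fix r P c C c' C' :: real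
    assume r: "0 < r" and R: "\<And>\<phi>. test_function \<phi> \<Longrightarrow> 0 \<le> riesz_energy \<beta> (deriv \<phi>) \<and>
        ennreal (riesz_energy \<beta> (deriv \<phi>)) = ennreal r * fourier_seminorm_sq (1 - \<beta> / 2) \<phi>"
      and P: "0 < P" "\<And>\<phi>. test_function \<phi> \<Longrightarrow> ennreal (normsq unit_meas \<phi>) \<le> ennreal P * fourier_seminorm_sq (1 - \<beta> / 2) \<phi>"
      and W: "\<And>\<theta>. 0 \<le> \<theta> \<Longrightarrow> \<theta> \<le> 1 \<Longrightarrow>
        weak_operator (1 - \<beta>) c C (frac_int \<beta> \<theta>) (\<lambda>\<phi>. frac_int \<beta> \<theta> (deriv \<phi>))"
      and WD: "weak_operator 1 c' C' (\<lambda>w. w) deriv"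
    interpret D: weak_operator 1 c' C' "\<lambda>w. w" deriv by (rule WD)
    show ?thesis
    proof (rule that[of "P / r * (2 * Gamma \<beta>)"])
      fix \<theta> :: real and v assume \<theta>: "0 \<le> \<theta>" "\<theta> \<le> 1" and v: "v \<in> H0 1"
      interpret T: weak_operator "1 - \<beta>" c C "frac_int \<beta> \<theta>" "\<lambda>\<phi>. frac_int \<beta> \<theta> (deriv \<phi>)"
        by (rule W[OF \<theta>])
      have v': "v \<in> H0 (1 - \<beta>)" by (rule H0_mono_exponent[OF v \<mu>'])
      note vU = H0_unit_L2[OF v]
      obtain \<phi> where \<phi>: "\<And>n::nat. test_function (\<phi> n)" "(\<lambda>n. Hnorm_sq 1 (\<lambda>x. v x - \<phi> n x)) \<longlonglongrightarrow> 0"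
        using H0_approx[OF v] by metis
      note \<phi>U = unit_L2_test_function[OF \<phi>(1)]
      have \<phi>': "(\<lambda>n. Hnorm_sq (1 - \<beta>) (\<lambda>x. v x - \<phi> n x)) \<longlonglongrightarrow> 0"
        by (rule Hnorm_sq_tendsto_mono_exponent[OF unit_L2_diff[OF vU \<phi>U] \<mu>' \<phi>(2)])
      note lT = T.T_approx(1)[OF v' \<phi>(1) \<phi>'] and lD = D.T_approx(1)[OF v \<phi>]
      have lim0: "(\<lambda>n. normsq unit_meas (\<lambda>x. \<phi> n x - v x)) \<longlonglongrightarrow> 0"
      proof -
        have "(\<lambda>n. ennreal (normsq unit_meas (\<lambda>x. \<phi> n x - v x))) \<longlonglongrightarrow> ennreal 0"
        proof (rule tendsto_sandwich[OF _ _ tendsto_const])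
          show "\<forall>\<^sub>F n in sequentially. ennreal (normsq unit_meas (\<lambda>x. \<phi> n x - v x)) \<le> Hnorm_sq 1 (\<lambda>x. v x - \<phi> n x)"
            unfolding normsq_minus_commute[of unit_meas _ v]
            by (intro always_eventually allI normsq_le_Hnorm_sq unit_L2_diff \<phi>U vU)
          show "(\<lambda>n. Hnorm_sq 1 (\<lambda>x. v x - \<phi> n x)) \<longlonglongrightarrow> ennreal 0" using \<phi>(2) by simp
        qed simp
        then show ?thesis by (subst (asm) tendsto_ennreal_iff) (auto simp: normsq_nonneg)
      qed
      show "normsq unit_meas v \<le> P / r * (2 * Gamma \<beta>) * ip unit_meas (weak_deriv (frac_int \<beta> \<theta> v)) (weak_deriv v)"
      proof (rule LIMSEQ_le)
        show "(\<lambda>n. normsq unit_meas (\<phi> n)) \<longlonglongrightarrow> normsq unit_meas v"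
          by (rule normsq_tendsto[OF unit_L2_D(3)[OF \<phi>U] unit_L2_D(3)[OF vU] lim0])
        show "(\<lambda>n. P / r * (2 * Gamma \<beta>) * ip unit_meas (frac_int \<beta> \<theta> (deriv (\<phi> n))) (deriv (\<phi> n)))
            \<longlonglongrightarrow> P / r * (2 * Gamma \<beta>) * ip unit_meas (weak_deriv (frac_int \<beta> \<theta> v)) (weak_deriv v)"
          by (intro tendsto_mult tendsto_const ip_tendsto T.A_L2 D.A_L2 \<phi>(1) T.T(2) D.T(2) v v' lT lD)
        have "normsq unit_meas (\<phi> n) \<le> P / r * (2 * Gamma \<beta>) * ip unit_meas (frac_int \<beta> \<theta> (deriv (\<phi> n))) (deriv (\<phi> n))" for n
        proof -
          note d = test_function_deriv[OF \<phi>(1)[of n]]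
          let ?E = "riesz_energy \<beta> (deriv (\<phi> n))"
          have "ennreal (normsq unit_meas (\<phi> n)) \<le> ennreal P * fourier_seminorm_sq (1 - \<beta> / 2) (\<phi> n)"
            by (rule P(2)[OF \<phi>(1)])
          also have "\<dots> = ennreal (P / r) * (ennreal r * fourier_seminorm_sq (1 - \<beta> / 2) (\<phi> n))"
            using P(1) r by (simp add: mult.assoc[symmetric] ennreal_mult[symmetric])
          also have "\<dots> = ennreal (P / r * ?E)"
            unfolding conjunct2[OF R[OF \<phi>(1)[of n]], symmetric]
            using conjunct1[OF R[OF \<phi>(1)[of n]]] P(1) r by (intro ennreal_mult[symmetric]) auto
          finally have "normsq unit_meas (\<phi> n) \<le> P / r * ?E"
            using R[OF \<phi>(1)[of n]] P(1) r by (subst (asm) ennreal_le_iff) auto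
          also have "?E = (2 * Gamma \<beta>) * ip unit_meas (frac_int \<beta> \<theta> (deriv (\<phi> n))) (deriv (\<phi> n))"
            unfolding ip_frac_int_self[OF \<beta> bdd_unit_test_function[OF d] test_function_L2[OF d]] using G by simp
          finally show ?thesis by (simp only: mult.assoc)
        qed
        then show "\<exists>N. \<forall>n\<ge>N. normsq unit_meas (\<phi> n)
            \<le> P / r * (2 * Gamma \<beta>) * ip unit_meas (frac_int \<beta> \<theta> (deriv (\<phi> n))) (deriv (\<phi> n))" by blast
      qed
    qed
  qed
qed


section \<open>The range of the fractional operator\<close>

lemma const_L2: "(\<lambda>x. a) \<in> L2 unit_meas"
  by (rule unit_meas.L2_const)

lemma ip_const: "ip unit_meas f (\<lambda>x. a) = a * (LINT x|unit_meas. f x)"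
  by (simp add: ip_def mult.commute)

lemma weak_range_deriv_mean_zero:
  assumes "h \<in> weak_range 1 (\<lambda>w. w)"
  shows "(LINT x|unit_meas. h x) = 0"
proof (rule weak_operator_deriv)
  fix c C assume "weak_operator 1 c C (\<lambda>w. w) deriv"
  then interpret D: weak_operator 1 c C "\<lambda>w. w" deriv .
  obtain v where v: "v \<in> H0 1" "weak_L2_deriv v h"
    using assms unfolding weak_range_def by blast
  obtain \<phi> where \<phi>: "\<And>n::nat. test_function (\<phi> n)" "(\<lambda>n. Hnorm_sq 1 (\<lambda>x. v x - \<phi> n x)) \<longlonglongrightarrow> 0"
    using H0_approx[OF v(1)] by metis
  have "(\<lambda>n. ip unit_meas (deriv (\<phi> n)) (\<lambda>x. 1)) \<longlonglongrightarrow> ip unit_meas (weak_deriv v) (\<lambda>x. 1)"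
    by (rule ip_tendsto_left[OF D.A_L2[OF \<phi>(1)] D.T(2)[OF v(1)] const_L2 D.T_approx(1)[OF v(1) \<phi>]])
  moreover have "ip unit_meas (deriv (\<phi> n)) (\<lambda>x. 1) = 0" for n
  proof -
    have "(LINT x|unit_meas. deriv (\<phi> n) x) = (LINT x|lborel. deriv (\<phi> n) x)"
      by (rule integral_unit_meas) (simp add: test_function_eq_0[OF test_function_deriv[OF \<phi>(1)]])
    then show ?thesis using integral_deriv_test_function[OF \<phi>(1)] by (simp add: ip_const)
  qed
  ultimately have "ip unit_meas (weak_deriv v) (\<lambda>x. 1) = 0" by (simp add: LIMSEQ_const_iff)
  moreover have "ip unit_meas h (\<lambda>x. 1) = ip unit_meas (weak_deriv v) (\<lambda>x. 1)"
    by (rule ip_AE_cong[OF _ _ _ D.T_unique[OF v]])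
       (use v D.T(2)[OF v(1)] in \<open>auto intro: L2_measurable weak_L2_deriv_L2\<close>)
  ultimately show ?thesis by (simp add: ip_const)
qed

text \<open>
  The derivatives of functions in \<open>H\<^sup>1\<^sub>0\<close> are the functions of mean zero: by du Bois-Reymond, their
  orthogonal complement consists of the constants.
\<close>

lemma weak_range_deriv_if_mean_zero:
  assumes z: "z \<in> L2 unit_meas" "(LINT x|unit_meas. z x) = 0"
  shows "z \<in> weak_range 1 (\<lambda>w. w)"
proof (rule weak_operator_deriv)
  fix c C assume "weak_operator 1 c C (\<lambda>w. w) deriv"
  then interpret D: weak_operator 1 c C "\<lambda>w. w" deriv .
  obtain m where m: "m \<in> weak_range 1 (\<lambda>w. w)"
    "\<And>v. v \<in> weak_range 1 (\<lambda>w. w) \<Longrightarrow> ip unit_meas (\<lambda>x. z x - m x) v = 0"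
    using D.range_T_projection[OF z(1)] by blast
  have mL: "m \<in> L2 unit_meas" using m(1) D.range_T_L2 by blast
  have i: "integrable unit_meas (\<lambda>x. z x - m x)"
    by (intro unit_meas.L2_integrable L2_diff z mL)
  have "(LINT x|unit_meas. (z x - m x) * deriv \<phi> x) = 0" if "test_function \<phi>" for \<phi>
  proof -
    have "deriv \<phi> \<in> weak_range 1 (\<lambda>w. w)"
      unfolding weak_range_def using test_function_H0[OF that] D.A[OF that] by blast
    from m(2)[OF this] show ?thesis by (simp add: ip_def)
  qed
  then obtain a where a: "AE x in unit_meas. z x - m x = a"
    using AE_const_if_test_deriv_integrals_0[OF i] by blast
  have "(LINT x|unit_meas. z x - m x) = (LINT x|unit_meas. a)"
    by (rule integral_cong_AE) (use a i in auto)
  also have "\<dots> = a" using measure_unit_meas by simp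
  also have "(LINT x|unit_meas. z x - m x) = 0"
    using z(2) weak_range_deriv_mean_zero[OF m(1)] unit_meas.L2_integrable[OF z(1)] unit_meas.L2_integrable[OF mL]
    by simp
  finally have "a = 0" by simp
  then have "AE x in unit_meas. m x = z x" using a by auto
  then show ?thesis
    using m(1) weak_L2_deriv_AE_cong[OF _ z(1)] unfolding weak_range_def by blast
qed

text \<open>
  The coercivity of \<open>(T\<^sub>\<theta> w, T\<^sub>1\<^sub>/\<^sub>2 w)\<close> makes surjectivity independent of \<open>\<theta>\<close>: if \<open>T\<^sub>\<theta>\<close> is onto, then
  an element of the orthogonal complement of the range of \<open>T\<^sub>1\<^sub>/\<^sub>2\<close> is some \<open>T\<^sub>\<theta> w\<close> and vanishes, so
  \<open>T\<^sub>1\<^sub>/\<^sub>2\<close> is onto; then an annihilator of the range of \<open>T\<^sub>1\<close> is some \<open>T\<^sub>1\<^sub>/\<^sub>2 w\<close> and vanishes as well.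
  But \<open>T\<^sub>1\<close> has a nontrivial annihilator.
\<close>

lemma weak_range_frac_proper:
  assumes \<beta>: "0 < \<beta>" "\<beta> < 1/2" and \<theta>: "0 \<le> \<theta>" "\<theta> \<le> 1"
  shows "weak_range (1 - \<beta>) (frac_int \<beta> \<theta>) \<noteq> L2 unit_meas"
proof
  assume onto: "weak_range (1 - \<beta>) (frac_int \<beta> \<theta>) = L2 unit_meas"
  show False
  proof (rule frac_coercive[OF \<beta>], rule weak_operator_frac[OF \<beta>], rule left_range_annihilator[OF \<beta>])
    fix k c C z
    assume k: "\<And>\<theta> w. 0 \<le> \<theta> \<Longrightarrow> \<theta> \<le> 1 \<Longrightarrow> w \<in> H0 (1 - \<beta>) \<Longrightarrow>
        normsq unit_meas (weak_deriv (frac_int \<beta> \<theta> w))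
          \<le> k * ip unit_meas (weak_deriv (frac_int \<beta> \<theta> w)) (weak_deriv (frac_int \<beta> (1/2) w))"
      and W: "\<And>\<theta>. 0 \<le> \<theta> \<Longrightarrow> \<theta> \<le> 1 \<Longrightarrow>
        weak_operator (1 - \<beta>) c C (frac_int \<beta> \<theta>) (\<lambda>\<phi>. frac_int \<beta> \<theta> (deriv \<phi>))"
      and z: "z \<in> L2 unit_meas" "0 < normsq unit_meas z"
        "\<And>\<phi>. test_function \<phi> \<Longrightarrow> ip unit_meas (frac_int \<beta> 1 (deriv \<phi>)) z = 0"
    interpret T: weak_operator "1 - \<beta>" c C "frac_int \<beta> \<theta>" "\<lambda>\<phi>. frac_int \<beta> \<theta> (deriv \<phi>)"
      by (rule W[OF \<theta>])
    interpret H: weak_operator "1 - \<beta>" c C "frac_int \<beta> (1/2)" "\<lambda>\<phi>. frac_int \<beta> (1/2) (deriv \<phi>)"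
      by (rule W) auto
    interpret L: weak_operator "1 - \<beta>" c C "frac_int \<beta> 1" "\<lambda>\<phi>. frac_int \<beta> 1 (deriv \<phi>)"
      by (rule W) auto
    have "weak_range (1 - \<beta>) (frac_int \<beta> (1/2)) = L2 unit_meas"
    proof (rule H.range_T_eq_L2)
      fix r assume r: "r \<in> L2 unit_meas"
        and orth: "\<And>v. v \<in> weak_range (1 - \<beta>) (frac_int \<beta> (1/2)) \<Longrightarrow> ip unit_meas r v = 0"
      obtain w where w: "w \<in> H0 (1 - \<beta>)" "weak_L2_deriv (frac_int \<beta> \<theta> w) r"
        using r onto unfolding weak_range_def by blast
      note AE = T.T_unique[OF w] and m = L2_measurable[OF r] L2_measurable[OF T.T(2)[OF w(1)]] L2_measurable[OF H.T(2)[OF w(1)]]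
      have "weak_deriv (frac_int \<beta> (1/2) w) \<in> weak_range (1 - \<beta>) (frac_int \<beta> (1/2))"
        unfolding weak_range_def using w(1) H.T(1) by blast
      from orth[OF this] have "ip unit_meas (weak_deriv (frac_int \<beta> \<theta> w)) (weak_deriv (frac_int \<beta> (1/2) w)) = 0"
        using ip_AE_cong[OF m AE] by simp
      then have "normsq unit_meas (weak_deriv (frac_int \<beta> \<theta> w)) \<le> 0"
        using k[OF \<theta> w(1)] by simp
      then show "normsq unit_meas r = 0"
        using normsq_AE_cong[OF m(1,2) AE] normsq_nonneg[of unit_meas r] by simp
    qed
    then obtain w where w: "w \<in> H0 (1 - \<beta>)" "weak_L2_deriv (frac_int \<beta> (1/2) w) z"
      using z(1) unfolding weak_range_def by blast
    note AE = H.T_unique[OF w] and m = L2_measurable[OF z(1)] L2_measurable[OF H.T(2)[OF w(1)]] L2_measurable[OF L.T(2)[OF w(1)]]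
    obtain \<phi> where \<phi>: "\<And>n::nat. test_function (\<phi> n)" "(\<lambda>n. Hnorm_sq (1 - \<beta>) (\<lambda>x. w x - \<phi> n x)) \<longlonglongrightarrow> 0"
      using H0_approx[OF w(1)] by metis
    have "(\<lambda>n. ip unit_meas (frac_int \<beta> 1 (deriv (\<phi> n))) z) \<longlonglongrightarrow> ip unit_meas (weak_deriv (frac_int \<beta> 1 w)) z"
      by (rule ip_tendsto_left[OF L.A_L2[OF \<phi>(1)] L.T(2)[OF w(1)] z(1) L.T_approx(1)[OF w(1) \<phi>]])
    then have "ip unit_meas (weak_deriv (frac_int \<beta> 1 w)) z = 0"
      unfolding z(3)[OF \<phi>(1)] by (simp add: LIMSEQ_const_iff)
    then have "ip unit_meas (weak_deriv (frac_int \<beta> 1 w)) (weak_deriv (frac_int \<beta> (1/2) w)) = 0"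
      using ip_AE_cong[OF m AE] by (simp add: ip_commute[of _ "weak_deriv (frac_int \<beta> 1 w)"])
    then have "normsq unit_meas (weak_deriv (frac_int \<beta> 1 w)) \<le> 0"
      using k[of 1, OF _ _ w(1)] by simp
    then have "c * (Hnorm (1 - \<beta>) w)\<^sup>2 \<le> 0"
      using L.T_bounds(1)[OF w(1)] by simp
    then have "(Hnorm (1 - \<beta>) w)\<^sup>2 = 0" using L.c by (simp add: mult_le_0_iff)
    then have "normsq unit_meas (weak_deriv (frac_int \<beta> (1/2) w)) \<le> 0"
      using H.T_bounds(2)[OF w(1)] by simp
    then show False using normsq_AE_cong[OF m(1,2) AE] z(2) by simp
  qed
qed

text \<open>
  An annihilator of mean zero is a derivative \<open>D v\<close>, and the energy estimate applies to \<open>v\<close>.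
\<close>

lemma annihilator_mean_zero:
  assumes \<beta>: "0 < \<beta>" "\<beta> < 1/2" and \<theta>: "0 \<le> \<theta>" "\<theta> \<le> 1"
    and z: "z \<in> L2 unit_meas" "(LINT x|unit_meas. z x) = 0"
      "\<And>v. v \<in> weak_range (1 - \<beta>) (frac_int \<beta> \<theta>) \<Longrightarrow> ip unit_meas z v = 0"
  shows "normsq unit_meas z = 0"
proof (rule energy_coercive[OF \<beta>], rule weak_operator_frac[OF \<beta>], rule weak_operator_deriv)
  fix k c C c' C'
  assume k: "\<And>\<theta> v. 0 \<le> \<theta> \<Longrightarrow> \<theta> \<le> 1 \<Longrightarrow> v \<in> H0 1 \<Longrightarrow>
      normsq unit_meas v \<le> k * ip unit_meas (weak_deriv (frac_int \<beta> \<theta> v)) (weak_deriv v)"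
    and W: "\<And>\<theta>. 0 \<le> \<theta> \<Longrightarrow> \<theta> \<le> 1 \<Longrightarrow>
      weak_operator (1 - \<beta>) c C (frac_int \<beta> \<theta>) (\<lambda>\<phi>. frac_int \<beta> \<theta> (deriv \<phi>))"
    and WD: "weak_operator 1 c' C' (\<lambda>w. w) deriv"
  interpret D: weak_operator 1 c' C' "\<lambda>w. w" deriv by (rule WD)
  interpret T: weak_operator "1 - \<beta>" c C "frac_int \<beta> \<theta>" "\<lambda>\<phi>. frac_int \<beta> \<theta> (deriv \<phi>)"
    by (rule W[OF \<theta>])
  obtain v where v: "v \<in> H0 1" "weak_L2_deriv v z"
    using weak_range_deriv_if_mean_zero[OF z(1,2)] unfolding weak_range_def by blast
  have v': "v \<in> H0 (1 - \<beta>)" by (rule H0_mono_exponent[OF v(1)]) (use \<beta> in auto)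
  note AE = D.T_unique[OF v] and m = L2_measurable[OF z(1)] L2_measurable[OF D.T(2)[OF v(1)]] L2_measurable[OF T.T(2)[OF v']]
  have "weak_deriv (frac_int \<beta> \<theta> v) \<in> weak_range (1 - \<beta>) (frac_int \<beta> \<theta>)"
    unfolding weak_range_def using v' T.T(1) by blast
  from z(3)[OF this] have "ip unit_meas (weak_deriv (frac_int \<beta> \<theta> v)) (weak_deriv v) = 0"
    using ip_AE_cong[OF m AE] by (simp add: ip_commute[of _ "weak_deriv (frac_int \<beta> \<theta> v)"])
  then have "normsq unit_meas v = 0"
    using k[OF \<theta> v(1)] normsq_nonneg[of unit_meas v] by simp
  then have "AE x in unit_meas. v x = 0"
    using normsq_0_iff[OF unit_L2_D(3)[OF H0_unit_L2[OF v(1)]]] by simp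
  then have "AE x in lborel. v x = 0"
    unfolding AE_unit_meas by (rule eventually_mono) (use unit_L2_D(2)[OF H0_unit_L2[OF v(1)]] in blast)
  then have "Hnorm 1 v = 0" using D.Hnorm_eq_0_iff[OF v(1)] by simp
  then have "normsq unit_meas (weak_deriv v) \<le> 0" using D.T_bounds(2)[OF v(1)] by simp
  then show ?thesis
    using normsq_AE_cong[OF m(1,2) AE] normsq_nonneg[of unit_meas z] by simp
qed

text \<open>
  If the range contained the constants, all its annihilators would have mean zero and vanish, and
  the range would be everything.
\<close>

lemma const_notin_weak_range_frac:
  assumes \<beta>: "0 < \<beta>" "\<beta> < 1/2" and \<theta>: "0 \<le> \<theta>" "\<theta> \<le> 1"
  shows "(\<lambda>x. 1) \<notin> weak_range (1 - \<beta>) (frac_int \<beta> \<theta>)"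
proof
  assume 1: "(\<lambda>x. 1) \<in> weak_range (1 - \<beta>) (frac_int \<beta> \<theta>)"
  show False
  proof (rule weak_operator_frac[OF \<beta>])
    fix c C
    assume W: "\<And>\<theta>. 0 \<le> \<theta> \<Longrightarrow> \<theta> \<le> 1 \<Longrightarrow>
        weak_operator (1 - \<beta>) c C (frac_int \<beta> \<theta>) (\<lambda>\<phi>. frac_int \<beta> \<theta> (deriv \<phi>))"
    interpret T: weak_operator "1 - \<beta>" c C "frac_int \<beta> \<theta>" "\<lambda>\<phi>. frac_int \<beta> \<theta> (deriv \<phi>)"
      by (rule W[OF \<theta>])
    have "weak_range (1 - \<beta>) (frac_int \<beta> \<theta>) = L2 unit_meas"
    proof (rule T.range_T_eq_L2)
      fix z assume z: "z \<in> L2 unit_meas"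
        and orth: "\<And>v. v \<in> weak_range (1 - \<beta>) (frac_int \<beta> \<theta>) \<Longrightarrow> ip unit_meas z v = 0"
      have "(LINT x|unit_meas. z x) = 0" using orth[OF 1] by (simp add: ip_const)
      then show "normsq unit_meas z = 0" by (rule annihilator_mean_zero[OF \<beta> \<theta> z _ orth])
    qed
    then show False using weak_range_frac_proper[OF \<beta> \<theta>] by simp
  qed
qed

text \<open>
  For \<open>k = 1 / K\<close> the hypothesis is what the function \<open>u\<^sub>l\<close> provides. As \<open>q \<noteq> 0\<close>, it transfers to
  \<open>k\<close> what is known for the constant function: \<open>k\<close> is not in the range, and an annihilator of the
  range and of \<open>k\<close> has mean zero and vanishes. So \<open>k\<close> spans a complement of the range.
\<close>

lemma weak_range_frac_complement:
  assumes \<beta>: "0 < \<beta>" "\<beta> < 1/2" and \<theta>: "0 \<le> \<theta>" "\<theta> \<le> 1" and k: "k \<in> L2 unit_meas"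
    and q: "q \<noteq> 0" "(\<lambda>x. q - \<kappa> * k x) \<in> weak_range (1 - \<beta>) (frac_int \<beta> \<theta>)"
  obtains e where "e \<in> L2 unit_meas" "0 < ip unit_meas k e"
    "\<And>v. v \<in> weak_range (1 - \<beta>) (frac_int \<beta> \<theta>) \<Longrightarrow> ip unit_meas v e = 0"
    "\<And>g. g \<in> L2 unit_meas \<Longrightarrow> \<exists>w\<in>H0 (1 - \<beta>). \<exists>a. weak_L2_deriv (frac_int \<beta> \<theta> w) (\<lambda>x. g x - a * k x)"
proof (rule weak_operator_frac[OF \<beta>])
  fix c C
  assume W: "\<And>\<theta>. 0 \<le> \<theta> \<Longrightarrow> \<theta> \<le> 1 \<Longrightarrow>
      weak_operator (1 - \<beta>) c C (frac_int \<beta> \<theta>) (\<lambda>\<phi>. frac_int \<beta> \<theta> (deriv \<phi>))"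
  interpret T: weak_operator "1 - \<beta>" c C "frac_int \<beta> \<theta>" "\<lambda>\<phi>. frac_int \<beta> \<theta> (deriv \<phi>)"
    by (rule W[OF \<theta>])
  let ?R = "weak_range (1 - \<beta>) (frac_int \<beta> \<theta>)"
  have add: "(\<lambda>x. f x + g x) \<in> ?R" if "f \<in> ?R" "g \<in> ?R" for f g
    using that unfolding weak_range_def by (blast intro: H0_add T.weak_deriv_add H0_unit_L2)
  have scale: "(\<lambda>x. a * f x) \<in> ?R" if "f \<in> ?R" for f a
    using that unfolding weak_range_def by (blast intro: H0_scale T.weak_deriv_scale H0_unit_L2)
  have cong: "g \<in> ?R" if "f \<in> ?R" "g \<in> L2 unit_meas" "AE x in unit_meas. f x = g x" for f g
    using that weak_L2_deriv_AE_cong unfolding weak_range_def by blast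
  have k_notin: "k \<notin> ?R"
  proof
    assume "k \<in> ?R"
    then have "(\<lambda>x. (1/q) * ((q - \<kappa> * k x) + \<kappa> * k x)) \<in> ?R" by (intro scale add q)
    then show False using const_notin_weak_range_frac[OF \<beta> \<theta>] q(1) by simp
  qed
  have zero: "normsq unit_meas z = 0"
    if z: "z \<in> L2 unit_meas" "\<And>v. v \<in> ?R \<Longrightarrow> ip unit_meas z v = 0" "ip unit_meas z k = 0" for z
  proof -
    have "ip unit_meas z (\<lambda>x. q - \<kappa> * k x) = q * (LINT x|unit_meas. z x) - \<kappa> * ip unit_meas z k"
      by (subst ip_diff_right[OF const_L2 L2_scale[OF k] z(1)]) (simp add: ip_const ip_scale_right)
    then have "(LINT x|unit_meas. z x) = 0" using z(2)[OF q(2)] z(3) q(1) by simp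
    then show ?thesis by (rule annihilator_mean_zero[OF \<beta> \<theta> z(1) _ z(2)])
  qed
  obtain p where p: "p \<in> ?R" "\<And>v. v \<in> ?R \<Longrightarrow> ip unit_meas (\<lambda>x. k x - p x) v = 0"
    using T.range_T_projection[OF k] by blast
  define e where "e x = k x - p x" for x
  have pL: "p \<in> L2 unit_meas" using p(1) T.range_T_L2 by blast
  have eL: "e \<in> L2 unit_meas" unfolding e_def by (intro L2_diff k pL)
  have e_orth: "ip unit_meas e v = 0" if "v \<in> ?R" for v
    using p(2)[OF that] by (simp add: e_def[abs_def])
  have ek: "ip unit_meas e k = normsq unit_meas e"
  proof -
    have "normsq unit_meas e = ip unit_meas e (\<lambda>x. k x - p x)" by (simp add: normsq_eq_ip e_def[abs_def])
    also have "\<dots> = ip unit_meas e k" using e_orth[OF p(1)] by (simp add: ip_diff_right k pL eL)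
    finally show ?thesis by simp
  qed
  have "normsq unit_meas e \<noteq> 0"
  proof
    assume "normsq unit_meas e = 0"
    then have "AE x in unit_meas. e x = 0" using normsq_0_iff[OF eL] by simp
    then have "AE x in unit_meas. p x = k x" by eventually_elim (simp add: e_def)
    then show False using cong[OF p(1) k] k_notin by blast
  qed
  then have e_pos: "0 < normsq unit_meas e" using normsq_nonneg[of unit_meas e] by simp
  show ?thesis
  proof (rule that[of e])
    show "e \<in> L2 unit_meas" by (rule eL)
    show "0 < ip unit_meas k e" using e_pos ek by (simp add: ip_commute)
    show "ip unit_meas v e = 0" if "v \<in> ?R" for v using e_orth[OF that] by (simp add: ip_commute)
    fix g assume g: "g \<in> L2 unit_meas"
    obtain m where m: "m \<in> ?R" "\<And>v. v \<in> ?R \<Longrightarrow> ip unit_meas (\<lambda>x. g x - m x) v = 0"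
      using T.range_T_projection[OF g] by blast
    have mL: "m \<in> L2 unit_meas" using m(1) T.range_T_L2 by blast
    define a where "a = ip unit_meas (\<lambda>x. g x - m x) k / normsq unit_meas e"
    define z where "z x = (g x - m x) - a * e x" for x
    have zL: "z \<in> L2 unit_meas" unfolding z_def by (intro L2_diff L2_scale g mL eL)
    have zip: "ip unit_meas z v = ip unit_meas (\<lambda>x. g x - m x) v - a * ip unit_meas e v" if "v \<in> L2 unit_meas" for v
      unfolding z_def by (subst ip_diff_left[OF L2_diff[OF g mL] L2_scale[OF eL] that]) (simp add: ip_scale_left)
    have "normsq unit_meas z = 0"
    proof (rule zero[OF zL])
      show "ip unit_meas z v = 0" if "v \<in> ?R" for v
        using zip[of v] m(2)[OF that] e_orth[OF that] T.range_T_L2 that by auto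
      show "ip unit_meas z k = 0" using zip[OF k] ek e_pos by (simp add: a_def)
    qed
    then have "AE x in unit_meas. z x = 0" using normsq_0_iff[OF zL] by simp
    then have "AE x in unit_meas. m x + (- a) * p x = g x - a * k x"
      by eventually_elim (simp add: z_def e_def algebra_simps)
    then have "(\<lambda>x. g x - a * k x) \<in> ?R"
      by (rule cong[OF add[OF m(1) scale[OF p(1)]] L2_diff[OF g L2_scale[OF k]]])
    then show "\<exists>w\<in>H0 (1 - \<beta>). \<exists>a. weak_L2_deriv (frac_int \<beta> \<theta> w) (\<lambda>x. g x - a * k x)"
      unfolding weak_range_def by blast
  qed
qed

section \<open>The function \<open>u\<^sub>l\<close>\<close>

lemma tail_integral_weak_deriv:
  assumes k: "k \<in> L2 unit_meas" and \<psi>: "test_function \<psi>"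
  shows "integrable unit_meas (\<lambda>x. (LINT s:{x<..<1}|lborel. k s) * deriv \<psi> x)"
    and "(LINT x|unit_meas. (LINT s:{x<..<1}|lborel. k s) * deriv \<psi> x) = ip unit_meas k \<psi>"
proof -
  note d = test_function_deriv[OF \<psi>]
  define k' where "k' s = indicator {0<..<1} s * k s" for s
  have [measurable]: "k' \<in> borel_measurable borel"
    using L2_measurable[OF k] unfolding k'_def by (subst (asm) borel_measurable_restrict_space_iff) auto
  have k'i: "integrable lborel k'"
    using unit_meas.L2_integrable[OF k] unfolding k'_def by (simp add: integrable_restrict_space)
  note [measurable] = test_function_borel[OF d]
  define f where "f s x = k' s * ((if x < s then 1 else 0) * deriv \<psi> x)" for s x
  have fm: "case_prod f \<in> borel_measurable (lborel \<Otimes>\<^sub>M lborel)" unfolding f_def by measurable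
  have "(\<integral>\<^sup>+s. \<integral>\<^sup>+x. ennreal (norm (f s x)) \<partial>lborel \<partial>lborel)
      \<le> (\<integral>\<^sup>+s. \<integral>\<^sup>+x. ennreal \<bar>k' s\<bar> * ennreal \<bar>deriv \<psi> x\<bar> \<partial>lborel \<partial>lborel)"
    by (intro nn_integral_mono) (auto simp: f_def abs_mult ennreal_mult[symmetric])
  also have "\<dots> = (\<integral>\<^sup>+s. ennreal \<bar>k' s\<bar> \<partial>lborel) * (\<integral>\<^sup>+x. ennreal \<bar>deriv \<psi> x\<bar> \<partial>lborel)"
    by (subst nn_integral_cmult, simp, subst nn_integral_multc) auto
  also have "\<dots> < \<infinity>"
    using k'i test_function_integrable[OF d] by (auto simp: integrable_iff_bounded ennreal_mult_less_top)
  finally have fin: "(\<integral>\<^sup>+s. \<integral>\<^sup>+x. ennreal (norm (f s x)) \<partial>lborel \<partial>lborel) < \<infinity>" .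
  have 1: "(LINT x|lborel. f s x) = k' s * \<psi> s" for s
  proof (cases "s \<in> {0<..<1}")
    case True
    have "has_bochner_integral lborel (\<lambda>x. deriv \<psi> x * indicator {0..s} x) (\<psi> s - \<psi> 0)"
      using True test_function_continuous[OF d, of UNIV]
      by (intro has_bochner_integral_FTC_Icc_real test_function_DERIV[OF \<psi>])
         (auto simp: continuous_on_eq_continuous_at)
    then have "(LINT x|lborel. deriv \<psi> x * indicator {0..s} x) = \<psi> s"
      using test_function_eq_0[OF \<psi>, of 0] by (simp add: has_bochner_integral_iff)
    moreover have "(LINT x|lborel. (if x < s then 1 else 0) * deriv \<psi> x) = (LINT x|lborel. deriv \<psi> x * indicator {0..s} x)"
    proof (rule integral_cong_AE)
      show "AE x in lborel. (if x < s then 1 else 0) * deriv \<psi> x = deriv \<psi> x * indicator {0..s} x"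
        using AE_lborel_singleton[of s]
      proof eventually_elim
        case (elim x)
        show ?case
        proof (cases "0 < x")
          case True
          then show ?thesis using elim by (auto simp: indicator_def)
        next
          case False
          then have "deriv \<psi> x = 0" by (intro test_function_eq_0[OF d]) simp
          then show ?thesis by simp
        qed
      qed
    qed measurable
    ultimately show ?thesis by (simp add: f_def)
  qed (simp add: f_def k'_def)
  have 2: "(LINT s|lborel. f s x) = (LINT s:{x<..<1}|lborel. k s) * deriv \<psi> x" if "x \<in> {0<..<1}" for x
  proof -
    have "(LINT s|lborel. f s x) = (LINT s|lborel. ((if x < s then 1 else 0) * k' s) * deriv \<psi> x)"
      unfolding f_def by (simp only: ac_simps)
    also have "\<dots> = (LINT s|lborel. (if x < s then 1 else 0) * k' s) * deriv \<psi> x"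
      by (rule integral_mult_left_zero)
    also have "(LINT s|lborel. (if x < s then 1 else 0) * k' s) = (LINT s:{x<..<1}|lborel. k s)"
      unfolding set_lebesgue_integral_def k'_def
      by (rule Bochner_Integration.integral_cong) (use that in \<open>auto simp: indicator_def\<close>)
    finally show ?thesis .
  qed
  have eq: "indicator {0<..<1} x *\<^sub>R ((LINT s:{x<..<1}|lborel. k s) * deriv \<psi> x) = (LINT s|lborel. f s x)" for x
  proof (cases "x \<in> {0<..<1}")
    case True
    then show ?thesis using 2[OF True] by simp
  next
    case False
    then have "deriv \<psi> x = 0" by (rule test_function_eq_0[OF d])
    then show ?thesis using False by (simp add: f_def)
  qed
  show "integrable unit_meas (\<lambda>x. (LINT s:{x<..<1}|lborel. k s) * deriv \<psi> x)"
    using integrable_integral_snd_lborel[OF fm fin] by (subst integrable_restrict_space) (simp_all only: eq, simp)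
  have "(LINT x|unit_meas. (LINT s:{x<..<1}|lborel. k s) * deriv \<psi> x) = (LINT x|lborel. LINT s|lborel. f s x)"
    by (subst integral_restrict_space) (simp_all only: eq, simp)
  also have "\<dots> = (LINT s|lborel. k' s * \<psi> s)"
    using Fubini_lborel_swap[OF fm fin] unfolding 1 by simp
  also have "\<dots> = ip unit_meas k \<psi>"
    unfolding ip_def k'_def by (subst integral_restrict_space) (simp_all add: mult.assoc)
  finally show "(LINT x|unit_meas. (LINT s:{x<..<1}|lborel. k s) * deriv \<psi> x) = ip unit_meas k \<psi>" .
qed

text \<open>
  Differentiating the equation of \<open>u\<^sub>l\<close>: the affine parts contribute the constant \<open>q\<close>, which is the
  number assumed not to vanish, and \<open>w\<^sub>l\<close> contributes a multiple of \<open>1 / K\<close>.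
\<close>

lemma u_l_weak_deriv:
  assumes \<beta>: "0 < \<beta>" and k: "(\<lambda>x. 1 / K x) \<in> L2 unit_meas" and u: "is_u_l K \<beta> \<theta> u"
  shows "weak_L2_deriv (frac_int \<beta> \<theta> u)
    (\<lambda>x. (1 + \<theta> * left_frac_int \<beta> u 1 - (1 - \<theta>) * right_frac_int \<beta> u 0)
      - inverse (LINT s:{0<..<1}|lborel. 1 / K s) * (1 / K x))"
    (is "weak_L2_deriv _ (\<lambda>x. ?q - ?\<kappa> * (1 / K x))")
proof -
  define a where "a = (1 - \<theta>) * right_frac_int \<beta> u 0 - 1"
  define b where "b = \<theta> * left_frac_int \<beta> u 1"
  define P where "P x = (LINT s:{x<..<1}|lborel. 1 / K s)" for x
  have uH: "u \<in> H0 (1 - \<beta>)" using u by (simp add: is_u_l_def)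
  note U = H0_unit_L2[OF uH]
  have AE: "AE x in unit_meas. frac_int \<beta> \<theta> u x = a * (1 - x) + b * x + ?\<kappa> * P x"
  proof -
    have eq: "frac_int \<beta> \<theta> u x = a * (1 - x) + b * x + ?\<kappa> * P x"
      if "frac_int \<beta> \<theta> u x - (1 - \<theta>) * right_frac_int \<beta> u 0 * w_l_const x
        - \<theta> * left_frac_int \<beta> u 1 * w_r_const x = w_l K x - w_l_const x" for x
    proof -
      have "frac_int \<beta> \<theta> u x = (1 - \<theta>) * right_frac_int \<beta> u 0 * w_l_const x
          + \<theta> * left_frac_int \<beta> u 1 * w_r_const x + w_l K x - w_l_const x"
        using that by simp
      then show ?thesis
        by (simp add: a_def b_def P_def w_l_const_def w_r_const_def w_l_def algebra_simps)
    qed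
    have "AE x in lborel. x \<in> {0<..<1} \<longrightarrow>
        frac_int \<beta> \<theta> u x - (1 - \<theta>) * right_frac_int \<beta> u 0 * w_l_const x
        - \<theta> * left_frac_int \<beta> u 1 * w_r_const x = w_l K x - w_l_const x"
      using u unfolding is_u_l_def by blast
    then show ?thesis
      unfolding AE_unit_meas by (rule eventually_mono) (blast intro: eq)
  qed
  show ?thesis
    unfolding weak_L2_deriv_def
  proof (intro conjI allI impI)
    show "(\<lambda>x. ?q - ?\<kappa> * (1 / K x)) \<in> L2 unit_meas" by (intro L2_diff const_L2 L2_scale k)
    fix \<psi> assume \<psi>: "test_function \<psi>"
    note d = test_function_deriv[OF \<psi>]
    note tail = tail_integral_weak_deriv[OF k \<psi>, folded P_def]
    have c: "continuous_on UNIV (\<lambda>x::real. 1 - x)" "continuous_on UNIV (\<lambda>x::real. x)"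
      by (intro continuous_intros)+
    have i: "integrable unit_meas (\<lambda>x. h x * deriv \<psi> x)" if "continuous_on UNIV h" for h
      using integrable_continuous_mult_test_function[OF that d] integrable_unit_meas[of "\<lambda>x. h x * deriv \<psi> x"]
        test_function_eq_0[OF d] by (metis mult_zero_right)
    have e: "(LINT x|unit_meas. h x * deriv \<psi> x) = (LINT x|lborel. h x * deriv \<psi> x)" for h
      by (rule integral_unit_meas) (simp add: test_function_eq_0[OF d])
    have m: "(LINT x|unit_meas. \<psi> x) = (LINT x|lborel. \<psi> x)"
      by (rule integral_unit_meas) (rule test_function_eq_0[OF \<psi>])
    have 1: "(LINT x|unit_meas. (1 - x) * deriv \<psi> x) = (LINT x|unit_meas. \<psi> x)"
    proof -
      have "(LINT x|lborel. (1 - x) * deriv \<psi> x) = - (LINT x|lborel. (- 1) * \<psi> x)"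
        by (rule integration_by_parts[OF _ _ \<psi>]) (auto intro!: derivative_eq_intros)
      then show ?thesis unfolding e m by simp
    qed
    have 2: "(LINT x|unit_meas. x * deriv \<psi> x) = - (LINT x|unit_meas. \<psi> x)"
    proof -
      have "(LINT x|lborel. x * deriv \<psi> x) = - (LINT x|lborel. 1 * \<psi> x)"
        by (rule integration_by_parts[OF _ _ \<psi>]) auto
      then show ?thesis unfolding e m by simp
    qed
    have "(LINT x|unit_meas. frac_int \<beta> \<theta> u x * deriv \<psi> x)
        = (LINT x|unit_meas. a * ((1 - x) * deriv \<psi> x) + (b * (x * deriv \<psi> x) + ?\<kappa> * (P x * deriv \<psi> x)))"
    proof (rule integral_cong_AE)
      show "AE x in unit_meas. frac_int \<beta> \<theta> u x * deriv \<psi> x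
          = a * ((1 - x) * deriv \<psi> x) + (b * (x * deriv \<psi> x) + ?\<kappa> * (P x * deriv \<psi> x))"
        using AE by eventually_elim (simp only: distrib_right mult.assoc add.assoc)
      have "integrable unit_meas (frac_int \<beta> \<theta> u)"
        by (rule frac_int_integrable[OF \<beta> unit_L2_integrable(1)[OF U] unit_L2_D(2)[OF U]])
      then show "(\<lambda>x. frac_int \<beta> \<theta> u x * deriv \<psi> x) \<in> borel_measurable unit_meas"
        using unit_meas_measurable[OF test_function_borel[OF d]] by (intro borel_measurable_times) auto
      show "(\<lambda>x. a * ((1 - x) * deriv \<psi> x) + (b * (x * deriv \<psi> x) + ?\<kappa> * (P x * deriv \<psi> x))) \<in> borel_measurable unit_meas"
        by (intro borel_measurable_integrable Bochner_Integration.integrable_add integrable_mult_right i c tail)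
    qed
    also have "\<dots> = a * (LINT x|unit_meas. (1 - x) * deriv \<psi> x)
        + (b * (LINT x|unit_meas. x * deriv \<psi> x) + ?\<kappa> * (LINT x|unit_meas. P x * deriv \<psi> x))"
      using i[OF c(1)] i[OF c(2)] tail(1)
      by (simp only: Bochner_Integration.integral_add integrable_mult_right Bochner_Integration.integrable_add integral_mult_right_zero)
    also have "\<dots> = a * (LINT x|unit_meas. \<psi> x) + (b * - (LINT x|unit_meas. \<psi> x) + ?\<kappa> * ip unit_meas (\<lambda>x. 1 / K x) \<psi>)"
      unfolding 1 2 tail(2) ..
    also have "\<dots> = - (?q * (LINT x|unit_meas. \<psi> x) - ?\<kappa> * ip unit_meas (\<lambda>x. 1 / K x) \<psi>)"
      unfolding a_def b_def by (simp only: algebra_simps)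
    also have "?q * (LINT x|unit_meas. \<psi> x) - ?\<kappa> * ip unit_meas (\<lambda>x. 1 / K x) \<psi> = ip unit_meas (\<lambda>x. ?q - ?\<kappa> * (1 / K x)) \<psi>"
      unfolding ip_diff_left[OF const_L2 L2_scale[OF k] test_function_L2[OF \<psi>]] ip_scale_left
        ip_commute[of _ "\<lambda>x. ?q"] ip_const ..
    finally show "(LINT x|unit_meas. frac_int \<beta> \<theta> u x * deriv \<psi> x) = - ip unit_meas (\<lambda>x. ?q - ?\<kappa> * (1 / K x)) \<psi>" .
  qed
qed


section \<open>Weak coercivity\<close>

lemma bounded_mult_L2:
  assumes f: "f \<in> L2 unit_meas" and b: "b \<in> borel_measurable unit_meas" "AE x in unit_meas. \<bar>b x\<bar> \<le> B"
  shows "(\<lambda>x. b x * f x) \<in> L2 unit_meas" "normsq unit_meas (\<lambda>x. b x * f x) \<le> B\<^sup>2 * normsq unit_meas f"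
proof -
  have i: "integrable unit_meas (\<lambda>x. (f x)\<^sup>2)" and fm: "f \<in> borel_measurable unit_meas"
    using f by (auto simp: L2_def)
  have AE: "AE x in unit_meas. (b x * f x)\<^sup>2 \<le> B\<^sup>2 * (f x)\<^sup>2"
    using b(2)
  proof eventually_elim
    case (elim x)
    then have "(b x)\<^sup>2 \<le> B\<^sup>2" by (metis abs_ge_zero power2_abs power_mono)
    then show ?case unfolding power_mult_distrib by (rule mult_right_mono) simp
  qed
  have i': "integrable unit_meas (\<lambda>x. (b x * f x)\<^sup>2)"
  proof (rule Bochner_Integration.integrable_bound[of _ "\<lambda>x. B\<^sup>2 * (f x)\<^sup>2"])
    show "integrable unit_meas (\<lambda>x. B\<^sup>2 * (f x)\<^sup>2)" using i by simp
    show "AE x in unit_meas. norm ((b x * f x)\<^sup>2) \<le> norm (B\<^sup>2 * (f x)\<^sup>2)"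
      using AE by eventually_elim simp
  qed (use fm b in measurable)
  then show "(\<lambda>x. b x * f x) \<in> L2 unit_meas" using fm b by (simp add: L2_def)
  have "normsq unit_meas (\<lambda>x. b x * f x) \<le> (LINT x|unit_meas. B\<^sup>2 * (f x)\<^sup>2)"
    unfolding normsq_def by (rule integral_mono_AE[OF i' _ AE]) (use i in simp)
  then show "normsq unit_meas (\<lambda>x. b x * f x) \<le> B\<^sup>2 * normsq unit_meas f"
    by (simp add: normsq_def)
qed

lemma equivalent_norm_bounds:
  assumes "equivalent_norm_on_H0 \<mu> N"
  obtains c C where "0 < c" "0 < C"
    "\<And>w. w \<in> H0 \<mu> \<Longrightarrow> c * Hnorm \<mu> w \<le> N w" "\<And>w. w \<in> H0 \<mu> \<Longrightarrow> N w \<le> C * Hnorm \<mu> w"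
  using assms unfolding equivalent_norm_on_H0_def by blast

lemma Hnorm_nonneg: "0 \<le> Hnorm \<mu> w"
  by (simp add: Hnorm_def)

text \<open>
  The Riesz representation of a bounded functional on \<open>H\<^sup>1\<^sub>0\<close> through the derivatives. The derivative
  of an element outside the kernel is made orthogonal to the derivatives of the elements of the
  kernel, and \<open>g\<close> is a multiple of the result.
\<close>

lemma H0_dual_representation:
  assumes f: "f \<in> H0_dual 1 N" and N: "equivalent_norm_on_H0 1 N"
  obtains g where "g \<in> L2 unit_meas" "\<And>v. v \<in> H0 1 \<Longrightarrow> f v = ip unit_meas g (weak_deriv v)"
proof (rule weak_operator_deriv, rule equivalent_norm_bounds[OF N])
  fix c C cN CN
  assume W: "weak_operator 1 c C (\<lambda>w. w) deriv"
    and cN: "0 < cN" "\<And>w. w \<in> H0 1 \<Longrightarrow> cN * Hnorm 1 w \<le> N w"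
    and CN: "0 < CN" "\<And>w. w \<in> H0 1 \<Longrightarrow> N w \<le> CN * Hnorm 1 w"
  interpret D: weak_operator 1 c C "\<lambda>w. w" deriv by (rule W)
  have add: "f (\<lambda>x. v x + z x) = f v + f z" if "v \<in> H0 1" "z \<in> H0 1" for v z
    using f that unfolding H0_dual_def by blast
  have scale: "f (\<lambda>x. a * v x) = a * f v" if "v \<in> H0 1" for a v
    using f that unfolding H0_dual_def by blast
  obtain B where B: "\<And>v. v \<in> H0 1 \<Longrightarrow> \<bar>f v\<bar> \<le> B * N v"
    using f unfolding H0_dual_def by blast
  have bound: "\<bar>f v\<bar> \<le> \<bar>B\<bar> * CN * Hnorm 1 v" if v: "v \<in> H0 1" for v
  proof -
    have N0: "0 \<le> N v"
      by (rule order_trans[OF _ cN(2)[OF v]]) (use cN(1) Hnorm_nonneg in simp)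
    have "\<bar>f v\<bar> \<le> B * N v" by (rule B[OF v])
    also have "\<dots> \<le> \<bar>B\<bar> * N v" by (intro mult_right_mono N0) simp
    also have "\<dots> \<le> \<bar>B\<bar> * (CN * Hnorm 1 v)" by (intro mult_left_mono CN(2) v) simp
    finally show ?thesis by (simp only: mult.assoc)
  qed
  have diff: "f (\<lambda>x. v x - z x) = f v - f z" if "v \<in> H0 1" "z \<in> H0 1" for v z
    using add[OF that(1) H0_scale[OF that(2), of "-1"]] scale[OF that(2), of "-1"] by simp
  show ?thesis
  proof (cases "\<exists>v1\<in>H0 1. f v1 \<noteq> 0")
    case False
    show ?thesis
      by (rule that[of "\<lambda>x. 0"]) (use False in \<open>auto simp: const_L2 ip_def\<close>)
  next
    case True
    then obtain v1 where v1: "v1 \<in> H0 1" "f v1 \<noteq> 0" by blast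
    define V where "V = {h. \<exists>v\<in>H0 1. weak_L2_deriv v h \<and> f v = 0}"
    have V_L2: "V \<subseteq> L2 unit_meas" unfolding V_def using weak_L2_deriv_L2 by blast
    have V_ne: "V \<noteq> {}"
    proof -
      have 1: "(\<lambda>x. 0 * v1 x) \<in> H0 1" by (rule H0_scale[OF v1(1)])
      have "f (\<lambda>x. 0 * v1 x) = 0" using scale[OF v1(1), of 0] by (simp only: mult_zero_left)
      with 1 have "weak_deriv (\<lambda>x. 0 * v1 x) \<in> V" unfolding V_def using D.T(1) by blast
      then show ?thesis by blast
    qed
    have V_add: "(\<lambda>x. h x + k x) \<in> V" if hk: "h \<in> V" "k \<in> V" for h k
    proof -
      obtain v z where v: "v \<in> H0 1" "weak_L2_deriv v h" "f v = 0" and z: "z \<in> H0 1" "weak_L2_deriv z k" "f z = 0"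
        using hk unfolding V_def by blast
      have "weak_L2_deriv (\<lambda>x. v x + z x) (\<lambda>x. h x + k x)"
        by (rule D.weak_deriv_add[OF H0_unit_L2[OF v(1)] H0_unit_L2[OF z(1)] v(2) z(2)])
      moreover have "f (\<lambda>x. v x + z x) = 0" using add[OF v(1) z(1)] v(3) z(3) by simp
      ultimately show ?thesis unfolding V_def using H0_add[OF v(1) z(1)] by blast
    qed
    have V_scale: "(\<lambda>x. a * h x) \<in> V" if h: "h \<in> V" for h a
    proof -
      obtain v where v: "v \<in> H0 1" "weak_L2_deriv v h" "f v = 0"
        using h unfolding V_def by blast
      have "weak_L2_deriv (\<lambda>x. a * v x) (\<lambda>x. a * h x)"
        by (rule D.weak_deriv_scale[OF H0_unit_L2[OF v(1)] v(2)])
      moreover have "f (\<lambda>x. a * v x) = 0" using scale[OF v(1)] v(3) by simp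
      ultimately show ?thesis unfolding V_def using H0_scale[OF v(1)] by blast
    qed
    have V_closed: "k \<in> V" if h: "\<And>n::nat. h n \<in> V" and k: "k \<in> L2 unit_meas"
      and lim: "(\<lambda>n. normsq unit_meas (\<lambda>x. h n x - k x)) \<longlonglongrightarrow> 0" for h k
    proof -
      have "\<forall>n. \<exists>v. v \<in> H0 1 \<and> weak_L2_deriv v (h n) \<and> f v = 0"
        using h unfolding V_def by blast
      from choice[OF this] obtain v where v: "\<And>n. v n \<in> H0 1" "\<And>n. weak_L2_deriv (v n) (h n)" "\<And>n. f (v n) = 0"
        by blast
      obtain z where z: "z \<in> H0 1" "weak_L2_deriv z k" "(\<lambda>n. Hnorm 1 (\<lambda>x. v n x - z x)) \<longlonglongrightarrow> 0"
        using D.range_T_closed[OF v(1,2) k lim] by blast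
      have "\<bar>f z\<bar> \<le> 0"
      proof (rule LIMSEQ_le[OF tendsto_const])
        have "(\<lambda>n. \<bar>B\<bar> * CN * Hnorm 1 (\<lambda>x. v n x - z x)) \<longlonglongrightarrow> \<bar>B\<bar> * CN * 0"
          by (intro tendsto_mult tendsto_const z(3))
        then show "(\<lambda>n. \<bar>B\<bar> * CN * Hnorm 1 (\<lambda>x. v n x - z x)) \<longlonglongrightarrow> 0" by simp
        have "\<bar>f z\<bar> \<le> \<bar>B\<bar> * CN * Hnorm 1 (\<lambda>x. v n x - z x)" for n
          using bound[OF H0_diff[OF v(1)[of n] z(1)]] diff[OF v(1)[of n] z(1)] v(3)[of n] by simp
        then show "\<exists>N. \<forall>n\<ge>N. \<bar>f z\<bar> \<le> \<bar>B\<bar> * CN * Hnorm 1 (\<lambda>x. v n x - z x)" by blast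
      qed
      then show ?thesis unfolding V_def using z(1,2) by auto
    qed
    have "\<exists>m. m \<in> V \<and> (\<forall>h. h \<in> V \<longrightarrow> ip unit_meas (\<lambda>x. weak_deriv v1 x - m x) h = 0)"
    proof (rule unit_meas.L2_projection[OF V_L2 V_ne _ _ _ D.T(2)[OF v1(1)]])
      show "(\<lambda>x. h x + k x) \<in> V" if "h \<in> V" "k \<in> V" for h k by (rule V_add[OF that])
      show "(\<lambda>x. a * h x) \<in> V" if "h \<in> V" for h a by (rule V_scale[OF that])
      show "k \<in> V" if "\<And>n::nat. h n \<in> V" "k \<in> L2 unit_meas"
        "(\<lambda>n. normsq unit_meas (\<lambda>x. h n x - k x)) \<longlonglongrightarrow> 0" for h k
        by (rule V_closed[OF that])
    qed blast
    then obtain m where m: "m \<in> V"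
      "\<And>h. h \<in> V \<Longrightarrow> ip unit_meas (\<lambda>x. weak_deriv v1 x - m x) h = 0"
      by blast
    obtain vm where vm: "vm \<in> H0 1" "weak_L2_deriv vm m" "f vm = 0"
      using m(1) unfolding V_def by blast
    define e where "e x = weak_deriv v1 x - m x" for x
    define ve where "ve x = v1 x - vm x" for x
    have ve: "ve \<in> H0 1" unfolding ve_def by (rule H0_diff[OF v1(1) vm(1)])
    have e: "weak_L2_deriv ve e"
      unfolding ve_def e_def
      by (rule D.weak_deriv_diff[OF H0_unit_L2[OF v1(1)] H0_unit_L2[OF vm(1)] D.T(1)[OF v1(1)] vm(2)])
    have eL: "e \<in> L2 unit_meas" by (rule weak_L2_deriv_L2[OF e])
    have fve: "f ve = f v1" unfolding ve_def using diff[OF v1(1) vm(1)] vm(3) by simp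
    have "normsq unit_meas e \<noteq> 0"
    proof
      assume "normsq unit_meas e = 0"
      then have "normsq unit_meas (weak_deriv ve) = 0"
        using normsq_AE_cong[OF L2_measurable[OF eL] L2_measurable[OF D.T(2)[OF ve]] D.T_unique[OF ve e]] by simp
      then have "c * (Hnorm 1 ve)\<^sup>2 \<le> 0" using D.T_bounds(1)[OF ve] by simp
      then have "Hnorm 1 ve = 0" using D.c by (simp add: mult_le_0_iff)
      then show False using bound[OF ve] fve v1(2) by simp
    qed
    then have e_pos: "0 < normsq unit_meas e" using normsq_nonneg[of unit_meas e] by simp
    show ?thesis
    proof (rule that[of "\<lambda>x. (f ve / normsq unit_meas e) * e x"])
      show "(\<lambda>x. (f ve / normsq unit_meas e) * e x) \<in> L2 unit_meas" by (rule L2_scale[OF eL])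
      fix v assume v: "v \<in> H0 1"
      define a where "a = f v / f ve"
      let ?h = "weak_deriv v"
      note hL = D.T(2)[OF v]
      have "weak_L2_deriv (\<lambda>x. v x - a * ve x) (\<lambda>x. ?h x - a * e x)"
        by (rule D.weak_deriv_diff[OF H0_unit_L2[OF v] unit_L2_scale[OF H0_unit_L2[OF ve]] D.T(1)[OF v]
              D.weak_deriv_scale[OF H0_unit_L2[OF ve] e]])
      moreover have "f (\<lambda>x. v x - a * ve x) = 0"
        using diff[OF v H0_scale[OF ve, of a]] scale[OF ve, of a] fve v1(2) by (simp add: a_def)
      ultimately have "(\<lambda>x. ?h x - a * e x) \<in> V"
        unfolding V_def using H0_diff[OF v H0_scale[OF ve]] by blast
      from m(2)[OF this] have "ip unit_meas e (\<lambda>x. ?h x - a * e x) = 0" by (simp add: e_def[abs_def])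
      then have "ip unit_meas e ?h = a * normsq unit_meas e"
        unfolding ip_diff_right[OF hL L2_scale[OF eL] eL] ip_scale_right normsq_eq_ip by simp
      then show "f v = ip unit_meas (\<lambda>x. (f ve / normsq unit_meas e) * e x) ?h"
        unfolding ip_scale_left using e_pos fve v1(2) by (simp add: a_def)
    qed
  qed
qed

theorem theorem6p4:
  fixes \<beta> \<theta> K_m K_M :: real and K u_l :: "real \<Rightarrow> real"
    and normX normY :: "(real \<Rightarrow> real) \<Rightarrow> real"
  assumes "0 < \<beta>" "\<beta> < 1 / 2" "0 \<le> \<theta>" "\<theta> \<le> 1"
    and "set_borel_measurable lborel {0<..<1} K" "0 < K_m"
    and "AE x in lborel. x \<in> {0<..<1} \<longrightarrow> K_m \<le> K x \<and> K x \<le> K_M"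
    and "equivalent_norm_on_H0 (1 - \<beta>) normX" "equivalent_norm_on_H0 1 normY"
    and "is_u_l K \<beta> \<theta> u_l"
    and "1 + \<theta> * left_frac_int \<beta> u_l 1 - (1 - \<theta>) * right_frac_int \<beta> u_l 0 \<noteq> 0"
  shows "(\<forall>w\<in>H0 (1 - \<beta>). has_L2_weak_deriv (frac_int \<beta> \<theta> w)) \<and>
    (\<forall>v\<in>H0 1. has_L2_weak_deriv v) \<and>
    bounded_bilinear_form (H0 (1 - \<beta>)) normX (H0 1) normY (form_A K \<beta> \<theta>) \<and>
    (\<exists>\<kappa>>0.
      (INF w\<in>H0_nonzero (1 - \<beta>). SUP v\<in>H0_nonzero 1.
         ereal (form_A K \<beta> \<theta> w v / (normX w * normY v))) \<ge> ereal \<kappa> \<and>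
      (\<forall>v\<in>H0_nonzero 1. (SUP w\<in>H0 (1 - \<beta>). ereal (form_A K \<beta> \<theta> w v)) > 0) \<and>
      (\<forall>f\<in>H0_dual 1 normY.
         \<exists>u\<in>H0 (1 - \<beta>).
           (\<forall>v\<in>H0 1. form_A K \<beta> \<theta> u v = f v) \<and>
           (\<forall>z\<in>H0 (1 - \<beta>). (\<forall>v\<in>H0 1. form_A K \<beta> \<theta> z v = f v) \<longrightarrow>
              (AE x in lborel. z x = u x)) \<and>
           normX u \<le> 1 / \<kappa> * dual_norm 1 normY f))"
proof (rule weak_operator_frac[OF assms(1,2)], rule weak_operator_deriv,
    rule equivalent_norm_bounds[OF assms(8)], rule equivalent_norm_bounds[OF assms(9)])
  fix c C cD CD cX CX cY CY :: real
  assume W: "\<And>\<theta>. 0 \<le> \<theta> \<Longrightarrow> \<theta> \<le> 1 \<Longrightarrow>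
      weak_operator (1 - \<beta>) c C (frac_int \<beta> \<theta>) (\<lambda>\<phi>. frac_int \<beta> \<theta> (deriv \<phi>))"
    and WD: "weak_operator 1 cD CD (\<lambda>w. w) deriv"
    and X: "0 < cX" "0 < CX" "\<And>w. w \<in> H0 (1 - \<beta>) \<Longrightarrow> cX * Hnorm (1 - \<beta>) w \<le> normX w"
      "\<And>w. w \<in> H0 (1 - \<beta>) \<Longrightarrow> normX w \<le> CX * Hnorm (1 - \<beta>) w"
    and Y: "0 < cY" "0 < CY" "\<And>v. v \<in> H0 1 \<Longrightarrow> cY * Hnorm 1 v \<le> normY v"
      "\<And>v. v \<in> H0 1 \<Longrightarrow> normY v \<le> CY * Hnorm 1 v"
  interpret T: weak_operator "1 - \<beta>" c C "frac_int \<beta> \<theta>" "\<lambda>\<phi>. frac_int \<beta> \<theta> (deriv \<phi>)"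
    by (rule W[OF assms(3,4)])
  interpret D: weak_operator 1 cD CD "\<lambda>w. w" deriv by (rule WD)
  let ?X = "H0 (1 - \<beta>)" and ?Y = "H0 1" and ?A = "form_A K \<beta> \<theta>"
  let ?T = "\<lambda>w. weak_deriv (frac_int \<beta> \<theta> w)" and ?D = "weak_deriv"
  let ?M = unit_meas

  have Km: "K \<in> borel_measurable ?M"
    using assms(5) by (simp add: set_borel_measurable_def borel_measurable_restrict_space_iff)
  have KAE: "AE x in ?M. K_m \<le> K x \<and> K x \<le> K_M" using assms(7) unfolding AE_unit_meas .
  have K_bd: "AE x in ?M. \<bar>K x\<bar> \<le> K_M" using KAE by eventually_elim (use assms(6) in auto)
  define k where "k x = 1 / K x" for x
  have km: "k \<in> borel_measurable ?M" unfolding k_def using Km by measurable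
  have k_bd: "AE x in ?M. \<bar>k x\<bar> \<le> 1 / K_m"
    using KAE by eventually_elim (use assms(6) in \<open>auto simp: k_def frac_le\<close>)
  have Kk: "AE x in ?M. K x * k x = 1"
    using KAE by eventually_elim (use assms(6) in \<open>auto simp: k_def\<close>)
  have kL: "k \<in> L2 ?M" by (rule unit_meas.L2_bounded[OF km k_bd])
  have TL: "?T w \<in> L2 ?M" if "w \<in> ?X" for w by (rule T.T(2)[OF that])
  have DL: "?D v \<in> L2 ?M" if "v \<in> ?Y" for v by (rule D.T(2)[OF that])
  have KT: "(\<lambda>x. K x * ?T w x) \<in> L2 ?M" "normsq ?M (\<lambda>x. K x * ?T w x) \<le> K_M\<^sup>2 * normsq ?M (?T w)"
    if "w \<in> ?X" for w
    by (rule bounded_mult_L2[OF TL[OF that] Km K_bd])+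
  have A_eq: "?A w v = ip ?M (\<lambda>x. K x * ?T w x) (?D v)" for w v
    by (simp add: form_A_def set_integral_unit_meas ip_def)

  have A_add_left: "?A (\<lambda>x. w x + z x) v = ?A w v + ?A z v" if w: "w \<in> ?X" and z: "z \<in> ?X" and v: "v \<in> ?Y" for w z v
  proof -
    have "?A (\<lambda>x. w x + z x) v = ip ?M (\<lambda>x. K x * ?T w x + K x * ?T z x) (?D v)"
      unfolding A_eq
    proof (rule ip_AE_cong)
      show "AE x in ?M. K x * ?T (\<lambda>x. w x + z x) x = K x * ?T w x + K x * ?T z x"
        using T.T_add[OF w z] by eventually_elim (metis distrib_left)
    qed (intro L2_measurable KT L2_add H0_add w z DL v)+
    then show ?thesis unfolding A_eq ip_add_left[OF KT(1)[OF w] KT(1)[OF z] DL[OF v]] .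
  qed
  have A_scale_left: "?A (\<lambda>x. a * w x) v = a * ?A w v" if w: "w \<in> ?X" and v: "v \<in> ?Y" for a w v
  proof -
    have "?A (\<lambda>x. a * w x) v = ip ?M (\<lambda>x. a * (K x * ?T w x)) (?D v)"
      unfolding A_eq
    proof (rule ip_AE_cong)
      show "AE x in ?M. K x * ?T (\<lambda>x. a * w x) x = a * (K x * ?T w x)"
        using T.T_scale[OF w, of a] by eventually_elim (metis mult.left_commute)
    qed (intro L2_measurable KT L2_scale H0_scale w DL v)+
    then show ?thesis unfolding A_eq ip_scale_left .
  qed
  have A_add_right: "?A w (\<lambda>x. v x + z x) = ?A w v + ?A w z" if w: "w \<in> ?X" and v: "v \<in> ?Y" and z: "z \<in> ?Y" for w v z
  proof -
    have "?A w (\<lambda>x. v x + z x) = ip ?M (\<lambda>x. ?D v x + ?D z x) (\<lambda>x. K x * ?T w x)"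
      unfolding A_eq ip_commute[of _ "\<lambda>x. K x * ?T w x"]
    proof (rule ip_AE_cong)
      show "AE x in ?M. ?D (\<lambda>x. v x + z x) x = ?D v x + ?D z x"
        using D.T_add[OF v z] by eventually_elim simp
    qed (intro L2_measurable KT L2_add H0_add w z DL v)+
    then show ?thesis
      unfolding A_eq ip_add_left[OF DL[OF v] DL[OF z] KT(1)[OF w]] ip_commute[of _ "\<lambda>x. K x * ?T w x"] .
  qed
  have A_scale_right: "?A w (\<lambda>x. a * v x) = a * ?A w v" if w: "w \<in> ?X" and v: "v \<in> ?Y" for a w v
  proof -
    have "?A w (\<lambda>x. a * v x) = ip ?M (\<lambda>x. a * ?D v x) (\<lambda>x. K x * ?T w x)"
      unfolding A_eq ip_commute[of _ "\<lambda>x. K x * ?T w x"]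
    proof (rule ip_AE_cong)
      show "AE x in ?M. ?D (\<lambda>x. a * v x) x = a * ?D v x"
        using D.T_scale[OF v, of a] by eventually_elim simp
    qed (intro L2_measurable KT L2_scale H0_scale w DL v)+
    then show ?thesis unfolding A_eq ip_scale_left ip_commute[of _ "\<lambda>x. K x * ?T w x"] .
  qed
  have KM0: "0 \<le> K_M"
  proof (rule ccontr)
    assume neg: "\<not> 0 \<le> K_M"
    have "AE x in ?M. False" using K_bd by eventually_elim (use neg abs_ge_zero order_trans in blast)
    moreover have "{x \<in> space ?M. \<not> False} = space ?M" by blast
    ultimately have "emeasure ?M (space ?M) = 0"
      using AE_iff_measurable[OF sets.top, of ?M "\<lambda>_. False"] by blast
    then show False unfolding emeasure_unit_meas by simp
  qed
  have A_bound: "\<bar>?A w v\<bar> \<le> (K_M * sqrt (2 * C) * sqrt (2 * CD) / (cX * cY)) * normX w * normY v"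
    if w: "w \<in> ?X" and v: "v \<in> ?Y" for w v
  proof -
    have 1: "sqrt (normsq ?M (\<lambda>x. K x * ?T w x)) \<le> K_M * (sqrt (2 * C) * Hnorm (1 - \<beta>) w)"
    proof -
      have "normsq ?M (\<lambda>x. K x * ?T w x) \<le> K_M\<^sup>2 * (2 * C * (Hnorm (1 - \<beta>) w)\<^sup>2)"
        using KT(2)[OF w] mult_left_mono[OF T.T_bounds(2)[OF w], of "K_M\<^sup>2"] by simp
      then have "sqrt (normsq ?M (\<lambda>x. K x * ?T w x)) \<le> sqrt (K_M\<^sup>2 * (2 * C * (Hnorm (1 - \<beta>) w)\<^sup>2))"
        by (rule real_sqrt_le_mono)
      then show ?thesis using KM0 Hnorm_nonneg by (simp add: real_sqrt_mult)
    qed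
    have 2: "sqrt (normsq ?M (?D v)) \<le> sqrt (2 * CD) * Hnorm 1 v"
      using real_sqrt_le_mono[OF D.T_bounds(2)[OF v]] Hnorm_nonneg by (simp add: real_sqrt_mult)
    have 3: "Hnorm (1 - \<beta>) w \<le> normX w / cX" "Hnorm 1 v \<le> normY v / cY"
      using X(1) X(3)[OF w] Y(1) Y(3)[OF v] by (simp_all add: field_simps)
    have "\<bar>?A w v\<bar> \<le> sqrt (normsq ?M (\<lambda>x. K x * ?T w x)) * sqrt (normsq ?M (?D v))"
      unfolding A_eq by (rule abs_ip_le[OF KT(1)[OF w] DL[OF v]])
    also have "\<dots> \<le> (K_M * (sqrt (2 * C) * Hnorm (1 - \<beta>) w)) * (sqrt (2 * CD) * Hnorm 1 v)"
      by (intro mult_mono 1 2) (use KM0 T.C Hnorm_nonneg normsq_nonneg in auto)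
    also have "\<dots> \<le> (K_M * (sqrt (2 * C) * (normX w / cX))) * (sqrt (2 * CD) * (normY v / cY))"
    proof -
      have 4: "0 \<le> normX w / cX" using 3(1) Hnorm_nonneg order_trans by blast
      show ?thesis
        by (intro mult_mono mult_left_mono 3 4 KM0 mult_nonneg_nonneg real_sqrt_ge_zero Hnorm_nonneg)
          (use T.C D.C in auto)
    qed
    also have "\<dots> = (K_M * sqrt (2 * C) * sqrt (2 * CD) / (cX * cY)) * normX w * normY v"
      by simp
    finally show ?thesis .
  qed
  have bilinear: "bounded_bilinear_form ?X normX ?Y normY ?A"
    unfolding bounded_bilinear_form_def
    using A_add_left A_scale_left A_add_right A_scale_right A_bound by blast

  have kL': "(\<lambda>x. 1 / K x) \<in> L2 ?M" using kL unfolding k_def .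
  have u_range: "(\<lambda>x. (1 + \<theta> * left_frac_int \<beta> u_l 1 - (1 - \<theta>) * right_frac_int \<beta> u_l 0)
      - inverse (LINT s:{0<..<1}|lborel. 1 / K s) * k x) \<in> weak_range (1 - \<beta>) (frac_int \<beta> \<theta>)"
    using u_l_weak_deriv[OF assms(1) kL' assms(10)] assms(10)
    unfolding weak_range_def k_def is_u_l_def by blast
  obtain e where e: "e \<in> L2 ?M" "0 < ip ?M k e"
    "\<And>v. v \<in> weak_range (1 - \<beta>) (frac_int \<beta> \<theta>) \<Longrightarrow> ip ?M v e = 0"
    "\<And>g. g \<in> L2 ?M \<Longrightarrow> \<exists>w\<in>?X. \<exists>a. weak_L2_deriv (frac_int \<beta> \<theta> w) (\<lambda>x. g x - a * k x)"
    using weak_range_frac_complement[OF assms(1-4) kL assms(11) u_range] by blast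

  \<comment> \<open>Every \<open>g\<close> in \<open>L\<^sup>2\<close> is represented by the form: solve \<open>K T w = g - a\<close> with a constant \<open>a\<close>,
    which is orthogonal to the derivatives of functions in \<open>H\<^sup>1\<^sub>0\<close>.\<close>
  have solve: "\<exists>w\<in>?X. \<forall>v\<in>?Y. ?A w v = ip ?M g (?D v)" if g: "g \<in> L2 ?M" for g
  proof -
    have gk: "(\<lambda>x. k x * g x) \<in> L2 ?M" by (rule bounded_mult_L2(1)[OF g km k_bd])
    obtain w a where w: "w \<in> ?X" "weak_L2_deriv (frac_int \<beta> \<theta> w) (\<lambda>x. k x * g x - a * k x)"
      using e(4)[OF gk] by blast
    have AE: "AE x in ?M. K x * ?T w x = g x - a"
      using T.T_unique[OF w] Kk
    proof eventually_elim
      case (elim x)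
      have "K x * ?T w x = (K x * k x) * (g x - a)"
        unfolding elim(1)[symmetric] by (simp add: algebra_simps)
      then show ?case using elim(2) by simp
    qed
    have "?A w v = ip ?M g (?D v)" if v: "v \<in> ?Y" for v
    proof -
      have "?A w v = ip ?M (\<lambda>x. g x - a) (?D v)"
        unfolding A_eq by (rule ip_AE_cong[OF _ _ _ AE]) (intro L2_measurable KT w L2_diff g const_L2 DL v)+
      also have "\<dots> = ip ?M g (?D v) - a * (LINT x|?M. ?D v x)"
        unfolding ip_diff_left[OF g const_L2 DL[OF v]] ip_commute[of _ "\<lambda>x. a"] ip_const ..
      also have "(LINT x|?M. ?D v x) = 0"
        by (rule weak_range_deriv_mean_zero) (use v D.T(1)[OF v] in \<open>auto simp: weak_range_def\<close>)
      finally show ?thesis by simp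
    qed
    then show ?thesis using w(1) by blast
  qed

  \<comment> \<open>The constant in \<open>normsq (T w) \<le> G * normsq (D v)\<close> for the test function \<open>v\<close> of \<open>w\<close> below; \<open>\<kappa>\<close> converts
    this estimate to the given norms.\<close>
  define G where "G = 2 / K_m\<^sup>2 * (1 + normsq ?M k * normsq ?M e / (ip ?M k e)\<^sup>2)"
  have G: "0 < G"
    unfolding G_def using assms(6) by (intro mult_pos_pos add_pos_nonneg) (auto simp: normsq_nonneg)
  define \<kappa> where "\<kappa> = sqrt (c * cD / (4 * G)) / (CX * CY)"
  have \<kappa>: "0 < \<kappa>" unfolding \<kappa>_def using T.c D.c G X(2) Y(2) by simp

  \<comment> \<open>The test function \<open>v\<close> for \<open>w\<close> is chosen with \<open>D v = K T w - a\<close>, where \<open>a\<close> is the mean of \<open>K T w\<close>.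
    As \<open>T w = k D v + a k\<close> is orthogonal to \<open>e\<close>, the constant \<open>a\<close> is controlled by \<open>D v\<close>.\<close>
  have test: "\<exists>v\<in>?Y. \<kappa> * normX w * normY v \<le> ?A w v \<and> (Hnorm (1 - \<beta>) w \<noteq> 0 \<longrightarrow> 0 < ?A w v)"
    if w: "w \<in> ?X" for w
  proof -
    define a where "a = (LINT x|?M. K x * ?T w x)"
    define g where "g x = K x * ?T w x - a" for x
    have gL: "g \<in> L2 ?M" unfolding g_def by (intro L2_diff KT const_L2 w)
    have g0: "(LINT x|?M. g x) = 0"
      unfolding g_def using unit_meas.L2_integrable[OF KT(1)[OF w]] measure_unit_meas
      by (simp add: a_def)
    obtain v where v: "v \<in> ?Y" "weak_L2_deriv v g"
      using weak_range_deriv_if_mean_zero[OF gL g0] unfolding weak_range_def by blast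
    have Dv: "normsq ?M (?D v) = normsq ?M g"
      using normsq_AE_cong[OF L2_measurable[OF gL] L2_measurable[OF DL[OF v(1)]] D.T_unique[OF v]] by simp
    have A: "?A w v = normsq ?M g"
    proof -
      have "?A w v = ip ?M g (\<lambda>x. g x + a)"
        unfolding A_eq ip_commute[of _ _ "?D v"]
      proof -
        have "ip ?M (?D v) (\<lambda>x. K x * ?T w x) = ip ?M g (\<lambda>x. K x * ?T w x)"
          by (rule ip_AE_cong[OF L2_measurable[OF gL] L2_measurable[OF DL[OF v(1)]] L2_measurable[OF KT(1)[OF w]] D.T_unique[OF v], symmetric])
        then show "ip ?M (?D v) (\<lambda>x. K x * ?T w x) = ip ?M g (\<lambda>x. g x + a)" by (simp add: g_def)
      qed
      then show ?thesis
        unfolding ip_add_right[OF gL const_L2 gL] ip_const g0 normsq_eq_ip by simp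
    qed
    have kg: "(\<lambda>x. k x * g x) \<in> L2 ?M" "normsq ?M (\<lambda>x. k x * g x) \<le> (1 / K_m)\<^sup>2 * normsq ?M g"
      by (rule bounded_mult_L2[OF gL km k_bd])+
    have AE: "AE x in ?M. ?T w x = k x * g x + a * k x"
      using Kk
    proof eventually_elim
      case (elim x)
      have "k x * g x + a * k x = (K x * k x) * ?T w x" by (simp add: g_def algebra_simps)
      then show ?case using elim by simp
    qed
    have "ip ?M (?T w) e = 0" by (rule e(3)) (use w T.T(1)[OF w] in \<open>auto simp: weak_range_def\<close>)
    moreover have "ip ?M (?T w) e = ip ?M (\<lambda>x. k x * g x + a * k x) e"
      by (rule ip_AE_cong[OF _ _ _ AE]) (intro L2_measurable TL w L2_add kg L2_scale kL e)+
    ultimately have "a * ip ?M k e = - ip ?M (\<lambda>x. k x * g x) e"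
      unfolding ip_add_left[OF kg(1) L2_scale[OF kL] e(1)] ip_scale_left by simp
    then have "(a * ip ?M k e)\<^sup>2 = (ip ?M (\<lambda>x. k x * g x) e)\<^sup>2" by simp
    also have "\<dots> \<le> normsq ?M (\<lambda>x. k x * g x) * normsq ?M e" by (rule Cauchy_Schwarz_L2[OF kg(1) e(1)])
    also have "\<dots> \<le> ((1 / K_m)\<^sup>2 * normsq ?M g) * normsq ?M e" by (intro mult_right_mono kg normsq_nonneg)
    finally have a2: "a\<^sup>2 \<le> (1 / K_m)\<^sup>2 * normsq ?M g * normsq ?M e / (ip ?M k e)\<^sup>2"
      using e(2) by (simp add: power_mult_distrib pos_le_divide_eq)
    have "normsq ?M (?T w) = normsq ?M (\<lambda>x. k x * g x + a * k x)"
      by (rule normsq_AE_cong[OF _ _ AE]) (intro L2_measurable TL w L2_add kg L2_scale kL)+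
    also have "\<dots> \<le> 2 * normsq ?M (\<lambda>x. k x * g x) + 2 * (a\<^sup>2 * normsq ?M k)"
      using normsq_add_le[OF kg(1) L2_scale[OF kL]] by (simp only: normsq_scale)
    also have "\<dots> \<le> 2 * ((1 / K_m)\<^sup>2 * normsq ?M g)
        + 2 * (((1 / K_m)\<^sup>2 * normsq ?M g * normsq ?M e / (ip ?M k e)\<^sup>2) * normsq ?M k)"
      by (intro add_mono mult_left_mono mult_right_mono kg a2 normsq_nonneg) auto
    also have "\<dots> = G * normsq ?M g"
      unfolding G_def by (simp add: power_divide algebra_simps)
    finally have "c * (Hnorm (1 - \<beta>) w)\<^sup>2 \<le> 2 * (G * normsq ?M g)" using T.T_bounds(1)[OF w] by simp
    then have hw: "(Hnorm (1 - \<beta>) w)\<^sup>2 \<le> 2 * G / c * normsq ?M g" using T.c by (simp add: field_simps)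
    have hv: "(Hnorm 1 v)\<^sup>2 \<le> 2 / cD * normsq ?M g"
      using D.T_bounds(1)[OF v(1)] D.c unfolding Dv by (simp add: field_simps)
    let ?n = "normsq ?M g"
    have n0: "0 \<le> ?n" by (rule normsq_nonneg)
    have "(Hnorm (1 - \<beta>) w * Hnorm 1 v)\<^sup>2 \<le> (2 * G / c * ?n) * (2 / cD * ?n)"
      unfolding power_mult_distrib by (intro mult_mono hw hv) (use T.c G n0 in auto)
    also have "\<dots> = (4 * G / (c * cD)) * ?n\<^sup>2" by (simp add: power2_eq_square)
    finally have "(c * cD / (4 * G)) * (Hnorm (1 - \<beta>) w * Hnorm 1 v)\<^sup>2 \<le> ?n\<^sup>2"
      using T.c D.c G by (simp add: field_simps)
    then have "sqrt ((c * cD / (4 * G)) * (Hnorm (1 - \<beta>) w * Hnorm 1 v)\<^sup>2) \<le> sqrt (?n\<^sup>2)"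
      by (rule real_sqrt_le_mono)
    then have hn: "sqrt (c * cD / (4 * G)) * (Hnorm (1 - \<beta>) w * Hnorm 1 v) \<le> ?n"
      unfolding real_sqrt_mult real_sqrt_abs abs_of_nonneg[OF n0]
        abs_of_nonneg[OF mult_nonneg_nonneg[OF Hnorm_nonneg Hnorm_nonneg]] .
    have "\<kappa> * normX w * normY v \<le> \<kappa> * (CX * Hnorm (1 - \<beta>) w) * (CY * Hnorm 1 v)"
    proof -
      have "0 \<le> normX w" "0 \<le> normY v"
        using X(1) X(3)[OF w] Y(1) Y(3)[OF v(1)] Hnorm_nonneg
        by (meson mult_nonneg_nonneg less_imp_le order_trans)+
      then show ?thesis
        by (intro mult_mono mult_left_mono X Y w v) (use \<kappa> X(2) Y(2) Hnorm_nonneg in auto)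
    qed
    also have "\<dots> = sqrt (c * cD / (4 * G)) * (Hnorm (1 - \<beta>) w * Hnorm 1 v)"
      unfolding \<kappa>_def using X(2) Y(2) by simp
    also note hn
    finally have "\<kappa> * normX w * normY v \<le> ?A w v" unfolding A .
    moreover have "0 < ?A w v" if "Hnorm (1 - \<beta>) w \<noteq> 0"
    proof -
      have "0 < (Hnorm (1 - \<beta>) w)\<^sup>2" using that by simp
      then have "?n \<noteq> 0" using hw by auto
      then show ?thesis using n0 unfolding A by simp
    qed
    ultimately show ?thesis using v(1) by blast
  qed

  have normX_pos: "0 < normX w" if "w \<in> H0_nonzero (1 - \<beta>)" for w
  proof -
    have w: "w \<in> ?X" "Hnorm (1 - \<beta>) w \<noteq> 0"
      using that T.Hnorm_eq_0_iff unfolding H0_nonzero_def by blast+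
    have "0 < cX * Hnorm (1 - \<beta>) w" using X(1) w(2) Hnorm_nonneg[of "1 - \<beta>" w] by simp
    then show ?thesis using X(3)[OF w(1)] by simp
  qed
  have normY_pos: "0 < normY v" if "v \<in> H0_nonzero 1" for v
  proof -
    have v: "v \<in> ?Y" "Hnorm 1 v \<noteq> 0"
      using that D.Hnorm_eq_0_iff unfolding H0_nonzero_def by blast+
    have "0 < cY * Hnorm 1 v" using Y(1) v(2) Hnorm_nonneg[of 1 v] by simp
    then show ?thesis using Y(3)[OF v(1)] by simp
  qed
  have test_nonzero: "\<exists>v\<in>H0_nonzero 1. \<kappa> * normX w * normY v \<le> ?A w v" if "w \<in> H0_nonzero (1 - \<beta>)" for w
  proof -
    have w: "w \<in> ?X" "Hnorm (1 - \<beta>) w \<noteq> 0"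
      using that T.Hnorm_eq_0_iff unfolding H0_nonzero_def by blast+
    obtain v where v: "v \<in> ?Y" "\<kappa> * normX w * normY v \<le> ?A w v" "0 < ?A w v"
      using test[OF w(1)] w(2) by blast
    have "v \<in> H0_nonzero 1"
    proof (rule ccontr)
      assume "v \<notin> H0_nonzero 1"
      then have "Hnorm 1 v = 0" using v(1) D.Hnorm_eq_0_iff[OF v(1)] unfolding H0_nonzero_def by blast
      then have "normY v = 0" using Y(3)[OF v(1)] Y(4)[OF v(1)] by simp
      then have "\<bar>?A w v\<bar> \<le> 0" using A_bound[OF w(1) v(1)] by simp
      then show False using v(3) by simp
    qed
    then show ?thesis using v(2) by blast
  qed

  have inf_sup: "ereal \<kappa> \<le> (INF w\<in>H0_nonzero (1 - \<beta>). SUP v\<in>H0_nonzero 1. ereal (?A w v / (normX w * normY v)))"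
  proof (rule INF_greatest)
    fix w assume w: "w \<in> H0_nonzero (1 - \<beta>)"
    obtain v where v: "v \<in> H0_nonzero 1" "\<kappa> * normX w * normY v \<le> ?A w v"
      using test_nonzero[OF w] by blast
    have "\<kappa> \<le> ?A w v / (normX w * normY v)"
      using v(2) normX_pos[OF w] normY_pos[OF v(1)] by (simp add: pos_le_divide_eq mult.assoc)
    then have "ereal \<kappa> \<le> ereal (?A w v / (normX w * normY v))" by simp
    also have "\<dots> \<le> (SUP v\<in>H0_nonzero 1. ereal (?A w v / (normX w * normY v)))"
      by (rule SUP_upper[OF v(1)])
    finally show "ereal \<kappa> \<le> (SUP v\<in>H0_nonzero 1. ereal (?A w v / (normX w * normY v)))" .
  qed

  have nondeg: "0 < (SUP w\<in>?X. ereal (?A w v))" if v': "v \<in> H0_nonzero 1" for v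
  proof -
    have v: "v \<in> ?Y" "Hnorm 1 v \<noteq> 0"
      using v' D.Hnorm_eq_0_iff unfolding H0_nonzero_def by blast+
    obtain w where w: "w \<in> ?X" "?A w v = ip ?M (?D v) (?D v)"
      using solve[OF DL[OF v(1)]] v(1) by blast
    have "0 < cD * (Hnorm 1 v)\<^sup>2" using D.c v(2) by simp
    then have "0 < normsq ?M (?D v)" using D.T_bounds(1)[OF v(1)] by simp
    then have "0 < ereal (?A w v)" using w(2) by (simp add: normsq_eq_ip)
    also have "\<dots> \<le> (SUP w\<in>?X. ereal (?A w v))" by (rule SUP_upper[OF w(1)])
    finally show ?thesis .
  qed

  have solution: "\<exists>u\<in>?X. (\<forall>v\<in>?Y. ?A u v = f v) \<and>
      (\<forall>z\<in>?X. (\<forall>v\<in>?Y. ?A z v = f v) \<longrightarrow> (AE x in lborel. z x = u x)) \<and>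
      normX u \<le> 1 / \<kappa> * dual_norm 1 normY f" if f: "f \<in> H0_dual 1 normY" for f
  proof -
    obtain g where g: "g \<in> L2 ?M" "\<And>v. v \<in> ?Y \<Longrightarrow> f v = ip ?M g (?D v)"
      using H0_dual_representation[OF f assms(9)] by blast
    obtain u where u: "u \<in> ?X" "\<And>v. v \<in> ?Y \<Longrightarrow> ?A u v = f v"
      using solve[OF g(1)] g(2) by auto
    have unique: "AE x in lborel. z x = u x" if z: "z \<in> ?X" "\<forall>v\<in>?Y. ?A z v = f v" for z
    proof -
      have d: "(\<lambda>x. z x - u x) \<in> ?X" by (rule H0_diff[OF z(1) u(1)])
      have "?A (\<lambda>x. z x - u x) v = 0" if v: "v \<in> ?Y" for v
        using A_add_left[OF z(1) H0_scale[OF u(1), of "-1"] v] A_scale_left[OF u(1) v, of "-1"] z(2) u(2)[OF v] v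
        by simp
      then have "Hnorm (1 - \<beta>) (\<lambda>x. z x - u x) = 0" using test[OF d] by force
      then have "AE x in lborel. z x - u x = 0" using T.Hnorm_eq_0_iff[OF d] by simp
      then show ?thesis by eventually_elim simp
    qed
    obtain B where B: "\<And>v. v \<in> ?Y \<Longrightarrow> \<bar>f v\<bar> \<le> B * normY v"
      using f unfolding H0_dual_def by blast
    have bdd: "bdd_above ((\<lambda>v. \<bar>f v\<bar> / normY v) ` H0_nonzero 1)"
    proof (rule bdd_aboveI2)
      fix v assume v: "v \<in> H0_nonzero 1"
      then have "v \<in> ?Y" by (simp add: H0_nonzero_def)
      from B[OF this] show "\<bar>f v\<bar> / normY v \<le> B" using normY_pos[OF v] by (simp add: pos_divide_le_eq)
    qed
    have dual_upper: "\<bar>f v\<bar> / normY v \<le> dual_norm 1 normY f" if "v \<in> H0_nonzero 1" for v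
      unfolding dual_norm_def by (rule cSUP_upper[OF that bdd])
    have "\<kappa> * normX u \<le> dual_norm 1 normY f"
    proof (cases "u \<in> H0_nonzero (1 - \<beta>)")
      case True
      obtain v where v: "v \<in> H0_nonzero 1" "\<kappa> * normX u * normY v \<le> ?A u v"
        using test_nonzero[OF True] by blast
      have "?A u v = f v" using u(2) v(1) by (simp add: H0_nonzero_def)
      then have "\<kappa> * normX u * normY v \<le> \<bar>f v\<bar>" using v(2) by simp
      then have "\<kappa> * normX u \<le> \<bar>f v\<bar> / normY v" using normY_pos[OF v(1)] by (simp add: pos_le_divide_eq)
      then show ?thesis using dual_upper[OF v(1)] by simp
    next
      case False
      then have "Hnorm (1 - \<beta>) u = 0"
        using u(1) T.Hnorm_eq_0_iff[OF u(1)] unfolding H0_nonzero_def by blast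
      then have u0: "normX u = 0" using X(3)[OF u(1)] X(4)[OF u(1)] by simp
      \<comment> \<open>The supremum in the dual norm is over a nonempty set, as there are functions of mean zero
        that are not zero.\<close>
      obtain v where v: "v \<in> H0_nonzero 1"
      proof -
        have half: "(0::real) < 1/2" "(1::real)/2 < 1" by auto
        define s where "s x = x - (LINT y|?M. y)" for x :: real
        have sm: "s \<in> borel_measurable borel" unfolding s_def by measurable
        have sb: "AE x in ?M. \<bar>s x\<bar> \<le> 1 + \<bar>LINT y|?M. y\<bar>"
          unfolding AE_unit_meas s_def by (rule AE_I2) auto
        have sL: "s \<in> L2 ?M" by (rule unit_meas.L2_bounded[OF unit_meas_measurable[OF sm] sb])
        have idL: "(\<lambda>x. x) \<in> L2 ?M"
          using L2_add[OF sL const_L2[of "LINT y|?M. y"]] by (simp add: s_def)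
        have s0: "(LINT x|?M. s x) = 0"
          unfolding s_def using unit_meas.L2_integrable[OF idL] measure_unit_meas by simp
        obtain v where v: "v \<in> ?Y" "weak_L2_deriv v s"
          using weak_range_deriv_if_mean_zero[OF sL s0] unfolding weak_range_def by blast
        have "v \<in> H0_nonzero 1"
        proof (rule ccontr)
          assume "v \<notin> H0_nonzero 1"
          then have "Hnorm 1 v = 0" using v(1) D.Hnorm_eq_0_iff[OF v(1)] unfolding H0_nonzero_def by blast
          then have "normsq ?M (?D v) \<le> 0" using D.T_bounds(2)[OF v(1)] by simp
          then have "normsq ?M s = 0"
            using normsq_AE_cong[OF L2_measurable[OF sL] L2_measurable[OF DL[OF v(1)]] D.T_unique[OF v]]
              normsq_nonneg[of ?M s] by simp
          then have "AE x in ?M. s x = 0" using normsq_0_iff[OF sL] by simp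
          then have "AE x in lborel. x \<in> {0<..<1} \<longrightarrow> s x = 0" by (simp only: AE_unit_meas)
          then have "AE x in lborel. x \<notin> {0<..<1::real}"
            using AE_lborel_singleton[of "LINT y|?M. y"] by eventually_elim (auto simp: s_def)
          then have "AE x in ?M. False" unfolding AE_unit_meas by eventually_elim blast
          moreover have "{x \<in> space ?M. \<not> False} = space ?M" by blast
          ultimately have "emeasure ?M (space ?M) = 0"
            using AE_iff_measurable[OF sets.top, of ?M "\<lambda>_. False"] by blast
          then show False unfolding emeasure_unit_meas by simp
        qed
        then show ?thesis by (rule that)
      qed
      have "0 \<le> \<bar>f v\<bar> / normY v" using normY_pos[OF v] by simp
      then show ?thesis using dual_upper[OF v] u0 by simp
    qed
    then have "normX u \<le> 1 / \<kappa> * dual_norm 1 normY f" using \<kappa> by (simp add: field_simps)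
    then show ?thesis using u unique by blast
  qed

  show ?thesis
    using T.T(3) D.T(3) bilinear \<kappa> inf_sup nondeg solution by blast
qed

end
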